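(* Let $n\ge1$ and $a\in\mathbb Z$. (a) If $a\geq 0$, then ${}^{\rm b}(\mathcal D^E,\mathcal H)^a_{0}$-mod is equivalent to the category of nilpotent representations of $A'(n+1)$. (b) If $-n-1<a<0$, then ${}^{\rm b}(\mathcal D^E,\mathcal H)^a_{0}$-mod is equivalent to the category of nilpotent representations of $A''(n+1)$.
   Context: Ground field $\mathbb C$. $\mathcal D=\mathcal D(n+1)$ is the Weyl algebra of differential operators on $\mathbb C[t_0,\dots,t_n]$, $\mathcal H=\mathbb C[t_0\partial_0,\dots,t_n\partial_n]$, $E=\sum_i t_i\partial_i$, and $\mathcal D^E$ is the centralizer of $E$ in $\mathcal D$. A generalized weight $(\mathcal D^E,\mathcal H)$-module is a $\mathcal D^E$-module $M=\bigoplus_{\lambda\in\mathbb C^{n+1}}M^{(\lambda)}$, where $M^{(\lambda)}=\{m:(t_i\partial_i-\lambda_i)^Nm=0\text{ for some }N>0\text{ and all }i\}$. For $a\in\mathbb Z$, ${}^{\rm b}(\mathcal D^E,\mathcal H)^a_0$-mod is the category of such modules with finite-dimensional $M^{(\lambda)}$, with locally nilpotent action of $E-a$, and with support $\{\lambda:M^{(\lambda)}\neq0\}$ contained in $\mathbb Z^{n+1}$. Quivers. $C(k)$ is the quiver whose vertices are the vertices of the $k$-dimensional cube, each edge of the cube giving two arrows of opposite orientation. Its arrows are colored by $k$ colors, two arrows having the same color iff the corresponding edges are parallel. For $k\ge2$, $C'(k)$ is obtained from $C(k)$ by removing one vertex (and its arrows) and attaching one loop at each vertex adjacent to the removed one.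 To the loop at $v$ one associates the color sequence $(c,c)$, where $c$ is the color of the edge joining $v$ to the removed vertex. Every path in $C'(k)$ thus has a sequence of colors (by concatenation). Two paths are equivalent if they have the same beginning and end and their color sequences are permutations of one another. $A'(k)$ is the quotient of the path algebra $\mathbb C[C'(k)]$ by the relations identifying all equivalent paths. For $k\ge3$, $C''(k)$ is obtained from $C(k)$ by removing two opposite vertices and attaching such loops at the vertices adjacent to the removed ones, with the same coloring rule; $A''(k)$ is the quotient of $\mathbb C[C''(k)]$ identifying all paths with the same beginning and end whose color sequences are permutations of each other. For $k=2$, $C''(2)$ is the quiver with two vertices $v,w$, loops $\alpha,\beta$ at $v$, loops $\varepsilon,\phi$ at $w$, and arrows $\gamma:v\to w$, $\delta:w\to v$; $A''(2)$ is the quotient of its path algebra by the relations $\alpha\beta=\beta\alpha=\delta\gamma$ and $\varepsilon\phi=\phi\varepsilon=\gamma\delta$ (paths composed from right to left). Nilpotent representations are finite-dimensional representations in which every sufficiently long path acts by zero.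
   Formalization: For n=1, a=-1 the given relations of A''(2) do not suffice and the claim fails; here A''(2) also satisfies γα=εγ, γβ=φγ, αδ=δε, βδ=δφ. *)

theory Defs
  imports
    Complex_Main
    "HOL-Library.Cardinality"
    "HOL-Library.Poly_Mapping"
    "HOL-Library.Multiset"
    "HOL-Library.FuncSet"
    "HOL-Algebra.QuotRing"
    "Graph_Theory.Arc_Walk"
begin

section \<open>Categories and equivalences\<close>

text \<open>
  Composition takes the three objects as arguments, and a functor takes the two ends of a
  morphism as arguments: hom sets of different pairs of objects need not be disjoint.
\<close>

record ('o, 'm) cat =
  Obj :: "'o set"
  Hom :: "'o \<Rightarrow> 'o \<Rightarrow> 'm set"
  Id :: "'o \<Rightarrow> 'm"
  Comp :: "'o \<Rightarrow> 'o \<Rightarrow> 'o \<Rightarrow> 'm \<Rightarrow> 'm \<Rightarrow> 'm"  \<comment> \<open>\<open>Comp X Y Z g f\<close> is \<open>g \<circ> f\<close> for \<open>f : X \<rightarrow> Y\<close>, \<open>g : Y \<rightarrow> Z\<close>\<close>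

definition is_category :: "('o, 'm) cat \<Rightarrow> bool" where
  "is_category C \<longleftrightarrow>
     (\<forall>X\<in>Obj C. Id C X \<in> Hom C X X) \<and>
     (\<forall>X\<in>Obj C. \<forall>Y\<in>Obj C. \<forall>Z\<in>Obj C. \<forall>f\<in>Hom C X Y. \<forall>g\<in>Hom C Y Z.
        Comp C X Y Z g f \<in> Hom C X Z) \<and>
     (\<forall>X\<in>Obj C. \<forall>Y\<in>Obj C. \<forall>f\<in>Hom C X Y.
        Comp C X X Y f (Id C X) = f \<and> Comp C X Y Y (Id C Y) f = f) \<and>
     (\<forall>W\<in>Obj C. \<forall>X\<in>Obj C. \<forall>Y\<in>Obj C. \<forall>Z\<in>Obj C.
        \<forall>f\<in>Hom C W X. \<forall>g\<in>Hom C X Y. \<forall>h\<in>Hom C Y Z.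
        Comp C W X Z (Comp C X Y Z h g) f = Comp C W Y Z h (Comp C W X Y g f))"

definition is_functor ::
    "('o, 'm) cat \<Rightarrow> ('p, 'k) cat \<Rightarrow> ('o \<Rightarrow> 'p) \<Rightarrow> ('o \<Rightarrow> 'o \<Rightarrow> 'm \<Rightarrow> 'k) \<Rightarrow> bool" where
  "is_functor C D F Fm \<longleftrightarrow>
     (\<forall>X\<in>Obj C. F X \<in> Obj D) \<and>
     (\<forall>X\<in>Obj C. \<forall>Y\<in>Obj C. \<forall>f\<in>Hom C X Y. Fm X Y f \<in> Hom D (F X) (F Y)) \<and>
     (\<forall>X\<in>Obj C. Fm X X (Id C X) = Id D (F X)) \<and>
     (\<forall>X\<in>Obj C. \<forall>Y\<in>Obj C. \<forall>Z\<in>Obj C. \<forall>f\<in>Hom C X Y. \<forall>g\<in>Hom C Y Z.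
        Fm X Z (Comp C X Y Z g f) = Comp D (F X) (F Y) (F Z) (Fm Y Z g) (Fm X Y f))"

definition is_iso :: "('o, 'm) cat \<Rightarrow> 'o \<Rightarrow> 'o \<Rightarrow> 'm \<Rightarrow> bool" where
  "is_iso C X Y f \<longleftrightarrow> f \<in> Hom C X Y \<and>
     (\<exists>g\<in>Hom C Y X. Comp C X Y X g f = Id C X \<and> Comp C Y X Y f g = Id C Y)"

definition is_natural_iso ::
    "('o, 'm) cat \<Rightarrow> ('p, 'k) cat \<Rightarrow> ('o \<Rightarrow> 'p) \<Rightarrow> ('o \<Rightarrow> 'o \<Rightarrow> 'm \<Rightarrow> 'k) \<Rightarrow>
     ('o \<Rightarrow> 'p) \<Rightarrow> ('o \<Rightarrow> 'o \<Rightarrow> 'm \<Rightarrow> 'k) \<Rightarrow> ('o \<Rightarrow> 'k) \<Rightarrow> bool" where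
  "is_natural_iso C D F Fm G Gm \<eta> \<longleftrightarrow>
     (\<forall>X\<in>Obj C. is_iso D (F X) (G X) (\<eta> X)) \<and>
     (\<forall>X\<in>Obj C. \<forall>Y\<in>Obj C. \<forall>f\<in>Hom C X Y.
        Comp D (F X) (F Y) (G Y) (\<eta> Y) (Fm X Y f) =
        Comp D (F X) (G X) (G Y) (Gm X Y f) (\<eta> X))"

definition equivalent_categories :: "('o, 'm) cat \<Rightarrow> ('p, 'k) cat \<Rightarrow> bool" where
  "equivalent_categories C D \<longleftrightarrow> is_category C \<and> is_category D \<and>
     (\<exists>F Fm G Gm \<eta> \<epsilon>.
        is_functor C D F Fm \<and> is_functor D C G Gm \<and>
        is_natural_iso C C (\<lambda>X. X) (\<lambda>X Y f. f)
          (\<lambda>X. G (F X)) (\<lambda>X Y f. Gm (F X) (F Y) (Fm X Y f)) \<eta> \<and>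
        is_natural_iso D D (\<lambda>X. F (G X)) (\<lambda>X Y f. Fm (G X) (G Y) (Gm X Y f))
          (\<lambda>X. X) (\<lambda>X Y f. f) \<epsilon>)"


section \<open>Modules over complex algebras\<close>

text \<open>
  A unital associative complex algebra is a ring with a structure map \<open>cscal\<close> from the complex
  numbers to its centre.
\<close>

record 'a calgebra = "'a ring" +
  cscal :: "complex \<Rightarrow> 'a"

text \<open>
  Set-theoretic size: The categories of modules below consist of the modules whose underlying
  complex vector space is a linear subspace of one fixed complex vector space, the type \<open>'u\<close> with
  scalar multiplication \<open>scale\<close>. If that space is infinite-dimensional, every module of countable
  dimension is isomorphic to one of these. All modules of the statement have countable dimension:
  they are finite-dimensional, or direct sums of finite-dimensional weight spaces indexed by a
  subset of a lattice. An object is a pair of the underlying subspace and the action.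
\<close>

type_synonym ('a, 'u) module_obj = "'u set \<times> ('a \<Rightarrow> 'u \<Rightarrow> 'u)"

definition left_module ::
    "(complex \<Rightarrow> 'u \<Rightarrow> 'u::ab_group_add) \<Rightarrow> 'a calgebra \<Rightarrow> ('a, 'u) module_obj \<Rightarrow> bool" where
  "left_module scale A = (\<lambda>(M, act).
     module.subspace scale M \<and>
     (\<forall>x\<in>carrier A. \<forall>m\<in>M. act x m \<in> M) \<and>
     (\<forall>x\<in>carrier A. \<forall>m\<in>M. \<forall>m'\<in>M. act x (m + m') = act x m + act x m') \<and>
     (\<forall>x\<in>carrier A. \<forall>y\<in>carrier A. \<forall>m\<in>M. act (x \<oplus>\<^bsub>A\<^esub> y) m = act x m + act y m) \<and>
     (\<forall>x\<in>carrier A. \<forall>y\<in>carrier A. \<forall>m\<in>M. act (x \<otimes>\<^bsub>A\<^esub> y) m = act x (act y m)) \<and>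
     (\<forall>m\<in>M. act \<one>\<^bsub>A\<^esub> m = m) \<and>
     (\<forall>c. \<forall>m\<in>M. act (cscal A c) m = scale c m))"

definition left_module_hom ::
    "'a calgebra \<Rightarrow> ('a, 'u::ab_group_add) module_obj \<Rightarrow> ('a, 'u) module_obj \<Rightarrow> ('u \<Rightarrow> 'u) set" where
  "left_module_hom A = (\<lambda>(M, act) (M', act').
     {f \<in> M \<rightarrow>\<^sub>E M'.
        (\<forall>m\<in>M. \<forall>m'\<in>M. f (m + m') = f m + f m') \<and>
        (\<forall>x\<in>carrier A. \<forall>m\<in>M. f (act x m) = act' x (f m))})"

text \<open>The full subcategory of the category of left modules on the modules satisfying \<open>P\<close>.\<close>

definition module_cat ::
    "(complex \<Rightarrow> 'u \<Rightarrow> 'u::ab_group_add) \<Rightarrow> 'a calgebra \<Rightarrow> (('a, 'u) module_obj \<Rightarrow> bool) \<Rightarrow>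
     (('a, 'u) module_obj, 'u \<Rightarrow> 'u) cat" where
  "module_cat scale A P =
     \<lparr>Obj = {X. left_module scale A X \<and> P X},
      Hom = left_module_hom A,
      Id = (\<lambda>X. restrict (\<lambda>m. m) (fst X)),
      Comp = (\<lambda>X Y Z g f. compose (fst X) g f)\<rparr>"

definition finite_dimensional :: "(complex \<Rightarrow> 'u \<Rightarrow> 'u::ab_group_add) \<Rightarrow> 'u set \<Rightarrow> bool" where
  "finite_dimensional scale V \<longleftrightarrow> (\<exists>B. finite B \<and> V \<subseteq> module.span scale B)"


section \<open>The Weyl algebra and the centralizer of the Euler operator\<close>

text \<open>
  Complex polynomials in variables \<open>t\<^sub>i\<close>, with \<open>i\<close> ranging over the finite type \<open>'i\<close>: finitely
  supported functions from exponent vectors to coefficients, with the convolution product.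
\<close>

type_synonym 'i mpoly = "('i \<Rightarrow>\<^sub>0 nat) \<Rightarrow>\<^sub>0 complex"
type_synonym 'i operator = "'i mpoly \<Rightarrow> 'i mpoly"

definition const_op :: "complex \<Rightarrow> 'i operator" where
  "const_op c p = Poly_Mapping.single 0 c * p"

definition mult_op :: "'i \<Rightarrow> 'i operator" where
  "mult_op i p = Poly_Mapping.single (Poly_Mapping.single i 1) 1 * p"

definition diff_op :: "'i \<Rightarrow> 'i operator" where
  "diff_op i p = (\<Sum>e\<in>Poly_Mapping.keys p.
     Poly_Mapping.single (e - Poly_Mapping.single i 1)
       (of_nat (Poly_Mapping.lookup e i) * Poly_Mapping.lookup p e))"

inductive_set weyl_ops :: "'i operator set" where
  const: "const_op c \<in> weyl_ops"
| mult: "mult_op i \<in> weyl_ops"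
| diff: "diff_op i \<in> weyl_ops"
| add: "d \<in> weyl_ops \<Longrightarrow> d' \<in> weyl_ops \<Longrightarrow> (\<lambda>p. d p + d' p) \<in> weyl_ops"
| comp: "d \<in> weyl_ops \<Longrightarrow> d' \<in> weyl_ops \<Longrightarrow> d \<circ> d' \<in> weyl_ops"

definition theta_op :: "'i \<Rightarrow> 'i operator" where
  "theta_op i = mult_op i \<circ> diff_op i"

definition euler_op :: "'i::finite operator" where
  "euler_op p = (\<Sum>i\<in>UNIV. theta_op i p)"

definition weyl_centralizer :: "'i::finite operator calgebra" where
  "weyl_centralizer =
     \<lparr>carrier = {d \<in> weyl_ops. d \<circ> euler_op = euler_op \<circ> d},
      mult = (\<circ>), one = id, zero = (\<lambda>p. 0), add = (\<lambda>d d' p. d p + d' p),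
      cscal = const_op\<rparr>"


section \<open>Generalized weight modules\<close>

definition weight_space ::
    "(complex \<Rightarrow> 'u \<Rightarrow> 'u::ab_group_add) \<Rightarrow> ('i operator, 'u) module_obj \<Rightarrow> ('i \<Rightarrow> complex) \<Rightarrow> 'u set" where
  "weight_space scale = (\<lambda>(M, act) l.
     {m \<in> M. \<exists>N>0. \<forall>i. ((\<lambda>x. act (theta_op i) x - scale (l i) x) ^^ N) m = 0})"

text \<open>The module is the direct sum of its generalized weight spaces.\<close>

definition weight_decomposition ::
    "(complex \<Rightarrow> 'u \<Rightarrow> 'u::ab_group_add) \<Rightarrow> ('i operator, 'u) module_obj \<Rightarrow> bool" where
  "weight_decomposition scale X \<longleftrightarrow>
     (\<forall>m\<in>fst X. \<exists>!f. (\<forall>l. f l \<in> weight_space scale X l) \<and> finite {l. f l \<noteq> 0} \<and>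
        m = (\<Sum>l\<in>{l. f l \<noteq> 0}. f l))"

definition bounded_weight_cat ::
    "'i itself \<Rightarrow> (complex \<Rightarrow> 'u \<Rightarrow> 'u::ab_group_add) \<Rightarrow> int \<Rightarrow>
     (('i::finite operator, 'u) module_obj, 'u \<Rightarrow> 'u) cat" where
  "bounded_weight_cat _ scale a = module_cat scale weyl_centralizer (\<lambda>X.
     weight_decomposition scale X \<and>
     (\<forall>l. finite_dimensional scale (weight_space scale X l)) \<and>
     (\<forall>m\<in>fst X. \<exists>N. ((\<lambda>x. snd X euler_op x - scale (of_int a) x) ^^ N) m = 0) \<and>
     (\<forall>l. weight_space scale X l \<noteq> {0} \<longrightarrow> (\<forall>i. l i \<in> \<int>)))"


section \<open>Path algebras and quivers with relations\<close>

text \<open>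
  A quiver is a directed multigraph. A path is a pair of its beginning and the list of its arrows
  in the order in which they are traversed, so that \<open>(u, [])\<close> is the trivial path at \<open>u\<close>.
\<close>

type_synonym ('v, 'e) quiver = "('v, 'e) pre_digraph"
type_synonym ('v, 'e) path = "'v \<times> 'e list"

definition path_end :: "('v, 'e) quiver \<Rightarrow> ('v, 'e) path \<Rightarrow> 'v" where
  "path_end Q = (\<lambda>(u, es). pre_digraph.awlast Q u es)"

definition paths :: "('v, 'e) quiver \<Rightarrow> ('v, 'e) path set" where
  "paths Q = {(u, es). pre_digraph.awalk Q u es (path_end Q (u, es))}"

definition path_elt :: "('v, 'e) path \<Rightarrow> ('v, 'e) path \<Rightarrow> complex" where
  "path_elt p = (\<lambda>q. if q = p then 1 else 0)"

text \<open>
  Paths are composed from right to left: in the product \<open>f * g\<close> the path coming from \<open>g\<close> is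
  traversed first.
\<close>

definition path_algebra :: "('v, 'e) quiver \<Rightarrow> (('v, 'e) path \<Rightarrow> complex) calgebra" where
  "path_algebra Q =
     \<lparr>carrier = {f. finite {p. f p \<noteq> 0} \<and> {p. f p \<noteq> 0} \<subseteq> paths Q},
      mult = (\<lambda>f g (u, es).
        \<Sum>j\<le>length es. f (path_end Q (u, take j es), drop j es) * g (u, take j es)),
      one = (\<lambda>(u, es). if u \<in> verts Q \<and> es = [] then 1 else 0),
      zero = (\<lambda>p. 0),
      add = (\<lambda>f g p. f p + g p),
      cscal = (\<lambda>c (u, es). if u \<in> verts Q \<and> es = [] then c else 0)\<rparr>"

text \<open>The ideal generated by \<open>p - q\<close> for all pairs of paths \<open>(p, q)\<close> in \<open>R\<close>.\<close>

definition relation_ideal ::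
    "('v, 'e) quiver \<Rightarrow> (('v, 'e) path \<times> ('v, 'e) path) set \<Rightarrow> (('v, 'e) path \<Rightarrow> complex) set" where
  "relation_ideal Q R =
     Idl\<^bsub>path_algebra Q\<^esub> ((\<lambda>(p, q) x. path_elt p x - path_elt q x) ` R)"

definition path_class ::
    "('v, 'e) quiver \<Rightarrow> (('v, 'e) path \<times> ('v, 'e) path) set \<Rightarrow> (('v, 'e) path \<Rightarrow> complex) \<Rightarrow>
     (('v, 'e) path \<Rightarrow> complex) set" where
  "path_class Q R f = relation_ideal Q R +>\<^bsub>path_algebra Q\<^esub> f"

definition quotient_path_algebra ::
    "('v, 'e) quiver \<Rightarrow> (('v, 'e) path \<times> ('v, 'e) path) set \<Rightarrow>
     (('v, 'e) path \<Rightarrow> complex) set calgebra" where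
  "quotient_path_algebra Q R =
     ring.extend (path_algebra Q Quot relation_ideal Q R)
       (calgebra.fields (\<lambda>c. path_class Q R (cscal (path_algebra Q) c)))"

definition nilpotent_rep_cat ::
    "(complex \<Rightarrow> 'u \<Rightarrow> 'u::ab_group_add) \<Rightarrow> ('v, 'e) quiver \<Rightarrow>
     (('v, 'e) path \<times> ('v, 'e) path) set \<Rightarrow>
     (((('v, 'e) path \<Rightarrow> complex) set, 'u) module_obj, 'u \<Rightarrow> 'u) cat" where
  "nilpotent_rep_cat scale Q R = module_cat scale (quotient_path_algebra Q R) (\<lambda>X.
     finite_dimensional scale (fst X) \<and>
     (\<exists>N. \<forall>p\<in>paths Q. length (snd p) \<ge> N \<longrightarrow>
        (\<forall>m\<in>fst X. snd X (path_class Q R (path_elt p)) m = 0)))"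


section \<open>Cubical quivers\<close>

text \<open>
  The vertices of the cube whose coordinate directions are the elements of \<open>'i\<close> are the subsets of
  \<open>'i\<close>; the directions also serve as the colors. \<open>Step v i\<close> is the arrow starting at \<open>v\<close> along the
  edge in direction \<open>i\<close>. \<open>Loop v i\<close> is the loop at \<open>v\<close> attached because the neighbor of \<open>v\<close> in
  direction \<open>i\<close> has been removed. With \<open>R = {}\<close> the quiver below is the full cube \<open>C(k)\<close>, where
  \<open>k = CARD('i)\<close>.
\<close>

datatype 'i cube_arrow = Step "'i set" 'i | Loop "'i set" 'i

fun cube_tail :: "'i cube_arrow \<Rightarrow> 'i set" where
  "cube_tail (Step v i) = v"
| "cube_tail (Loop v i) = v"

fun cube_head :: "'i cube_arrow \<Rightarrow> 'i set" where
  "cube_head (Step v i) = sym_diff v {i}"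
| "cube_head (Loop v i) = v"

fun cube_colors :: "'i cube_arrow \<Rightarrow> 'i list" where
  "cube_colors (Step v i) = [i]"
| "cube_colors (Loop v i) = [i, i]"

definition punctured_cube :: "'i set set \<Rightarrow> ('i set, 'i cube_arrow) quiver" where
  "punctured_cube R =
     \<lparr>verts = - R,
      arcs = {Step v i | v i. v \<notin> R \<and> sym_diff v {i} \<notin> R} \<union>
             {Loop v i | v i. v \<notin> R \<and> sym_diff v {i} \<in> R},
      tail = cube_tail, head = cube_head\<rparr>"

text \<open>Pairs of paths with the same ends whose color sequences are permutations of each other.\<close>

definition color_relations ::
    "('i set, 'i cube_arrow) quiver \<Rightarrow>
     (('i set, 'i cube_arrow) path \<times> ('i set, 'i cube_arrow) path) set" where
  "color_relations Q = {(p, q). p \<in> paths Q \<and> q \<in> paths Q \<and>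
     fst p = fst q \<and> path_end Q p = path_end Q q \<and>
     mset (concat (map cube_colors (snd p))) = mset (concat (map cube_colors (snd q)))}"

text \<open>
  Nilpotent representations of \<open>A'(k)\<close> for \<open>k = CARD('i) \<ge> 2\<close>, and of \<open>A''(k)\<close> for
  \<open>k = CARD('i) \<ge> 3\<close>. All vertices of the cube, and all pairs of opposite vertices, are equivalent
  under its symmetries, so the vertices to be removed can be fixed.
\<close>

definition A1_nilpotent_rep_cat ::
    "'i itself \<Rightarrow> (complex \<Rightarrow> 'u \<Rightarrow> 'u::ab_group_add) \<Rightarrow>
     (((('i set, 'i cube_arrow) path \<Rightarrow> complex) set, 'u) module_obj, 'u \<Rightarrow> 'u) cat" where
  "A1_nilpotent_rep_cat _ scale =
     (let Q = punctured_cube {{}} in nilpotent_rep_cat scale Q (color_relations Q))"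

definition A2_nilpotent_rep_cat ::
    "'i itself \<Rightarrow> (complex \<Rightarrow> 'u \<Rightarrow> 'u::ab_group_add) \<Rightarrow>
     (((('i set, 'i cube_arrow) path \<Rightarrow> complex) set, 'u) module_obj, 'u \<Rightarrow> 'u) cat" where
  "A2_nilpotent_rep_cat _ scale =
     (let Q = punctured_cube {{}, UNIV} in nilpotent_rep_cat scale Q (color_relations Q))"


section \<open>The quiver \<open>C''(2)\<close>\<close>

datatype sq_vertex = SqV | SqW
datatype sq_arrow = Alpha | Beta | Gamma | Delta | Epsilon | Phi

fun sq_tail :: "sq_arrow \<Rightarrow> sq_vertex" where
  "sq_tail Alpha = SqV" | "sq_tail Beta = SqV" | "sq_tail Gamma = SqV"
| "sq_tail Delta = SqW" | "sq_tail Epsilon = SqW" | "sq_tail Phi = SqW"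

fun sq_head :: "sq_arrow \<Rightarrow> sq_vertex" where
  "sq_head Alpha = SqV" | "sq_head Beta = SqV" | "sq_head Delta = SqV"
| "sq_head Gamma = SqW" | "sq_head Epsilon = SqW" | "sq_head Phi = SqW"

definition sq_quiver :: "(sq_vertex, sq_arrow) quiver" where
  "sq_quiver = \<lparr>verts = UNIV, arcs = UNIV, tail = sq_tail, head = sq_head\<rparr>"

text \<open>
  The relations \<open>\<alpha>\<beta> = \<beta>\<alpha> = \<delta>\<gamma>\<close> and \<open>\<epsilon>\<phi> = \<phi>\<epsilon> = \<gamma>\<delta>\<close>. Arrow lists are in order of traversal,
  hence reversed.
\<close>

definition sq_product_relations ::
    "((sq_vertex, sq_arrow) path \<times> (sq_vertex, sq_arrow) path) set" where
  "sq_product_relations =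
     {((SqV, [Beta, Alpha]), (SqV, [Alpha, Beta])), ((SqV, [Alpha, Beta]), (SqV, [Gamma, Delta])),
      ((SqW, [Phi, Epsilon]), (SqW, [Epsilon, Phi])), ((SqW, [Epsilon, Phi]), (SqW, [Delta, Gamma]))}"

text \<open>
  The relations \<open>\<gamma>\<alpha> = \<epsilon>\<gamma>\<close>, \<open>\<gamma>\<beta> = \<phi>\<gamma>\<close>, \<open>\<alpha>\<delta> = \<delta>\<epsilon>\<close>, \<open>\<beta>\<delta> = \<delta>\<phi>\<close>. \<^emph>\<open>They are a correction:\<close> the source
  presents \<open>A''(2)\<close> by the product relations alone. The product relations do not imply them, while the
  corresponding identities hold in every weight module of degree \<open>-1\<close> in two variables: there \<open>\<alpha>\<close> and
  \<open>\<epsilon>\<close> are the nilpotent parts of \<open>t\<^sub>0\<partial>\<^sub>0\<close>, \<open>\<beta>\<close> and \<open>\<phi>\<close> those of \<open>t\<^sub>1\<partial>\<^sub>1\<close>, and \<open>\<gamma>\<close>, \<open>\<delta>\<close> are the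
  actions of \<open>t\<^sub>1\<partial>\<^sub>0\<close>, \<open>t\<^sub>0\<partial>\<^sub>1\<close>. With the product relations alone there is a uniserial nilpotent
  representation of length three with \<open>\<gamma>\<alpha> \<noteq> 0\<close> and \<open>\<beta> = \<delta> = \<epsilon> = \<phi> = 0\<close>, whose two upper composition
  factors are isomorphic and differ from the socle; no weight module has this structure, so that the
  two categories would not be equivalent. All relations of both lists, and no others up to
  consequences, come from the rule identifying paths with the same ends and permuted color
  sequences, for the colors \<open>\<alpha>, \<epsilon> : (0,0)\<close>; \<open>\<beta>, \<phi> : (1,1)\<close>; \<open>\<gamma>, \<delta> : (0,1)\<close>.
\<close>

definition sq_commutation_relations ::
    "((sq_vertex, sq_arrow) path \<times> (sq_vertex, sq_arrow) path) set" where
  "sq_commutation_relations =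
     {((SqV, [Alpha, Gamma]), (SqV, [Gamma, Epsilon])), ((SqV, [Beta, Gamma]), (SqV, [Gamma, Phi])),
      ((SqW, [Delta, Alpha]), (SqW, [Epsilon, Delta])), ((SqW, [Delta, Beta]), (SqW, [Phi, Delta]))}"

definition A2_sq_nilpotent_rep_cat ::
    "(complex \<Rightarrow> 'u \<Rightarrow> 'u::ab_group_add) \<Rightarrow>
     ((((sq_vertex, sq_arrow) path \<Rightarrow> complex) set, 'u) module_obj, 'u \<Rightarrow> 'u) cat" where
  "A2_sq_nilpotent_rep_cat scale =
     nilpotent_rep_cat scale sq_quiver (sq_product_relations \<union> sq_commutation_relations)"

end

theory Submission
  imports Defs
begin

text \<open>
  Every operator in the Weyl algebra is a finite sum of weighted shifts: \<open>t\<^sup>e\<close> goes to a multiple of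
  \<open>t\<close> to the power \<open>e + \<alpha>\<close> whose coefficient is a polynomial in \<open>e\<close> times a universal factor coming
  from the derivations. The operator commutes with \<open>E\<close> iff only \<open>\<alpha>\<close> of total degree \<open>0\<close> occur.
  In a weight module these shifts map weight spaces to weight spaces. After division by the invertible
  factors of the composition constants, the composite of the shifts from \<open>l\<close> to \<open>m\<close> and from \<open>m\<close> to
  \<open>n\<close> is the shift from \<open>l\<close> to \<open>n\<close> times the product of the nilpotent parts \<open>x\<^sub>i\<close> of \<open>t\<^sub>i\<partial>\<^sub>i\<close> over all
  \<open>i\<close> for which the way through \<open>m\<close> crosses the wall between \<open>-1\<close> and \<open>0\<close> back and forth.

  Hence weight spaces whose weights have the same type \<open>{i. 0 \<le> l i}\<close> are canonically isomorphic. The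
  types occurring in degree \<open>a > -n-1\<close> are the nonempty subsets, without the full set if \<open>a < 0\<close>; they
  are the vertices of the quiver. Choosing a weight for each type sends \<open>M\<close> to the sum of the chosen
  weight spaces, on which a path with color content \<open>c\<close> acts as the normalized shift times the product
  of the \<open>x\<^sub>i\<close> to the power \<open>c i div 2\<close>. In the opposite direction, a representation \<open>V\<close> gives the
  finitely supported functions taking a weight \<open>l\<close> of degree \<open>a\<close> to the space of \<open>V\<close> at the type of
  \<open>l\<close>. Only one property of the three quivers enters: paths with the same ends and the same
  color content are identified, and there are enough paths of small content. For \<open>C''(2)\<close>, whose
  relations are given explicitly, the identification follows from a normal form of paths.
\<close>

section \<open>Categories of modules\<close>

text \<open>Both sides match through one carry. The ends of a path force the parity of each color
  multiplicity, so the free part of its content is \<open>c i div 2\<close>. Under concatenation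
  these quotients add, with a carry where both multiplicities are odd; that is exactly where the
  composite of two weighted shifts crosses the wall back and forth, and both events give the factor
  \<open>x i\<close>.

  The wall lies between \<open>-1\<close> and \<open>0\<close> because \<open>x + c\<close> with
  \<open>x\<close> nilpotent is invertible unless \<open>c = 0\<close>, and \<open>c = 0\<close>
  belongs to the step from \<open>0\<close> down to \<open>-1\<close>.

  Generators and relations of the centralizer are avoided. Operators act on polynomials by
  definition, so each is given by its matrix in the monomials; dividing out falling factorials
  leaves entries that are polynomial in the exponent. These are evaluated in a representation to
  define its weight module, and multiplicativity becomes an identity of products over integer
  intervals. Substituting commuting operators into a polynomial function is well defined because the
  monomials are linearly independent functions.\<close>

lemma fully_faithful_equivalence:
  assumes C: "is_category C" and D: "is_category D" and F: "is_functor C D F Fm"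
    and faithful: "\<And>X Y. X \<in> Obj C \<Longrightarrow> Y \<in> Obj C \<Longrightarrow> inj_on (Fm X Y) (Hom C X Y)"
    and full: "\<And>X Y g. X \<in> Obj C \<Longrightarrow> Y \<in> Obj C \<Longrightarrow> g \<in> Hom D (F X) (F Y) \<Longrightarrow> \<exists>f\<in>Hom C X Y. Fm X Y f = g"
    and surj: "\<And>Y. Y \<in> Obj D \<Longrightarrow> \<exists>X\<in>Obj C. \<exists>h. is_iso D (F X) Y h"
  shows "equivalent_categories C D"
proof -
  define G where "G Y = (SOME X. X \<in> Obj C \<and> (\<exists>h. is_iso D (F X) Y h))" for Y
  define e where "e Y = (SOME h. is_iso D (F (G Y)) Y h)" for Y
  have G: "G Y \<in> Obj C" "\<exists>h. is_iso D (F (G Y)) Y h" if "Y \<in> Obj D" for Y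
    using someI_ex[of "\<lambda>X. X \<in> Obj C \<and> (\<exists>h. is_iso D (F X) Y h)"] surj[OF that]
    unfolding G_def by auto
  have e: "is_iso D (F (G Y)) Y (e Y)" if "Y \<in> Obj D" for Y
    using someI_ex[OF G(2)[OF that]] unfolding e_def .
  define e' where "e' Y = (SOME g. g \<in> Hom D Y (F (G Y)) \<and>
     Comp D (F (G Y)) Y (F (G Y)) g (e Y) = Id D (F (G Y)) \<and>
     Comp D Y (F (G Y)) Y (e Y) g = Id D Y)" for Y
  have e': "e' Y \<in> Hom D Y (F (G Y))" "Comp D (F (G Y)) Y (F (G Y)) (e' Y) (e Y) = Id D (F (G Y))"
     "Comp D Y (F (G Y)) Y (e Y) (e' Y) = Id D Y" if "Y \<in> Obj D" for Y
    using someI_ex[of "\<lambda>g. g \<in> Hom D Y (F (G Y)) \<and>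
     Comp D (F (G Y)) Y (F (G Y)) g (e Y) = Id D (F (G Y)) \<and>
     Comp D Y (F (G Y)) Y (e Y) g = Id D Y"] e[OF that]
    unfolding e'_def is_iso_def by auto
  have eH: "e Y \<in> Hom D (F (G Y)) Y" if "Y \<in> Obj D" for Y
    using e[OF that] by (simp add: is_iso_def)
  define lft where "lft X Y g = (SOME f. f \<in> Hom C X Y \<and> Fm X Y f = g)" for X Y g
  have lft: "lft X Y g \<in> Hom C X Y" "Fm X Y (lft X Y g) = g"
    if "X \<in> Obj C" "Y \<in> Obj C" "g \<in> Hom D (F X) (F Y)" for X Y g
    using someI_ex[of "\<lambda>f. f \<in> Hom C X Y \<and> Fm X Y f = g"] full[OF that]
    unfolding lft_def by auto
  have eq: "f = f'" if "X \<in> Obj C" "Y \<in> Obj C" "f \<in> Hom C X Y" "f' \<in> Hom C X Y" "Fm X Y f = Fm X Y f'" for X Y f f'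
    using faithful[OF that(1,2)] that(3-5) by (auto dest: inj_onD)
  \<comment> \<open>Conjugation by the chosen isomorphisms turns \<open>h\<close> into a morphism
    between images of \<open>F\<close>, which fullness lifts. Faithfulness then gives functoriality,
    since equalities can be tested after applying \<open>F\<close>.\<close>
  define Gm where "Gm Y Z h = lft (G Y) (G Z)
     (Comp D (F (G Y)) Z (F (G Z)) (e' Z) (Comp D (F (G Y)) Y Z h (e Y)))" for Y Z h
  note Ccomp = C[unfolded is_category_def, THEN conjunct2, THEN conjunct1, rule_format]
  note Cid = C[unfolded is_category_def, THEN conjunct1, rule_format]
  note Cunit = C[unfolded is_category_def, THEN conjunct2, THEN conjunct2, THEN conjunct1, rule_format]
  note Dcomp = D[unfolded is_category_def, THEN conjunct2, THEN conjunct1, rule_format]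
  note Did = D[unfolded is_category_def, THEN conjunct1, rule_format]
  note Dunit = D[unfolded is_category_def, THEN conjunct2, THEN conjunct2, THEN conjunct1, rule_format]
  note Dassoc = D[unfolded is_category_def, THEN conjunct2, THEN conjunct2, THEN conjunct2, rule_format]
  note Fo = F[unfolded is_functor_def, THEN conjunct1, rule_format]
  note Fmo = F[unfolded is_functor_def, THEN conjunct2, THEN conjunct1, rule_format]
  note Fid = F[unfolded is_functor_def, THEN conjunct2, THEN conjunct2, THEN conjunct1, rule_format]
  note Fcomp = F[unfolded is_functor_def, THEN conjunct2, THEN conjunct2, THEN conjunct2, rule_format]
  have GmF: "Fm (G Y) (G Z) (Gm Y Z h) = Comp D (F (G Y)) Z (F (G Z)) (e' Z) (Comp D (F (G Y)) Y Z h (e Y))"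
    and GmH: "Gm Y Z h \<in> Hom C (G Y) (G Z)"
    if "Y \<in> Obj D" "Z \<in> Obj D" "h \<in> Hom D Y Z" for Y Z h
    using that unfolding Gm_def by (auto intro!: lft G Dcomp[of _ Z] Dcomp[of _ Y] Fo e' eH)
  have eGm: "Comp D (F (G Y)) (F (G Z)) Z (e Z) (Fm (G Y) (G Z) (Gm Y Z h)) = Comp D (F (G Y)) Y Z h (e Y)"
    if "Y \<in> Obj D" "Z \<in> Obj D" "h \<in> Hom D Y Z" for Y Z h
  proof -
    have c: "Comp D (F (G Y)) Y Z h (e Y) \<in> Hom D (F (G Y)) Z"
      using that by (auto intro!: Dcomp[of _ Y] Fo G eH)
    show ?thesis
      using that c by (simp add: GmF Dassoc[of "F (G Y)" Z "F (G Z)" Z, symmetric] Fo G eH e' Dunit)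
  qed
  have G_functor: "is_functor D C G Gm"
    unfolding is_functor_def
  proof (intro conjI ballI)
    show "G X \<in> Obj C" if "X \<in> Obj D" for X using G that by auto
    show "Gm X Y f \<in> Hom C (G X) (G Y)" if "X \<in> Obj D" "Y \<in> Obj D" "f \<in> Hom D X Y" for X Y f
      using GmH that by auto
    show "Gm X X (Id D X) = Id C (G X)" if "X \<in> Obj D" for X
      by (rule eq[of "G X" "G X"]) (use that in \<open>simp_all add: G GmH GmF Did Cid Dunit[where Y = X] Fid eH e' Fo\<close>)
    show "Gm X Z (Comp D X Y Z g f) = Comp C (G X) (G Y) (G Z) (Gm Y Z g) (Gm X Y f)"
      if "X \<in> Obj D" "Y \<in> Obj D" "Z \<in> Obj D" "f \<in> Hom D X Y" "g \<in> Hom D Y Z" for X Y Z f g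
    proof (rule eq[of "G X" "G Z"])
      have c: "Comp D (F (G X)) X Y f (e X) \<in> Hom D (F (G X)) Y"
        using that by (auto intro!: Dcomp[of _ X] Fo G eH)
      have c2: "Fm (G X) (G Y) (Gm X Y f) \<in> Hom D (F (G X)) (F (G Y))"
        using that by (auto intro!: Fmo G GmH)
      have c3: "Comp D (F (G Y)) Y Z g (e Y) \<in> Hom D (F (G Y)) Z"
        using that by (auto intro!: Dcomp[of _ Y] Fo G eH)
      have "Fm (G X) (G Z) (Comp C (G X) (G Y) (G Z) (Gm Y Z g) (Gm X Y f)) =
         Comp D (F (G X)) (F (G Y)) (F (G Z)) (Fm (G Y) (G Z) (Gm Y Z g)) (Fm (G X) (G Y) (Gm X Y f))"
        using that by (simp add: Fcomp G GmH)
      also have "\<dots> = Comp D (F (G X)) Z (F (G Z)) (e' Z)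
          (Comp D (F (G X)) (F (G Y)) Z (Comp D (F (G Y)) Y Z g (e Y)) (Fm (G X) (G Y) (Gm X Y f)))"
        using that c2 c3 by (simp add: GmF[of Y Z] Dassoc[of _ "F (G Y)" Z] Fo G eH e')
      also have "Comp D (F (G X)) (F (G Y)) Z (Comp D (F (G Y)) Y Z g (e Y)) (Fm (G X) (G Y) (Gm X Y f))
         = Comp D (F (G X)) Y Z g (Comp D (F (G X)) X Y f (e X))"
        using that c2 by (simp add: Dassoc[of _ "F (G Y)" Y Z] eGm Fo G eH e')
      also have "\<dots> = Comp D (F (G X)) X Z (Comp D X Y Z g f) (e X)"
        using that by (simp add: Dassoc Fo G eH)
      finally show "Fm (G X) (G Z) (Gm X Z (Comp D X Y Z g f)) =
         Fm (G X) (G Z) (Comp C (G X) (G Y) (G Z) (Gm Y Z g) (Gm X Y f))"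
        using that by (simp add: GmF Dcomp)
    qed (use that in \<open>auto intro!: GmH G Dcomp[of _ Y] Ccomp[of _ "G Y"]\<close>)
  qed
  \<comment> \<open>The unit is the lift of the inverse of the counit at \<open>F X\<close>;
    faithfulness carries the inverse laws and naturality back from \<open>D\<close> to
    \<open>C\<close>.\<close>
  define u where "u X = lft X (G (F X)) (e' (F X))" for X
  define u' where "u' X = lft (G (F X)) X (e (F X))" for X
  have u: "u X \<in> Hom C X (G (F X))" "Fm X (G (F X)) (u X) = e' (F X)" if "X \<in> Obj C" for X
    unfolding u_def using that by (auto intro!: lft G Fo e')
  have u': "u' X \<in> Hom C (G (F X)) X" "Fm (G (F X)) X (u' X) = e (F X)" if "X \<in> Obj C" for X
    unfolding u'_def using that by (auto intro!: lft G Fo eH)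
  have nat1: "is_natural_iso C C (\<lambda>X. X) (\<lambda>X Y f. f) (\<lambda>X. G (F X)) (\<lambda>X Y f. Gm (F X) (F Y) (Fm X Y f)) u"
    unfolding is_natural_iso_def
  proof (intro conjI ballI)
    fix X assume X: "X \<in> Obj C"
    have "Comp C X (G (F X)) X (u' X) (u X) = Id C X"
      by (rule eq[of X X]) (use X in \<open>auto simp: Fcomp u u' G Fo Fid e' intro!: Ccomp[of _ "G (F X)"] Cid\<close>)
    moreover have "Comp C (G (F X)) X (G (F X)) (u X) (u' X) = Id C (G (F X))"
      by (rule eq[of "G (F X)" "G (F X)"]) (use X in \<open>auto simp: Fcomp u u' G Fo Fid e' intro!: Ccomp[of _ X] Cid\<close>)
    ultimately show "is_iso C X (G (F X)) (u X)"
      using X u u' unfolding is_iso_def by blast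
  next
    fix X Y f assume X: "X \<in> Obj C" and Y: "Y \<in> Obj C" and f: "f \<in> Hom C X Y"
    have FF: "F X \<in> Obj D" "F Y \<in> Obj D" "Fm X Y f \<in> Hom D (F X) (F Y)" using X Y f Fo Fmo by auto
    have c: "Comp D (F (G (F X))) (F X) (F Y) (Fm X Y f) (e (F X)) \<in> Hom D (F (G (F X))) (F Y)"
      using FF by (auto intro!: Dcomp[of _ "F X"] Fo G eH)
    show "Comp C X Y (G (F Y)) (u Y) f = Comp C X (G (F X)) (G (F Y)) (Gm (F X) (F Y) (Fm X Y f)) (u X)"
    proof (rule eq[of X "G (F Y)"])
      have "Fm X (G (F Y)) (Comp C X (G (F X)) (G (F Y)) (Gm (F X) (F Y) (Fm X Y f)) (u X)) =
        Comp D (F X) (F (G (F X))) (F (G (F Y))) (Comp D (F (G (F X))) (F Y) (F (G (F Y))) (e' (F Y))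
           (Comp D (F (G (F X))) (F X) (F Y) (Fm X Y f) (e (F X)))) (e' (F X))"
        using X Y FF by (simp add: Fcomp GmF u G GmH)
      also have "\<dots> = Comp D (F X) (F Y) (F (G (F Y))) (e' (F Y)) (Comp D (F X) (F (G (F X))) (F Y)
           (Comp D (F (G (F X))) (F X) (F Y) (Fm X Y f) (e (F X))) (e' (F X)))"
        using FF c by (simp add: Dassoc[of _ "F (G (F X))" "F Y"] Fo G eH e')
      also have "Comp D (F X) (F (G (F X))) (F Y)
           (Comp D (F (G (F X))) (F X) (F Y) (Fm X Y f) (e (F X))) (e' (F X)) = Fm X Y f"
        using FF by (simp add: Dassoc Fo G eH e' Dunit[of "F X" "F Y"])
      finally show "Fm X (G (F Y)) (Comp C X Y (G (F Y)) (u Y) f) = Fm X (G (F Y)) (Comp C X (G (F X)) (G (F Y)) (Gm (F X) (F Y) (Fm X Y f)) (u X))"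
        using X Y f FF by (simp add: Fcomp u G)
    qed (use X Y f FF in \<open>auto simp: u G GmH intro!: Ccomp[of _ Y] Ccomp[of _ "G (F X)"]\<close>)
  qed
  have nat2: "is_natural_iso D D (\<lambda>X. F (G X)) (\<lambda>X Y f. Fm (G X) (G Y) (Gm X Y f)) (\<lambda>X. X) (\<lambda>X Y f. f) e"
    unfolding is_natural_iso_def using e eGm by auto
  show ?thesis
    unfolding equivalent_categories_def using C D F G_functor nat1 nat2 by blast
qed

lemma module_cat_is_category:
  assumes "vector_space scale"
  shows "is_category (module_cat scale A P)"
proof -
  interpret vector_space scale by fact
  have add: "m + m' \<in> M" if "left_module scale A (M, act)" "m \<in> M" "m' \<in> M" for M act m m'
    using that by (auto simp: left_module_def subspace_add)
  have cl: "act x m \<in> M" if "left_module scale A (M, act)" "m \<in> M" "x \<in> carrier A" for M act m x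
    using that by (auto simp: left_module_def)
  show ?thesis
    unfolding is_category_def module_cat_def
    by (auto simp: left_module_hom_def add cl compose_def restrict_def PiE_def extensional_def Pi_def fun_eq_iff
        split: prod.splits)
qed

lemma module_cat_isoI:
  assumes X: "(M, act) \<in> Obj (module_cat scale A P)" and Y: "(M', act') \<in> Obj (module_cat scale A P)"
    and f: "f \<in> left_module_hom A (M, act) (M', act')" and bij: "bij_betw f M M'"
    and closed: "\<And>x m. x \<in> carrier A \<Longrightarrow> m \<in> M \<Longrightarrow> act x m \<in> M"
    and add: "\<And>m m'. m \<in> M \<Longrightarrow> m' \<in> M \<Longrightarrow> m + m' \<in> M"
  shows "is_iso (module_cat scale A P) (M, act) (M', act') f"
proof -
  \<comment> \<open>Morphisms are extensional functions, hence the restriction of the inverse to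
    \<open>M'\<close>.\<close>
  define g where "g = restrict (inv_into M f) M'"
  have gf: "g (f m) = m" if "m \<in> M" for m
    using that bij by (auto simp: g_def bij_betw_def)
  have fg: "f (g m) = m" "g m \<in> M" if "m \<in> M'" for m
    using that bij by (auto simp: g_def bij_betw_def f_inv_into_f inv_into_into)
  have f': "f \<in> M \<rightarrow> M'" "\<And>m m'. m \<in> M \<Longrightarrow> m' \<in> M \<Longrightarrow> f (m + m') = f m + f m'"
     "\<And>x m. x \<in> carrier A \<Longrightarrow> m \<in> M \<Longrightarrow> f (act x m) = act' x (f m)"
    using f by (auto simp: left_module_hom_def)
  have "g \<in> left_module_hom A (M', act') (M, act)"
  proof -
    have "g (m + m') = g m + g m'" if "m \<in> M'" "m' \<in> M'" for m m'
      using gf[of "g m + g m'"] add[of "g m" "g m'"] f'(2)[of "g m" "g m'"] fg that by simp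
    moreover have "g (act' x m) = act x (g m)" if "m \<in> M'" "x \<in> carrier A" for m x
      using gf[of "act x (g m)"] closed[of x "g m"] f'(3)[of x "g m"] fg that by simp
    ultimately show ?thesis
      using fg by (auto simp: left_module_hom_def g_def)
  qed
  moreover have "compose M g f = restrict (\<lambda>m. m) M" "compose M' f g = restrict (\<lambda>m. m) M'"
    using gf fg by (auto simp: compose_def fun_eq_iff)
  ultimately show ?thesis
    using f unfolding is_iso_def module_cat_def by auto
qed

section \<open>Modules over path algebras with relations\<close>

text \<open>With finitely many vertices the sum of all trivial paths is an element of the path
  algebra, which is therefore unital.\<close>

locale quiver = wf_digraph Q for Q :: "('v, 'e) quiver" +
  assumes finite_verts: "finite (verts Q)"
begin

lemma path_end_Nil [simp]: "path_end Q (u, []) = u"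
  by (simp add: path_end_def)

lemma path_end_Cons [simp]: "path_end Q (u, e # es) = path_end Q (head Q e, es)"
  by (simp add: path_end_def)

lemma path_end_append: "path_end Q (u, es @ fs) = path_end Q (path_end Q (u, es), fs)"
  by (induction es arbitrary: u) auto

lemma paths_iff: "(u, es) \<in> paths Q \<longleftrightarrow> u \<in> verts Q \<and> set es \<subseteq> arcs Q \<and> cas u es (path_end Q (u, es))"
  by (simp add: paths_def awalk_def)

lemma Nil_in_paths [simp]: "(u, []) \<in> paths Q \<longleftrightarrow> u \<in> verts Q"
  by (simp add: paths_iff)

lemma Cons_in_paths: "(u, e # es) \<in> paths Q \<longleftrightarrow> e \<in> arcs Q \<and> tail Q e = u \<and> (head Q e, es) \<in> paths Q"
  by (auto simp: paths_iff)

lemma path_verts: "(u, es) \<in> paths Q \<Longrightarrow> u \<in> verts Q \<and> path_end Q (u, es) \<in> verts Q"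
  by (induction es arbitrary: u) (auto simp: Cons_in_paths)

lemma paths_append:
  "(u, es @ fs) \<in> paths Q \<longleftrightarrow> (u, es) \<in> paths Q \<and> (path_end Q (u, es), fs) \<in> paths Q"
  by (induction es arbitrary: u) (auto simp: Cons_in_paths dest: path_verts)

abbreviation "PA \<equiv> path_algebra Q"

lemma carrier_PA: "f \<in> carrier PA \<longleftrightarrow> finite {p. f p \<noteq> 0} \<and> {p. f p \<noteq> 0} \<subseteq> paths Q"
  by (simp add: path_algebra_def)

lemma add_PA: "f \<oplus>\<^bsub>PA\<^esub> g = (\<lambda>p. f p + g p)" and zero_PA: "\<zero>\<^bsub>PA\<^esub> = (\<lambda>p. 0)"
  and one_PA: "\<one>\<^bsub>PA\<^esub> = (\<lambda>(u, es). if u \<in> verts Q \<and> es = [] then 1 else 0)"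
  by (simp_all add: path_algebra_def)

lemma mult_PA: "(f \<otimes>\<^bsub>PA\<^esub> g) (u, es) =
   (\<Sum>j\<le>length es. f (path_end Q (u, take j es), drop j es) * g (u, take j es))"
  by (simp add: path_algebra_def)

text \<open>The support of a product lies among the concatenations of paths from the two
  supports.\<close>

lemma mult_closed_PA:
  assumes f: "f \<in> carrier PA" and g: "g \<in> carrier PA"
  shows "f \<otimes>\<^bsub>PA\<^esub> g \<in> carrier PA"
proof -
  let ?h = "\<lambda>(p, q). (fst q, snd q @ snd p)"
  have split: "\<exists>p q. f p \<noteq> 0 \<and> g q \<noteq> 0 \<and> x = ?h (p, q) \<and> x \<in> paths Q"
    if nz: "(f \<otimes>\<^bsub>PA\<^esub> g) x \<noteq> 0" for x
  proof -
    obtain u es where x: "x = (u, es)" by force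
    from nz[unfolded x mult_PA] obtain j where
      "f (path_end Q (u, take j es), drop j es) * g (u, take j es) \<noteq> 0"
      by (meson sum.neutral)
    then have nz': "f (path_end Q (u, take j es), drop j es) \<noteq> 0" "g (u, take j es) \<noteq> 0" by auto
    then have "(path_end Q (u, take j es), drop j es) \<in> paths Q" "(u, take j es) \<in> paths Q"
      using f g by (auto simp: carrier_PA)
    then have "x \<in> paths Q" using paths_append[of u "take j es" "drop j es"] x by simp
    then show ?thesis using nz' x
      by (intro exI[of _ "(path_end Q (u, take j es), drop j es)"] exI[of _ "(u, take j es)"]) auto
  qed
  have "{x. (f \<otimes>\<^bsub>PA\<^esub> g) x \<noteq> 0} \<subseteq> ?h ` ({p. f p \<noteq> 0} \<times> {q. g q \<noteq> 0})"
    using split by blast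
  moreover have "finite (?h ` ({p. f p \<noteq> 0} \<times> {q. g q \<noteq> 0}))"
    using f g by (simp add: carrier_PA)
  ultimately show ?thesis
    using split finite_subset by (auto simp: carrier_PA)
qed

lemma mult_assoc_PA: "(f \<otimes>\<^bsub>PA\<^esub> g) \<otimes>\<^bsub>PA\<^esub> h = f \<otimes>\<^bsub>PA\<^esub> (g \<otimes>\<^bsub>PA\<^esub> h)"
proof
  fix x :: "'v \<times> 'e list"
  obtain u es where x: "x = (u, es)" by force
  \<comment> \<open>Both bracketings sum over pairs of cuts \<open>j \<le> k\<close> of the list of
    arrows; \<open>T j k\<close> is the contribution of one such pair.\<close>
  define T where "T j k = f (path_end Q (u, take k es), drop k es) *
     (g (path_end Q (u, take j es), take (k - j) (drop j es)) * h (u, take j es))" for j k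
  have pe: "path_end Q (path_end Q (u, take j es), take i (drop j es)) = path_end Q (u, take (j + i) es)" for i j
    by (simp add: path_end_append[symmetric] take_add)
  have "((f \<otimes>\<^bsub>PA\<^esub> g) \<otimes>\<^bsub>PA\<^esub> h) x = (\<Sum>j\<le>length es. \<Sum>i\<le>length es - j. T j (j + i))"
    unfolding x mult_PA T_def by (intro sum.cong refl) (simp add: sum_distrib_right mult.assoc pe add.commute)
  also have "\<dots> = (\<Sum>j\<le>length es. \<Sum>k\<in>{j..length es}. T j k)"
    by (intro sum.cong refl sum.reindex_bij_witness[of _ "\<lambda>k. k - j" "\<lambda>i. j + i" for j]) auto
  also have "\<dots> = (\<Sum>k\<le>length es. \<Sum>j\<le>k. T j k)"
    by (simp add: sum.Sigma) (rule sum.reindex_bij_witness[of _ "\<lambda>(k, j). (j, k)" "\<lambda>(j, k). (k, j)"], auto)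
  also have "\<dots> = (f \<otimes>\<^bsub>PA\<^esub> (g \<otimes>\<^bsub>PA\<^esub> h)) x"
    unfolding x mult_PA T_def
    by (intro sum.cong refl) (auto simp: sum_distrib_left min_def drop_take intro!: sum.cong)
  finally show "((f \<otimes>\<^bsub>PA\<^esub> g) \<otimes>\<^bsub>PA\<^esub> h) x = (f \<otimes>\<^bsub>PA\<^esub> (g \<otimes>\<^bsub>PA\<^esub> h)) x" .
qed

lemma cscal_carrier: "cscal PA c \<in> carrier PA"
proof -
  have "{p. cscal PA c p \<noteq> 0} \<subseteq> (\<lambda>u. (u, [])) ` verts Q"
    by (auto simp: path_algebra_def split: if_splits)
  moreover have "\<dots> \<subseteq> paths Q" by auto
  ultimately show ?thesis
    using finite_subset[OF _ finite_imageI[OF finite_verts]] by (auto simp: carrier_PA)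
qed

lemma one_eq_cscal: "\<one>\<^bsub>PA\<^esub> = cscal PA 1"
  by (simp add: path_algebra_def)

lemma cscal_mult:
  assumes "g \<in> carrier PA"
  shows "cscal PA c \<otimes>\<^bsub>PA\<^esub> g = (\<lambda>p. c * g p)"
proof
  fix x :: "'v \<times> 'e list"
  obtain u es where x: "x = (u, es)" by force
  have "(cscal PA c \<otimes>\<^bsub>PA\<^esub> g) (u, es) = (\<Sum>j\<le>length es. if j = length es then c * g (u, es) else 0)"
    unfolding mult_PA
  proof (intro sum.cong refl)
    fix j assume j: "j \<in> {..length es}"
    \<comment> \<open>Scalars are supported on trivial paths, so only the cut that leaves the whole
      path to \<open>g\<close> survives. Its end is a vertex wherever \<open>g\<close> is
      nonzero.\<close>
    have "(path_end Q (u, es) \<in> verts Q) \<or> g (u, es) = 0"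
      using assms path_verts by (auto simp: carrier_PA)
    then show "cscal PA c (path_end Q (u, take j es), drop j es) * g (u, take j es) =
         (if j = length es then c * g (u, es) else 0)"
      using j by (auto simp: path_algebra_def)
  qed
  then show "(cscal PA c \<otimes>\<^bsub>PA\<^esub> g) x = c * g x"
    by (simp add: x)
qed

lemma mult_one_PA:
  assumes "g \<in> carrier PA"
  shows "g \<otimes>\<^bsub>PA\<^esub> \<one>\<^bsub>PA\<^esub> = g"
proof
  fix x :: "'v \<times> 'e list"
  obtain u es where x: "x = (u, es)" by force
  have "(g \<otimes>\<^bsub>PA\<^esub> \<one>\<^bsub>PA\<^esub>) (u, es) = (\<Sum>j\<le>length es. if j = 0 then g (u, es) else 0)"
    unfolding mult_PA
  proof (intro sum.cong refl)
    fix j assume j: "j \<in> {..length es}"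
    have "u \<in> verts Q \<or> g (u, es) = 0"
      using assms path_verts by (auto simp: carrier_PA)
    then show "g (path_end Q (u, take j es), drop j es) * \<one>\<^bsub>PA\<^esub> (u, take j es) = (if j = 0 then g (u, es) else 0)"
      using j by (auto simp: one_PA)
  qed
  then show "(g \<otimes>\<^bsub>PA\<^esub> \<one>\<^bsub>PA\<^esub>) x = g x"
    by (simp add: x)
qed

lemma add_closed_PA:
  assumes "f \<in> carrier PA" "g \<in> carrier PA"
  shows "f \<oplus>\<^bsub>PA\<^esub> g \<in> carrier PA"
proof -
  have "{p. (f \<oplus>\<^bsub>PA\<^esub> g) p \<noteq> 0} \<subseteq> {p. f p \<noteq> 0} \<union> {p. g p \<noteq> 0}"
    by (auto simp: add_PA)
  with assms show ?thesis
    unfolding carrier_PA by (meson finite_UnI finite_subset le_supI order_trans)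
qed

lemma ring_PA: "ring PA"
proof (intro ringI abelian_groupI monoidI)
  show "\<exists>y\<in>carrier PA. y \<oplus>\<^bsub>PA\<^esub> f = \<zero>\<^bsub>PA\<^esub>" if "f \<in> carrier PA" for f
    using that by (intro bexI[of _ "\<lambda>p. - f p"]) (auto simp: carrier_PA add_PA zero_PA)
  show "\<one>\<^bsub>PA\<^esub> \<in> carrier PA" by (simp add: one_eq_cscal cscal_carrier)
  show "\<one>\<^bsub>PA\<^esub> \<otimes>\<^bsub>PA\<^esub> f = f" if "f \<in> carrier PA" for f
    using that by (simp add: one_eq_cscal cscal_mult)
  show "(f \<oplus>\<^bsub>PA\<^esub> g) \<otimes>\<^bsub>PA\<^esub> h = f \<otimes>\<^bsub>PA\<^esub> h \<oplus>\<^bsub>PA\<^esub> g \<otimes>\<^bsub>PA\<^esub> h" for f g h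
    by (auto simp: fun_eq_iff add_PA mult_PA algebra_simps sum.distrib)
  show "h \<otimes>\<^bsub>PA\<^esub> (f \<oplus>\<^bsub>PA\<^esub> g) = h \<otimes>\<^bsub>PA\<^esub> f \<oplus>\<^bsub>PA\<^esub> h \<otimes>\<^bsub>PA\<^esub> g" for f g h
    by (auto simp: fun_eq_iff add_PA mult_PA algebra_simps sum.distrib)
  show "\<zero>\<^bsub>PA\<^esub> \<in> carrier PA" by (simp add: carrier_PA zero_PA)
qed (auto simp: mult_closed_PA mult_assoc_PA mult_one_PA add_closed_PA,
  auto simp: zero_PA add_PA algebra_simps)

sublocale PA: ring PA by (rule ring_PA)

lemma path_elt_carrier [simp]: "p \<in> paths Q \<Longrightarrow> path_elt p \<in> carrier PA"
  by (auto simp: carrier_PA path_elt_def)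

lemma path_elt_mult:
  "path_elt (v, fs) \<otimes>\<^bsub>PA\<^esub> path_elt (u, es) =
     (if v = path_end Q (u, es) then path_elt (u, es @ fs) else (\<lambda>p. 0))"
proof
  fix x :: "'v \<times> 'e list"
  obtain w gs where x: "x = (w, gs)" by force
  have "(path_elt (v, fs) \<otimes>\<^bsub>PA\<^esub> path_elt (u, es)) (w, gs) =
     (\<Sum>j\<le>length gs. if j = length es then (if v = path_end Q (u, es) \<and> (w, gs) = (u, es @ fs) then 1 else 0) else 0)"
    unfolding mult_PA
  proof (intro sum.cong refl)
    fix j assume j: "j \<in> {..length gs}"
    have "(path_end Q (w, take j gs), drop j gs) = (v, fs) \<and> (w, take j gs) = (u, es) \<longleftrightarrow>
       j = length es \<and> v = path_end Q (u, es) \<and> (w, gs) = (u, es @ fs)"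
      using j by (auto simp: min_def)
    moreover have "path_elt p q * path_elt p' q' = (if q = p \<and> q' = p' then 1 else 0)" for p q p' q' :: "'v \<times> 'e list"
      by (simp add: path_elt_def)
    ultimately show "path_elt (v, fs) (path_end Q (w, take j gs), drop j gs) * path_elt (u, es) (w, take j gs) =
       (if j = length es then (if v = path_end Q (u, es) \<and> (w, gs) = (u, es @ fs) then 1 else 0) else 0)"
      by presburger
  qed
  also have "\<dots> = (if v = path_end Q (u, es) then path_elt (u, es @ fs) else (\<lambda>p. 0)) (w, gs)"
    by (auto simp: path_elt_def)
  finally show "(path_elt (v, fs) \<otimes>\<^bsub>PA\<^esub> path_elt (u, es)) x =
    (if v = path_end Q (u, es) then path_elt (u, es @ fs) else (\<lambda>p. 0)) x" by (simp add: x)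
qed

text \<open>Induction on the size of the support: setting one value to zero removes one path. Linear
  statements thus reduce to single paths.\<close>

lemma PA_induct [consumes 1, case_names zero add]:
  assumes "f \<in> carrier PA" and "P (\<lambda>p. 0)"
    and "\<And>g c p. g \<in> carrier PA \<Longrightarrow> p \<in> paths Q \<Longrightarrow> g p = 0 \<Longrightarrow> P g \<Longrightarrow> P (\<lambda>q. g q + c * path_elt p q)"
  shows "P f"
proof -
  have "finite S \<Longrightarrow> \<forall>f. {p. f p \<noteq> 0} = S \<longrightarrow> S \<subseteq> paths Q \<longrightarrow> P f" for S
  proof (induction S rule: finite_induct)
    case empty
    have "f = (\<lambda>p. 0)" if "{p. f p \<noteq> 0} = {}" for f :: "'v \<times> 'e list \<Rightarrow> complex"
      using that by auto
    then show ?case using assms(2) by blast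
  next
    case (insert p S)
    show ?case
    proof (intro allI impI)
      fix f assume f: "{p. f p \<noteq> (0::complex)} = insert p S" "insert p S \<subseteq> paths Q"
      define g where "g = f(p := 0)"
      have g: "{p. g p \<noteq> 0} = S" using f insert.hyps by (auto simp: g_def)
      then have "P g" using insert.IH f by auto
      moreover have "g \<in> carrier PA" using g f insert.hyps by (simp add: carrier_PA)
      moreover have "f = (\<lambda>q. g q + f p * path_elt p q)" by (auto simp: g_def path_elt_def)
      ultimately show "P f" using assms(3)[of g p "f p"] f by (metis fun_upd_same g_def insert_subset)
    qed
  qed
  then show ?thesis using assms(1) by (auto simp: carrier_PA)
qed

end

section \<open>The quotient of the path algebra by relations\<close>

locale quiver_relations = quiver Q for Q :: "('v, 'e) quiver" +
  fixes R :: "(('v, 'e) path \<times> ('v, 'e) path) set"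
  assumes relations_paths: "(p, q) \<in> R \<Longrightarrow> p \<in> paths Q \<and> q \<in> paths Q"
begin

abbreviation "J \<equiv> relation_ideal Q R"
abbreviation "QA \<equiv> quotient_path_algebra Q R"
abbreviation "cl \<equiv> path_class Q R"

lemma gens_carrier: "(\<lambda>(p, q) x. path_elt p x - path_elt q x) ` R \<subseteq> carrier PA"
proof
  fix f assume "f \<in> (\<lambda>(p, q) x. path_elt p x - path_elt q x) ` R"
  then obtain p q where pq: "(p, q) \<in> R" and f: "f = (\<lambda>x. path_elt p x - path_elt q x)" by auto
  have "{x. f x \<noteq> 0} \<subseteq> {p, q}" by (auto simp: f path_elt_def split: if_splits)
  with relations_paths[OF pq] show "f \<in> carrier PA"
    by (auto simp: carrier_PA intro: finite_subset)
qed

sublocale J: ideal J PA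
  unfolding relation_ideal_def by (rule PA.genideal_ideal[OF gens_carrier])

lemma a_inv_PA: "g \<in> carrier PA \<Longrightarrow> \<ominus>\<^bsub>PA\<^esub> g = (\<lambda>p. - g p)"
  by (rule PA.minus_equality) (auto simp: add_PA zero_PA carrier_PA)

lemma class_eq_iff: "f \<in> carrier PA \<Longrightarrow> g \<in> carrier PA \<Longrightarrow> cl f = cl g \<longleftrightarrow> (\<lambda>p. f p - g p) \<in> J"
  unfolding path_class_def
  by (subst PA.quotient_eq_iff_same_a_r_cos[OF J.ideal_axioms, symmetric])
    (auto simp: a_minus_def a_inv_PA add_PA)

lemma relation_class: "(p, q) \<in> R \<Longrightarrow> cl (path_elt p) = cl (path_elt q)"
  using relations_paths[of p q] PA.genideal_self[OF gens_carrier]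
  by (subst class_eq_iff) (auto simp: relation_ideal_def)

lemma QA_carrier: "carrier QA = cl ` carrier PA"
  by (auto simp: quotient_path_algebra_def ring.defs calgebra.defs FactRing_def A_RCOSETS_def'
      path_class_def)

lemma QA_add: "f \<in> carrier PA \<Longrightarrow> g \<in> carrier PA \<Longrightarrow> cl f \<oplus>\<^bsub>QA\<^esub> cl g = cl (f \<oplus>\<^bsub>PA\<^esub> g)"
  using ring_hom_add[OF J.rcos_ring_hom, of f g]
  by (simp add: quotient_path_algebra_def ring.defs calgebra.defs path_class_def)

lemma QA_mult: "f \<in> carrier PA \<Longrightarrow> g \<in> carrier PA \<Longrightarrow> cl f \<otimes>\<^bsub>QA\<^esub> cl g = cl (f \<otimes>\<^bsub>PA\<^esub> g)"
  using ring_hom_mult[OF J.rcos_ring_hom, of f g]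
  by (simp add: quotient_path_algebra_def ring.defs calgebra.defs path_class_def)

lemma QA_one: "\<one>\<^bsub>QA\<^esub> = cl \<one>\<^bsub>PA\<^esub>"
  using ring_hom_one[OF J.rcos_ring_hom]
  by (simp add: quotient_path_algebra_def ring.defs calgebra.defs path_class_def)

lemma QA_cscal: "cscal QA c = cl (cscal PA c)"
  by (simp add: quotient_path_algebra_def ring.defs calgebra.defs path_class_def)

end

context quiver begin

lemma mult_cscal:
  assumes "g \<in> carrier PA"
  shows "g \<otimes>\<^bsub>PA\<^esub> cscal PA c = (\<lambda>p. c * g p)"
proof
  fix x :: "'v \<times> 'e list"
  obtain u es where x: "x = (u, es)" by force
  have "(g \<otimes>\<^bsub>PA\<^esub> cscal PA c) (u, es) = (\<Sum>j\<le>length es. if j = 0 then c * g (u, es) else 0)"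
    unfolding mult_PA
  proof (intro sum.cong refl)
    fix j assume j: "j \<in> {..length es}"
    have "u \<in> verts Q \<or> g (u, es) = 0"
      using assms path_verts by (auto simp: carrier_PA)
    then show "g (path_end Q (u, take j es), drop j es) * cscal PA c (u, take j es) = (if j = 0 then c * g (u, es) else 0)"
      using j by (auto simp: path_algebra_def)
  qed
  then show "(g \<otimes>\<^bsub>PA\<^esub> cscal PA c) x = c * g x"
    by (simp add: x)
qed

lemma carrier_smult: "g \<in> carrier PA \<Longrightarrow> (\<lambda>p. c * g p) \<in> carrier PA"
  using mult_closed_PA[OF cscal_carrier, of g c] by (simp add: cscal_mult)

lemma cscal_sum: "cscal PA c = (\<lambda>p. \<Sum>u\<in>verts Q. c * path_elt (u, []) p)"
proof
  fix p :: "'v \<times> 'e list"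
  obtain u es where p: "p = (u, es)" by force
  have "(\<Sum>v\<in>verts Q. c * path_elt (v, []) p) = (\<Sum>v\<in>verts Q. if v = u then (if es = [] then c else 0) else 0)"
    by (intro sum.cong) (auto simp: p path_elt_def)
  then show "cscal PA c p = (\<Sum>u\<in>verts Q. c * path_elt (u, []) p)"
    using finite_verts by (simp add: p path_algebra_def)
qed

end

section \<open>Modules over the quotient algebra\<close>

locale quiver_modules = quiver_relations Q R + vector_space scale
  for Q :: "('v, 'e) quiver" and R :: "(('v, 'e) path \<times> ('v, 'e) path) set"
    and scale :: "complex \<Rightarrow> 'u \<Rightarrow> 'u::ab_group_add"
begin

lemma QA_module_hom_scale:
  assumes "left_module scale QA (M, act)" "left_module scale QA (M', act')"
    "f \<in> left_module_hom QA (M, act) (M', act')" "m \<in> M"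
  shows "f (scale c m) = scale c (f m)"
proof -
  have "cscal QA c \<in> carrier QA" by (simp add: QA_carrier QA_cscal cscal_carrier)
  then show ?thesis using assms by (auto simp: left_module_def left_module_hom_def Pi_def PiE_def)
qed

context
  fixes M act
  assumes mod: "left_module scale QA (M, act)"
begin

lemma QA_subspace: "subspace M"
  using mod by (simp add: left_module_def)

lemma QA_act_closed: "f \<in> carrier PA \<Longrightarrow> m \<in> M \<Longrightarrow> act (cl f) m \<in> M"
  using mod by (simp add: left_module_def QA_carrier)

lemma QA_act_add: "f \<in> carrier PA \<Longrightarrow> m \<in> M \<Longrightarrow> m' \<in> M \<Longrightarrow> act (cl f) (m + m') = act (cl f) m + act (cl f) m'"
  using mod by (simp add: left_module_def QA_carrier)

lemma QA_act_cscal: "m \<in> M \<Longrightarrow> act (cl (cscal PA c)) m = scale c m"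
  using mod by (simp add: left_module_def QA_cscal)

lemma QA_act_plus: "f \<in> carrier PA \<Longrightarrow> g \<in> carrier PA \<Longrightarrow> m \<in> M \<Longrightarrow>
    act (cl (\<lambda>p. f p + g p)) m = act (cl f) m + act (cl g) m"
  using mod by (simp add: left_module_def QA_carrier QA_add[symmetric] add_PA[symmetric])

lemma QA_act_mult: "f \<in> carrier PA \<Longrightarrow> g \<in> carrier PA \<Longrightarrow> m \<in> M \<Longrightarrow>
    act (cl (f \<otimes>\<^bsub>PA\<^esub> g)) m = act (cl f) (act (cl g) m)"
  using mod by (simp add: left_module_def QA_carrier QA_mult[symmetric])

lemma QA_act_smult: "f \<in> carrier PA \<Longrightarrow> m \<in> M \<Longrightarrow> act (cl (\<lambda>p. c * f p)) m = scale c (act (cl f) m)"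
  using QA_act_mult[OF cscal_carrier, of f m c] by (simp add: cscal_mult QA_act_cscal QA_act_closed)

lemma QA_act_scale: "f \<in> carrier PA \<Longrightarrow> m \<in> M \<Longrightarrow> act (cl f) (scale c m) = scale c (act (cl f) m)"
  using QA_act_mult[OF _ cscal_carrier, of f m c] by (simp add: mult_cscal QA_act_cscal QA_act_smult)

lemma QA_act_zero: "m \<in> M \<Longrightarrow> act (cl (\<lambda>p. 0)) m = 0"
proof -
  have "(\<lambda>p. 0) = cscal PA 0" by (auto simp: path_algebra_def fun_eq_iff)
  then show "m \<in> M \<Longrightarrow> act (cl (\<lambda>p. 0)) m = 0" using QA_act_cscal[of m 0] by simp
qed

lemma QA_act_path_mult:
  assumes "(v, fs) \<in> paths Q" "(u, es) \<in> paths Q" "m \<in> M"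
  shows "act (cl (path_elt (v, fs))) (act (cl (path_elt (u, es))) m) =
    (if v = path_end Q (u, es) then act (cl (path_elt (u, es @ fs))) m else 0)"
  using QA_act_mult[of "path_elt (v, fs)" "path_elt (u, es)" m] assms
  by (auto simp: path_elt_mult QA_act_zero split: if_splits)

lemma QA_act_sum:
  assumes "finite S" "\<And>i. i \<in> S \<Longrightarrow> g i \<in> carrier PA" "m \<in> M"
  shows "act (cl (\<lambda>p. \<Sum>i\<in>S. g i p)) m = (\<Sum>i\<in>S. act (cl (g i)) m) \<and> (\<lambda>p. \<Sum>i\<in>S. g i p) \<in> carrier PA"
  using assms(1,2)
proof (induction S rule: finite_induct)
  case empty
  then show ?case using assms(3) by (simp add: QA_act_zero carrier_PA)
next
  case (insert i S)
  then show ?case using assms(3) add_closed_PA[of "g i" "\<lambda>p. \<Sum>i\<in>S. g i p"] by (simp add: QA_act_plus add_PA)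
qed

lemma QA_act_unit: "m \<in> M \<Longrightarrow> (\<Sum>u\<in>verts Q. act (cl (path_elt (u, []))) m) = m"
  using QA_act_sum[OF finite_verts, of "\<lambda>u p. 1 * path_elt (u, []) p" m] QA_act_cscal[of m 1]
  by (simp add: cscal_sum[of 1])

end

text \<open>The classes of paths span the quotient algebra, so a linear map that commutes with them
  is a module map.\<close>

lemma QA_module_homI:
  assumes X: "left_module scale QA (M, act)" and Y: "left_module scale QA (M', act')"
    and f: "f \<in> M \<rightarrow>\<^sub>E M'" and add: "\<And>m m'. m \<in> M \<Longrightarrow> m' \<in> M \<Longrightarrow> f (m + m') = f m + f m'"
    and sc: "\<And>c m. m \<in> M \<Longrightarrow> f (scale c m) = scale c (f m)"
    and path: "\<And>p m. p \<in> paths Q \<Longrightarrow> m \<in> M \<Longrightarrow> f (act (cl (path_elt p)) m) = act' (cl (path_elt p)) (f m)"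
  shows "f \<in> left_module_hom QA (M, act) (M', act')"
proof -
  have f': "\<And>m. m \<in> M \<Longrightarrow> f m \<in> M'" using f by auto
  have "0 \<in> M" using QA_subspace[OF X] subspace_0 by blast
  then have f0: "f 0 = 0" using add[of 0 0] by simp
  have "\<forall>m\<in>M. f (act (cl g) m) = act' (cl g) (f m)" if "g \<in> carrier PA" for g
    using that
  proof (induction rule: PA_induct)
    case zero
    then show ?case using f' f0 by (simp add: QA_act_zero[OF X] QA_act_zero[OF Y])
  next
    case (add g c p)
    have 1: "(\<lambda>q. c * path_elt p q) \<in> carrier PA" using add.hyps by (simp add: carrier_smult)
    show ?case
      using add 1 f'
      by (simp add: QA_act_plus[OF X] QA_act_plus[OF Y] QA_act_smult[OF X] QA_act_smult[OF Y]
          path sc assms(4) QA_act_closed[OF X] subspace_scale[OF QA_subspace[OF X]])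
  qed
  then show ?thesis
    using f add by (auto simp: left_module_hom_def QA_carrier)
qed

text \<open>The source of the representations attached to weight modules: operators for single
  paths, multiplicative under concatenation and agreeing on each pair of \<open>R\<close>, extend
  linearly to the path algebra and descend to the quotient.\<close>

lemma QA_module_of_paths:
  fixes V :: "'u set" and \<rho> :: "('v, 'e) path \<Rightarrow> 'u \<Rightarrow> 'u"
  assumes V: "subspace V" and clo: "\<And>p m. p \<in> paths Q \<Longrightarrow> m \<in> V \<Longrightarrow> \<rho> p m \<in> V"
    and add: "\<And>p m m'. p \<in> paths Q \<Longrightarrow> m \<in> V \<Longrightarrow> m' \<in> V \<Longrightarrow> \<rho> p (m + m') = \<rho> p m + \<rho> p m'"
    and sc: "\<And>p c m. p \<in> paths Q \<Longrightarrow> m \<in> V \<Longrightarrow> \<rho> p (scale c m) = scale c (\<rho> p m)"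
    and mul: "\<And>u es v fs m. (u, es) \<in> paths Q \<Longrightarrow> (v, fs) \<in> paths Q \<Longrightarrow> m \<in> V \<Longrightarrow>
       \<rho> (v, fs) (\<rho> (u, es) m) = (if v = path_end Q (u, es) then \<rho> (u, es @ fs) m else 0)"
    and un: "\<And>m. m \<in> V \<Longrightarrow> (\<Sum>u\<in>verts Q. \<rho> (u, []) m) = m"
    and rel: "\<And>p q m. (p, q) \<in> R \<Longrightarrow> m \<in> V \<Longrightarrow> \<rho> p m = \<rho> q m"
  shows "\<exists>act. left_module scale QA (V, act) \<and> (\<forall>p\<in>paths Q. \<forall>m\<in>V. act (cl (path_elt p)) m = \<rho> p m)"
proof -
  define ra where "ra f m = (\<Sum>p\<in>{p. f p \<noteq> 0}. scale (f p) (\<rho> p m))" for f m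
  have ra: "ra f m = (\<Sum>p\<in>S. scale (f p) (\<rho> p m))" if "finite S" "{p. f p \<noteq> 0} \<subseteq> S" for f m S
    unfolding ra_def using that by (intro sum.mono_neutral_left) auto
  have ra_add: "ra (\<lambda>p. f p + c * g p) m = ra f m + scale c (ra g m)"
    if "f \<in> carrier PA" "g \<in> carrier PA" for f g c m
  proof -
    let ?S = "{p. f p \<noteq> 0} \<union> {p. g p \<noteq> 0}"
    have "{p. f p + c * g p \<noteq> 0} \<subseteq> ?S" by auto
    then show ?thesis
      using that ra[of ?S "\<lambda>p. f p + c * g p" m] ra[of ?S f m] ra[of ?S g m]
      by (simp add: carrier_PA scale_left_distrib sum.distrib scale_sum_right)
  qed
  have ra_elt: "ra (path_elt p) m = \<rho> p m" for p m
    using ra[of "{p}" "path_elt p" m] by (auto simp: path_elt_def)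
  have ra_0: "ra (\<lambda>p. 0) m = 0" for m by (simp add: ra_def)
  have ra_clo: "ra f m \<in> V" if "f \<in> carrier PA" "m \<in> V" for f m
    unfolding ra_def using that by (intro subspace_sum V subspace_scale clo) (auto simp: carrier_PA)
  have V0: "0 \<in> V" using V subspace_0 by blast
  have \<rho>0: "\<rho> p 0 = 0" if "p \<in> paths Q" for p using sc[OF that V0, of 0] by simp
  have \<rho>_sum: "\<rho> p (\<Sum>i\<in>S. h i) = (\<Sum>i\<in>S. \<rho> p (h i))" if "p \<in> paths Q" "finite S" "\<And>i. i \<in> S \<Longrightarrow> h i \<in> V"
    for p and S :: "('v \<times> 'e list) set" and h
    using that(2,3) by (induction S rule: finite_induct)
      (auto simp: \<rho>0 that(1) add subspace_sum[OF V])
  have ra_lin: "ra f (m + scale c m') = ra f m + scale c (ra f m')" if "f \<in> carrier PA" "m \<in> V" "m' \<in> V" for f m m' c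
  proof -
    have "ra f (m + scale c m') = (\<Sum>p\<in>{p. f p \<noteq> 0}. scale (f p) (\<rho> p m + scale c (\<rho> p m')))"
      unfolding ra_def using that by (intro sum.cong refl) (auto simp: carrier_PA add sc subspace_scale[OF V])
    then show ?thesis by (simp add: ra_def scale_right_distrib sum.distrib scale_sum_right mult.commute)
  qed
  have ra_mult1: "ra (path_elt p \<otimes>\<^bsub>PA\<^esub> g) m = \<rho> p (ra g m)" if p: "p \<in> paths Q" and g: "g \<in> carrier PA" and m: "m \<in> V" for p g m
    using g
  proof (induction rule: PA_induct)
    case zero
    have "path_elt p \<otimes>\<^bsub>PA\<^esub> (\<lambda>p. 0) = (\<lambda>p. 0)" by (auto simp: fun_eq_iff mult_PA)
    then show ?case by (simp add: ra_0 \<rho>0 p)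
  next
    case (add g c q)
    have "path_elt p \<otimes>\<^bsub>PA\<^esub> (\<lambda>x. g x + c * path_elt q x) =
       (\<lambda>x. (path_elt p \<otimes>\<^bsub>PA\<^esub> g) x + c * (path_elt p \<otimes>\<^bsub>PA\<^esub> path_elt q) x)"
      by (auto simp: fun_eq_iff mult_PA algebra_simps sum.distrib sum_distrib_left)
    moreover have "ra (path_elt p \<otimes>\<^bsub>PA\<^esub> path_elt q) m = \<rho> p (\<rho> q m)"
      using mul[of "fst q" "snd q" "fst p" "snd p" m] add.hyps p m path_elt_mult[of "fst p" "snd p" "fst q" "snd q"]
      by (auto simp: ra_elt ra_0)
    ultimately show ?case
      using add p m by (simp add: ra_add mult_closed_PA ra_elt assms(3) ra_clo clo sc subspace_scale[OF V])
  qed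
  have ra_mult: "ra (f \<otimes>\<^bsub>PA\<^esub> g) m = ra f (ra g m)" if f: "f \<in> carrier PA" and g: "g \<in> carrier PA" and m: "m \<in> V" for f g m
    using f
  proof (induction rule: PA_induct)
    case zero
    have "(\<lambda>p. 0) \<otimes>\<^bsub>PA\<^esub> g = (\<lambda>p. 0)" by (auto simp: fun_eq_iff mult_PA)
    then show ?case by (simp add: ra_0)
  next
    case (add f c q)
    have "(\<lambda>x. f x + c * path_elt q x) \<otimes>\<^bsub>PA\<^esub> g =
       (\<lambda>x. (f \<otimes>\<^bsub>PA\<^esub> g) x + c * (path_elt q \<otimes>\<^bsub>PA\<^esub> g) x)"
      by (auto simp: fun_eq_iff mult_PA algebra_simps sum.distrib sum_distrib_left)
    then show ?case
      using add g m by (simp add: ra_add mult_closed_PA ra_elt ra_mult1)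
  qed
  have ra_V0: "ra f 0 = 0" if "f \<in> carrier PA" for f
    unfolding ra_def using that by (intro sum.neutral) (auto simp: carrier_PA \<rho>0)
  \<comment> \<open>The annihilator of \<open>V\<close> is a two-sided ideal and contains the
    generating differences, hence it contains the whole relation ideal.\<close>
  define I0 where "I0 = {f \<in> carrier PA. \<forall>m\<in>V. ra f m = 0}"
  have "ideal I0 PA"
  proof (rule idealI[OF ring_PA])
    show "subgroup I0 (add_monoid PA)"
    proof (rule PA.add.subgroupI)
      show "I0 \<noteq> {}" using ra_0 by (auto simp: I0_def carrier_PA intro!: exI[of _ "\<lambda>p. 0"])
      show "\<ominus>\<^bsub>PA\<^esub> f \<in> I0" if "f \<in> I0" for f
        using that ra_add[of "\<lambda>p. 0" f "-1"] by (auto simp: I0_def a_inv_PA ra_0 carrier_PA)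
      show "f \<oplus>\<^bsub>PA\<^esub> g \<in> I0" if "f \<in> I0" "g \<in> I0" for f g
        using that ra_add[of f g 1] add_closed_PA by (auto simp: I0_def add_PA)
    qed (auto simp: I0_def)
  qed (auto simp: I0_def ra_mult mult_closed_PA ra_clo ra_V0)
  moreover have "(\<lambda>(p, q) x. path_elt p x - path_elt q x) ` R \<subseteq> I0"
  proof -
    have "ra (\<lambda>x. path_elt p x - path_elt q x) m = 0" if "(p, q) \<in> R" "m \<in> V" for p q m
      using that ra_add[of "path_elt p" "path_elt q" "-1" m] relations_paths[OF that(1)]
      by (simp add: ra_elt rel)
    then show ?thesis using gens_carrier by (fastforce simp: I0_def)
  qed
  ultimately have J: "J \<subseteq> I0"
    unfolding relation_ideal_def by (rule PA.genideal_minimal)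
  have ra_cl: "ra f m = ra g m" if "f \<in> carrier PA" "g \<in> carrier PA" "cl f = cl g" "m \<in> V" for f g m
  proof -
    have "ra (\<lambda>p. f p - g p) m = 0" using that J by (auto simp: class_eq_iff I0_def)
    then show ?thesis using ra_add[of f g "-1" m] that by simp
  qed
  \<comment> \<open>The choice of a representative is harmless by \<open>ra_cl\<close>.\<close>
  define act where "act C m = ra (SOME f. f \<in> carrier PA \<and> cl f = C) m" for C m
  have act: "act (cl f) m = ra f m" if "f \<in> carrier PA" "m \<in> V" for f m
    unfolding act_def using someI[of "\<lambda>g. g \<in> carrier PA \<and> cl g = cl f" f] that
    by (intro ra_cl) auto
  have cs: "ra (cscal PA c) m = scale c m" if "m \<in> V" for c m
  proof -
    have "ra (cscal PA c) m = (\<Sum>p\<in>(\<lambda>u. (u, [])) ` verts Q. scale (cscal PA c p) (\<rho> p m))"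
      by (rule ra) (auto simp: finite_verts path_algebra_def split: if_splits)
    also have "\<dots> = (\<Sum>u\<in>verts Q. scale c (\<rho> (u, []) m))"
      by (subst sum.reindex) (auto simp: inj_on_def path_algebra_def)
    finally show ?thesis using un[OF that] by (simp add: scale_sum_right[symmetric])
  qed
  have "left_module scale QA (V, act)"
    unfolding left_module_def prod.case
  proof (intro conjI ballI allI)
    show "subspace V" by fact
  next
    fix x m assume "x \<in> carrier QA" "m \<in> V" then show "act x m \<in> V" by (auto simp: QA_carrier act ra_clo)
  next
    fix x m m' assume "x \<in> carrier QA" "m \<in> V" "m' \<in> V"
    then show "act x (m + m') = act x m + act x m'"
      using ra_lin[of _ m m' 1] by (auto simp: QA_carrier act subspace_add[OF V])
  next
    fix x y m assume "x \<in> carrier QA" "y \<in> carrier QA" "m \<in> V"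
    then show "act (x \<oplus>\<^bsub>QA\<^esub> y) m = act x m + act y m"
      using ra_add[of _ _ 1] add_closed_PA by (auto simp: QA_carrier QA_add act) (simp add: add_PA)
  next
    fix x y m assume "x \<in> carrier QA" "y \<in> carrier QA" "m \<in> V"
    then show "act (x \<otimes>\<^bsub>QA\<^esub> y) m = act x (act y m)"
      by (auto simp: QA_carrier QA_mult act mult_closed_PA ra_mult ra_clo)
  next
    fix m assume "m \<in> V"
    then show "act \<one>\<^bsub>QA\<^esub> m = m"
      using cs[of m 1] cscal_carrier[of 1] by (simp add: QA_one one_eq_cscal act)
  next
    fix c m assume "m \<in> V"
    then show "act (cscal QA c) m = scale c m"
      by (simp add: QA_cscal cs act cscal_carrier)
  qed
  then show ?thesis using act ra_elt by (intro exI[of _ act]) simp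
qed

end

section \<open>Polynomial functions\<close>

text \<open>Polynomials are functions here, not formal expressions: a shift of the argument is then
  plain substitution. Coefficients appear only through \<open>expansion\<close>.\<close>

inductive_set polys :: "(('i::finite \<Rightarrow> complex) \<Rightarrow> complex) set" where
  const: "(\<lambda>z. c) \<in> polys"
| var: "(\<lambda>z. z i) \<in> polys"
| add: "f \<in> polys \<Longrightarrow> g \<in> polys \<Longrightarrow> (\<lambda>z. f z + g z) \<in> polys"
| mult: "f \<in> polys \<Longrightarrow> g \<in> polys \<Longrightarrow> (\<lambda>z. f z * g z) \<in> polys"

lemma polys_minus: "f \<in> polys \<Longrightarrow> g \<in> polys \<Longrightarrow> (\<lambda>z. f z - g z) \<in> polys"
  using polys.add[OF _ polys.mult[OF polys.const[of "-1"]], of f g] by simp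

lemma polys_sum: "(\<And>i. i \<in> S \<Longrightarrow> f i \<in> polys) \<Longrightarrow> (\<lambda>z. \<Sum>i\<in>S. f i z) \<in> polys"
  by (induction S rule: infinite_finite_induct) (auto intro: polys.intros)

lemma polys_prod: "(\<And>i. i \<in> S \<Longrightarrow> f i \<in> polys) \<Longrightarrow> (\<lambda>z. \<Prod>i\<in>S. f i z) \<in> polys"
  by (induction S rule: infinite_finite_induct) (auto intro: polys.intros)

lemma polys_power: "f \<in> polys \<Longrightarrow> (\<lambda>z. f z ^ N) \<in> polys"
  by (induction N) (auto intro: polys.intros)

lemma polys_shift:
  assumes "f \<in> polys" shows "(\<lambda>z. f (\<lambda>i. z i + a i)) \<in> polys"
  using assms
proof induction
  case (var i)
  show ?case by (rule polys.add[OF polys.var polys.const])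
qed (rule polys.intros, assumption?, assumption?)+

lemmas polys_intros = polys.intros polys_minus polys_sum polys_prod polys_power

definition monomial :: "('i::finite \<Rightarrow> nat) \<Rightarrow> ('i \<Rightarrow> complex) \<Rightarrow> complex" where
  "monomial e z = (\<Prod>i\<in>UNIV. z i ^ e i)"

lemma monomial_times: "monomial e (\<lambda>i. z i * w i) = monomial e z * monomial e w"
  by (simp add: monomial_def power_mult_distrib prod.distrib)

lemma monomial_add: "monomial (\<lambda>i. e i + f i) z = monomial e z * monomial f z"
  by (simp add: monomial_def power_add prod.distrib)

text \<open>Dedekind's argument: distinct monomials are distinct multiplicative characters.\<close>

lemma monomials_independent:
  assumes "finite K" "\<And>x :: 'i::finite \<Rightarrow> nat. (\<forall>i. x i \<ge> b) \<Longrightarrow> (\<Sum>e\<in>K. c e * monomial e (\<lambda>i. of_nat (x i))) = 0"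
  shows "\<forall>e\<in>K. c e = 0"
  using assms
proof (induction K arbitrary: c b rule: finite_induct)
  case empty
  then show ?case by simp
next
  case (insert e K)
  let ?m = "\<lambda>e (x :: 'i \<Rightarrow> nat). monomial e (\<lambda>i. of_nat (x i))"
  have K: "c f = 0" if f: "f \<in> K" for f
  proof -
    have "f \<noteq> e" using insert.hyps f by auto
    then obtain i where i: "f i \<noteq> e i" by auto
    \<comment> \<open>Multiplying the coordinate \<open>i\<close> by 2 scales the monomials of
      \<open>e\<close> and \<open>f\<close> by different powers of 2, and keeps all coordinates at
      least \<open>b\<close>.\<close>
    define y :: "'i \<Rightarrow> nat" where "y j = (if j = i then 2 else 1)" for j
    have y: "?m g y = 2 ^ g i" for g
    proof -
      have "?m g y = (\<Prod>j\<in>UNIV. if j = i then 2 ^ g j else 1)"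
        unfolding monomial_def by (intro prod.cong) (auto simp: y_def)
      then show ?thesis by simp
    qed
    have "\<forall>g\<in>K. c g * (?m g y - ?m e y) = 0"
    proof (rule insert.IH[of b])
      fix x :: "'i \<Rightarrow> nat" assume x: "\<forall>i. x i \<ge> b"
      have "\<forall>j. x j * y j \<ge> b"
      proof
        fix j
        have "x j * 1 \<le> x j * y j" by (rule mult_le_mono2) (simp add: y_def)
        then show "x j * y j \<ge> b" using x le_trans by fastforce
      qed
      from insert.prems[OF this]
      have "(\<Sum>g\<in>insert e K. c g * (?m g x * ?m g y)) = 0" by (simp add: monomial_times)
      moreover have "(\<Sum>g\<in>insert e K. c g * ?m g x) = 0" using insert.prems[OF x] .
      \<comment> \<open>The relation at \<open>x * y\<close> minus \<open>?m e y\<close> times the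
        relation at \<open>x\<close>: the term of \<open>e\<close> cancels, and the induction
        hypothesis applies to the rest.\<close>
      moreover have "(\<Sum>g\<in>insert e K. c g * (?m g y - ?m e y) * ?m g x) =
          (\<Sum>g\<in>insert e K. c g * (?m g x * ?m g y)) - (\<Sum>g\<in>insert e K. c g * ?m g x) * ?m e y"
        unfolding sum_distrib_right sum_subtractf[symmetric] by (intro sum.cong refl) (simp add: algebra_simps)
      ultimately have "(\<Sum>g\<in>insert e K. c g * (?m g y - ?m e y) * ?m g x) = 0"
        by simp
      then show "(\<Sum>g\<in>K. c g * (?m g y - ?m e y) * ?m g x) = 0"
        using insert.hyps by simp
    qed
    moreover have "?m f y \<noteq> ?m e y"
    proof
      assume "?m f y = ?m e y"
      then have "norm ((2::complex) ^ f i) = norm ((2::complex) ^ e i)" by (simp add: y)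
      then show False using i by (simp add: norm_power)
    qed
    ultimately show ?thesis using f by auto
  qed
  \<comment> \<open>Only the term of \<open>e\<close> is left; at the point with all coordinates
    \<open>Suc b\<close> its monomial is nonzero.\<close>
  moreover have "c e = 0"
    using insert.prems[of "\<lambda>_. Suc b"] K insert.hyps of_nat_neq_0[of b, where 'a = complex]
    by (simp add: monomial_def)
  ultimately show ?case by auto
qed

text \<open>The pairs (coefficient, exponent) are indexed by lists, so that products need no collection
  of equal exponents.\<close>

definition expansion :: "(complex \<times> ('i::finite \<Rightarrow> nat)) list \<Rightarrow> (('i \<Rightarrow> nat) \<Rightarrow> 'b::comm_monoid_add) \<Rightarrow>
    (complex \<Rightarrow> 'b \<Rightarrow> 'b) \<Rightarrow> 'b" where
  "expansion xs \<phi> s = (\<Sum>(c, e)\<leftarrow>xs. s c (\<phi> e))"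

text \<open>The scalar action \<open>s\<close> is abstract so that the same regrouping serves for
  values of polynomials and for operators applied to a vector.\<close>

lemma expansion_collect:
  assumes "\<And>a b x. s (a + b) x = s a x + s b x" "\<And>x. s 0 x = (0::'b::comm_monoid_add)"
  shows "expansion xs \<phi> s = (\<Sum>e\<in>snd ` set xs. s (\<Sum>(c, e')\<leftarrow>xs. if e' = e then c else 0) (\<phi> e))"
proof (induction xs)
  case Nil
  then show ?case by (simp add: expansion_def)
next
  case (Cons x xs)
  obtain c f where x: "x = (c, f)" by force
  let ?k = "\<lambda>xs e. \<Sum>(c, e')\<leftarrow>xs. if e' = e then c else 0"
  have nz: "?k xs e = 0" if "e \<notin> snd ` set xs" for e
    using that by (induction xs) auto
  have "(\<Sum>e\<in>insert f (snd ` set xs). s (?k xs e) (\<phi> e)) = (\<Sum>e\<in>snd ` set xs. s (?k xs e) (\<phi> e))"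
    by (rule sum.mono_neutral_right) (auto simp: nz assms(2))
  moreover have "(\<Sum>e\<in>insert f (snd ` set xs). s (if f = e then c else 0) (\<phi> e)) = s c (\<phi> f)"
  proof -
    have "(\<Sum>e\<in>insert f (snd ` set xs). s (if f = e then c else 0) (\<phi> e)) =
       (\<Sum>e\<in>insert f (snd ` set xs). if e = f then s c (\<phi> f) else 0)"
      by (intro sum.cong) (auto simp: assms(2))
    then show ?thesis by simp
  qed
  ultimately show ?case using Cons by (simp add: x expansion_def assms(1) sum.distrib)
qed

text \<open>A transfer principle. If the list vanishes as a function on natural points far out, its
  collected coefficients are zero, and so the list vanishes for every family \<open>\<phi>\<close>
  with any scalar action.\<close>

lemma expansion_eq_0:
  assumes z: "\<And>x :: 'i::finite \<Rightarrow> nat. (\<forall>i. x i \<ge> b) \<Longrightarrow> expansion xs (\<lambda>e. monomial e (\<lambda>i. of_nat (x i))) (*) = 0"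
    and s: "\<And>a b x. s (a + b) x = s a x + s b x" "\<And>x. s 0 x = (0::'b::comm_monoid_add)"
  shows "expansion xs \<phi> s = 0"
proof -
  have "\<forall>e\<in>snd ` set xs. (\<Sum>(c, e')\<leftarrow>xs. if e' = e then c else 0) = 0"
    using z by (intro monomials_independent[of _ b]) (simp_all add: expansion_collect distrib_right)
  then show ?thesis using s by (subst expansion_collect) (auto intro!: sum.neutral)
qed

lemma expansion_append: "expansion (xs @ ys) \<phi> s = expansion xs \<phi> s + expansion ys \<phi> s"
  by (simp add: expansion_def)

lemma expansion_Nil [simp]: "expansion [] \<phi> s = 0"
  by (simp add: expansion_def)

lemma expansion_Cons [simp]: "expansion ((c, e) # xs) \<phi> s = s c (\<phi> e) + expansion xs \<phi> s"
  by (simp add: expansion_def)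

definition expansion_times where
  "expansion_times xs ys = concat (map (\<lambda>(c, e). map (\<lambda>(d, f). (c * d, \<lambda>i. e i + f i)) ys) xs)"

lemma expansion_times_Nil [simp]: "expansion_times [] ys = []"
  by (simp add: expansion_times_def)

lemma expansion_times_Cons [simp]: "expansion_times ((c, e) # xs) ys =
   map (\<lambda>(d, f). (c * d, \<lambda>i. e i + f i)) ys @ expansion_times xs ys"
  by (simp add: expansion_times_def)

lemma expansion_times:
  "expansion (expansion_times xs ys) (\<lambda>e. monomial e z) (*) =
   expansion xs (\<lambda>e. monomial e z) (*) * expansion ys (\<lambda>e. monomial e z) (*)"
proof (induction xs)
  case (Cons x xs)
  obtain c e where x: "x = (c, e)" by force
  have "expansion (map (\<lambda>(d, f). (c * d, \<lambda>i. e i + f i)) ys) (\<lambda>e. monomial e z) (*) =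
     c * monomial e z * expansion ys (\<lambda>e. monomial e z) (*)"
    by (induction ys) (auto simp: monomial_add algebra_simps)
  then show ?case by (simp add: x expansion_append Cons algebra_simps)
qed simp

lemma polys_expansion:
  assumes "f \<in> polys" shows "\<exists>xs. \<forall>z. f z = expansion xs (\<lambda>e. monomial e z) (*)"
  using assms
proof induction
  case (const c)
  show ?case by (intro exI[of _ "[(c, \<lambda>_. 0)]"]) (simp add: monomial_def)
next
  case (var i)
  have "(\<Prod>j\<in>UNIV. z j ^ (if j = i then 1 else 0)) = z i" for z :: "'a \<Rightarrow> complex"
  proof -
    have "(\<Prod>j\<in>UNIV. z j ^ (if j = i then 1 else 0)) = (\<Prod>j\<in>UNIV. if j = i then z j else 1)"
      by (intro prod.cong) auto
    then show ?thesis by simp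
  qed
  then show ?case by (intro exI[of _ "[(1, \<lambda>j. if j = i then 1 else 0)]"]) (simp add: monomial_def)
next
  case (add f g)
  then obtain xs ys where "\<forall>z. f z = expansion xs (\<lambda>e. monomial e z) (*)"
    "\<forall>z. g z = expansion ys (\<lambda>e. monomial e z) (*)" by blast
  then show ?case by (intro exI[of _ "xs @ ys"]) (simp add: expansion_append)
next
  case (mult f g)
  then obtain xs ys where "\<forall>z. f z = expansion xs (\<lambda>e. monomial e z) (*)"
    "\<forall>z. g z = expansion ys (\<lambda>e. monomial e z) (*)" by blast
  then show ?case by (intro exI[of _ "expansion_times xs ys"]) (simp add: expansion_times)
qed

text \<open>Natural points beyond \<open>b\<close> suffice. The bound matters because the matrix of
  an operator gives no information at exponents where \<open>fall\<close> vanishes.\<close>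

lemma poly_eqI:
  assumes f: "f \<in> polys" and g: "g \<in> polys"
    and eq: "\<And>x :: 'i::finite \<Rightarrow> nat. (\<forall>i. x i \<ge> b) \<Longrightarrow> f (\<lambda>i. of_nat (x i)) = g (\<lambda>i. of_nat (x i))"
  shows "f = g"
proof -
  obtain xs where xs: "\<And>z. f z - g z = expansion xs (\<lambda>e. monomial e z) (*)"
    using polys_expansion[OF polys_minus[OF f g]] by auto
  have *: "expansion xs (\<lambda>e. monomial e (\<lambda>i. of_nat (x i))) (*) = 0" if "\<forall>i. x i \<ge> b" for x :: "'i \<Rightarrow> nat"
    unfolding xs[symmetric] eq[OF that] by simp
  have "expansion xs (\<lambda>e. monomial e z) (*) = 0" for z
    by (rule expansion_eq_0[of b, OF *]) (simp_all add: distrib_right)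
  then have "f z = g z" for z using xs[of z] by simp
  then show ?thesis by (rule ext)
qed

section \<open>Operators in terms of weighted shifts of monomials\<close>

text \<open>A unit step down is labeled by its upper end, so the descent from \<open>l\<close> to
  \<open>m\<close> is \<open>{m<..l}\<close>, which is empty for an ascent. At most one of the two
  intervals here is nonempty: \<open>m\<close> lies below both \<open>l\<close> and
  \<open>n\<close>, or above both.\<close>

definition overshoot :: "int \<Rightarrow> int \<Rightarrow> int \<Rightarrow> int set" where
  "overshoot l m n = {m<..min l n} \<union> {max l n<..m}"

lemma finite_overshoot [simp]: "finite (overshoot l m n)"
  by (simp add: overshoot_def)

lemma prod_greaterThanAtMost_split:
  fixes \<phi> :: "int \<Rightarrow> 'a::comm_monoid_mult"
  assumes "a \<le> b" "b \<le> c"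
  shows "prod \<phi> {a<..c} = prod \<phi> {a<..b} * prod \<phi> {b<..c}"
proof -
  have "{a<..c} = {a<..b} \<union> {b<..c}" using assms by auto
  then show ?thesis by (simp add: prod.union_disjoint disjoint_iff)
qed

text \<open>A path from \<open>l\<close> to \<open>n\<close> through \<open>m\<close> descends along more unit steps than the direct one:
  the excess are the steps of the part of the path beyond the interval between \<open>l\<close> and \<open>n\<close>.\<close>

lemma overshoot_prod:
  fixes \<phi> :: "int \<Rightarrow> 'a::comm_monoid_mult"
  shows "prod \<phi> {n<..m} * prod \<phi> {m<..l} = prod \<phi> (overshoot l m n) * prod \<phi> {n<..l}"
proof -
  consider (a) "m \<le> n" "n \<le> l" | (b) "n \<le> l" "l \<le> m" | (c) "n \<le> m" "m \<le> l" | (d) "l \<le> n"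
    by linarith
  then show ?thesis
  proof cases
    case a
    then have "overshoot l m n = {m<..n}" by (auto simp: overshoot_def)
    then show ?thesis using a prod_greaterThanAtMost_split[of m n l \<phi>] by simp
  next
    case b
    then have "overshoot l m n = {l<..m}" by (auto simp: overshoot_def)
    then show ?thesis using b prod_greaterThanAtMost_split[of n l m \<phi>] by (simp add: mult.commute)
  next
    case c
    then have "overshoot l m n = {}" by (auto simp: overshoot_def)
    then show ?thesis using c prod_greaterThanAtMost_split[of n m l \<phi>] by (simp add: mult.commute)
  next
    case d
    then have "overshoot l m n = {m<..l} \<union> {n<..m}" "{m<..l} \<inter> {n<..m} = {}" by (auto simp: overshoot_def)
    then show ?thesis using d by (simp add: prod.union_disjoint mult.commute)
  qed
qed

abbreviation plus_int :: "('i \<Rightarrow> complex) \<Rightarrow> ('i \<Rightarrow> int) \<Rightarrow> 'i \<Rightarrow> complex" where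
  "plus_int z \<alpha> \<equiv> (\<lambda>i. z i + of_int (\<alpha> i))"

text \<open>A product of falling factorials \<open>z (z - 1) ... (z + \<alpha> + 1)\<close>, one for
  each negative entry of \<open>\<alpha>\<close>: the factor produced by the derivations when
  applied to a monomial.\<close>

definition fall :: "('i::finite \<Rightarrow> int) \<Rightarrow> ('i \<Rightarrow> complex) \<Rightarrow> complex" where
  "fall \<alpha> z = (\<Prod>i\<in>UNIV. \<Prod>c\<in>{\<alpha> i<..0}. z i + of_int c)"

text \<open>The structure constants of the composition of weighted shifts, see \<open>wop_comp\<close>.\<close>

definition turn :: "('i::finite \<Rightarrow> int) \<Rightarrow> ('i \<Rightarrow> int) \<Rightarrow> ('i \<Rightarrow> complex) \<Rightarrow> complex" where
  "turn \<beta> \<alpha> z = (\<Prod>i\<in>UNIV. \<Prod>c\<in>overshoot 0 (\<alpha> i) (\<alpha> i + \<beta> i). z i + of_int c)"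

lemma turn_polys: "turn \<beta> \<alpha> \<in> polys"
  unfolding turn_def by (intro polys_intros)

text \<open>After the substitution of \<open>c + a\<close> for \<open>c\<close> the factors of the
  second step run over \<open>{a + b<..a}\<close>, in the same scale as those of the first;
  \<open>overshoot_prod\<close> with \<open>l = 0\<close> then compares the two steps with the
  direct one.\<close>

lemma fall_comp: "fall \<beta> (plus_int z \<alpha>) * fall \<alpha> z = turn \<beta> \<alpha> z * fall (\<lambda>i. \<alpha> i + \<beta> i) z"
proof -
  have "(\<Prod>c\<in>{b<..0}. x + of_int a + of_int c) = (\<Prod>c\<in>{a + b<..a}. x + of_int c)" for x :: complex and a b :: int
    by (rule prod.reindex_bij_witness[of _ "\<lambda>c. c - a" "\<lambda>c. c + a"]) (auto simp: algebra_simps)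
  then show ?thesis
    unfolding fall_def turn_def prod.distrib[symmetric] by (intro prod.cong refl) (simp add: overshoot_prod)
qed

abbreviation exponent_point :: "('i \<Rightarrow>\<^sub>0 nat) \<Rightarrow> 'i \<Rightarrow> complex" where
  "exponent_point e \<equiv> (\<lambda>i. of_nat (Poly_Mapping.lookup e i))"

abbreviation exponent_diff :: "('i \<Rightarrow>\<^sub>0 nat) \<Rightarrow> ('i \<Rightarrow>\<^sub>0 nat) \<Rightarrow> 'i \<Rightarrow> int" where
  "exponent_diff f e \<equiv> (\<lambda>i. int (Poly_Mapping.lookup f i) - int (Poly_Mapping.lookup e i))"

text \<open>\<open>nat\<close> truncates negative entries to 0. Exactly in these cases the
  coefficient \<open>fall\<close> vanishes, see \<open>fall_eq_0_iff\<close>.\<close>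

definition shift_exponent :: "('i::finite \<Rightarrow>\<^sub>0 nat) \<Rightarrow> ('i \<Rightarrow> int) \<Rightarrow> 'i \<Rightarrow>\<^sub>0 nat" where
  "shift_exponent e \<alpha> = Abs_poly_mapping (\<lambda>i. nat (int (Poly_Mapping.lookup e i) + \<alpha> i))"

lemma lookup_shift_exponent [simp]: "Poly_Mapping.lookup (shift_exponent e \<alpha>) i = nat (int (Poly_Mapping.lookup e i) + \<alpha> i)"
  by (simp add: shift_exponent_def)

lemma fall_eq_0_iff: "fall \<alpha> (exponent_point e) = 0 \<longleftrightarrow> (\<exists>i. int (Poly_Mapping.lookup e i) + \<alpha> i < 0)"
proof -
  have *: "complex_of_nat n + of_int c = 0 \<longleftrightarrow> int n + c = 0" for n c
    by (metis of_int_0_eq_iff of_int_add of_int_of_nat_eq)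
  have "fall \<alpha> (exponent_point e) = 0 \<longleftrightarrow> (\<exists>i. \<exists>c\<in>{\<alpha> i<..0}. int (Poly_Mapping.lookup e i) + c = 0)"
    by (simp add: fall_def *)
  also have "\<dots> \<longleftrightarrow> (\<exists>i. int (Poly_Mapping.lookup e i) + \<alpha> i < 0)"
  proof (intro ex_cong1 iffI)
    fix i assume "int (Poly_Mapping.lookup e i) + \<alpha> i < 0"
    then show "\<exists>c\<in>{\<alpha> i<..0}. int (Poly_Mapping.lookup e i) + c = 0" by (intro bexI[of _ "- int (Poly_Mapping.lookup e i)"]) auto
  qed auto
  finally show ?thesis .
qed

abbreviation xpow :: "('i \<Rightarrow>\<^sub>0 nat) \<Rightarrow> 'i mpoly" where
  "xpow e \<equiv> Poly_Mapping.single e 1"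

definition lin_op :: "'i operator \<Rightarrow> bool" where
  "lin_op d \<longleftrightarrow> (\<forall>p q. d (p + q) = d p + d q) \<and> (\<forall>c p. d (const_op c p) = const_op c (d p))"

lemma lookup_const_op: "Poly_Mapping.lookup (const_op c p) e = c * Poly_Mapping.lookup p e"
  by (simp add: const_op_def mult_map_scale_conv_mult[symmetric] map.rep_eq when_def)

lemma lin_op_0: "lin_op d \<Longrightarrow> d 0 = 0"
  unfolding lin_op_def by (metis add_cancel_right_right)

lemma lin_op_sum: "lin_op d \<Longrightarrow> d (\<Sum>i\<in>S. p i) = (\<Sum>i\<in>S. d (p i))"
  by (induction S rule: infinite_finite_induct) (auto simp: lin_op_0 lin_op_def)

lemma sum_monomials: "p = (\<Sum>e\<in>Poly_Mapping.keys p. const_op (Poly_Mapping.lookup p e) (xpow e))"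
proof (rule poly_mapping_eqI)
  fix f
  have "(\<Sum>e\<in>Poly_Mapping.keys p. Poly_Mapping.lookup p e * Poly_Mapping.lookup (xpow e) f) = (\<Sum>e\<in>Poly_Mapping.keys p. if e = f then Poly_Mapping.lookup p f else 0)"
    by (intro sum.cong) (auto simp: lookup_single when_def)
  then show "Poly_Mapping.lookup p f = Poly_Mapping.lookup (\<Sum>e\<in>Poly_Mapping.keys p. const_op (Poly_Mapping.lookup p e) (xpow e)) f"
    by (simp add: lookup_sum lookup_const_op in_keys_iff)
qed

lemma lookup_lin_op:
  assumes "lin_op d" shows "Poly_Mapping.lookup (d p) f = (\<Sum>e\<in>Poly_Mapping.keys p. Poly_Mapping.lookup p e * Poly_Mapping.lookup (d (xpow e)) f)"
proof -
  have "d p = (\<Sum>e\<in>Poly_Mapping.keys p. const_op (Poly_Mapping.lookup p e) (d (xpow e)))"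
    using assms by (subst sum_monomials[of p]) (simp add: lin_op_sum, simp add: lin_op_def)
  then show ?thesis by (simp add: lookup_sum lookup_const_op)
qed

lemma lin_op_eqI:
  assumes "lin_op d" "lin_op d'" "\<And>e f. Poly_Mapping.lookup (d (xpow e)) f = Poly_Mapping.lookup (d' (xpow e)) f"
  shows "d = d'"
proof (intro ext poly_mapping_eqI)
  fix p f
  show "Poly_Mapping.lookup (d p) f = Poly_Mapping.lookup (d' p) f"
    unfolding lookup_lin_op[OF assms(1), of p] lookup_lin_op[OF assms(2), of p] assms(3) ..
qed

text \<open>An operator with kernel \<open>K\<close> is the sum over \<open>\<alpha>\<close> of the operators taking
  \<open>t\<^sup>e\<close> to \<open>fall \<alpha> e * K \<alpha> e\<close> times \<open>t\<close> to the power \<open>e + \<alpha>\<close>. The factor \<open>fall \<alpha> e\<close> comes from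
  \<open>\<partial>\<close> and vanishes if \<open>e + \<alpha>\<close> has a negative entry.\<close>

definition has_kernel :: "'i::finite operator \<Rightarrow> (('i \<Rightarrow> int) \<Rightarrow> ('i \<Rightarrow> complex) \<Rightarrow> complex) \<Rightarrow> bool" where
  "has_kernel d K \<longleftrightarrow> lin_op d \<and> finite {\<alpha>. K \<alpha> \<noteq> (\<lambda>z. 0)} \<and> (\<forall>\<alpha>. K \<alpha> \<in> polys) \<and>
     (\<forall>e f. Poly_Mapping.lookup (d (xpow e)) f =
        fall (exponent_diff f e) (exponent_point e) * K (exponent_diff f e) (exponent_point e))"

lemma has_kernel_ext: "has_kernel d K \<Longrightarrow> has_kernel d' K \<Longrightarrow> d = d'"
  by (rule lin_op_eqI) (auto simp: has_kernel_def)

text \<open>Where \<open>e + \<alpha>\<close> has no negative entry \<open>fall\<close> is nonzero,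
  so the matrix of \<open>d\<close> determines the value of \<open>K \<alpha>\<close> at
  \<open>e\<close>. These \<open>e\<close> include all natural points far out, and those determine a
  polynomial.\<close>

lemma kernel_unique:
  assumes K: "has_kernel d K" and K': "has_kernel d K'"
  shows "K = K'"
proof
  fix \<alpha> :: "'a \<Rightarrow> int"
  \<comment> \<open>If all \<open>x i\<close> are at least \<open>b\<close>, no entry of
    \<open>x + \<alpha>\<close> is negative.\<close>
  define b where "b = Max (range (\<lambda>i. nat (- \<alpha> i)))"
  show "K \<alpha> = K' \<alpha>"
  proof (rule poly_eqI[of _ _ b])
    fix x :: "'a \<Rightarrow> nat" assume x: "\<forall>i. b \<le> x i"
    have "nat (- \<alpha> i) \<le> b" for i by (auto simp: b_def)
    then have pos: "int (x i) + \<alpha> i \<ge> 0" for i using x[rule_format, of i] le_trans[of "nat (- \<alpha> i)" b "x i"] by (simp add: nat_le_iff)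
    define e where "e = Abs_poly_mapping x"
    have e: "Poly_Mapping.lookup e = x" by (simp add: e_def)
    define f where "f = shift_exponent e \<alpha>"
    have f: "exponent_diff f e = \<alpha>" using pos by (auto simp: f_def e)
    have "fall \<alpha> (exponent_point e) \<noteq> 0" using fall_eq_0_iff[of \<alpha> e] pos by (simp add: not_less[symmetric] e)
    moreover have "fall \<alpha> (exponent_point e) * K \<alpha> (exponent_point e) = fall \<alpha> (exponent_point e) * K' \<alpha> (exponent_point e)"
    proof -
      have "Poly_Mapping.lookup (d (xpow e)) f = fall (exponent_diff f e) (exponent_point e) * K (exponent_diff f e) (exponent_point e)"
        "Poly_Mapping.lookup (d (xpow e)) f = fall (exponent_diff f e) (exponent_point e) * K' (exponent_diff f e) (exponent_point e)"
        using K K' unfolding has_kernel_def by blast+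
      then show ?thesis unfolding f by (rule trans[OF sym])
    qed
    ultimately show "K \<alpha> (\<lambda>i. of_nat (x i)) = K' \<alpha> (\<lambda>i. of_nat (x i))" by (simp add: e)
  qed (use K K' in \<open>auto simp: has_kernel_def\<close>)
qed

definition kernel :: "'i::finite operator \<Rightarrow> ('i \<Rightarrow> int) \<Rightarrow> ('i \<Rightarrow> complex) \<Rightarrow> complex" where
  "kernel d = (THE K. has_kernel d K)"

lemma kernel_eq: "has_kernel d K \<Longrightarrow> kernel d = K"
  unfolding kernel_def using kernel_unique by blast

lemma has_kernel_add:
  assumes "has_kernel d K" "has_kernel d' K'"
  shows "has_kernel (\<lambda>p. d p + d' p) (\<lambda>\<alpha> z. K \<alpha> z + K' \<alpha> z)"
proof -
  have "{\<alpha>. (\<lambda>z. K \<alpha> z + K' \<alpha> z) \<noteq> (\<lambda>z. 0)} \<subseteq> {\<alpha>. K \<alpha> \<noteq> (\<lambda>z. 0)} \<union> {\<alpha>. K' \<alpha> \<noteq> (\<lambda>z. 0)}" by auto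
  then have "finite {\<alpha>. (\<lambda>z. K \<alpha> z + K' \<alpha> z) \<noteq> (\<lambda>z. 0)}"
    using assms unfolding has_kernel_def by (meson finite_UnI finite_subset)
  moreover have "const_op c (p + q) = const_op c p + const_op c q" for c and p q :: "'a mpoly"
    by (simp add: const_op_def distrib_left)
  ultimately show ?thesis
    using assms unfolding has_kernel_def lin_op_def
    by (auto simp: lookup_add distrib_left intro!: polys.add)
qed

text \<open>A single weighted shift. Every operator with a kernel is a finite sum of these, see
  \<open>weyl_expand\<close>.\<close>

definition wop :: "('i \<Rightarrow> int) \<Rightarrow> (('i \<Rightarrow> complex) \<Rightarrow> complex) \<Rightarrow> 'i::finite operator" where
  "wop \<alpha> k p = (\<Sum>e\<in>Poly_Mapping.keys p. Poly_Mapping.single (shift_exponent e \<alpha>)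
      (Poly_Mapping.lookup p e * (fall \<alpha> (exponent_point e) * k (exponent_point e))))"

lemma lin_op_wop: "lin_op (wop \<alpha> k)"
proof -
  let ?F = "\<lambda>e x. Poly_Mapping.single (shift_exponent e \<alpha>) (x * (fall \<alpha> (exponent_point e) * k (exponent_point e)))"
  have sup: "wop \<alpha> k p = (\<Sum>e\<in>S. ?F e (Poly_Mapping.lookup p e))" if "finite S" "Poly_Mapping.keys p \<subseteq> S" for S p
    unfolding wop_def using that by (intro sum.mono_neutral_left) (auto simp: in_keys_iff)
  have "wop \<alpha> k (p + q) = wop \<alpha> k p + wop \<alpha> k q" for p q
    using sup[of "Poly_Mapping.keys p \<union> Poly_Mapping.keys q" "p + q"] sup[of "Poly_Mapping.keys p \<union> Poly_Mapping.keys q" p] sup[of "Poly_Mapping.keys p \<union> Poly_Mapping.keys q" q] keys_add[of p q]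
    by (simp add: lookup_add sum.distrib[symmetric] single_add[symmetric] distrib_right)
  moreover have "wop \<alpha> k (const_op c p) = const_op c (wop \<alpha> k p)" for c p
  proof -
    have "Poly_Mapping.keys (const_op c p) \<subseteq> Poly_Mapping.keys p" by (auto simp: in_keys_iff lookup_const_op)
    then have "wop \<alpha> k (const_op c p) = (\<Sum>e\<in>Poly_Mapping.keys p. ?F e (Poly_Mapping.lookup (const_op c p) e))" by (intro sup) auto
    also have "\<dots> = const_op c (wop \<alpha> k p)"
      unfolding lookup_const_op by (simp add: const_op_def wop_def sum_distrib_left mult_single mult.assoc)
    finally show ?thesis .
  qed
  ultimately show ?thesis by (simp add: lin_op_def)
qed

lemma has_kernel_wop:
  assumes "k \<in> polys"
  shows "has_kernel (wop \<alpha> k) (\<lambda>\<beta>. if \<beta> = \<alpha> then k else (\<lambda>z. 0))"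
proof -
  have "{\<beta>. (if \<beta> = \<alpha> then k else (\<lambda>z. 0)) \<noteq> (\<lambda>z. 0)} \<subseteq> {\<alpha>}" by auto
  then have "finite {\<beta>. (if \<beta> = \<alpha> then k else (\<lambda>z. 0)) \<noteq> (\<lambda>z. 0)}" by (meson finite.emptyI finite.insertI finite_subset)
  moreover have "Poly_Mapping.lookup (wop \<alpha> k (xpow e)) f = fall (exponent_diff f e) (exponent_point e) *
     (if exponent_diff f e = \<alpha> then k else (\<lambda>z. 0)) (exponent_point e)" for e f
  proof (cases "fall \<alpha> (exponent_point e) = 0")
    case True
    then show ?thesis by (auto simp: wop_def)
  next
    case False
    then have "int (Poly_Mapping.lookup e i) + \<alpha> i \<ge> 0" for i by (auto simp: fall_eq_0_iff not_less)
    then have "shift_exponent e \<alpha> = f \<longleftrightarrow> exponent_diff f e = \<alpha>"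
      by (fastforce simp: poly_mapping_eq_iff fun_eq_iff)
    then show ?thesis by (simp add: wop_def lookup_single when_def)
  qed
  ultimately show ?thesis using assms by (auto simp: has_kernel_def lin_op_wop intro: polys.const)
qed

text \<open>A twisted convolution: \<open>\<gamma>\<close> is split into the shift
  \<open>\<alpha>\<close> of the operator applied first and the remaining shift, whose polynomial is
  evaluated at the intermediate exponent. The mismatch of the factors \<open>fall\<close> is
  \<open>turn\<close>.\<close>

definition kernel_comp :: "(('i::finite \<Rightarrow> int) \<Rightarrow> ('i \<Rightarrow> complex) \<Rightarrow> complex) \<Rightarrow>
    (('i \<Rightarrow> int) \<Rightarrow> ('i \<Rightarrow> complex) \<Rightarrow> complex) \<Rightarrow> ('i \<Rightarrow> int) \<Rightarrow> ('i \<Rightarrow> complex) \<Rightarrow> complex" where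
  "kernel_comp K K' \<gamma> z = (\<Sum>\<alpha>\<in>{\<alpha>. K' \<alpha> \<noteq> (\<lambda>z. 0)}.
     turn (\<lambda>i. \<gamma> i - \<alpha> i) \<alpha> z * K (\<lambda>i. \<gamma> i - \<alpha> i) (plus_int z \<alpha>) * K' \<alpha> z)"

lemma kernel_comp_eq:
  assumes "finite S" "{\<alpha>. K' \<alpha> \<noteq> (\<lambda>z. 0)} \<subseteq> S"
  shows "kernel_comp K K' \<gamma> z = (\<Sum>\<alpha>\<in>S. turn (\<lambda>i. \<gamma> i - \<alpha> i) \<alpha> z * K (\<lambda>i. \<gamma> i - \<alpha> i) (plus_int z \<alpha>) * K' \<alpha> z)"
  unfolding kernel_comp_def
proof (rule sum.mono_neutral_left[OF assms], rule ballI)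
  fix \<alpha> assume "\<alpha> \<in> S - {\<alpha>. K' \<alpha> \<noteq> (\<lambda>z. 0)}"
  then have "K' \<alpha> = (\<lambda>z. 0)" by blast
  then show "turn (\<lambda>i. \<gamma> i - \<alpha> i) \<alpha> z * K (\<lambda>i. \<gamma> i - \<alpha> i) (plus_int z \<alpha>) * K' \<alpha> z = 0" by simp
qed

lemma has_kernel_comp:
  assumes d: "has_kernel d K" and d': "has_kernel d' K'"
  shows "has_kernel (d \<circ> d') (kernel_comp K K')"
proof -
  let ?S = "{\<alpha>. K' \<alpha> \<noteq> (\<lambda>z. 0)}"
  have fin: "finite ?S" "finite {\<alpha>. K \<alpha> \<noteq> (\<lambda>z. 0)}" and pol: "K \<alpha> \<in> polys" "K' \<alpha> \<in> polys" for \<alpha>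
    using d d' by (auto simp: has_kernel_def)
  have lk: "Poly_Mapping.lookup (d (xpow e)) f = fall (exponent_diff f e) (exponent_point e) * K (exponent_diff f e) (exponent_point e)" for e f
    using d by (auto simp: has_kernel_def)
  have lk': "Poly_Mapping.lookup (d' (xpow e)) f = fall (exponent_diff f e) (exponent_point e) * K' (exponent_diff f e) (exponent_point e)" for e f
    using d' by (auto simp: has_kernel_def)
  have lin: "lin_op d" "lin_op d'" using d d' by (auto simp: has_kernel_def)
  have "finite {\<gamma>. kernel_comp K K' \<gamma> \<noteq> (\<lambda>z. 0)}"
  proof (rule finite_subset)
    show "{\<gamma>. kernel_comp K K' \<gamma> \<noteq> (\<lambda>z. 0)} \<subseteq> (\<lambda>(\<alpha>, \<beta>) i. \<alpha> i + \<beta> i) ` (?S \<times> {\<alpha>. K \<alpha> \<noteq> (\<lambda>z. 0)})"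
    proof
      fix \<gamma> assume "\<gamma> \<in> {\<gamma>. kernel_comp K K' \<gamma> \<noteq> (\<lambda>z. 0)}"
      then obtain z where "kernel_comp K K' \<gamma> z \<noteq> 0" by auto
      then obtain \<alpha> where \<alpha>: "\<alpha> \<in> ?S" "K (\<lambda>i. \<gamma> i - \<alpha> i) (plus_int z \<alpha>) \<noteq> 0"
        unfolding kernel_comp_def by (elim sum.not_neutral_contains_not_neutral) auto
      then show "\<gamma> \<in> (\<lambda>(\<alpha>, \<beta>) i. \<alpha> i + \<beta> i) ` (?S \<times> {\<alpha>. K \<alpha> \<noteq> (\<lambda>z. 0)})"
        by (intro image_eqI[of _ _ "(\<alpha>, \<lambda>i. \<gamma> i - \<alpha> i)"]) auto
    qed
  qed (use fin in auto)
  moreover have "kernel_comp K K' \<gamma> \<in> polys" for \<gamma>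
    unfolding kernel_comp_def[abs_def] by (intro polys_intros turn_polys pol polys_shift[OF pol(1)])
  moreover have "Poly_Mapping.lookup ((d \<circ> d') (xpow e)) f =
      fall (exponent_diff f e) (exponent_point e) * kernel_comp K K' (exponent_diff f e) (exponent_point e)" for e f
  proof -
    let ?z = "exponent_point e" and ?\<gamma> = "exponent_diff f e"
    define T where "T \<alpha> = fall (\<lambda>i. ?\<gamma> i - \<alpha> i) (plus_int ?z \<alpha>) * K (\<lambda>i. ?\<gamma> i - \<alpha> i) (plus_int ?z \<alpha>) *
       (fall \<alpha> ?z * K' \<alpha> ?z)" for \<alpha>
    have "Poly_Mapping.lookup ((d \<circ> d') (xpow e)) f =
       (\<Sum>g\<in>Poly_Mapping.keys (d' (xpow e)). Poly_Mapping.lookup (d' (xpow e)) g * Poly_Mapping.lookup (d (xpow g)) f)"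
      by (simp add: lookup_lin_op[OF lin(1), of "d' (xpow e)"])
    \<comment> \<open>Intermediate exponents \<open>g\<close> correspond to shifts
      \<open>g - e\<close>. Conversely a shift with nonzero coefficient has
      \<open>e + \<alpha> \<ge> 0\<close>, so \<open>shift_exponent\<close> does not
      truncate.\<close>
    also have "\<dots> = (\<Sum>\<alpha>\<in>{\<alpha>. fall \<alpha> ?z * K' \<alpha> ?z \<noteq> 0}. T \<alpha>)"
    proof (rule sum.reindex_bij_witness[of _ "shift_exponent e" "\<lambda>g. exponent_diff g e"])
      fix g assume g: "g \<in> Poly_Mapping.keys (d' (xpow e))"
      show "shift_exponent e (exponent_diff g e) = g" by (rule poly_mapping_eqI) simp
      show "exponent_diff g e \<in> {\<alpha>. fall \<alpha> ?z * K' \<alpha> ?z \<noteq> 0}" using g by (simp add: in_keys_iff lk')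
      have "(\<lambda>i. ?\<gamma> i - exponent_diff g e i) = exponent_diff f g" "plus_int ?z (exponent_diff g e) = exponent_point g"
        by auto
      then show "T (exponent_diff g e) = Poly_Mapping.lookup (d' (xpow e)) g * Poly_Mapping.lookup (d (xpow g)) f"
        by (simp add: T_def lk lk')
    next
      fix \<alpha> assume a: "\<alpha> \<in> {\<alpha>. fall \<alpha> ?z * K' \<alpha> ?z \<noteq> 0}"
      then have "int (Poly_Mapping.lookup e i) + \<alpha> i \<ge> 0" for i by (auto simp: fall_eq_0_iff not_less)
      then show *: "exponent_diff (shift_exponent e \<alpha>) e = \<alpha>" by auto
      show "shift_exponent e \<alpha> \<in> Poly_Mapping.keys (d' (xpow e))"
        using a unfolding in_keys_iff lk' * by simp
    qed
    also have "\<dots> = (\<Sum>\<alpha>\<in>?S. T \<alpha>)"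
      using fin by (intro sum.mono_neutral_left) (auto simp: T_def)
    also have "\<dots> = fall ?\<gamma> ?z * kernel_comp K K' ?\<gamma> ?z"
    proof -
      have "T \<alpha> = fall ?\<gamma> ?z * (turn (\<lambda>i. ?\<gamma> i - \<alpha> i) \<alpha> ?z * K (\<lambda>i. ?\<gamma> i - \<alpha> i) (plus_int ?z \<alpha>) * K' \<alpha> ?z)" for \<alpha>
      proof -
        have "fall (\<lambda>i. ?\<gamma> i - \<alpha> i) (plus_int ?z \<alpha>) * fall \<alpha> ?z = turn (\<lambda>i. ?\<gamma> i - \<alpha> i) \<alpha> ?z * fall ?\<gamma> ?z"
          unfolding fall_comp by simp
        moreover have "A * X * (B * Y) = D * (C * X * Y)" if "A * B = C * D" for A B C D X Y :: complex
        proof -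
          have "A * X * (B * Y) = A * B * (X * Y)" by (simp add: mult_ac)
          then show ?thesis unfolding that by (simp add: mult_ac)
        qed
        ultimately show ?thesis unfolding T_def by blast
      qed
      then show ?thesis by (simp add: kernel_comp_def sum_distrib_left)
    qed
    finally show ?thesis .
  qed
  moreover have "lin_op (d \<circ> d')" using lin by (simp add: lin_op_def)
  ultimately show ?thesis by (simp add: has_kernel_def)
qed

lemma overshoot_simps [simp]: "overshoot l m m = {}" "overshoot l l n = {}"
  by (auto simp: overshoot_def)

lemma turn_0 [simp]: "turn \<beta> (\<lambda>_. 0) z = 1" "turn (\<lambda>_. 0) \<alpha> z = 1"
  by (simp_all add: turn_def)

lemma fall_0 [simp]: "fall (\<lambda>_. 0) z = 1"
  by (simp add: fall_def)

lemma wop_comp: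
  assumes "k \<in> polys" "k' \<in> polys"
  shows "wop \<beta> k' \<circ> wop \<alpha> k = wop (\<lambda>i. \<alpha> i + \<beta> i) (\<lambda>z. turn \<beta> \<alpha> z * k' (plus_int z \<alpha>) * k z)"
proof (rule has_kernel_ext)
  have eq: "(\<lambda>i. \<gamma> i - \<alpha> i) = \<beta> \<longleftrightarrow> \<gamma> = (\<lambda>i. \<alpha> i + \<beta> i)" for \<gamma> by (auto simp: fun_eq_iff algebra_simps)
  have "kernel_comp (\<lambda>\<gamma>. if \<gamma> = \<beta> then k' else (\<lambda>z. 0)) (\<lambda>\<gamma>. if \<gamma> = \<alpha> then k else (\<lambda>z. 0)) =
     (\<lambda>\<gamma>. if \<gamma> = (\<lambda>i. \<alpha> i + \<beta> i) then (\<lambda>z. turn \<beta> \<alpha> z * k' (plus_int z \<alpha>) * k z) else (\<lambda>z. 0))"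
    by (intro ext, subst kernel_comp_eq[where S = "{\<alpha>}"]) (auto simp: eq)
  then show "has_kernel (wop \<beta> k' \<circ> wop \<alpha> k) (\<lambda>\<gamma>. if \<gamma> = (\<lambda>i. \<alpha> i + \<beta> i) then (\<lambda>z. turn \<beta> \<alpha> z * k' (plus_int z \<alpha>) * k z) else (\<lambda>z. 0))"
    using has_kernel_comp[OF has_kernel_wop[OF assms(2), of \<beta>] has_kernel_wop[OF assms(1), of \<alpha>]] by simp
  show "has_kernel (wop (\<lambda>i. \<alpha> i + \<beta> i) (\<lambda>z. turn \<beta> \<alpha> z * k' (plus_int z \<alpha>) * k z))
     (\<lambda>\<gamma>. if \<gamma> = (\<lambda>i. \<alpha> i + \<beta> i) then (\<lambda>z. turn \<beta> \<alpha> z * k' (plus_int z \<alpha>) * k z) else (\<lambda>z. 0))"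
    by (intro has_kernel_wop polys_intros turn_polys assms polys_shift[OF assms(2)])
qed

lemma wop_add: "wop \<alpha> (\<lambda>z. f z + g z) = (\<lambda>p. wop \<alpha> f p + wop \<alpha> g p)"
  by (simp add: wop_def fun_eq_iff sum.distrib[symmetric] single_add[symmetric] distrib_left)

lemma wop_xpow: "wop \<alpha> k (xpow e) = Poly_Mapping.single (shift_exponent e \<alpha>) (fall \<alpha> (exponent_point e) * k (exponent_point e))"
  by (simp add: wop_def)

section \<open>The Weyl algebra in terms of weighted shifts\<close>

lemma const_op_wop: "(const_op c :: 'i::finite operator) = wop (\<lambda>_. 0) (\<lambda>z. c)"
proof (rule lin_op_eqI[OF _ lin_op_wop])
  show "lin_op (const_op c)" by (simp add: lin_op_def const_op_def algebra_simps)
  have "shift_exponent e (\<lambda>_. 0) = e" for e :: "'i \<Rightarrow>\<^sub>0 nat" by (rule poly_mapping_eqI) simp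
  then show "Poly_Mapping.lookup (const_op c (xpow e)) f = Poly_Mapping.lookup (wop (\<lambda>_. 0) (\<lambda>z. c) (xpow e)) f" for e f :: "'i \<Rightarrow>\<^sub>0 nat"
    by (simp add: wop_xpow const_op_def mult_single)
qed

abbreviation unit_vec :: "'i \<Rightarrow> 'i \<Rightarrow> int" where
  "unit_vec i \<equiv> (\<lambda>j. if j = i then 1 else 0)"

abbreviation neg_vec :: "'i \<Rightarrow> 'i \<Rightarrow> int" where
  "neg_vec i \<equiv> (\<lambda>j. if j = i then - 1 else 0)"

lemma mult_op_wop: "mult_op i = wop (unit_vec i) (\<lambda>z. 1)"
proof (rule lin_op_eqI[OF _ lin_op_wop])
  show "lin_op (mult_op i)" by (simp add: lin_op_def const_op_def mult_op_def algebra_simps)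
  have "shift_exponent e (unit_vec i) = Poly_Mapping.single i 1 + e" for e :: "'a \<Rightarrow>\<^sub>0 nat"
    by (rule poly_mapping_eqI) (simp add: lookup_add lookup_single when_def nat_add_distrib)
  moreover have "fall (unit_vec i) z = 1" for z by (auto simp: fall_def intro!: prod.neutral)
  ultimately show "Poly_Mapping.lookup (mult_op i (xpow e)) f = Poly_Mapping.lookup (wop (unit_vec i) (\<lambda>z. 1) (xpow e)) f" for e f
    by (simp add: wop_xpow mult_op_def mult_single)
qed

lemma fall_neg_vec: "fall (neg_vec i) z = z i"
proof -
  have "{- 1<..0::int} = {0}" by auto
  then have "fall (neg_vec i) z = (\<Prod>j\<in>UNIV. if j = i then z j else 1)" unfolding fall_def
    by (intro prod.cong refl) auto
  then show ?thesis by simp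
qed

lemma diff_op_wop: "diff_op i = wop (neg_vec i) (\<lambda>z. 1)"
proof
  fix p :: "'a mpoly"
  have "shift_exponent e (neg_vec i) = e - Poly_Mapping.single i 1" for e :: "'a \<Rightarrow>\<^sub>0 nat"
    by (rule poly_mapping_eqI) (auto simp: lookup_minus lookup_single when_def nat_diff_distrib)
  then show "diff_op i p = wop (neg_vec i) (\<lambda>z. 1) p"
    by (simp add: diff_op_def wop_def fall_neg_vec mult.commute)
qed

lemma weyl_has_kernel: "d \<in> weyl_ops \<Longrightarrow> \<exists>K. has_kernel d K"
proof (induction rule: weyl_ops.induct)
  case (const c)
  then show ?case unfolding const_op_wop using has_kernel_wop[OF polys.const] by blast
next
  case (mult i)
  then show ?case unfolding mult_op_wop using has_kernel_wop[OF polys.const] by blast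
next
  case (diff i)
  then show ?case unfolding diff_op_wop using has_kernel_wop[OF polys.const] by blast
next
  case (add d d')
  then show ?case using has_kernel_add by blast
next
  case (comp d d')
  then show ?case using has_kernel_comp by blast
qed

lemma kernel_weyl: "d \<in> weyl_ops \<Longrightarrow> has_kernel d (kernel d)"
  using weyl_has_kernel kernel_eq by metis

text \<open>Going one step down and back up overshoots by the step with label 0, so
  \<open>turn\<close> contributes the factor \<open>z i\<close>.\<close>

lemma theta_op_wop: "theta_op i = wop (\<lambda>_. 0) (\<lambda>z. z i)"
proof -
  have "overshoot 0 (- 1) 0 = {0}" by (auto simp: overshoot_def)
  then have "turn (unit_vec i) (neg_vec i) z = (\<Prod>j\<in>UNIV. if j = i then z j else 1)" for z
    unfolding turn_def by (intro prod.cong refl) auto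
  then have "turn (unit_vec i) (neg_vec i) z = z i" for z by simp
  moreover have "(\<lambda>j. neg_vec i j + unit_vec i j) = (\<lambda>_. 0)" by auto
  ultimately show ?thesis
    by (simp add: theta_op_def mult_op_wop diff_op_wop wop_comp polys.const)
qed

lemma wop_0_weyl: "k \<in> polys \<Longrightarrow> wop (\<lambda>_. 0) k \<in> weyl_ops"
proof (induction rule: polys.induct)
  case (const c)
  then show ?case unfolding const_op_wop[symmetric] by (rule weyl_ops.const)
next
  case (var i)
  then show ?case unfolding theta_op_wop[symmetric] theta_op_def by (intro weyl_ops.intros)
next
  case (add f g)
  then show ?case unfolding wop_add by (intro weyl_ops.add)
next
  case (mult f g)
  have "wop (\<lambda>_. 0) (\<lambda>z. f z * g z) = wop (\<lambda>_. 0) f \<circ> wop (\<lambda>_. 0) g"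
    using mult by (simp add: wop_comp)
  then show ?case using mult weyl_ops.comp by metis
qed

lemma wop_1_weyl: "wop \<alpha> (\<lambda>z. 1) \<in> weyl_ops"
proof (induction "\<Sum>i\<in>UNIV. nat \<bar>\<alpha> i\<bar>" arbitrary: \<alpha> rule: less_induct)
  case less
  show ?case
  proof (cases "\<alpha> = (\<lambda>_. 0)")
    case True
    then show ?thesis by (simp add: wop_0_weyl polys.const)
  next
    case False
    then obtain i where i: "\<alpha> i \<noteq> 0" by auto
    \<comment> \<open>A unit step in the direction of the sign of \<open>\<alpha> i\<close>. Then
      \<open>\<beta>\<close> lies between 0 and \<open>\<alpha>\<close> in each coordinate, the way
      through \<open>\<beta>\<close> does not overshoot, and \<open>turn\<close> is 1.\<close>
    define s where "s = (if \<alpha> i > 0 then unit_vec i else neg_vec i)"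
    define \<beta> where "\<beta> j = \<alpha> j - s j" for j
    have "(\<Sum>i\<in>UNIV. nat \<bar>\<beta> i\<bar>) < (\<Sum>i\<in>UNIV. nat \<bar>\<alpha> i\<bar>)"
      using i by (intro sum_strict_mono_ex1) (auto simp: \<beta>_def s_def intro!: bexI[of _ i])
    then have "wop \<beta> (\<lambda>z. 1) \<in> weyl_ops" by (rule less)
    moreover have "wop s (\<lambda>z. 1) \<in> weyl_ops"
      unfolding s_def by (simp add: mult_op_wop[symmetric] diff_op_wop[symmetric] weyl_ops.intros)
    moreover have "wop s (\<lambda>z. 1) \<circ> wop \<beta> (\<lambda>z. 1) = wop \<alpha> (\<lambda>z. 1)"
    proof -
      have "overshoot 0 (\<beta> j) (\<beta> j + s j) = {}" for j
        using i by (auto simp: overshoot_def \<beta>_def s_def)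
      then have "turn s \<beta> z = 1" for z by (simp add: turn_def)
      moreover have "(\<lambda>j. \<beta> j + s j) = \<alpha>" by (simp add: \<beta>_def)
      ultimately show ?thesis by (simp add: wop_comp polys.const)
    qed
    ultimately show ?thesis using weyl_ops.comp by metis
  qed
qed

lemma wop_weyl: "k \<in> polys \<Longrightarrow> wop \<alpha> k \<in> weyl_ops"
  using weyl_ops.comp[OF wop_1_weyl[of \<alpha>] wop_0_weyl] by (simp add: wop_comp polys.const)

lemma wop_sum: "wop \<alpha> (\<lambda>z. \<Sum>i\<in>S. f i z) = (\<lambda>p. \<Sum>i\<in>S. wop \<alpha> (f i) p)"
  by (induction S rule: infinite_finite_induct) (auto simp: wop_add, auto simp: wop_def)

lemma euler_op_wop: "(euler_op :: 'a::finite operator) = wop (\<lambda>_. 0) (\<lambda>z. \<Sum>i\<in>UNIV. z i)"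
proof
  fix p :: "'a mpoly"
  have "wop (\<lambda>_. 0) (\<lambda>z. \<Sum>i\<in>UNIV. z i) p = (\<Sum>i\<in>UNIV. wop (\<lambda>_. 0) (\<lambda>z. z i) p)"
    by (rule fun_cong[OF wop_sum])
  then show "euler_op p = wop (\<lambda>_. 0) (\<lambda>z. \<Sum>i\<in>UNIV. z i) p"
    by (simp only: euler_op_def theta_op_wop)
qed

section \<open>The centralizer of the Euler operator\<close>

lemma wop_centralizer:
  assumes "k \<in> polys" "(\<Sum>i\<in>UNIV. \<alpha> i) = 0"
  shows "wop \<alpha> k \<in> carrier weyl_centralizer"
proof -
  have "(\<lambda>z :: 'a \<Rightarrow> complex. \<Sum>i\<in>UNIV. z i) \<in> polys" by (intro polys_intros)
  moreover have "(\<Sum>i\<in>UNIV. of_int (\<alpha> i)) = (0 :: complex)" using arg_cong[OF assms(2), of of_int] by simp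
  ultimately have "wop \<alpha> k \<circ> euler_op = euler_op \<circ> wop \<alpha> k"
    using assms by (simp add: euler_op_wop wop_comp sum.distrib mult.commute)
  then show ?thesis using assms by (simp add: weyl_centralizer_def wop_weyl)
qed

text \<open>The kernel of the commutator of \<open>E\<close> and \<open>d\<close> at
  \<open>\<gamma>\<close> is the kernel of \<open>d\<close> times the sum of the entries of
  \<open>\<gamma>\<close>, because \<open>E\<close> takes the values \<open>\<Sum> z\<close> and
  \<open>\<Sum> (z + \<gamma>)\<close> before and after the shift.\<close>

lemma kernel_centralizer:
  assumes "d \<in> carrier weyl_centralizer" "kernel d \<gamma> \<noteq> (\<lambda>z. 0)"
  shows "(\<Sum>i\<in>UNIV. \<gamma> i) = 0"
proof -
  let ?E = "\<lambda>z :: 'a \<Rightarrow> complex. \<Sum>i\<in>UNIV. z i"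
  let ?K = "\<lambda>\<gamma>. if \<gamma> = (\<lambda>_. 0) then ?E else (\<lambda>z. 0)"
  have d: "d \<in> weyl_ops" "d \<circ> euler_op = euler_op \<circ> d" using assms by (auto simp: weyl_centralizer_def)
  have K: "has_kernel d (kernel d)" using d kernel_weyl by blast
  have E: "has_kernel euler_op ?K" unfolding euler_op_wop by (intro has_kernel_wop polys_intros)
  obtain z where z: "kernel d \<gamma> z \<noteq> 0" using assms(2) by auto
  have fin: "finite {\<alpha>. kernel d \<alpha> \<noteq> (\<lambda>z. 0)}" using K by (simp add: has_kernel_def)
  have "kernel_comp (kernel d) ?K = kernel_comp ?K (kernel d)"
    by (rule kernel_unique) (use has_kernel_comp[OF K E] has_kernel_comp[OF E K] d in auto)
  then have "kernel_comp (kernel d) ?K \<gamma> z = kernel_comp ?K (kernel d) \<gamma> z" by simp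
  moreover have "kernel_comp (kernel d) ?K \<gamma> z = kernel d \<gamma> z * ?E z"
    by (subst kernel_comp_eq[where S = "{\<lambda>_. 0}"]) auto
  moreover have "kernel_comp ?K (kernel d) \<gamma> z = (\<Sum>\<alpha>\<in>{\<alpha>. kernel d \<alpha> \<noteq> (\<lambda>z. 0)}.
      if \<alpha> = \<gamma> then ?E (plus_int z \<gamma>) * kernel d \<gamma> z else 0)"
    unfolding kernel_comp_def
  proof (intro sum.cong refl)
    fix \<alpha>
    have "(\<lambda>i. \<gamma> i - \<alpha> i) = (\<lambda>_. 0) \<longleftrightarrow> \<alpha> = \<gamma>" by (auto simp: fun_eq_iff)
    then show "turn (\<lambda>i. \<gamma> i - \<alpha> i) \<alpha> z * ?K (\<lambda>i. \<gamma> i - \<alpha> i) (plus_int z \<alpha>) * kernel d \<alpha> z =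
        (if \<alpha> = \<gamma> then ?E (plus_int z \<gamma>) * kernel d \<gamma> z else 0)" by auto
  qed
  ultimately have "kernel d \<gamma> z * ?E z = ?E (plus_int z \<gamma>) * kernel d \<gamma> z"
    using fin assms(2) by simp
  then have "(\<Sum>i\<in>UNIV. of_int (\<gamma> i)) = (0 :: complex)"
    using z by (simp add: sum.distrib algebra_simps)
  then have "of_int (\<Sum>i\<in>UNIV. \<gamma> i) = (0 :: complex)" by simp
  then show ?thesis by (simp only: of_int_eq_0_iff)
qed

lemma weyl_expand:
  assumes "has_kernel d K"
  shows "d = (\<lambda>p. \<Sum>\<alpha>\<in>{\<alpha>. K \<alpha> \<noteq> (\<lambda>z. 0)}. wop \<alpha> (K \<alpha>) p)"
proof -
  have pol: "K \<alpha> \<in> polys" for \<alpha> using assms by (simp add: has_kernel_def)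
  have "has_kernel (\<lambda>p. \<Sum>\<alpha>\<in>S. wop \<alpha> (K \<alpha>) p) (\<lambda>\<alpha>. if \<alpha> \<in> S then K \<alpha> else (\<lambda>z. 0))" if "finite S" for S
    using that
  proof (induction S rule: finite_induct)
    case empty
    have "wop (\<lambda>_. 0) (\<lambda>z. 0) = (\<lambda>p :: 'a mpoly. 0)" by (simp add: wop_def fun_eq_iff)
    then show ?case using has_kernel_wop[OF polys.const, of "\<lambda>_ :: 'a. 0" 0] by simp
  next
    case (insert \<alpha> S)
    have "(\<lambda>\<beta> z. (if \<beta> = \<alpha> then K \<alpha> else (\<lambda>z. 0)) z + (if \<beta> \<in> S then K \<beta> else (\<lambda>z. 0)) z) =
       (\<lambda>\<beta>. if \<beta> \<in> insert \<alpha> S then K \<beta> else (\<lambda>z. 0))" by (intro ext) (use insert.hyps in auto)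
    then show ?case using has_kernel_add[OF has_kernel_wop[OF pol, of \<alpha> \<alpha>] insert.IH] insert.hyps by simp
  qed
  from this[of "{\<alpha>. K \<alpha> \<noteq> (\<lambda>z. 0)}"] assms
  have "has_kernel (\<lambda>p. \<Sum>\<alpha>\<in>{\<alpha>. K \<alpha> \<noteq> (\<lambda>z. 0)}. wop \<alpha> (K \<alpha>) p) (\<lambda>\<alpha>. if \<alpha> \<in> {\<alpha>. K \<alpha> \<noteq> (\<lambda>z. 0)} then K \<alpha> else (\<lambda>z. 0))"
    by (auto simp: has_kernel_def)
  moreover have "(\<lambda>\<alpha>. if \<alpha> \<in> {\<alpha>. K \<alpha> \<noteq> (\<lambda>z. 0)} then K \<alpha> else (\<lambda>z. 0)) = K" by auto
  ultimately show ?thesis using has_kernel_ext[OF assms] by simp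
qed

section \<open>Generalized weight modules\<close>

text \<open>The factor \<open>c = 0\<close> is the only one that is not invertible near \<open>x = 0\<close>; it is left to
  \<open>crossing\<close>.\<close>

definition descent :: "('i::finite \<Rightarrow> int) \<Rightarrow> ('i \<Rightarrow> int) \<Rightarrow> ('i \<Rightarrow> complex) \<Rightarrow> complex" where
  "descent l m x = (\<Prod>i\<in>UNIV. \<Prod>c\<in>{m i<..l i} - {0}. x i + of_int c)"

definition crossing :: "('i::finite \<Rightarrow> int) \<Rightarrow> ('i \<Rightarrow> int) \<Rightarrow> ('i \<Rightarrow> int) \<Rightarrow> ('i \<Rightarrow> complex) \<Rightarrow> complex" where
  "crossing l m n x = (\<Prod>i\<in>UNIV. if 0 \<in> overshoot (l i) (m i) (n i) then x i else 1)"

lemma descent_polys: "descent l m \<in> polys"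
  unfolding descent_def by (intro polys_intros)

lemma crossing_polys: "crossing l m n \<in> polys"
proof -
  have "(\<lambda>x. if b then x i else 1) \<in> polys" for b and i :: 'a
    by (cases b) (auto intro: polys.intros)
  then show ?thesis unfolding crossing_def by (intro polys_prod)
qed

text \<open>Only the signs of the three numbers enter. Hence \<open>crossing\<close> depends on the
  types of weights alone, and weights can be replaced by representatives of their types.\<close>

lemma crossing_iff: "0 \<in> overshoot l m n \<longleftrightarrow> ((0 \<le> l) = (0 \<le> n)) \<and> (0 \<le> m) \<noteq> (0 \<le> l)"
  by (auto simp: overshoot_def)

lemma descent_self [simp]: "descent l l x = 1"
  by (simp add: descent_def)

lemma crossing_self [simp]: "crossing l l n x = 1" "crossing l m m x = 1"
  by (simp_all add: crossing_def)

text \<open>The interval identity behind \<open>turn\<close>, read at the weight \<open>l\<close>: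
  the factors with \<open>c \<noteq> 0\<close> are collected in \<open>descent\<close>, and the
  factor \<open>c = 0\<close> of the overshoot is \<open>crossing\<close>.\<close>

lemma descent_turn:
  "descent m n x * descent l m x * crossing l m n x =
   turn (\<lambda>i. n i - m i) (\<lambda>i. m i - l i) (plus_int x l) * descent l n x"
proof -
  \<comment> \<open>Replacing the factor at \<open>c = 0\<close> by 1 lets all products run over
    full intervals, to which \<open>overshoot_prod\<close> applies.\<close>
  define \<phi> where "\<phi> y c = (if c = 0 then 1 else y + of_int c)" for y :: complex and c :: int
  have \<phi>: "(\<Prod>c\<in>S - {0}. y + of_int c) = prod (\<phi> y) S" if "finite S" for S y
    using that by (intro prod.mono_neutral_cong_left) (auto simp: \<phi>_def)
  have full: "(\<Prod>c\<in>S. y + of_int c) = prod (\<phi> y) S * (if 0 \<in> S then y else 1)" if "finite S" for S y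
  proof (cases "0 \<in> S")
    case True
    then have "(\<Prod>c\<in>S. y + of_int c) = y * prod (\<phi> y) S"
      using that prod.remove[of S 0 "\<lambda>c. y + of_int c"] by (simp add: \<phi>)
    then show ?thesis using True by simp
  next
    case False
    then show ?thesis using \<phi>[OF that, of y] by simp
  qed
  \<comment> \<open>\<open>turn\<close> counts steps relative to the starting weight; translation by
    \<open>a\<close> puts them at their absolute positions, where the wall has label 0.\<close>
  have shift: "(\<Prod>d\<in>overshoot 0 (b - a) (c - a). y + of_int a + of_int d) = (\<Prod>d\<in>overshoot a b c. y + of_int d)" for a b c and y :: complex
    by (rule prod.reindex_bij_witness[of _ "\<lambda>d. d - a" "\<lambda>d. d + a"]) (auto simp: overshoot_def)
  have "(\<Prod>c\<in>{n i<..m i} - {0}. x i + of_int c) * (\<Prod>c\<in>{m i<..l i} - {0}. x i + of_int c) *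
      (if 0 \<in> overshoot (l i) (m i) (n i) then x i else 1) =
     (\<Prod>c\<in>overshoot 0 (m i - l i) (m i - l i + (n i - m i)). plus_int x l i + of_int c) *
      (\<Prod>c\<in>{n i<..l i} - {0}. x i + of_int c)" for i
  proof -
    have "m i - l i + (n i - m i) = n i - l i" by simp
    then have "(\<Prod>c\<in>overshoot 0 (m i - l i) (m i - l i + (n i - m i)). plus_int x l i + of_int c) =
        prod (\<phi> (x i)) (overshoot (l i) (m i) (n i)) * (if 0 \<in> overshoot (l i) (m i) (n i) then x i else 1)"
      by (simp only: shift full finite_overshoot)
    moreover have "prod (\<phi> (x i)) {n i<..m i} * prod (\<phi> (x i)) {m i<..l i} =
        prod (\<phi> (x i)) (overshoot (l i) (m i) (n i)) * prod (\<phi> (x i)) {n i<..l i}"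
      by (rule overshoot_prod)
    ultimately show ?thesis by (simp only: \<phi> finite_greaterThanAtMost_int) (simp only: mult_ac)
  qed
  then show ?thesis
    unfolding descent_def crossing_def turn_def prod.distrib[symmetric] by simp
qed

text \<open>On the weight space of \<open>l\<close> the argument \<open>z i - l i\<close> stands for
  the nilpotent part of \<open>t\<^sub>i\<partial>\<^sub>i\<close>.\<close>

definition centered :: "('i \<Rightarrow> int) \<Rightarrow> (('i \<Rightarrow> complex) \<Rightarrow> complex) \<Rightarrow> ('i \<Rightarrow> complex) \<Rightarrow> complex" where
  "centered l k z = k (\<lambda>i. z i - of_int (l i))"

lemma centered_polys: "k \<in> polys \<Longrightarrow> centered l k \<in> polys"
  using polys_shift[of k "\<lambda>i. - of_int (l i)"] by (simp add: centered_def[abs_def])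

text \<open>A shift from \<open>l\<close> to \<open>m\<close> carries the nilpotent parts at
  \<open>l\<close> to those at \<open>m\<close>, so polynomials in them may be evaluated before or
  after it.\<close>

lemma centered_shift: "centered m k (plus_int z (\<lambda>i. m i - l i)) = centered l k z"
  by (simp add: centered_def)

locale complex_vector_space = vector_space scale
  for scale :: "complex \<Rightarrow> 'u \<Rightarrow> 'u::ab_group_add"
begin

lemma finite_dimensional_basis:
  assumes "finite_dimensional scale V" "subspace V"
  obtains B where "B \<subseteq> V" "finite B" "independent B" "span B = V"
proof -
  obtain B0 where B0: "finite B0" "V \<subseteq> span B0" using assms by (auto simp: finite_dimensional_def)
  obtain B where B: "B \<subseteq> V" "independent B" "V \<subseteq> span B" using maximal_independent_subset by blast
  have "finite B" using independent_span_bound[OF B0(1) B(2)] B B0 by auto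
  moreover have "span B \<subseteq> V" using B(1) assms(2) by (rule span_minimal)
  ultimately show ?thesis using that B by auto
qed

end

section \<open>Weighted shifts acting on a weight module\<close>

locale weight_module = complex_vector_space scale
  for scale :: "complex \<Rightarrow> 'u \<Rightarrow> 'u::ab_group_add" +
  fixes M :: "'u set" and act :: "'i::finite operator \<Rightarrow> 'u \<Rightarrow> 'u" and a :: int
  assumes object: "(M, act) \<in> Obj (bounded_weight_cat TYPE('i) scale a)"
begin

lemma module: "left_module scale weyl_centralizer (M, act)"
  and decomposition: "weight_decomposition scale (M, act)"
  and weight_space_finite: "finite_dimensional scale (weight_space scale (M, act) l)"
  and euler_nilpotent: "m \<in> M \<Longrightarrow> \<exists>N. ((\<lambda>x. act euler_op x - scale (of_int a) x) ^^ N) m = 0"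
  and weights_integral: "weight_space scale (M, act) l \<noteq> {0} \<Longrightarrow> l i \<in> \<int>"
  using object by (auto simp: bounded_weight_cat_def module_cat_def)

lemma subspace_M: "subspace M"
  using module by (simp add: left_module_def)

definition W :: "('i \<Rightarrow> int) \<Rightarrow> (('i \<Rightarrow> complex) \<Rightarrow> complex) \<Rightarrow> 'u \<Rightarrow> 'u" where
  "W \<alpha> k = act (wop \<alpha> k)"

abbreviation balanced :: "('i \<Rightarrow> int) \<Rightarrow> bool" where
  "balanced \<alpha> \<equiv> (\<Sum>i\<in>UNIV. \<alpha> i) = 0"

context
  fixes \<alpha> :: "'i \<Rightarrow> int" and k :: "('i \<Rightarrow> complex) \<Rightarrow> complex"
  assumes \<alpha>: "balanced \<alpha>" and k: "k \<in> polys"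
begin

lemma W_closed: "m \<in> M \<Longrightarrow> W \<alpha> k m \<in> M"
  using module wop_centralizer[OF k \<alpha>] by (simp add: left_module_def W_def)

lemma W_add: "m \<in> M \<Longrightarrow> m' \<in> M \<Longrightarrow> W \<alpha> k (m + m') = W \<alpha> k m + W \<alpha> k m'"
  using module wop_centralizer[OF k \<alpha>] by (simp add: left_module_def W_def)

lemma W_plus: "k' \<in> polys \<Longrightarrow> m \<in> M \<Longrightarrow> W \<alpha> (\<lambda>z. k z + k' z) m = W \<alpha> k m + W \<alpha> k' m"
  using module wop_centralizer[OF k \<alpha>] wop_centralizer[OF _ \<alpha>, of k']
  by (auto simp: left_module_def W_def weyl_centralizer_def wop_add)

lemma W_comp:
  assumes "balanced \<beta>" "k' \<in> polys" "m \<in> M"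
  shows "W \<beta> k' (W \<alpha> k m) = W (\<lambda>i. \<alpha> i + \<beta> i) (\<lambda>z. turn \<beta> \<alpha> z * k' (plus_int z \<alpha>) * k z) m"
proof -
  have "act (wop \<beta> k' \<circ> wop \<alpha> k) m = act (wop \<beta> k') (act (wop \<alpha> k) m)"
    using module wop_centralizer[OF k \<alpha>] wop_centralizer[OF assms(2,1)] assms(3)
    by (simp add: left_module_def weyl_centralizer_def)
  then show ?thesis using wop_comp[OF k assms(2)] by (simp add: W_def)
qed

lemma W_zero: "W \<alpha> k 0 = 0"
  using W_add[of 0 0] subspace_0[OF subspace_M] by simp

end

lemma W_const: "m \<in> M \<Longrightarrow> W (\<lambda>_. 0) (\<lambda>z. c) m = scale c m"
  using module by (simp add: left_module_def weyl_centralizer_def W_def const_op_wop)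

lemma W_comp0: "balanced \<alpha> \<Longrightarrow> k \<in> polys \<Longrightarrow> k' \<in> polys \<Longrightarrow> m \<in> M \<Longrightarrow>
    W \<alpha> k' (W (\<lambda>_. 0) k m) = W \<alpha> (\<lambda>z. k' z * k z) m"
  by (simp add: W_comp)

lemma W_comp0': "balanced \<alpha> \<Longrightarrow> k \<in> polys \<Longrightarrow> k' \<in> polys \<Longrightarrow> m \<in> M \<Longrightarrow>
    W (\<lambda>_. 0) k' (W \<alpha> k m) = W \<alpha> (\<lambda>z. k' (plus_int z \<alpha>) * k z) m"
  by (simp add: W_comp)

lemma W_scale:
  assumes "balanced \<alpha>" "k \<in> polys" "m \<in> M"
  shows "W \<alpha> k (scale c m) = scale c (W \<alpha> k m)" "W \<alpha> (\<lambda>z. c * k z) m = scale c (W \<alpha> k m)"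
proof -
  show *: "W \<alpha> (\<lambda>z. c * k z) m = scale c (W \<alpha> k m)"
    using W_comp0'[OF assms(1,2) polys.const assms(3), of c] assms by (simp add: W_const W_closed)
  show "W \<alpha> k (scale c m) = scale c (W \<alpha> k m)"
    using W_comp0[OF assms(1) polys.const assms(2,3), of c] assms *
    by (simp add: W_const mult.commute[of _ c])
qed

lemma W_minus:
  assumes "balanced \<alpha>" "k \<in> polys" "m \<in> M" "m' \<in> M"
  shows "W \<alpha> k (m - m') = W \<alpha> k m - W \<alpha> k m'"
  using W_add[OF assms(1,2), of "m - m'" m'] assms subspace_diff[OF subspace_M] by (simp add: algebra_simps)

lemma W_sum:
  assumes "balanced \<alpha>" "\<And>j. j \<in> S \<Longrightarrow> k j \<in> polys" "m \<in> M"
  shows "W \<alpha> (\<lambda>z. \<Sum>j\<in>S. k j z) m = (\<Sum>j\<in>S. W \<alpha> (k j) m)"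
proof -
  have 0: "W \<alpha> (\<lambda>z. 0) m = 0" using W_scale(2)[OF assms(1) polys.const assms(3), of 0 0] by simp
  show ?thesis using assms(2)
    by (induction S rule: infinite_finite_induct) (simp_all add: 0 W_plus assms polys_sum)
qed

text \<open>Turns the iterated operator in the definition of weight spaces into one polynomial in
  the \<open>t\<^sub>i\<partial>\<^sub>i\<close>, to which the composition rules apply.\<close>

lemma theta_power:
  assumes "m \<in> M"
  shows "((\<lambda>x. act (theta_op i) x - scale c x) ^^ N) m = W (\<lambda>_. 0) (\<lambda>z. (z i - c) ^ N) m"
proof (induction N)
  case 0
  then show ?case using W_const[OF assms, of 1] by simp
next
  case (Suc N)
  have p: "(\<lambda>z :: 'i \<Rightarrow> complex. (z i - c) ^ N) \<in> polys" "(\<lambda>z :: 'i \<Rightarrow> complex. z i) \<in> polys"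
    by (intro polys_intros)+
  have "W (\<lambda>_. 0) (\<lambda>z. (z i - c) ^ Suc N) m = W (\<lambda>_. 0) (\<lambda>z. z i * (z i - c) ^ N + (- c) * (z i - c) ^ N) m"
    by (simp add: algebra_simps)
  also have "\<dots> = W (\<lambda>_. 0) (\<lambda>z. z i * (z i - c) ^ N) m + W (\<lambda>_. 0) (\<lambda>z. (- c) * (z i - c) ^ N) m"
    by (rule W_plus) (intro polys_intros p assms | simp)+
  also have "W (\<lambda>_. 0) (\<lambda>z. z i * (z i - c) ^ N) m = W (\<lambda>_. 0) (\<lambda>z. z i) (W (\<lambda>_. 0) (\<lambda>z. (z i - c) ^ N) m)"
    using p assms by (simp add: W_comp0)
  also have "W (\<lambda>_. 0) (\<lambda>z. (- c) * (z i - c) ^ N) m = scale (- c) (W (\<lambda>_. 0) (\<lambda>z. (z i - c) ^ N) m)"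
    using p assms by (intro W_scale) auto
  finally show ?case using Suc by (simp add: theta_op_wop W_def)
qed

abbreviation Wt :: "('i \<Rightarrow> int) \<Rightarrow> 'u set" where
  "Wt l \<equiv> weight_space scale (M, act) (\<lambda>i. of_int (l i))"

lemma weight_space_iff: "m \<in> weight_space scale (M, act) l \<longleftrightarrow>
    m \<in> M \<and> (\<exists>N>0. \<forall>i. W (\<lambda>_. 0) (\<lambda>z. (z i - l i) ^ N) m = 0)"
  by (auto simp: weight_space_def theta_power)

lemma weight_power_mono:
  assumes "m \<in> M" "N \<le> N'" "W (\<lambda>_. 0) (\<lambda>z. (z i - c) ^ N) m = 0"
  shows "W (\<lambda>_. 0) (\<lambda>z. (z i - c) ^ N') m = 0"
proof -
  have p: "(\<lambda>z :: 'i \<Rightarrow> complex. (z i - c) ^ N) \<in> polys" for N by (intro polys_intros)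
  have "W (\<lambda>_. 0) (\<lambda>z. (z i - c) ^ N') m = W (\<lambda>_. 0) (\<lambda>z. (z i - c) ^ (N' - N)) (W (\<lambda>_. 0) (\<lambda>z. (z i - c) ^ N) m)"
    using assms(1,2) p by (subst W_comp0) (simp_all add: power_add[symmetric])
  then show ?thesis using assms(3) p by (simp add: W_zero)
qed

lemma subspace_weight_space: "subspace (weight_space scale (M, act) l)"
proof (rule subspaceI)
  have p: "(\<lambda>z :: 'i \<Rightarrow> complex. (z i - l i) ^ N) \<in> polys" for N i by (intro polys_intros)
  show "0 \<in> weight_space scale (M, act) l"
    using p subspace_0[OF subspace_M] by (auto simp: weight_space_iff W_zero)
  show "scale c m \<in> weight_space scale (M, act) l" if "m \<in> weight_space scale (M, act) l" for c m
    using that p subspace_scale[OF subspace_M] by (auto simp: weight_space_iff W_scale)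
  show "m + m' \<in> weight_space scale (M, act) l"
    if m: "m \<in> weight_space scale (M, act) l" and m': "m' \<in> weight_space scale (M, act) l" for m m'
  proof -
    obtain N N' where N: "N > 0" "\<And>i. W (\<lambda>_. 0) (\<lambda>z. (z i - l i) ^ N) m = 0"
      "\<And>i. W (\<lambda>_. 0) (\<lambda>z. (z i - l i) ^ N') m' = 0" "m \<in> M" "m' \<in> M"
      using m m' by (auto simp: weight_space_iff)
    then have "W (\<lambda>_. 0) (\<lambda>z. (z i - l i) ^ (max N N')) (m + m') = 0" for i
      using p weight_power_mono[of m N "max N N'" i "l i"] weight_power_mono[of m' N' "max N N'" i "l i"]
      by (simp add: W_add)
    then show ?thesis using N subspace_add[OF subspace_M] unfolding weight_space_iff
      by (intro conjI exI[of _ "max N N'"]) auto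
  qed
qed

lemma Wt_M: "m \<in> Wt l \<Longrightarrow> m \<in> M"
  by (simp add: weight_space_iff)

text \<open>Moved past a shift by \<open>\<alpha>\<close>, the operator of
  \<open>z i - (l i + \<alpha> i)\<close> becomes that of \<open>z i - l i\<close>, so the same
  exponent \<open>N\<close> works.\<close>

lemma W_weight:
  assumes "m \<in> Wt l" "balanced \<alpha>" "k \<in> polys"
  shows "W \<alpha> k m \<in> Wt (\<lambda>i. l i + \<alpha> i)"
proof -
  obtain N where N: "m \<in> M" "N > 0" "\<And>i. W (\<lambda>_. 0) (\<lambda>z. (z i - of_int (l i)) ^ N) m = 0"
    using assms by (auto simp: weight_space_iff)
  have p: "(\<lambda>z :: 'i \<Rightarrow> complex. (z i - c) ^ N) \<in> polys" for i c by (intro polys_intros)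
  have "W (\<lambda>_. 0) (\<lambda>z. (z i - of_int (l i + \<alpha> i)) ^ N) (W \<alpha> k m) = W \<alpha> k (W (\<lambda>_. 0) (\<lambda>z. (z i - of_int (l i)) ^ N) m)" for i
    using assms(2,3) N(1) p W_comp0[OF assms(2) p assms(3) N(1), of i "of_int (l i)"] by (simp add: W_comp0' mult.commute)
  then show ?thesis using assms N by (auto simp: weight_space_iff W_zero W_closed)
qed

text \<open>One coordinate at a time: the last nonvanishing power of the nilpotent part, applied to
  the vector found so far, is killed by this nilpotent part and stays killed by the earlier ones,
  which commute with it.\<close>

lemma common_eigenvector:
  assumes "m \<in> Wt l" "m \<noteq> 0"
  shows "\<exists>v\<in>Wt l. v \<noteq> 0 \<and> (\<forall>i. W (\<lambda>_. 0) (\<lambda>z. z i - of_int (l i)) v = 0)"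
proof -
  have p: "(\<lambda>z :: 'i \<Rightarrow> complex. (z i - c) ^ N) \<in> polys" "(\<lambda>z :: 'i \<Rightarrow> complex. z i - c) \<in> polys" for i c N
    by (intro polys_intros)+
  have "\<exists>v\<in>Wt l. v \<noteq> 0 \<and> (\<forall>i\<in>S. W (\<lambda>_. 0) (\<lambda>z. z i - of_int (l i)) v = 0)" for S :: "'i set"
    using finite[of S]
  proof (induction S rule: finite_induct)
    case empty
    then show ?case using assms by auto
  next
    case (insert i S)
    then obtain v where v: "v \<in> Wt l" "v \<noteq> 0" "\<And>j. j \<in> S \<Longrightarrow> W (\<lambda>_. 0) (\<lambda>z. z j - of_int (l j)) v = 0" by auto
    then have vM: "v \<in> M" using Wt_M by blast
    let ?X = "\<lambda>N. W (\<lambda>_. 0) (\<lambda>z. (z i - of_int (l i)) ^ N) v"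
    have ex: "\<exists>N. ?X N = 0" using v(1) by (auto simp: weight_space_iff)
    define N where "N = (LEAST N. ?X N = 0)"
    have N: "?X N = 0" unfolding N_def using ex by (rule LeastI_ex)
    have "N \<noteq> 0" using N v(2) W_const[OF vM, of 1] by (cases N) auto
    then obtain N' where N': "N = Suc N'" by (cases N) auto
    have nz: "?X N' \<noteq> 0" using not_less_Least[of N' "\<lambda>N. ?X N = 0"] N' by (auto simp: N_def[symmetric])
    have "W (\<lambda>_. 0) (\<lambda>z. z i - of_int (l i)) (?X N') = ?X N" using vM p by (simp add: W_comp0 N')
    moreover have "W (\<lambda>_. 0) (\<lambda>z. z j - of_int (l j)) (?X N') = 0" if "j \<in> S" for j
    proof -
      have "W (\<lambda>_. 0) (\<lambda>z. z j - of_int (l j)) (?X N') =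
         W (\<lambda>_. 0) (\<lambda>z. (z i - of_int (l i)) ^ N') (W (\<lambda>_. 0) (\<lambda>z. z j - of_int (l j)) v)"
        using vM p W_comp0[of "\<lambda>_. 0", OF _ p(2) p(1) vM, of i "of_int (l i)" N' j "of_int (l j)"] by (simp add: W_comp0 mult.commute)
      then show ?thesis using v(3)[OF that] p by (simp add: W_zero)
    qed
    moreover have "?X N' \<in> Wt l" using W_weight[OF v(1) _ p(1), of "\<lambda>_. 0"] by simp
    ultimately show ?case using N nz by (intro bexI[of _ "?X N'"]) auto
  qed
  from this[of UNIV] show ?thesis by simp
qed

text \<open>On a common eigenvector \<open>E\<close> acts by the sum of the \<open>l i\<close>, and
  local nilpotency of \<open>E - a\<close> forces this scalar to be \<open>a\<close>.\<close>

lemma weight_total: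
  assumes "m \<in> Wt l" "m \<noteq> 0" shows "(\<Sum>i\<in>UNIV. l i) = a"
proof -
  obtain v where v: "v \<in> Wt l" "v \<noteq> 0" "\<And>i. W (\<lambda>_. 0) (\<lambda>z. z i - of_int (l i)) v = 0"
    using common_eigenvector[OF assms] by auto
  have vM: "v \<in> M" using v Wt_M by blast
  have "W (\<lambda>_. 0) (\<lambda>z. z i) v = scale (of_int (l i)) v" for i
  proof -
    have "W (\<lambda>_. 0) (\<lambda>z. (z i - of_int (l i)) + of_int (l i)) v = 0 + scale (of_int (l i)) v"
      unfolding v(3)[of i, symmetric] W_const[OF vM, of "of_int (l i)", symmetric]
      by (rule W_plus) (intro polys_intros vM | simp)+
    then show ?thesis by simp
  qed
  then have e: "act euler_op v = scale (of_int (\<Sum>i\<in>UNIV. l i)) v"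
    using W_sum[of "\<lambda>_. 0" UNIV "\<lambda>i z. z i" v] vM
    by (simp add: euler_op_wop W_def[symmetric] polys.var scale_sum_left)
  let ?d = "of_int ((\<Sum>i\<in>UNIV. l i) - a) :: complex"
  have eu: "euler_op \<in> carrier (weyl_centralizer :: 'i operator calgebra)"
    unfolding euler_op_wop by (intro wop_centralizer polys_intros) simp
  have sc: "act euler_op (scale c v) = scale c (act euler_op v)" for c
    using W_scale(1)[of "\<lambda>_. 0" "\<lambda>z. \<Sum>i\<in>UNIV. z i" v c] vM
    by (simp add: euler_op_wop W_def polys_sum polys.var)
  have "((\<lambda>x. act euler_op x - scale (of_int a) x) ^^ N) v = scale (?d ^ N) v" for N
  proof (induction N)
    case (Suc N)
    have "scale (?d ^ N) (scale (of_int (\<Sum>i\<in>UNIV. l i)) v) - scale (of_int a) (scale (?d ^ N) v) =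
       scale (?d ^ N * of_int (\<Sum>i\<in>UNIV. l i) - of_int a * ?d ^ N) v"
      by (simp only: scale_scale scale_left_diff_distrib)
    also have "?d ^ N * of_int (\<Sum>i\<in>UNIV. l i) - of_int a * ?d ^ N = ?d ^ Suc N"
      by (simp only: of_int_diff power_Suc left_diff_distrib) (simp only: mult.commute)
    finally show ?case using Suc by (simp only: funpow.simps comp_apply sc e)
  qed simp
  then have "\<exists>N. scale (?d ^ N) v = 0" using euler_nilpotent[OF vM] by simp
  then obtain N where "scale (?d ^ N) v = 0" by auto
  then have "?d ^ N = 0" using v(2) by simp
  then have "?d = 0" by (rule power_eq_0_iff[THEN iffD1, THEN conjunct1])
  then show ?thesis unfolding of_int_eq_0_iff by simp
qed

end

section \<open>Projections to integral weight spaces and invertible operators on them\<close>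

context weight_module
begin

text \<open>The decomposition indexed by integral instead of complex weights, which loses nothing
  because the support is integral.\<close>

definition decomposes :: "'u \<Rightarrow> (('i \<Rightarrow> int) \<Rightarrow> 'u) \<Rightarrow> bool" where
  "decomposes m g \<longleftrightarrow> (\<forall>l. g l \<in> Wt l) \<and> finite {l. g l \<noteq> 0} \<and> m = (\<Sum>l\<in>{l. g l \<noteq> 0}. g l)"

lemma ex_decomposes:
  assumes "m \<in> M" shows "\<exists>g. decomposes m g"
proof -
  obtain f where f: "\<And>l. f l \<in> weight_space scale (M, act) l" "finite {l. f l \<noteq> 0}" "m = (\<Sum>l\<in>{l. f l \<noteq> 0}. f l)"
    using decomposition assms unfolding weight_decomposition_def by (metis fst_conv)
  define emb :: "('i \<Rightarrow> int) \<Rightarrow> 'i \<Rightarrow> complex" where "emb l = (\<lambda>i. of_int (l i))" for l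
  have inj: "inj emb" by (auto simp: inj_def emb_def fun_eq_iff)
  have eq: "{l. f l \<noteq> 0} = emb ` {l. f (emb l) \<noteq> 0}"
  proof (intro equalityI subsetI)
    fix l assume l: "l \<in> {l. f l \<noteq> 0}"
    then have "weight_space scale (M, act) l \<noteq> {0}" using f(1)[of l] by auto
    then have "l i \<in> \<int>" for i using weights_integral by blast
    then have "l = emb (\<lambda>i. \<lfloor>Re (l i)\<rfloor>)" unfolding emb_def
      by (intro HOL.ext) (metis Ints_cases Re_complex_of_real floor_of_int of_real_of_int_eq)
    then show "l \<in> emb ` {l. f (emb l) \<noteq> 0}" using l by (metis (mono_tags, lifting) image_eqI mem_Collect_eq)
  qed auto
  have "decomposes m (\<lambda>l. f (emb l))"
    unfolding decomposes_def
  proof (intro conjI allI)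
    show "f (emb l) \<in> Wt l" for l using f(1)[of "emb l"] by (simp add: emb_def)
    show "finite {l. f (emb l) \<noteq> 0}" using f(2) unfolding eq using inj by (simp add: finite_image_iff inj_on_def inj_def)
    show "m = (\<Sum>l\<in>{l. f (emb l) \<noteq> 0}. f (emb l))"
      using f(3) unfolding eq by (subst (asm) sum.reindex) (use inj in \<open>auto simp: inj_on_def inj_def\<close>)
  qed
  then show ?thesis by blast
qed

lemma decomposes_unique:
  assumes "m \<in> M" "decomposes m g" "decomposes m h" shows "g = h"
proof -
  define emb :: "('i \<Rightarrow> int) \<Rightarrow> 'i \<Rightarrow> complex" where "emb l = (\<lambda>i. of_int (l i))" for l
  have inj: "inj emb" by (auto simp: inj_def emb_def fun_eq_iff)
  \<comment> \<open>Extension by zero to complex weights, where uniqueness of the decomposition is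
    available.\<close>
  define lift0 where "lift0 g l = (if l \<in> range emb then g (inv_into UNIV emb l) else 0)" for g :: "('i \<Rightarrow> int) \<Rightarrow> 'u" and l
  have ext_emb: "lift0 g (emb l) = g l" for g l using inj by (simp add: lift0_def)
  have *: "(\<forall>l. lift0 g l \<in> weight_space scale (M, act) l) \<and> finite {l. lift0 g l \<noteq> 0} \<and> m = (\<Sum>l\<in>{l. lift0 g l \<noteq> 0}. lift0 g l)"
    if g: "decomposes m g" for g
  proof -
    have eq: "{l. lift0 g l \<noteq> 0} = emb ` {l. g l \<noteq> 0}" using inj by (auto simp: lift0_def inj_eq)
    have "lift0 g l \<in> weight_space scale (M, act) l" for l
    proof (cases "l \<in> range emb")
      case True
      then obtain l' where l': "l = emb l'" by auto
      show ?thesis using g unfolding l' ext_emb by (simp add: decomposes_def emb_def)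
    next
      case False
      then show ?thesis using subspace_0[OF subspace_weight_space] by (simp add: lift0_def)
    qed
    moreover have "(\<Sum>l\<in>{l. lift0 g l \<noteq> 0}. lift0 g l) = (\<Sum>l\<in>{l. g l \<noteq> 0}. g l)"
      unfolding eq by (subst sum.reindex) (use inj ext_emb in \<open>auto simp: inj_on_def inj_def\<close>)
    ultimately show ?thesis using g by (simp add: decomposes_def eq)
  qed
  have "lift0 g = lift0 h"
    using decomposition assms(1) *[OF assms(2)] *[OF assms(3)] unfolding weight_decomposition_def fst_conv
    by blast
  then show ?thesis using ext_emb by (intro ext) metis
qed

definition proj :: "('i \<Rightarrow> int) \<Rightarrow> 'u \<Rightarrow> 'u" where
  "proj l m = (THE g. decomposes m g) l"

lemma proj_eqI: "m \<in> M \<Longrightarrow> decomposes m g \<Longrightarrow> proj l m = g l"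
  unfolding proj_def using decomposes_unique by (metis the_equality)

lemma decomposes_proj:
  assumes "m \<in> M" shows "decomposes m (\<lambda>l. proj l m)"
proof -
  obtain g where g: "decomposes m g" using ex_decomposes[OF assms] ..
  then have "(\<lambda>l. proj l m) = g" using proj_eqI[OF assms g] by auto
  then show ?thesis using g by simp
qed

lemma proj_Wt: "m \<in> M \<Longrightarrow> proj l m \<in> Wt l"
  and proj_finite: "m \<in> M \<Longrightarrow> finite {l. proj l m \<noteq> 0}"
  and proj_sum: "m \<in> M \<Longrightarrow> m = (\<Sum>l\<in>{l. proj l m \<noteq> 0}. proj l m)"
  using decomposes_proj by (auto simp: decomposes_def)

lemma proj_sum_superset:
  assumes "m \<in> M" "finite S" "{l. proj l m \<noteq> 0} \<subseteq> S"
  shows "(\<Sum>l\<in>S. proj l m) = m"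
proof -
  have "(\<Sum>l\<in>{l. proj l m \<noteq> 0}. proj l m) = (\<Sum>l\<in>S. proj l m)"
    by (rule sum.mono_neutral_left) (use assms in auto)
  then show ?thesis unfolding proj_sum[OF assms(1), symmetric] by (rule sym)
qed

lemma proj_of_sum:
  assumes "finite S" "\<And>l. l \<in> S \<Longrightarrow> g l \<in> Wt l"
  shows "proj l (\<Sum>l\<in>S. g l) = (if l \<in> S then g l else 0)"
proof -
  define h where "h l = (if l \<in> S then g l else 0)" for l
  have "decomposes (\<Sum>l\<in>S. g l) h"
    unfolding decomposes_def
  proof (intro conjI allI)
    show "h l \<in> Wt l" for l using assms(2) subspace_0[OF subspace_weight_space] by (simp add: h_def)
    have sub: "{l. h l \<noteq> 0} \<subseteq> S" by (auto simp: h_def)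
    then show "finite {l. h l \<noteq> 0}" using assms(1) finite_subset by blast
    have "(\<Sum>l\<in>S. g l) = (\<Sum>l\<in>S. h l)" by (simp add: h_def)
    also have "\<dots> = (\<Sum>l\<in>{l. h l \<noteq> 0}. h l)" using assms(1) sub by (intro sum.mono_neutral_right) auto
    finally show "(\<Sum>l\<in>S. g l) = (\<Sum>l\<in>{l. h l \<noteq> 0}. h l)" .
  qed
  moreover have "(\<Sum>l\<in>S. g l) \<in> M" using assms Wt_M by (intro subspace_sum[OF subspace_M]) auto
  ultimately show ?thesis using proj_eqI by (simp add: h_def)
qed

lemma proj_weight: "m \<in> Wt l \<Longrightarrow> proj l' m = (if l' = l then m else 0)"
  using proj_of_sum[of "{l}" "\<lambda>_. m"] by simp

lemma proj_add:
  assumes "m \<in> M" "m' \<in> M" shows "proj l (m + m') = proj l m + proj l m'"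
proof -
  let ?S = "{l. proj l m \<noteq> 0} \<union> {l. proj l m' \<noteq> 0}"
  have f: "finite ?S" using assms proj_finite by simp
  have "(\<Sum>l\<in>?S. proj l m + proj l m') = m + m'"
    using assms f by (simp add: sum.distrib proj_sum_superset)
  then show ?thesis
    using proj_of_sum[OF f, of "\<lambda>l. proj l m + proj l m'" l] assms proj_Wt subspace_add[OF subspace_weight_space]
    by (auto split: if_splits)
qed

lemma proj_scale:
  assumes "m \<in> M" shows "proj l (scale c m) = scale c (proj l m)"
proof -
  have "(\<Sum>l\<in>{l. proj l m \<noteq> 0}. scale c (proj l m)) = scale c m"
    unfolding scale_sum_right[symmetric] proj_sum[OF assms, symmetric] ..
  then show ?thesis
    using proj_of_sum[OF proj_finite[OF assms], of "\<lambda>l. scale c (proj l m)" l] assms proj_Wt subspace_scale[OF subspace_weight_space]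
    by (auto split: if_splits)
qed

text \<open>Polynomials in the \<open>t\<^sub>i\<partial>\<^sub>i\<close> that may be divided by on
  the weight space of \<open>l\<close>. They are closed under products, so linear factors suffice
  for \<open>descent\<close>.\<close>

definition units :: "('i \<Rightarrow> int) \<Rightarrow> (('i \<Rightarrow> complex) \<Rightarrow> complex) set" where
  "units l = {k \<in> polys. bij_betw (W (\<lambda>_. 0) k) (Wt l) (Wt l)}"

lemma W0_Wt: "k \<in> polys \<Longrightarrow> m \<in> Wt l \<Longrightarrow> W (\<lambda>_. 0) k m \<in> Wt l"
  using W_weight[of m l "\<lambda>_. 0" k] by simp

lemma units_one: "(\<lambda>z. 1) \<in> units l"
proof -
  have "bij_betw (W (\<lambda>_. 0) (\<lambda>z. 1)) (Wt l) (Wt l) \<longleftrightarrow> bij_betw id (Wt l) (Wt l)"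
    by (rule bij_betw_cong) (simp add: W_const Wt_M)
  then show ?thesis by (simp add: units_def polys.const)
qed

lemma units_mult:
  assumes "k \<in> units l" "k' \<in> units l" shows "(\<lambda>z. k z * k' z) \<in> units l"
proof -
  have p: "k \<in> polys" "k' \<in> polys" using assms by (auto simp: units_def)
  have "bij_betw (W (\<lambda>_. 0) k \<circ> W (\<lambda>_. 0) k') (Wt l) (Wt l)"
    using assms by (intro bij_betw_trans[of _ _ "Wt l"]) (auto simp: units_def)
  moreover have "bij_betw (W (\<lambda>_. 0) k \<circ> W (\<lambda>_. 0) k') (Wt l) (Wt l) \<longleftrightarrow> bij_betw (W (\<lambda>_. 0) (\<lambda>z. k z * k' z)) (Wt l) (Wt l)"
    by (rule bij_betw_cong) (simp add: W_comp0 Wt_M p)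
  ultimately show ?thesis using p by (simp add: units_def polys.mult)
qed

lemma units_prod: "(\<And>j. j \<in> S \<Longrightarrow> f j \<in> units l) \<Longrightarrow> (\<lambda>z. \<Prod>j\<in>S. f j z) \<in> units l"
  by (induction S rule: infinite_finite_induct) (auto simp: units_one intro: units_mult)

text \<open>A nilpotent operator plus a nonzero scalar. Surjectivity is by induction on the order of
  nilpotency of the target; injectivity holds because a nilpotent operator has no eigenvalue
  \<open>-c\<close>.\<close>

lemma units_linear:
  assumes c: "c \<noteq> 0" shows "(\<lambda>z. z i - of_int (l i) + c) \<in> units l"
proof -
  define X where "X = W (\<lambda>_. 0) (\<lambda>z. z i - of_int (l i))"
  have px: "(\<lambda>z :: 'i \<Rightarrow> complex. z i - of_int (l i)) \<in> polys" by (intro polys_intros)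
  have pX: "(\<lambda>z :: 'i \<Rightarrow> complex. (z i - of_int (l i)) ^ N) \<in> polys" for N by (intro polys_intros)
  have XW: "X m \<in> Wt l" if "m \<in> Wt l" for m using W0_Wt[OF px that] by (simp add: X_def)
  have XN: "W (\<lambda>_. 0) (\<lambda>z. (z i - of_int (l i)) ^ Suc N) m = W (\<lambda>_. 0) (\<lambda>z. (z i - of_int (l i)) ^ N) (X m)" if "m \<in> Wt l" for N m
    using W_comp0[OF _ px pX Wt_M[OF that], of "\<lambda>_. 0" N] by (simp add: X_def mult.commute)
  have Xc: "W (\<lambda>_. 0) (\<lambda>z. z i - of_int (l i) + c) m = X m + scale c m" if "m \<in> Wt l" for m
    unfolding X_def W_const[OF Wt_M[OF that], of c, symmetric] by (rule W_plus) (intro px polys.const Wt_M[OF that] | simp)+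
  have sub: "subspace (Wt l)" by (rule subspace_weight_space)
  have surj: "\<exists>m'\<in>Wt l. X m' + scale c m' = m" if "m \<in> Wt l" "W (\<lambda>_. 0) (\<lambda>z. (z i - of_int (l i)) ^ N) m = 0" for N m
    using that
  proof (induction N arbitrary: m)
    case 0
    then have "m = 0" using W_const[OF Wt_M[OF 0(1)], of 1] by simp
    then show ?case using subspace_0[OF sub] W_zero[OF _ px, of "\<lambda>_. 0"] by (intro bexI[of _ 0]) (auto simp: X_def)
  next
    case (Suc N)
    from Suc.IH[of "X m"] Suc.prems XN XW obtain m' where m': "m' \<in> Wt l" "X m' + scale c m' = X m" by metis
    have d: "m - m' \<in> Wt l" using m' Suc.prems subspace_diff[OF sub] by blast
    have "X (m - m') = scale c m'"
    proof -
      have "X (m - m') = X m - X m'"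
        using W_minus[OF _ px Wt_M[OF Suc.prems(1)] Wt_M[OF m'(1)], of "\<lambda>_. 0"] by (simp add: X_def)
      then show ?thesis unfolding m'(2)[symmetric] by simp
    qed
    \<comment> \<open>The solution for \<open>m\<close> is \<open>(m - m') / c\<close>, where
      \<open>m'\<close> solves the equation for \<open>X m\<close>: applying \<open>X\<close> to it
      gives \<open>m'\<close>, and \<open>c\<close> times it is \<open>m - m'\<close>.\<close>
    then have "X (scale (1 / c) (m - m')) = m'"
      using W_scale(1)[OF _ px Wt_M[OF d], of "\<lambda>_. 0" "1 / c"] c by (simp add: X_def[symmetric])
    moreover have "scale c (scale (1 / c) (m - m')) = m - m'" using c by simp
    ultimately show ?case using subspace_scale[OF sub d] by (intro bexI[of _ "scale (1 / c) (m - m')"]) auto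
  qed
  have inj: "m = 0" if m: "m \<in> Wt l" and 0: "X m + scale c m = 0" for m
  proof -
    have X: "X m = scale (- c) m" using 0 by (simp add: add_eq_0_iff2)
    have "W (\<lambda>_. 0) (\<lambda>z. (z i - of_int (l i)) ^ N) m = scale ((- c) ^ N) m" for N
    proof (induction N)
      case 0
      then show ?case using W_const[OF Wt_M[OF m], of 1] by simp
    next
      case (Suc N)
      then show ?case unfolding XN[OF m] X using W_scale(1)[OF _ pX Wt_M[OF m], of "\<lambda>_. 0" N "- c"] by (simp add: mult.commute)
    qed
    moreover obtain N where "W (\<lambda>_. 0) (\<lambda>z. (z i - of_int (l i)) ^ N) m = 0" using m by (auto simp: weight_space_iff)
    ultimately show ?thesis using c by simp
  qed
  have "bij_betw (W (\<lambda>_. 0) (\<lambda>z. z i - of_int (l i) + c)) (Wt l) (Wt l)"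
    unfolding bij_betw_def
  proof
    have p: "(\<lambda>z :: 'i \<Rightarrow> complex. z i - of_int (l i) + c) \<in> polys" by (intro polys_intros)
    show "inj_on (W (\<lambda>_. 0) (\<lambda>z. z i - of_int (l i) + c)) (Wt l)"
    proof (rule inj_onI)
      fix m m' assume m: "m \<in> Wt l" "m' \<in> Wt l"
        "W (\<lambda>_. 0) (\<lambda>z. z i - of_int (l i) + c) m = W (\<lambda>_. 0) (\<lambda>z. z i - of_int (l i) + c) m'"
      have d: "m - m' \<in> Wt l" using m subspace_diff[OF sub] by blast
      have "X (m - m') + scale c (m - m') = 0"
        unfolding Xc[OF d, symmetric] using W_minus[OF _ p Wt_M[OF m(1)] Wt_M[OF m(2)], of "\<lambda>_. 0"] m(3) by simp
      then show "m = m'" using inj[OF d] by simp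
    qed
    show "W (\<lambda>_. 0) (\<lambda>z. z i - of_int (l i) + c) ` Wt l = Wt l"
    proof (intro equalityI subsetI)
      fix m assume m: "m \<in> Wt l"
      then obtain N where "W (\<lambda>_. 0) (\<lambda>z. (z i - of_int (l i)) ^ N) m = 0" by (auto simp: weight_space_iff)
      from surj[OF m this] obtain m' where "m' \<in> Wt l" "X m' + scale c m' = m" by auto
      then show "m \<in> W (\<lambda>_. 0) (\<lambda>z. z i - of_int (l i) + c) ` Wt l"
        using Xc[of m'] by (intro image_eqI[of _ _ m']) auto
    qed (use W0_Wt[OF p] in auto)
  qed
  then show ?thesis by (auto simp: units_def intro!: polys_intros)
qed

lemma descent_units: "centered l (descent l' m) \<in> units l"
proof -
  have "(\<lambda>z. \<Prod>i\<in>UNIV. \<Prod>c\<in>{m i<..l' i} - {0}. z i - of_int (l i) + of_int c) \<in> units l"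
    by (intro units_prod units_linear) auto
  then show ?thesis by (simp add: centered_def[abs_def] descent_def)
qed

end

section \<open>Normalized shifts between weight spaces\<close>

context weight_module
begin

abbreviation "degree l \<equiv> (\<Sum>i\<in>UNIV. l i :: int)"

lemma degree_diff: "degree l = degree m \<Longrightarrow> balanced (\<lambda>i. m i - l i)"
  by (simp add: sum_subtractf)

text \<open>The operator \<open>Theta l m k\<close> from the weight space of \<open>l\<close> to that of \<open>m\<close> is \<open>k\<close>, evaluated at
  the nilpotent parts of the \<open>t\<^sub>i\<partial>\<^sub>i\<close>, times the monomial in \<open>t\<close> and \<open>\<partial>\<close> of degree \<open>m - l\<close>, divided by
  the invertible factors \<open>descent l m\<close>. With this normalization only the crossings of the walls
  between the exponents \<open>-1\<close> and \<open>0\<close> remain visible in compositions.\<close>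

definition Theta :: "('i \<Rightarrow> int) \<Rightarrow> ('i \<Rightarrow> int) \<Rightarrow> (('i \<Rightarrow> complex) \<Rightarrow> complex) \<Rightarrow> 'u \<Rightarrow> 'u" where
  "Theta l m k v = W (\<lambda>i. m i - l i) (centered l k)
     (inv_into (Wt l) (W (\<lambda>_. 0) (centered l (descent l m))) v)"

lemma ex_unit_preimage: "u \<in> units l \<Longrightarrow> v \<in> Wt l \<Longrightarrow> \<exists>v'\<in>Wt l. v = W (\<lambda>_. 0) u v'"
  by (auto simp: units_def bij_betw_def)

text \<open>The inverse in \<open>Theta\<close> is never computed. Vectors are presented as images
  under \<open>descent\<close>, which the division cancels; the extra factor \<open>g\<close> allows
  several denominators to be cleared at once.\<close>

lemma Theta_on:
  assumes lm: "degree l = degree m" and k: "k \<in> polys" and g: "g \<in> polys" and v: "v \<in> Wt l"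
  shows "Theta l m k (W (\<lambda>_. 0) (centered l (\<lambda>x. descent l m x * g x)) v) =
     W (\<lambda>i. m i - l i) (centered l (\<lambda>x. k x * g x)) v"
proof -
  have p: "centered l (descent l m) \<in> polys" "centered l g \<in> polys" "centered l k \<in> polys"
    using k g by (auto intro!: centered_polys descent_polys)
  have gv: "W (\<lambda>_. 0) (centered l g) v \<in> Wt l" using v p by (simp add: W0_Wt)
  have "W (\<lambda>_. 0) (centered l (\<lambda>x. descent l m x * g x)) v =
     W (\<lambda>_. 0) (centered l (descent l m)) (W (\<lambda>_. 0) (centered l g) v)"
    using p v Wt_M by (subst W_comp0) (auto simp: centered_def[abs_def])
  moreover have "inv_into (Wt l) (W (\<lambda>_. 0) (centered l (descent l m))) (W (\<lambda>_. 0) (centered l (descent l m)) (W (\<lambda>_. 0) (centered l g) v))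
     = W (\<lambda>_. 0) (centered l g) v"
    using descent_units[of l l m] gv by (intro inv_into_f_f) (auto simp: units_def bij_betw_def)
  ultimately have "Theta l m k (W (\<lambda>_. 0) (centered l (\<lambda>x. descent l m x * g x)) v) =
     W (\<lambda>i. m i - l i) (centered l k) (W (\<lambda>_. 0) (centered l g) v)"
    by (simp add: Theta_def)
  also have "\<dots> = W (\<lambda>i. m i - l i) (centered l (\<lambda>x. k x * g x)) v"
    using p v Wt_M degree_diff[OF lm] by (subst W_comp0) (auto simp: centered_def[abs_def])
  finally show ?thesis .
qed

lemma Theta_on1:
  assumes "degree l = degree m" "k \<in> polys" "v \<in> Wt l"
  shows "Theta l m k (W (\<lambda>_. 0) (centered l (descent l m)) v) = W (\<lambda>i. m i - l i) (centered l k) v"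
  using Theta_on[OF assms(1,2) polys.const assms(3), of 1] by simp

lemma ex_descent_preimage: "v \<in> Wt l \<Longrightarrow> \<exists>v'\<in>Wt l. v = W (\<lambda>_. 0) (centered l (descent l m)) v'"
  by (rule ex_unit_preimage[OF descent_units])

lemma Theta_Wt:
  assumes "degree l = degree m" "k \<in> polys" "v \<in> Wt l"
  shows "Theta l m k v \<in> Wt m"
proof -
  obtain v' where v': "v' \<in> Wt l" "v = W (\<lambda>_. 0) (centered l (descent l m)) v'"
    using ex_descent_preimage[OF assms(3)] by blast
  then show ?thesis
    using W_weight[OF v'(1) degree_diff[OF assms(1)] centered_polys[OF assms(2)]] by (simp add: Theta_on1 assms)
qed

text \<open>Unnormalized shifts compose with the factor \<open>turn\<close>; by
  \<open>descent_turn\<close> the three normalizations absorb it up to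
  \<open>crossing\<close>.\<close>

lemma Theta_comp:
  assumes lm: "degree l = degree m" and mn: "degree m = degree n"
    and k: "k \<in> polys" and k': "k' \<in> polys" and v: "v \<in> Wt l"
  shows "Theta m n k' (Theta l m k v) = Theta l n (\<lambda>x. k x * k' x * crossing l m n x) v"
proof -
  note p = descent_polys crossing_polys turn_polys
  \<comment> \<open>The three factors are the denominators of the shifts from \<open>l\<close> to
    \<open>m\<close>, from \<open>l\<close> to \<open>n\<close> and from \<open>m\<close> to
    \<open>n\<close>; the last is transported back to \<open>l\<close>.\<close>
  have "(\<lambda>z. centered l (descent l m) z * (centered l (descent l n) z * centered l (descent m n) z)) \<in> units l"
    by (intro units_mult descent_units)
  from ex_unit_preimage[OF this v] obtain v' where v': "v' \<in> Wt l"
    "v = W (\<lambda>_. 0) (centered l (\<lambda>x. descent l m x * (descent l n x * descent m n x))) v'"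
    by (auto simp: centered_def[abs_def])
  have "Theta l m k v = W (\<lambda>i. m i - l i) (centered l (\<lambda>x. k x * (descent l n x * descent m n x))) v'"
    unfolding v'(2) by (rule Theta_on[OF lm k]) (intro polys_intros p v')+
  also have "\<dots> = W (\<lambda>_. 0) (centered m (descent m n)) (W (\<lambda>i. m i - l i) (centered l (\<lambda>x. k x * descent l n x)) v')"
    using v'(1) Wt_M degree_diff[OF lm] by (subst W_comp0')
      (auto simp: centered_shift intro!: centered_polys polys_intros k p, simp add: centered_def[abs_def] mult_ac)
  finally have 1: "Theta l m k v = \<dots>" .
  have w: "W (\<lambda>i. m i - l i) (centered l (\<lambda>x. k x * descent l n x)) v' \<in> Wt m"
    using W_weight[OF v'(1) degree_diff[OF lm] centered_polys[OF polys.mult[OF k descent_polys]]] by simp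
  have "Theta m n k' (Theta l m k v) = W (\<lambda>i. n i - m i) (centered m k') (W (\<lambda>i. m i - l i) (centered l (\<lambda>x. k x * descent l n x)) v')"
    unfolding 1 by (rule Theta_on1[OF mn k' w])
  also have "\<dots> = W (\<lambda>i. n i - l i) (\<lambda>z. turn (\<lambda>i. n i - m i) (\<lambda>i. m i - l i) z * centered l k' z * centered l (\<lambda>x. k x * descent l n x) z) v'"
  proof -
    have "(\<lambda>i. m i - l i + (n i - m i)) = (\<lambda>i. n i - l i)" by auto
    then show ?thesis
      using W_comp[OF degree_diff[OF lm] centered_polys[OF polys.mult[OF k descent_polys]]
        degree_diff[OF mn] centered_polys[OF k'] Wt_M[OF v'(1)], of m l l n]
      by (simp only: centered_shift)
  qed
  also have "(\<lambda>z. turn (\<lambda>i. n i - m i) (\<lambda>i. m i - l i) z * centered l k' z * centered l (\<lambda>x. k x * descent l n x) z) =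
     centered l (\<lambda>x. (k x * k' x * crossing l m n x) * (descent l m x * descent m n x))"
  proof
    fix z
    have "turn (\<lambda>i. n i - m i) (\<lambda>i. m i - l i) z = turn (\<lambda>i. n i - m i) (\<lambda>i. m i - l i) (plus_int (\<lambda>i. z i - of_int (l i)) l)"
      by simp
    then show "turn (\<lambda>i. n i - m i) (\<lambda>i. m i - l i) z * centered l k' z * centered l (\<lambda>x. k x * descent l n x) z =
      centered l (\<lambda>x. (k x * k' x * crossing l m n x) * (descent l m x * descent m n x)) z"
      using descent_turn[of m n "\<lambda>i. z i - of_int (l i)" l] by (simp add: centered_def mult_ac)
  qed
  also have "W (\<lambda>i. n i - l i) (centered l (\<lambda>x. (k x * k' x * crossing l m n x) * (descent l m x * descent m n x))) v' =
      Theta l n (\<lambda>x. k x * k' x * crossing l m n x) (W (\<lambda>_. 0) (centered l (\<lambda>x. descent l n x * (descent l m x * descent m n x))) v')"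
    using lm mn by (intro Theta_on[symmetric] polys_intros k k' p v') simp
  also have "(\<lambda>x. descent l n x * (descent l m x * descent m n x)) = (\<lambda>x. descent l m x * (descent l n x * descent m n x))"
    by (simp add: mult_ac)
  finally show ?thesis unfolding v'(2) .
qed

lemma Theta_id:
  assumes "v \<in> Wt l" shows "Theta l l (\<lambda>x. 1) v = v"
  using Theta_on1[OF refl polys.const assms, of 1] Wt_M[OF assms] W_const[of v 1]
  by (simp add: centered_def[abs_def])

lemma Theta_add:
  assumes "degree l = degree m" "k \<in> polys" "v \<in> Wt l" "w \<in> Wt l"
  shows "Theta l m k (v + w) = Theta l m k v + Theta l m k w"
proof -
  obtain v' w' where v': "v' \<in> Wt l" "v = W (\<lambda>_. 0) (centered l (descent l m)) v'"
    and w': "w' \<in> Wt l" "w = W (\<lambda>_. 0) (centered l (descent l m)) w'"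
    using ex_descent_preimage[OF assms(3)] ex_descent_preimage[OF assms(4)] by blast
  have "v + w = W (\<lambda>_. 0) (centered l (descent l m)) (v' + w')"
    unfolding v' w' by (rule W_add[symmetric]) (use v' w' Wt_M in \<open>auto intro!: centered_polys descent_polys\<close>)
  moreover have "v' + w' \<in> Wt l" using v' w' subspace_add[OF subspace_weight_space] by blast
  ultimately show ?thesis
    unfolding v'(2) w'(2) using v'(1) w'(1)
    by (simp add: Theta_on1 assms W_add degree_diff centered_polys Wt_M)
qed

lemma Theta_scale:
  assumes "degree l = degree m" "k \<in> polys" "v \<in> Wt l"
  shows "Theta l m k (scale c v) = scale c (Theta l m k v)" "Theta l m (\<lambda>x. c * k x) v = scale c (Theta l m k v)"
proof -
  obtain v' where v': "v' \<in> Wt l" "v = W (\<lambda>_. 0) (centered l (descent l m)) v'"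
    using ex_descent_preimage[OF assms(3)] by blast
  have "scale c v = W (\<lambda>_. 0) (centered l (descent l m)) (scale c v')"
    unfolding v' by (rule W_scale(1)[symmetric]) (use v' Wt_M in \<open>auto intro!: centered_polys descent_polys\<close>)
  moreover have "scale c v' \<in> Wt l" using v' subspace_scale[OF subspace_weight_space] by blast
  ultimately show "Theta l m k (scale c v) = scale c (Theta l m k v)"
    unfolding v'(2) using v'(1) by (simp add: Theta_on1 assms W_scale degree_diff centered_polys Wt_M)
  have "centered l (\<lambda>x. c * k x) = (\<lambda>z. c * centered l k z)" by (auto simp: centered_def)
  then show "Theta l m (\<lambda>x. c * k x) v = scale c (Theta l m k v)"
    unfolding v'(2) using v'(1) assms
    by (simp add: Theta_on1 W_scale degree_diff centered_polys Wt_M polys.mult polys.const)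
qed

lemma Theta_plus:
  assumes "degree l = degree m" "k \<in> polys" "k' \<in> polys" "v \<in> Wt l"
  shows "Theta l m (\<lambda>x. k x + k' x) v = Theta l m k v + Theta l m k' v"
proof -
  obtain v' where v': "v' \<in> Wt l" "v = W (\<lambda>_. 0) (centered l (descent l m)) v'"
    using ex_descent_preimage[OF assms(4)] by blast
  have "centered l (\<lambda>x. k x + k' x) = (\<lambda>z. centered l k z + centered l k' z)" by (auto simp: centered_def)
  then show ?thesis
    unfolding v'(2) using v'(1) assms
    by (simp add: Theta_on1 W_plus degree_diff centered_polys Wt_M polys.add)
qed

text \<open>Expresses the plain shifts by the normalized ones. Compatibility with the algebra can
  thus be tested on \<open>Theta\<close>, and the same formula dictates the matrix entries of the
  module built from a representation.\<close>

lemma W_Theta: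
  assumes "degree l = degree m" "k \<in> polys" "v \<in> Wt l"
  shows "W (\<lambda>i. m i - l i) k v = Theta l m (\<lambda>x. k (plus_int x l) * descent l m x) v"
proof -
  obtain v' where v': "v' \<in> Wt l" "v = W (\<lambda>_. 0) (centered l (descent l m)) v'"
    using ex_descent_preimage[OF assms(3)] by blast
  have "(\<lambda>z. k z * centered l (descent l m) z) = centered l (\<lambda>x. k (plus_int x l) * descent l m x)"
    by (simp add: centered_def fun_eq_iff)
  moreover have "W (\<lambda>i. m i - l i) k v = W (\<lambda>i. m i - l i) (\<lambda>z. k z * centered l (descent l m) z) v'"
    unfolding v'(2) by (rule W_comp0) (use v' assms Wt_M in \<open>auto intro!: degree_diff centered_polys descent_polys\<close>)
  moreover have "Theta l m (\<lambda>x. k (plus_int x l) * descent l m x) v = W (\<lambda>i. m i - l i) (centered l (\<lambda>x. k (plus_int x l) * descent l m x)) v'"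
    unfolding v'(2) by (rule Theta_on1[OF assms(1) _ v'(1)]) (intro polys.mult polys_shift assms descent_polys)
  ultimately show ?thesis by simp
qed

text \<open>Each vector of a finite basis is killed by some power; the sum of these exponents works
  for the whole weight space and all coordinates.\<close>

lemma Theta_nilpotent: "\<exists>N. \<forall>v\<in>Wt l. \<forall>i. Theta l l (\<lambda>x. x i ^ N) v = 0"
proof -
  have p: "(\<lambda>x :: 'i \<Rightarrow> complex. x i ^ N) \<in> polys" for i N by (intro polys_intros)
  have c: "centered l (\<lambda>x. x i ^ N) = (\<lambda>z. (z i - of_int (l i)) ^ N)" for i N by (auto simp: centered_def)
  have c1: "W (\<lambda>_. 0) (centered l (\<lambda>x. 1)) v = v" if "v \<in> Wt l" for v
    using W_const[OF Wt_M[OF that], of 1] by (simp add: centered_def[abs_def])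
  have T: "Theta l l (\<lambda>x. x i ^ N) v = W (\<lambda>_. 0) (\<lambda>z. (z i - of_int (l i)) ^ N) v" if "v \<in> Wt l" for i N v
  proof -
    have "descent l l = (\<lambda>x. 1)" by auto
    then show ?thesis using Theta_on1[OF refl p that, of i N] c1[OF that] by (simp add: c)
  qed
  obtain B where B: "B \<subseteq> Wt l" "finite B" "span B = Wt l"
    using finite_dimensional_basis[OF weight_space_finite subspace_weight_space] by metis
  have "\<forall>b\<in>B. \<exists>N. \<forall>i. W (\<lambda>_. 0) (\<lambda>z. (z i - of_int (l i)) ^ N) b = 0"
    using B(1) unfolding subset_eq weight_space_iff by blast
  then obtain N where N: "\<And>b i. b \<in> B \<Longrightarrow> W (\<lambda>_. 0) (\<lambda>z. (z i - of_int (l i)) ^ N b) b = 0" by metis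
  define K where "K = (\<Sum>b\<in>B. N b)"
  have K: "W (\<lambda>_. 0) (\<lambda>z. (z i - of_int (l i)) ^ K) b = 0" if "b \<in> B" for b i
    using that B(1,2) Wt_M by (intro weight_power_mono[OF _ _ N[OF that]]) (auto simp: K_def intro: member_le_sum)
  have pw: "(\<lambda>z :: 'i \<Rightarrow> complex. (z i - of_int (l i)) ^ K) \<in> polys" for i by (intro polys_intros)
  have "v \<in> Wt l \<and> (\<forall>i. W (\<lambda>_. 0) (\<lambda>z. (z i - of_int (l i)) ^ K) v = 0)" if "v \<in> span B" for v
    using that
  proof (induction rule: span_induct_alt)
    case base
    then show ?case using subspace_0[OF subspace_weight_space] W_zero[OF _ pw] by simp
  next
    case (step c b v)
    then have b: "b \<in> Wt l" using B by auto
    then have "scale c b \<in> Wt l" using subspace_scale[OF subspace_weight_space] by blast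
    then show ?case
      using step b K[OF step(1)] subspace_add[OF subspace_weight_space, of "scale c b"] pw
      by (auto simp: W_add W_scale Wt_M)
  qed
  then show ?thesis using T B(3) by (intro exI[of _ K]) auto
qed

lemma act_sum:
  assumes "finite S" "\<And>\<alpha>. \<alpha> \<in> S \<Longrightarrow> balanced \<alpha> \<and> K \<alpha> \<in> polys" "v \<in> M"
  shows "act (\<lambda>p. \<Sum>\<alpha>\<in>S. wop \<alpha> (K \<alpha>) p) v = (\<Sum>\<alpha>\<in>S. W \<alpha> (K \<alpha>) v) \<and> (\<lambda>p. \<Sum>\<alpha>\<in>S. wop \<alpha> (K \<alpha>) p) \<in> carrier weyl_centralizer"
  using assms(1,2)
proof (induction S rule: finite_induct)
  case empty
  have "(\<lambda>p :: 'i mpoly. 0) = wop (\<lambda>_. 0) (\<lambda>z. 0)" by (simp add: wop_def fun_eq_iff)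
  then show ?case using W_const[OF assms(3), of 0] wop_centralizer[OF polys.const, of "\<lambda>_ :: 'i. 0" 0] by (simp add: W_def)
next
  case (insert \<alpha> S)
  let ?s = "\<lambda>p. \<Sum>\<alpha>\<in>S. wop \<alpha> (K \<alpha>) p"
  have c: "?s \<in> carrier weyl_centralizer" "wop \<alpha> (K \<alpha>) \<in> carrier weyl_centralizer"
    using insert wop_centralizer by auto
  have e: "(\<lambda>p. \<Sum>\<alpha>\<in>insert \<alpha> S. wop \<alpha> (K \<alpha>) p) = wop \<alpha> (K \<alpha>) \<oplus>\<^bsub>weyl_centralizer\<^esub> ?s"
    using insert.hyps by (simp add: weyl_centralizer_def)
  have "act (wop \<alpha> (K \<alpha>) \<oplus>\<^bsub>weyl_centralizer\<^esub> ?s) v = act (wop \<alpha> (K \<alpha>)) v + act ?s v"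
    using module c assms(3) by (simp add: left_module_def)
  moreover have "wop \<alpha> (K \<alpha>) \<oplus>\<^bsub>weyl_centralizer\<^esub> ?s \<in> carrier weyl_centralizer"
  proof -
    have lin: "lin_op (euler_op :: 'i operator)" by (simp add: euler_op_wop lin_op_wop)
    show ?thesis
      using c lin by (auto simp: weyl_centralizer_def fun_eq_iff lin_op_def intro!: weyl_ops.add)
  qed
  ultimately show ?case unfolding e using insert by (simp add: W_def)
qed

lemma act_expand:
  assumes "d \<in> carrier weyl_centralizer" "v \<in> M"
  shows "act d v = (\<Sum>\<alpha>\<in>{\<alpha>. kernel d \<alpha> \<noteq> (\<lambda>z. 0)}. W \<alpha> (kernel d \<alpha>) v)"
proof -
  have k: "has_kernel d (kernel d)" using assms kernel_weyl by (auto simp: weyl_centralizer_def)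
  have "act (\<lambda>p. \<Sum>\<alpha>\<in>{\<alpha>. kernel d \<alpha> \<noteq> (\<lambda>z. 0)}. wop \<alpha> (kernel d \<alpha>) p) v = (\<Sum>\<alpha>\<in>{\<alpha>. kernel d \<alpha> \<noteq> (\<lambda>z. 0)}. W \<alpha> (kernel d \<alpha>) v)"
    by (rule act_sum[OF _ _ assms(2), THEN conjunct1])
      (use k kernel_centralizer[OF assms(1)] in \<open>auto simp: has_kernel_def\<close>)
  then show ?thesis using weyl_expand[OF k] by simp
qed

end

section \<open>Colored quivers\<close>

text \<open>An arrow may carry several colors, with multiplicity; \<open>\<nu> u\<close> is the type of the weights that
  the vertex \<open>u\<close> stands for.\<close>

locale colored_quiver = quiver_relations Q R
  for Q :: "('v, 'e) quiver" and R +
  fixes col :: "'e \<Rightarrow> 'i::finite multiset" and \<nu> :: "'v \<Rightarrow> 'i set"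
  assumes inj_\<nu>: "inj_on \<nu> (verts Q)"
    and col_parity: "e \<in> arcs Q \<Longrightarrow> odd (count (col e) i) \<longleftrightarrow> (i \<in> \<nu> (tail Q e)) \<noteq> (i \<in> \<nu> (head Q e))"
    and col_nonempty: "e \<in> arcs Q \<Longrightarrow> col e \<noteq> {#}"
    and direct_path: "u \<in> verts Q \<Longrightarrow> v \<in> verts Q \<Longrightarrow> \<exists>es. (u, es) \<in> paths Q \<and> path_end Q (u, es) = v \<and>
       sum_list (map col es) = mset_set (sym_diff (\<nu> u) (\<nu> v))"
    and loop_path: "u \<in> verts Q \<Longrightarrow> \<exists>es. (u, es) \<in> paths Q \<and> path_end Q (u, es) = u \<and> sum_list (map col es) = {#i, i#}"
    and relation_colors: "(p, q) \<in> R \<Longrightarrow> fst p = fst q \<and> path_end Q p = path_end Q q \<and>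
       sum_list (map col (snd p)) = sum_list (map col (snd q))"
    and color_class: "(u, es) \<in> paths Q \<Longrightarrow> (u, fs) \<in> paths Q \<Longrightarrow> path_end Q (u, es) = path_end Q (u, fs) \<Longrightarrow>
       sum_list (map col es) = sum_list (map col fs) \<Longrightarrow> path_class Q R (path_elt (u, es)) = path_class Q R (path_elt (u, fs))"
begin

abbreviation cols :: "'e list \<Rightarrow> 'i multiset" where
  "cols es \<equiv> sum_list (map col es)"

text \<open>Parities add along a path, and so do the changes of type. The parity of the content is
  therefore a function of the ends.\<close>

lemma cols_parity:
  "(u, es) \<in> paths Q \<Longrightarrow> odd (count (cols es) i) \<longleftrightarrow> (i \<in> \<nu> u) \<noteq> (i \<in> \<nu> (path_end Q (u, es)))"
proof (induction es arbitrary: u)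
  case (Cons e es)
  then have e: "e \<in> arcs Q" "tail Q e = u" "(head Q e, es) \<in> paths Q" by (auto simp: Cons_in_paths)
  have "odd (count (cols (e # es)) i) \<longleftrightarrow> odd (count (col e) i) \<noteq> odd (count (cols es) i)" by simp
  then show ?case using col_parity[OF e(1), of i] Cons.IH[OF e(3)] e(2) unfolding path_end_Cons by blast
qed simp

text \<open>Converts the length bound in the definition of nilpotent representations into a bound on
  colors.\<close>

lemma size_cols: "(u, es) \<in> paths Q \<Longrightarrow> length es \<le> size (cols es)"
proof (induction es arbitrary: u)
  case (Cons e es)
  then have "size (col e) \<ge> 1" using col_nonempty[of e] by (simp add: Cons_in_paths Suc_leI nonempty_has_size)
  moreover have "length es \<le> size (cols es)" using Cons by (auto simp: Cons_in_paths)
  ultimately show ?case by simp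
qed simp

end

text \<open>A color of odd multiplicity is used once for the change of type between the ends, which
  \<open>div\<close> discards; each remaining pair of equal colors is one factor
  \<open>x i\<close>.\<close>

definition half :: "'i::finite multiset \<Rightarrow> ('i \<Rightarrow> complex) \<Rightarrow> complex" where
  "half c x = (\<Prod>i\<in>UNIV. x i ^ (count c i div 2))"

lemma half_polys: "half c \<in> polys"
  unfolding half_def by (intro polys_intros)

text \<open>The last product is the carry of adding two odd numbers before halving;
  \<open>crossing_cols\<close> identifies it with a crossing.\<close>

lemma half_add:
  "half (c + d) x = half c x * half d x * (\<Prod>i\<in>UNIV. if odd (count c i) \<and> odd (count d i) then x i else 1)"
proof -
  have "(m + n) div 2 = m div 2 + n div 2 + (if odd m \<and> odd n then 1 else 0)" for m n :: nat
    by (auto elim!: oddE evenE)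
  then show ?thesis
    unfolding half_def prod.distrib[symmetric] by (intro prod.cong refl) (auto simp: power_add)
qed

lemma half_empty [simp]: "half {#} x = 1"
  by (simp add: half_def)

lemma half_ge:
  assumes "K \<le> count c i div 2" shows "\<exists>g\<in>polys. half c = (\<lambda>x. x i ^ K * g x)"
proof -
  let ?g = "\<lambda>x :: 'a \<Rightarrow> complex. x i ^ (count c i div 2 - K) * (\<Prod>j\<in>UNIV - {i}. x j ^ (count c j div 2))"
  have "half c = (\<lambda>x. x i ^ K * ?g x)"
    using assms by (simp add: half_def fun_eq_iff prod.remove[of UNIV i] mult.assoc[symmetric] power_add[symmetric])
  then show ?thesis by (intro bexI[of _ ?g]) (assumption, intro polys_intros)
qed

lemma size_count_bound:
  fixes c :: "'i::finite multiset"
  assumes "\<And>i. count c i \<le> K" shows "size c \<le> CARD('i) * K"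
proof -
  have "size c = (\<Sum>i\<in>set_mset c. count c i)" by (simp add: size_multiset_overloaded_eq)
  also have "\<dots> \<le> (\<Sum>i\<in>UNIV. count c i)" by (rule sum_mono2) auto
  also have "\<dots> \<le> (\<Sum>i\<in>(UNIV :: 'i set). K)" by (rule sum_mono) (rule assms)
  finally show ?thesis by simp
qed

locale weight_quiver = colored_quiver Q R col \<nu> + quiver_modules Q R scale + complex_vector_space scale
  for Q :: "('v, 'e) quiver" and R and col :: "'e \<Rightarrow> 'i::finite multiset" and \<nu> :: "'v \<Rightarrow> 'i set"
    and scale :: "complex \<Rightarrow> 'u \<Rightarrow> 'u::ab_group_add" +
  fixes a :: int and lam :: "'v \<Rightarrow> 'i \<Rightarrow> int"
  assumes lam_degree: "u \<in> verts Q \<Longrightarrow> (\<Sum>i\<in>UNIV. lam u i) = a"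
    and lam_type: "u \<in> verts Q \<Longrightarrow> {i. 0 \<le> lam u i} = \<nu> u"
    and ex_type: "(\<Sum>i\<in>UNIV. l i) = a \<Longrightarrow> \<exists>u\<in>verts Q. \<nu> u = {i. 0 \<le> l i}"
begin

lemma inj_lam: "inj_on lam (verts Q)"
proof (rule inj_onI)
  fix u v assume "u \<in> verts Q" "v \<in> verts Q" "lam u = lam v"
  moreover from this have "\<nu> u = \<nu> v" using lam_type[of u] lam_type[of v] by simp
  ultimately show "u = v" using inj_onD[OF inj_\<nu>] by blast
qed

text \<open>By \<open>cols_parity\<close> both multiplicities are odd iff coordinate
  \<open>i\<close> changes its sign on the first path and changes it back on the second, which is
  the criterion of \<open>crossing_iff\<close>.\<close>

lemma crossing_cols:
  assumes "(u, es) \<in> paths Q" "(path_end Q (u, es), fs) \<in> paths Q"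
  shows "half (cols (es @ fs)) x = half (cols es) x * half (cols fs) x *
    crossing (lam u) (lam (path_end Q (u, es))) (lam (path_end Q (u, es @ fs))) x"
proof -
  let ?v = "path_end Q (u, es)" and ?w = "path_end Q (u, es @ fs)"
  have V: "u \<in> verts Q" "?v \<in> verts Q" "?w \<in> verts Q"
    using assms path_verts paths_append by auto
  have lam: "0 \<le> lam y i \<longleftrightarrow> i \<in> \<nu> y" if "y \<in> verts Q" for y i using lam_type[OF that] by auto
  have w: "path_end Q (?v, fs) = ?w" by (simp add: path_end_append)
  have "(odd (count (cols es) i) \<and> odd (count (cols fs) i)) \<longleftrightarrow> 0 \<in> overshoot (lam u i) (lam ?v i) (lam ?w i)" for i
    unfolding crossing_iff cols_parity[OF assms(1)] cols_parity[OF assms(2), unfolded w] lam[OF V(1)] lam[OF V(2)] lam[OF V(3)]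
    by blast
  then show ?thesis by (simp add: half_add crossing_def)
qed

text \<open>The sum of the chosen weight spaces, described by the vanishing of all other components.
  The projections take \<open>M\<close> and \<open>act\<close> as arguments because the functor is
  defined before a particular weight module is fixed.\<close>

definition FV :: "'u set \<Rightarrow> ('i operator \<Rightarrow> 'u \<Rightarrow> 'u) \<Rightarrow> 'u set" where
  "FV M act = {m \<in> M. \<forall>l. weight_module.proj scale M act l m \<noteq> 0 \<longrightarrow> l \<in> lam ` verts Q}"

definition path_op :: "'u set \<Rightarrow> ('i operator \<Rightarrow> 'u \<Rightarrow> 'u) \<Rightarrow> ('v, 'e) path \<Rightarrow> 'u \<Rightarrow> 'u" where
  "path_op M act p m = weight_module.Theta scale M act (lam (fst p)) (lam (path_end Q p)) (half (cols (snd p)))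
     (weight_module.proj scale M act (lam (fst p)) m)"

text \<open>The path operators determine how the quotient algebra acts; a module structure with
  these operators exists by \<open>ex_Fact\<close> and is picked by choice.\<close>

definition Fact :: "'u set \<Rightarrow> ('i operator \<Rightarrow> 'u \<Rightarrow> 'u) \<Rightarrow> (('v, 'e) path \<Rightarrow> complex) set \<Rightarrow> 'u \<Rightarrow> 'u" where
  "Fact M act = (SOME act'. left_module scale QA (FV M act, act') \<and>
     (\<forall>p\<in>paths Q. \<forall>m\<in>FV M act. act' (cl (path_elt p)) m = path_op M act p m))"

definition F :: "('i operator, 'u) module_obj \<Rightarrow> ((('v, 'e) path \<Rightarrow> complex) set, 'u) module_obj" where
  "F X = (FV (fst X) (snd X), Fact (fst X) (snd X))"

end

locale weight_module_quiver = weight_quiver Q R col \<nu> scale a lam + weight_module scale M act a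
  for Q :: "('v, 'e) quiver" and R and col :: "'e \<Rightarrow> 'i::finite multiset" and \<nu> :: "'v \<Rightarrow> 'i set"
    and scale :: "complex \<Rightarrow> 'u \<Rightarrow> 'u::ab_group_add" and a lam M and act :: "'i operator \<Rightarrow> 'u \<Rightarrow> 'u"
begin

abbreviation "V \<equiv> FV M act"
abbreviation "\<rho> \<equiv> path_op M act"

lemma V_M: "m \<in> V \<Longrightarrow> m \<in> M"
  by (simp add: FV_def)

lemma Wt_V: "u \<in> verts Q \<Longrightarrow> m \<in> Wt (lam u) \<Longrightarrow> m \<in> V"
  using Wt_M by (auto simp: FV_def proj_weight split: if_splits)

lemma V_sum: "m \<in> V \<Longrightarrow> (\<Sum>u\<in>verts Q. proj (lam u) m) = m"
  using proj_sum_superset[of m "lam ` verts Q"] finite_verts inj_lam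
  by (auto simp: FV_def sum.reindex)

lemma subspace_V: "subspace V"
proof (rule subspaceI)
  have "proj l 0 = 0" for l using proj_scale[of 0 l 0] subspace_0[OF subspace_M] by simp
  then show "0 \<in> V" using subspace_0[OF subspace_M] by (simp add: FV_def)
  show "x + y \<in> V" if x: "x \<in> V" and y: "y \<in> V" for x y
  proof -
    have "l \<in> lam ` verts Q" if "proj l (x + y) \<noteq> 0" for l
    proof -
      have "proj l x \<noteq> 0 \<or> proj l y \<noteq> 0" using that proj_add[OF V_M[OF x] V_M[OF y], of l] by auto
      then show ?thesis using x y by (auto simp: FV_def)
    qed
    then show ?thesis using subspace_add[OF subspace_M V_M[OF x] V_M[OF y]] by (simp add: FV_def)
  qed
  show "scale c x \<in> V" if x: "x \<in> V" for c x
    using x subspace_scale[OF subspace_M V_M[OF x], of c] proj_scale[OF V_M[OF x]] by (simp add: FV_def)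
qed

lemma degree_lam: "u \<in> verts Q \<Longrightarrow> v \<in> verts Q \<Longrightarrow> degree (lam u) = degree (lam v)"
  by (simp add: lam_degree)

lemma path_op_Wt: "p \<in> paths Q \<Longrightarrow> m \<in> V \<Longrightarrow> \<rho> p m \<in> Wt (lam (path_end Q p))"
  unfolding path_op_def using path_verts[of "fst p" "snd p"]
  by (intro Theta_Wt degree_lam half_polys proj_Wt V_M) auto

lemma Theta_0: "degree l = degree m \<Longrightarrow> k \<in> polys \<Longrightarrow> Theta l m k 0 = 0"
  using Theta_scale(1)[of l m k 0 0] subspace_0[OF subspace_weight_space] by simp

text \<open>If the vertices match, the composite of the two normalized shifts gains the crossing
  that concatenation adds to \<open>half\<close>; otherwise the projection to a different weight
  gives zero.\<close>

lemma path_op_mult: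
  assumes p: "(u, es) \<in> paths Q" "(v, fs) \<in> paths Q" "m \<in> V"
  shows "\<rho> (v, fs) (\<rho> (u, es) m) = (if v = path_end Q (u, es) then \<rho> (u, es @ fs) m else 0)"
proof -
  have W: "\<rho> (u, es) m \<in> Wt (lam (path_end Q (u, es)))" by (rule path_op_Wt[OF p(1,3)])
  have V: "u \<in> verts Q" "v \<in> verts Q" "path_end Q (u, es) \<in> verts Q" "path_end Q (v, fs) \<in> verts Q" using path_verts[OF p(1)] path_verts[OF p(2)] by auto
  have m: "proj (lam u) m \<in> Wt (lam u)" by (rule proj_Wt[OF V_M[OF p(3)]])
  show ?thesis
  proof (cases "v = path_end Q (u, es)")
    case True
    have "\<rho> (v, fs) (\<rho> (u, es) m) = Theta (lam v) (lam (path_end Q (v, fs))) (half (cols fs)) (\<rho> (u, es) m)"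
      unfolding path_op_def[of M act "(v, fs)"] fst_conv snd_conv
      using proj_weight[OF W, of "lam v"] True by (simp only: simp_thms if_True)
    also have "\<dots> = Theta (lam v) (lam (path_end Q (v, fs))) (half (cols fs)) (Theta (lam u) (lam v) (half (cols es)) (proj (lam u) m))"
      by (simp only: True path_op_def[of M act "(u, es)"] fst_conv snd_conv)
    also have "\<dots> = Theta (lam u) (lam (path_end Q (v, fs)))
        (\<lambda>x. half (cols es) x * half (cols fs) x * crossing (lam u) (lam v) (lam (path_end Q (v, fs))) x) (proj (lam u) m)"
      by (rule Theta_comp[OF degree_lam[OF V(1,2)] degree_lam[OF V(2,4)] half_polys half_polys m])
    also have "\<dots> = \<rho> (u, es @ fs) m"
    proof -
      have "half (cols (es @ fs)) = (\<lambda>x. half (cols es) x * half (cols fs) x * crossing (lam u) (lam v) (lam (path_end Q (v, fs))) x)"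
        by (rule HOL.ext, unfold True path_end_append[symmetric])
          (rule crossing_cols[OF p(1) p(2)[unfolded True]])
      then show ?thesis by (simp only: True path_op_def[of M act "(u, es @ fs)"] path_end_append fst_conv snd_conv)
    qed
    finally show ?thesis using True by simp
  next
    case False
    then have "lam v \<noteq> lam (path_end Q (u, es))" using inj_onD[OF inj_lam _ V(2,3)] by blast
    then have "proj (lam v) (\<rho> (u, es) m) = 0" using proj_weight[OF W, of "lam v"] by simp
    then show ?thesis using False V by (simp add: path_op_def[of M act "(v, fs)"] Theta_0 lam_degree half_polys)
  qed
qed

lemma path_op_Nil: "u \<in> verts Q \<Longrightarrow> m \<in> V \<Longrightarrow> \<rho> (u, []) m = proj (lam u) m"
  using Theta_id[OF proj_Wt[OF V_M]] by (simp add: path_op_def half_empty[abs_def])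

lemma ex_Fact: "\<exists>act'. left_module scale QA (V, act') \<and> (\<forall>p\<in>paths Q. \<forall>m\<in>V. act' (cl (path_elt p)) m = \<rho> p m)"
proof (rule QA_module_of_paths[OF subspace_V])
  show "\<rho> p m \<in> V" if "p \<in> paths Q" "m \<in> V" for p m
    using path_op_Wt[OF that] path_verts[of "fst p" "snd p"] that by (intro Wt_V) auto
  show "\<rho> p (m + m') = \<rho> p m + \<rho> p m'" if "p \<in> paths Q" "m \<in> V" "m' \<in> V" for p m m'
    unfolding path_op_def using that path_verts[of "fst p" "snd p"]
    by (simp add: proj_add V_M Theta_add lam_degree half_polys proj_Wt)
  show "\<rho> p (scale c m) = scale c (\<rho> p m)" if "p \<in> paths Q" "m \<in> V" for p c m
    unfolding path_op_def using that path_verts[of "fst p" "snd p"]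
    by (simp add: proj_scale V_M Theta_scale lam_degree half_polys proj_Wt)
  show "(\<Sum>u\<in>verts Q. \<rho> (u, []) m) = m" if "m \<in> V" for m
    using V_sum[OF that] that by (simp add: path_op_Nil)
  show "\<rho> p m = \<rho> q m" if "(p, q) \<in> R" for p q m
    unfolding path_op_def using relation_colors[OF that] by simp
qed (rule path_op_mult)

lemma F_module: "left_module scale QA (V, Fact M act)"
  and Fact_path: "p \<in> paths Q \<Longrightarrow> m \<in> V \<Longrightarrow> Fact M act (cl (path_elt p)) m = \<rho> p m"
  using someI_ex[OF ex_Fact] unfolding Fact_def by blast+

lemma V_finite_dimensional: "finite_dimensional scale V"
proof -
  have "\<exists>B. finite B \<and> Wt (lam u) \<subseteq> span B" for u
    using weight_space_finite by (auto simp: finite_dimensional_def)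
  then obtain B where B: "\<And>u. finite (B u)" "\<And>u. Wt (lam u) \<subseteq> span (B u)" by metis
  have "V \<subseteq> span (\<Union>u\<in>verts Q. B u)"
  proof
    fix m assume m: "m \<in> V"
    have "proj (lam u) m \<in> span (\<Union>u\<in>verts Q. B u)" if "u \<in> verts Q" for u
      using B(2)[of u] proj_Wt[OF V_M[OF m], of "lam u"] span_mono[of "B u" "\<Union>u\<in>verts Q. B u"] that by blast
    then have "(\<Sum>u\<in>verts Q. proj (lam u) m) \<in> span (\<Union>u\<in>verts Q. B u)" by (rule span_sum)
    then show "m \<in> span (\<Union>u\<in>verts Q. B u)" by (simp add: V_sum m)
  qed
  then show ?thesis
    unfolding finite_dimensional_def using B finite_verts by (intro exI[of _ "\<Union>u\<in>verts Q. B u"]) auto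
qed

lemma path_op_nilpotent: "\<exists>N. \<forall>p\<in>paths Q. N \<le> length (snd p) \<longrightarrow> (\<forall>m\<in>V. \<rho> p m = 0)"
proof -
  have "\<forall>u. \<exists>N. \<forall>v\<in>Wt (lam u). \<forall>i. Theta (lam u) (lam u) (\<lambda>x. x i ^ N) v = 0" using Theta_nilpotent by blast
  then obtain N where N: "\<And>u v i. v \<in> Wt (lam u) \<Longrightarrow> Theta (lam u) (lam u) (\<lambda>x. x i ^ N u) v = 0" by metis
  define K where "K = (\<Sum>u\<in>verts Q. N u)"
  \<comment> \<open>If all multiplicities were at most \<open>2 * K\<close>, the content would have
    size at most \<open>CARD('i) * (2 * K)\<close>. A longer path repeats some color often enough
    for \<open>half\<close> to contain a power \<open>x i ^ N\<close> that vanishes.\<close>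
  have "\<rho> p m = 0" if p: "p \<in> paths Q" and len: "CARD('i) * (2 * K) + 1 \<le> length (snd p)" and m: "m \<in> V" for p m
  proof -
    let ?u = "fst p" and ?c = "cols (snd p)"
    have u: "?u \<in> verts Q" "path_end Q p \<in> verts Q" using path_verts[of "fst p" "snd p"] p by auto
    have "\<not> size ?c \<le> CARD('i) * (2 * K)" using size_cols[of "fst p" "snd p"] p len by simp
    then obtain i where "\<not> count ?c i \<le> 2 * K" using size_count_bound[of ?c "2 * K"] by blast
    moreover have "N ?u \<le> K" unfolding K_def using u finite_verts by (intro member_le_sum) auto
    ultimately have "N ?u \<le> count ?c i div 2" by simp
    then obtain g where g: "g \<in> polys" "half ?c = (\<lambda>x. x i ^ N ?u * g x)" using half_ge by blast
    \<comment> \<open>The factor \<open>crossing\<close> with equal first weights is 1; inserting it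
      produces the shape of \<open>Theta_comp\<close>.\<close>
    have "\<rho> p m = Theta (lam ?u) (lam (path_end Q p)) (\<lambda>x. x i ^ N ?u * g x * crossing (lam ?u) (lam ?u) (lam (path_end Q p)) x) (proj (lam ?u) m)"
      by (simp add: path_op_def g)
    also have "\<dots> = Theta (lam ?u) (lam (path_end Q p)) g (Theta (lam ?u) (lam ?u) (\<lambda>x. x i ^ N ?u) (proj (lam ?u) m))"
      using u by (intro Theta_comp[symmetric] degree_lam g proj_Wt V_M m polys_power polys.var)
    also have "\<dots> = 0" using u g by (simp add: N proj_Wt V_M m Theta_0 lam_degree)
    finally show ?thesis .
  qed
  then show ?thesis by blast
qed

lemma F_object: "(V, Fact M act) \<in> Obj (nilpotent_rep_cat scale Q R)"
  using F_module V_finite_dimensional path_op_nilpotent Fact_path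
  by (fastforce simp: nilpotent_rep_cat_def module_cat_def)

end

section \<open>The functor is fully faithful\<close>

lemma crossing_same_left:
  assumes "{i. 0 \<le> m i} = {i. 0 \<le> l i}" shows "crossing l m n x = 1"
proof -
  have "(0 \<le> m i) = (0 \<le> l i)" for i using assms by auto
  then show ?thesis unfolding crossing_def crossing_iff by (intro prod.neutral) simp
qed

lemma crossing_same_right:
  assumes "{i. 0 \<le> m i} = {i. 0 \<le> n i}" shows "crossing l m n x = 1"
proof -
  have "(0 \<le> m i) = (0 \<le> n i)" for i using assms by auto
  then show ?thesis unfolding crossing_def crossing_iff by (intro prod.neutral) auto
qed

lemma half_direct: "half (mset_set S) x = 1"
  unfolding half_def
proof (intro prod.neutral ballI)
  fix i :: 'a
  show "x i ^ (count (mset_set S) i div 2) = 1" by (cases "i \<in> S") (simp_all add: count_mset_set)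
qed

lemma half_loop: "half {#i, i#} x = x i"
proof -
  have "half {#i, i#} x = (\<Prod>j\<in>UNIV. if j = i then x j else 1)"
    unfolding half_def by (intro prod.cong) auto
  then show ?thesis by simp
qed

context complex_vector_space
begin

lemma additive_sum:
  assumes S: "subspace S" and f: "\<And>x y. x \<in> S \<Longrightarrow> y \<in> S \<Longrightarrow> f (x + y) = f x + (f y :: 'u)"
    and g: "\<And>j. j \<in> A \<Longrightarrow> g j \<in> S"
  shows "f (\<Sum>j\<in>A. g j) = (\<Sum>j\<in>A. f (g j))"
proof -
  have f0: "f 0 = 0" using f[of 0 0] subspace_0[OF S] by simp
  show ?thesis using g
    by (induction A rule: infinite_finite_induct) (auto simp: f0 f subspace_sum[OF S])
qed

end

locale weight_module_pair =
  M: weight_module_quiver Q R col \<nu> scale a lam M act +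
  N: weight_module_quiver Q R col \<nu> scale a lam N act'
  for Q :: "('v, 'e) quiver" and R and col :: "'e \<Rightarrow> 'i::finite multiset" and \<nu> :: "'v \<Rightarrow> 'i set"
    and scale :: "complex \<Rightarrow> 'u \<Rightarrow> 'u::ab_group_add" and a lam M
    and act :: "'i operator \<Rightarrow> 'u \<Rightarrow> 'u" and N and act' :: "'i operator \<Rightarrow> 'u \<Rightarrow> 'u"
begin

abbreviation "fdeg l \<equiv> (\<Sum>i\<in>UNIV. l i :: int)"

context
  fixes f assumes f: "f \<in> left_module_hom weyl_centralizer (M, act) (N, act')"
begin

lemma hom_add: "m \<in> M \<Longrightarrow> m' \<in> M \<Longrightarrow> f (m + m') = f m + f m'"
  and hom_N: "m \<in> M \<Longrightarrow> f m \<in> N"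
  and hom_act: "d \<in> carrier weyl_centralizer \<Longrightarrow> m \<in> M \<Longrightarrow> f (act d m) = act' d (f m)"
  using f by (auto simp: left_module_hom_def)

lemma hom_W: "M.balanced \<alpha> \<Longrightarrow> k \<in> polys \<Longrightarrow> m \<in> M \<Longrightarrow> f (M.W \<alpha> k m) = N.W \<alpha> k (f m)"
  unfolding M.W_def N.W_def by (rule hom_act[OF wop_centralizer])

lemma hom_scale: "m \<in> M \<Longrightarrow> f (scale c m) = scale c (f m)"
  using hom_W[OF _ polys.const, of "\<lambda>_. 0" m c] M.W_const[of m c] N.W_const[OF hom_N, of m c] by simp

lemma hom_0: "f 0 = 0"
  using hom_add[of 0 0] M.subspace_0[OF M.subspace_M] by simp

lemma hom_Wt: "m \<in> M.Wt l \<Longrightarrow> f m \<in> N.Wt l"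
proof -
  have p: "(\<lambda>z :: 'i \<Rightarrow> complex. (z i - c) ^ n) \<in> polys" for i c n by (intro polys_intros)
  assume m: "m \<in> M.Wt l"
  then obtain K where K: "m \<in> M" "K > 0" "\<And>i. M.W (\<lambda>_. 0) (\<lambda>z. (z i - of_int (l i)) ^ K) m = 0"
    by (auto simp: M.weight_space_iff)
  have "N.W (\<lambda>_. 0) (\<lambda>z. (z i - of_int (l i)) ^ K) (f m) = 0" for i
    using hom_W[OF _ p K(1), of "\<lambda>_. 0" i "of_int (l i)" K] K(3) hom_0 by simp
  then show ?thesis using K hom_N by (auto simp: N.weight_space_iff)
qed

lemma hom_proj:
  assumes m: "m \<in> M" shows "f (M.proj l m) = N.proj l (f m)"
proof -
  let ?S = "{l. M.proj l m \<noteq> 0}"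
  have "f m = f (\<Sum>l\<in>?S. M.proj l m)" using arg_cong[OF M.proj_sum[OF m], of f] .
  also have "\<dots> = (\<Sum>l\<in>?S. f (M.proj l m))"
    by (rule M.additive_sum[OF M.subspace_M]) (auto simp: hom_add intro: M.Wt_M[OF M.proj_Wt[OF m]])
  finally have "N.proj l (f m) = (if l \<in> ?S then f (M.proj l m) else 0)"
    using N.proj_of_sum[OF M.proj_finite[OF m], of "\<lambda>l. f (M.proj l m)" l] hom_Wt[OF M.proj_Wt[OF m]] by simp
  then show ?thesis using hom_0 by auto
qed

lemma hom_Theta:
  assumes "fdeg l = fdeg m" "k \<in> polys" "v \<in> M.Wt l"
  shows "f (M.Theta l m k v) = N.Theta l m k (f v)"
proof -
  obtain v' where v': "v' \<in> M.Wt l" "v = M.W (\<lambda>_. 0) (centered l (descent l m)) v'"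
    using M.ex_descent_preimage[OF assms(3)] by blast
  have fv: "f v = N.W (\<lambda>_. 0) (centered l (descent l m)) (f v')"
    unfolding v'(2) by (rule hom_W) (auto intro!: centered_polys descent_polys M.Wt_M[OF v'(1)])
  have "f (M.Theta l m k v) = f (M.W (\<lambda>i. m i - l i) (centered l k) v')"
    unfolding v'(2) by (simp only: M.Theta_on1[OF assms(1,2) v'(1)])
  also have "\<dots> = N.W (\<lambda>i. m i - l i) (centered l k) (f v')"
    by (rule hom_W[OF M.degree_diff[OF assms(1)] centered_polys[OF assms(2)] M.Wt_M[OF v'(1)]])
  also have "\<dots> = N.Theta l m k (f v)"
    unfolding fv by (rule N.Theta_on1[OF assms(1,2) hom_Wt[OF v'(1)], symmetric])
  finally show ?thesis .
qed

lemma hom_V: "m \<in> M.V \<Longrightarrow> f m \<in> N.V"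
  using hom_N[OF M.V_M] hom_proj[OF M.V_M] hom_0 unfolding M.FV_def mem_Collect_eq by metis

lemma hom_path_op:
  assumes p: "p \<in> paths Q" and m: "m \<in> M.V"
  shows "f (M.\<rho> p m) = N.\<rho> p (f m)"
proof -
  have V: "fst p \<in> verts Q" "path_end Q p \<in> verts Q" using M.path_verts[of "fst p" "snd p"] p by auto
  show ?thesis
    unfolding M.path_op_def hom_proj[OF M.V_M[OF m], symmetric]
    by (rule hom_Theta[OF M.degree_lam[OF V] half_polys M.proj_Wt[OF M.V_M[OF m]]])
qed

lemma hom_restrict: "restrict f M.V \<in> left_module_hom M.QA (M.V, M.Fact M act) (N.V, M.Fact N act')"
proof (rule M.QA_module_homI[OF M.F_module N.F_module])
  show "restrict f M.V \<in> M.V \<rightarrow>\<^sub>E N.V" using hom_V by auto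
next
  fix m m' assume "m \<in> M.V" "m' \<in> M.V"
  then show "restrict f M.V (m + m') = restrict f M.V m + restrict f M.V m'"
    using M.subspace_add[OF M.subspace_V] hom_add M.V_M by simp
next
  fix c m assume "m \<in> M.V"
  then show "restrict f M.V (scale c m) = scale c (restrict f M.V m)"
    using M.subspace_scale[OF M.subspace_V] hom_scale M.V_M by simp
next
  fix p m assume p: "p \<in> paths Q" and m: "m \<in> M.V"
  have "M.\<rho> p m \<in> M.V" using M.path_op_Wt[OF p m] M.path_verts[of "fst p" "snd p"] p by (intro M.Wt_V) auto
  then show "restrict f M.V (M.Fact M act (M.cl (path_elt p)) m) = M.Fact N act' (M.cl (path_elt p)) (restrict f M.V m)"
    using m p hom_V[OF m] by (simp add: M.Fact_path N.Fact_path hom_path_op)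
qed

end

text \<open>Elements of the centralizer are sums of weighted shifts, and on a weight space each of
  these is some \<open>Theta\<close> by \<open>W_Theta\<close>. Commutation with
  \<open>Theta\<close> is therefore enough.\<close>

lemma homI:
  assumes add: "\<And>m m'. m \<in> M \<Longrightarrow> m' \<in> M \<Longrightarrow> f (m + m') = f m + f m'"
    and fN: "f \<in> M \<rightarrow>\<^sub>E N"
    and Wt: "\<And>l v. fdeg l = a \<Longrightarrow> v \<in> M.Wt l \<Longrightarrow> f v \<in> N.Wt l"
    and Theta: "\<And>l m k v. fdeg l = a \<Longrightarrow> fdeg m = a \<Longrightarrow> k \<in> polys \<Longrightarrow> v \<in> M.Wt l \<Longrightarrow> f (M.Theta l m k v) = N.Theta l m k (f v)"
  shows "f \<in> left_module_hom weyl_centralizer (M, act) (N, act')"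
proof -
  have f0: "f 0 = 0" using add[of 0 0] M.subspace_0[OF M.subspace_M] by simp
  have fN': "f m \<in> N" if "m \<in> M" for m using fN that by auto
  have W1: "f (M.W \<alpha> k v) = N.W \<alpha> k (f v)" if "M.balanced \<alpha>" "k \<in> polys" "v \<in> M.Wt l" for \<alpha> k v l
  proof (cases "v = 0")
    case True
    then show ?thesis using that by (simp add: f0 M.W_zero N.W_zero)
  next
    case False
    \<comment> \<open>A weight is known to have degree \<open>a\<close> only if its weight space
      contains a nonzero vector, hence the case distinction.\<close>
    then have l: "fdeg l = a" using M.weight_total that by blast
    define m where "m = (\<lambda>i. l i + \<alpha> i)"
    have m: "fdeg m = a" "\<alpha> = (\<lambda>i. m i - l i)" using l that by (auto simp: m_def sum.distrib)
    have lm: "fdeg l = fdeg m" using l m by simp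
    have p: "(\<lambda>x. k (plus_int x l) * descent l m x) \<in> polys" by (intro polys.mult polys_shift that descent_polys)
    show ?thesis
      unfolding m(2) M.W_Theta[OF lm that(2,3)] N.W_Theta[OF lm that(2) Wt[OF l that(3)]]
      by (rule Theta[OF l m(1) p that(3)])
  qed
  have W2: "f (M.W \<alpha> k m) = N.W \<alpha> k (f m)" if b: "M.balanced \<alpha>" and k: "k \<in> polys" and m: "m \<in> M" for \<alpha> k m
  proof -
    let ?S = "{l. M.proj l m \<noteq> 0}"
    have pM: "M.proj l m \<in> M" for l using M.Wt_M[OF M.proj_Wt[OF m]] .
    have "M.W \<alpha> k m = M.W \<alpha> k (\<Sum>l\<in>?S. M.proj l m)" using arg_cong[OF M.proj_sum[OF m]] .
    also have "\<dots> = (\<Sum>l\<in>?S. M.W \<alpha> k (M.proj l m))"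
      by (rule M.additive_sum[OF M.subspace_M]) (auto simp: M.W_add b k pM)
    finally have "f (M.W \<alpha> k m) = f (\<Sum>l\<in>?S. M.W \<alpha> k (M.proj l m))" by simp
    also have "\<dots> = (\<Sum>l\<in>?S. f (M.W \<alpha> k (M.proj l m)))"
      by (rule M.additive_sum[OF M.subspace_M]) (auto simp: add M.W_closed b k pM)
    also have "\<dots> = (\<Sum>l\<in>?S. N.W \<alpha> k (f (M.proj l m)))"
      by (intro sum.cong refl W1[OF b k M.proj_Wt[OF m]])
    also have "\<dots> = N.W \<alpha> k (\<Sum>l\<in>?S. f (M.proj l m))"
      by (rule M.additive_sum[OF N.subspace_M, symmetric]) (auto simp: N.W_add b k pM fN')
    also have "(\<Sum>l\<in>?S. f (M.proj l m)) = f (\<Sum>l\<in>?S. M.proj l m)"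
      by (rule M.additive_sum[OF M.subspace_M, symmetric]) (auto simp: add pM)
    also have "(\<Sum>l\<in>?S. M.proj l m) = m" using M.proj_sum[OF m] by (rule sym)
    finally show ?thesis .
  qed
  have "f (act d m) = act' d (f m)" if d: "d \<in> carrier weyl_centralizer" and m: "m \<in> M" for d m
  proof -
    have k: "has_kernel d (kernel d)" using d kernel_weyl by (auto simp: weyl_centralizer_def)
    then have kp: "kernel d \<alpha> \<in> polys" for \<alpha> by (simp add: has_kernel_def)
    have bal: "M.balanced \<alpha>" if "kernel d \<alpha> \<noteq> (\<lambda>z. 0)" for \<alpha> using kernel_centralizer[OF d that] .
    show ?thesis
      unfolding M.act_expand[OF d m] N.act_expand[OF d fN'[OF m]]
      by (subst M.additive_sum[OF M.subspace_M])
        (auto simp: add M.W_closed bal kp m W2 intro!: sum.cong)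
  qed
  then show ?thesis using add fN by (auto simp: left_module_hom_def)
qed

text \<open>Between weights of equal type nothing is crossed, so the normalized shifts with
  \<open>k = 1\<close> are mutually inverse.\<close>

lemma Theta_round:
  assumes "fdeg l = a" "u \<in> verts Q" "\<nu> u = {i. 0 \<le> l i}" "v \<in> M.Wt l"
  shows "M.Theta (lam u) l (\<lambda>x. 1) (M.Theta l (lam u) (\<lambda>x. 1) v) = v"
proof -
  have "M.Theta (lam u) l (\<lambda>x. 1) (M.Theta l (lam u) (\<lambda>x. 1) v) = M.Theta l l (\<lambda>x. 1 * 1 * crossing l (lam u) l x) v"
    using assms M.lam_degree by (intro M.Theta_comp polys.const) auto
  also have "\<dots> = v"
    using assms M.Theta_id M.lam_type[OF assms(2)] by (simp add: crossing_same_left)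
  finally show ?thesis .
qed

text \<open>By \<open>Theta_round\<close> each weight vector is transported from a chosen weight
  space, where the two maps agree, and both commute with the transport.\<close>

lemma faithful:
  assumes f: "f \<in> left_module_hom weyl_centralizer (M, act) (N, act')"
    and g: "g \<in> left_module_hom weyl_centralizer (M, act) (N, act')"
    and eq: "restrict f M.V = restrict g M.V"
  shows "f = g"
proof -
  have V: "f v = g v" if "v \<in> M.V" for v using fun_cong[OF eq, of v] that by simp
  have Wt: "f v = g v" if v: "v \<in> M.Wt l" for l v
  proof (cases "v = 0")
    case True
    then show ?thesis using hom_0[OF f] hom_0[OF g] by simp
  next
    case False
    then have l: "fdeg l = a" using M.weight_total v by blast
    obtain u where u: "u \<in> verts Q" "\<nu> u = {i. 0 \<le> l i}" using M.ex_type[OF l] by blast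
    let ?w = "M.Theta l (lam u) (\<lambda>x. 1) v"
    have lu: "fdeg l = fdeg (lam u)" using l M.lam_degree[OF u(1)] by simp
    have w: "?w \<in> M.Wt (lam u)" by (rule M.Theta_Wt[OF lu polys.const v])
    have "v = M.Theta (lam u) l (\<lambda>x. 1) ?w" using Theta_round[OF l u v] by simp
    then have "f v = N.Theta (lam u) l (\<lambda>x. 1) (f ?w)" "g v = N.Theta (lam u) l (\<lambda>x. 1) (g ?w)"
      using hom_Theta[OF f lu[symmetric] polys.const w, of 1] hom_Theta[OF g lu[symmetric] polys.const w, of 1] by simp_all
    then show ?thesis using V[OF M.Wt_V[OF u(1) w]] by simp
  qed
  have "f m = g m" for m
  proof (cases "m \<in> M")
    case True
    let ?S = "{l. M.proj l m \<noteq> 0}"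
    have pM: "M.proj l m \<in> M" for l using M.Wt_M[OF M.proj_Wt[OF True]] .
    have "h m = (\<Sum>l\<in>?S. h (M.proj l m))" if "h \<in> left_module_hom weyl_centralizer (M, act) (N, act')" for h
    proof -
      have "h m = h (\<Sum>l\<in>?S. M.proj l m)" using arg_cong[OF M.proj_sum[OF True]] .
      also have "\<dots> = (\<Sum>l\<in>?S. h (M.proj l m))"
        by (rule M.additive_sum[OF M.subspace_M]) (auto simp: hom_add[OF that] pM)
      finally show ?thesis .
    qed
    from this[OF f] this[OF g] show ?thesis by (simp only: Wt[OF M.proj_Wt[OF True]])
  next
    case False
    then show ?thesis using f g by (auto simp: left_module_hom_def PiE_def extensional_def)
  qed
  then show ?thesis by auto
qed

end

context weight_quiver
begin

definition type_vertex :: "('i \<Rightarrow> int) \<Rightarrow> 'v" where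
  "type_vertex l = (SOME u. u \<in> verts Q \<and> \<nu> u = {i. 0 \<le> l i})"

lemma type_vertex:
  assumes "(\<Sum>i\<in>UNIV. l i) = a"
  shows "type_vertex l \<in> verts Q" "\<nu> (type_vertex l) = {i. 0 \<le> l i}" "{i. 0 \<le> lam (type_vertex l) i} = {i. 0 \<le> l i}"
proof -
  show 1: "type_vertex l \<in> verts Q" and 2: "\<nu> (type_vertex l) = {i. 0 \<le> l i}"
    using someI_ex[of "\<lambda>u. u \<in> verts Q \<and> \<nu> u = {i. 0 \<le> l i}"] ex_type[OF assms] unfolding type_vertex_def by blast+
  show "{i. 0 \<le> lam (type_vertex l) i} = {i. 0 \<le> l i}" using lam_type[OF 1] 2 by simp
qed

lemma type_vertex_lam: "u \<in> verts Q \<Longrightarrow> type_vertex (lam u) = u"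
  using type_vertex[OF lam_degree[of u]] lam_type[of u] inj_onD[OF inj_\<nu>] by metis

end

section \<open>Fullness: extending maps of representations to weight modules\<close>

context weight_module_pair
begin

context
  fixes g assumes g: "g \<in> left_module_hom M.QA (M.V, M.Fact M act) (N.V, M.Fact N act')"
begin

lemma rep_hom_add: "m \<in> M.V \<Longrightarrow> m' \<in> M.V \<Longrightarrow> g (m + m') = g m + g m'"
  and rep_hom_V: "m \<in> M.V \<Longrightarrow> g m \<in> N.V"
  using g by (auto simp: left_module_hom_def)

lemma rep_hom_scale: "m \<in> M.V \<Longrightarrow> g (scale c m) = scale c (g m)"
  by (rule M.QA_module_hom_scale[OF M.F_module N.F_module g])

lemma rep_hom_path:
  assumes "p \<in> paths Q" "m \<in> M.V" shows "g (M.\<rho> p m) = N.\<rho> p (g m)"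
proof -
  have "M.cl (path_elt p) \<in> carrier M.QA" using assms by (simp add: M.QA_carrier)
  then have "g (M.Fact M act (M.cl (path_elt p)) m) = M.Fact N act' (M.cl (path_elt p)) (g m)"
    using g assms by (auto simp: left_module_hom_def)
  then show ?thesis using assms rep_hom_V by (simp add: M.Fact_path N.Fact_path)
qed

text \<open>The trivial path at \<open>u\<close> acts as the projection to the weight space of
  \<open>lam u\<close>, and \<open>g\<close> commutes with it.\<close>

lemma rep_hom_Wt:
  assumes u: "u \<in> verts Q" and v: "v \<in> M.Wt (lam u)"
  shows "g v \<in> N.Wt (lam u)"
proof -
  have V: "v \<in> M.V" by (rule M.Wt_V[OF u v])
  have p: "(u, []) \<in> paths Q" using u by simp
  have "M.\<rho> (u, []) v = v" using M.path_op_Nil[OF u V] M.proj_weight[OF v, of "lam u"] by simp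
  then have "g v = N.\<rho> (u, []) (g v)" using rep_hom_path[OF p V] by simp
  then show ?thesis using N.path_op_Wt[OF p rep_hom_V[OF V]] by simp
qed

lemma rep_hom_Theta_path:
  assumes "(u, es) \<in> paths Q" "v \<in> M.Wt (lam u)"
  shows "g (M.Theta (lam u) (lam (path_end Q (u, es))) (half (M.cols es)) v) =
     N.Theta (lam u) (lam (path_end Q (u, es))) (half (M.cols es)) (g v)"
proof -
  have u: "u \<in> verts Q" using M.path_verts assms by blast
  have "M.proj (lam u) v = v" using M.proj_weight[OF assms(2), of "lam u"] by simp
  moreover have "N.proj (lam u) (g v) = g v" using N.proj_weight[OF rep_hom_Wt[OF u assms(2)], of "lam u"] by simp
  ultimately show ?thesis
    using rep_hom_path[OF assms(1) M.Wt_V[OF u assms(2)]] by (simp add: M.path_op_def)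
qed

text \<open>A direct path uses each color at most once, so its polynomial \<open>half\<close> is
  1.\<close>

lemma rep_hom_Theta_1:
  assumes "u \<in> verts Q" "v \<in> verts Q" "x \<in> M.Wt (lam u)"
  shows "g (M.Theta (lam u) (lam v) (\<lambda>x. 1) x) = N.Theta (lam u) (lam v) (\<lambda>x. 1) (g x)"
proof -
  obtain es where es: "(u, es) \<in> paths Q" "path_end Q (u, es) = v" "M.cols es = mset_set (sym_diff (\<nu> u) (\<nu> v))"
    using M.direct_path[OF assms(1,2)] by blast
  have "half (M.cols es) = (\<lambda>x. 1)" unfolding es(3) by (rule HOL.ext) (rule half_direct)
  then show ?thesis using rep_hom_Theta_path[OF es(1) assms(3)] es(2) by simp
qed

text \<open>A closed path of content \<open>{#i, i#}\<close> acts as the variable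
  \<open>x i\<close>; these variables generate all polynomials.\<close>

lemma rep_hom_Theta_self:
  assumes u: "u \<in> verts Q" and k: "k \<in> polys"
  shows "v \<in> M.Wt (lam u) \<Longrightarrow> g (M.Theta (lam u) (lam u) k v) = N.Theta (lam u) (lam u) k (g v)"
  using k
proof (induction arbitrary: v rule: polys.induct)
  case (const c)
  have v: "v \<in> M.V" by (rule M.Wt_V[OF u const])
  have "M.Theta (lam u) (lam u) (\<lambda>x. c * 1) v = scale c v" "N.Theta (lam u) (lam u) (\<lambda>x. c * 1) (g v) = scale c (g v)"
    using M.Theta_scale(2)[OF refl polys.const const] N.Theta_scale(2)[OF refl polys.const rep_hom_Wt[OF u const]]
      M.Theta_id[OF const] N.Theta_id[OF rep_hom_Wt[OF u const]] by metis+
  then show ?case by (simp add: rep_hom_scale[OF v])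
next
  case (var i)
  obtain es where es: "(u, es) \<in> paths Q" "path_end Q (u, es) = u" "M.cols es = {#i, i#}"
    using M.loop_path[OF u] by blast
  have "half (M.cols es) = (\<lambda>x. x i)" unfolding es(3) by (rule HOL.ext) (rule half_loop)
  then show ?case using rep_hom_Theta_path[OF es(1) var] es(2) by simp
next
  case (add f h)
  have "M.Theta (lam u) (lam u) k' v \<in> M.V" if "k' \<in> polys" for k'
    by (rule M.Wt_V[OF u M.Theta_Wt[OF refl that add.prems]])
  then show ?case
    using add by (simp add: M.Theta_plus N.Theta_plus rep_hom_Wt[OF u] rep_hom_add)
next
  case (mult f h)
  have "M.Theta (lam u) (lam u) (\<lambda>x. f x * h x) v = M.Theta (lam u) (lam u) f (M.Theta (lam u) (lam u) h v)"
    using M.Theta_comp[OF refl refl mult.hyps(2,1) mult.prems] by (simp add: mult.commute)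
  moreover have "N.Theta (lam u) (lam u) (\<lambda>x. f x * h x) (g v) = N.Theta (lam u) (lam u) f (N.Theta (lam u) (lam u) h (g v))"
    using N.Theta_comp[OF refl refl mult.hyps(2,1) rep_hom_Wt[OF u mult.prems]] by (simp add: mult.commute)
  ultimately show ?case
    using mult.IH(1)[OF M.Theta_Wt[OF refl mult.hyps(2) mult.prems]] mult.IH(2)[OF mult.prems] by simp
qed

text \<open>Any normalized shift is a polynomial at the starting vertex followed by the shift of a
  direct path, by \<open>Theta_comp\<close> with trivial crossing.\<close>

lemma rep_hom_Theta:
  assumes u: "u \<in> verts Q" and v: "v \<in> verts Q" and k: "k \<in> polys" and x: "x \<in> M.Wt (lam u)"
  shows "g (M.Theta (lam u) (lam v) k x) = N.Theta (lam u) (lam v) k (g x)"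
proof -
  note d = M.degree_lam[OF u v]
  have "M.Theta (lam u) (lam v) k x = M.Theta (lam u) (lam v) (\<lambda>x. 1) (M.Theta (lam u) (lam u) k x)"
    using M.Theta_comp[OF refl d k polys.const[of 1] x] by simp
  moreover have "N.Theta (lam u) (lam v) k (g x) = N.Theta (lam u) (lam v) (\<lambda>x. 1) (N.Theta (lam u) (lam u) k (g x))"
    using N.Theta_comp[OF refl d k polys.const[of 1] rep_hom_Wt[OF u x]] by simp
  ultimately show ?thesis
    using rep_hom_Theta_1[OF u v M.Theta_Wt[OF refl k x]] rep_hom_Theta_self[OF u k x] by simp
qed

text \<open>An extension of \<open>g\<close> has to commute with \<open>Theta\<close>, so its value
  on the weight space of \<open>l\<close> can only be \<open>g\<close> conjugated by the
  identification with the representative of the type.\<close>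

definition extend_wt :: "('i \<Rightarrow> int) \<Rightarrow> 'u \<Rightarrow> 'u" where
  "extend_wt l v = N.Theta (lam (M.type_vertex l)) l (\<lambda>x. 1) (g (M.Theta l (lam (M.type_vertex l)) (\<lambda>x. 1) v))"

definition extend_hom :: "'u \<Rightarrow> 'u" where
  "extend_hom = restrict (\<lambda>m. \<Sum>l\<in>{l. M.proj l m \<noteq> 0}. extend_wt l (M.proj l m)) M"

context
  fixes l :: "'i \<Rightarrow> int" assumes l: "fdeg l = a"
begin

lemma deg_tv: "fdeg l = fdeg (lam (M.type_vertex l))" "fdeg (lam (M.type_vertex l)) = fdeg l"
  using M.lam_degree[OF M.type_vertex(1)[OF l]] l by simp_all

lemma Theta_tv: "v \<in> M.Wt l \<Longrightarrow> M.Theta l (lam (M.type_vertex l)) (\<lambda>x. 1) v \<in> M.Wt (lam (M.type_vertex l))"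
  by (rule M.Theta_Wt[OF deg_tv(1) polys.const])

lemma g_Theta_tv: "v \<in> M.Wt l \<Longrightarrow> g (M.Theta l (lam (M.type_vertex l)) (\<lambda>x. 1) v) \<in> N.Wt (lam (M.type_vertex l))"
  by (rule rep_hom_Wt[OF M.type_vertex(1)[OF l] Theta_tv])

lemma extend_wt_Wt: "v \<in> M.Wt l \<Longrightarrow> extend_wt l v \<in> N.Wt l"
  unfolding extend_wt_def by (rule N.Theta_Wt[OF deg_tv(2) polys.const g_Theta_tv])

lemma extend_wt_add:
  assumes "v \<in> M.Wt l" "w \<in> M.Wt l" shows "extend_wt l (v + w) = extend_wt l v + extend_wt l w"
  unfolding extend_wt_def
  by (simp only: M.Theta_add[OF deg_tv(1) polys.const assms]
      rep_hom_add[OF M.Wt_V[OF M.type_vertex(1)[OF l] Theta_tv[OF assms(1)]] M.Wt_V[OF M.type_vertex(1)[OF l] Theta_tv[OF assms(2)]]]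
      N.Theta_add[OF deg_tv(2) polys.const g_Theta_tv[OF assms(1)] g_Theta_tv[OF assms(2)]])

end

text \<open>Weights and their representatives have equal types, so all crossings in the compositions
  are trivial and the claim reduces to \<open>rep_hom_Theta\<close>.\<close>

lemma extend_wt_Theta:
  assumes l: "fdeg l = a" and m: "fdeg m = a" and k: "k \<in> polys" and v: "v \<in> M.Wt l"
  shows "extend_wt m (M.Theta l m k v) = N.Theta l m k (extend_wt l v)"
proof -
  let ?u = "M.type_vertex l" and ?v = "M.type_vertex m"
  note tl = M.type_vertex[OF l] and tm = M.type_vertex[OF m]
  have d: "fdeg l = fdeg m" "fdeg l = fdeg (lam ?v)" "fdeg (lam ?u) = fdeg (lam ?v)" "fdeg (lam ?u) = fdeg m"
    using l m M.lam_degree[OF tl(1)] M.lam_degree[OF tm(1)] by simp_all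
  let ?w = "M.Theta l (lam ?u) (\<lambda>x. 1) v"
  have w: "?w \<in> M.Wt (lam ?u)" by (rule Theta_tv[OF l v])
  have gw: "g ?w \<in> N.Wt (lam ?u)" by (rule g_Theta_tv[OF l v])
  have "M.Theta m (lam ?v) (\<lambda>x. 1) (M.Theta l m k v) = M.Theta l (lam ?v) k v"
    using M.Theta_comp[OF d(1) deg_tv(1)[OF m] k polys.const[of 1] v] by (simp add: crossing_same_right tm(3))
  also have "\<dots> = M.Theta (lam ?u) (lam ?v) k ?w"
    using M.Theta_comp[OF deg_tv(1)[OF l] d(3) polys.const[of 1] k v] by (simp add: crossing_same_left tl(3))
  finally have "extend_wt m (M.Theta l m k v) = N.Theta (lam ?v) m (\<lambda>x. 1) (N.Theta (lam ?u) (lam ?v) k (g ?w))"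
    by (simp add: extend_wt_def rep_hom_Theta[OF tl(1) tm(1) k w])
  also have "\<dots> = N.Theta (lam ?u) m k (g ?w)"
    using N.Theta_comp[OF d(3) deg_tv(2)[OF m] k polys.const[of 1] gw] by (simp add: crossing_same_right tm(3))
  also have "\<dots> = N.Theta l m k (extend_wt l v)"
    using N.Theta_comp[OF deg_tv(2)[OF l] d(1) polys.const[of 1] k gw] by (simp add: extend_wt_def crossing_same_left tl(3))
  finally show ?thesis .
qed

lemma extend_wt_0:
  assumes "fdeg l = a" shows "extend_wt l 0 = 0"
  using extend_wt_add[OF assms, of 0 0] M.subspace_0[OF M.subspace_weight_space] by simp

lemma proj_degree: "m \<in> M \<Longrightarrow> M.proj l m \<noteq> 0 \<Longrightarrow> fdeg l = a"
  using M.weight_total[OF M.proj_Wt] .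

lemma extend_hom_sum:
  assumes m: "m \<in> M" and S: "finite S" "{l. M.proj l m \<noteq> 0} \<subseteq> S" "\<And>l. l \<in> S \<Longrightarrow> fdeg l = a"
  shows "extend_hom m = (\<Sum>l\<in>S. extend_wt l (M.proj l m))"
proof -
  have "extend_hom m = (\<Sum>l\<in>{l. M.proj l m \<noteq> 0}. extend_wt l (M.proj l m))" using m by (simp add: extend_hom_def)
  also have "\<dots> = (\<Sum>l\<in>S. extend_wt l (M.proj l m))"
    by (rule sum.mono_neutral_left[OF S(1,2)]) (auto simp: extend_wt_0 S(3))
  finally show ?thesis .
qed

lemma extend_hom_weight:
  assumes l: "fdeg l = a" and v: "v \<in> M.Wt l" shows "extend_hom v = extend_wt l v"
proof -
  have "{l'. M.proj l' v \<noteq> 0} \<subseteq> {l}" using M.proj_weight[OF v] by auto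
  then have "extend_hom v = (\<Sum>l\<in>{l}. extend_wt l (M.proj l v))"
    by (rule extend_hom_sum[OF M.Wt_M[OF v], rotated]) (auto simp: l)
  then show ?thesis using M.proj_weight[OF v, of l] by simp
qed

lemma extend_hom_hom: "extend_hom \<in> left_module_hom weyl_centralizer (M, act) (N, act')"
proof (rule homI)
  fix m m' assume m: "m \<in> M" "m' \<in> M"
  let ?S = "{l. M.proj l m \<noteq> 0} \<union> {l. M.proj l m' \<noteq> 0}"
  have S: "finite ?S" "\<And>l. l \<in> ?S \<Longrightarrow> fdeg l = a" using m M.proj_finite proj_degree by auto
  have mm: "m + m' \<in> M" using m M.subspace_add[OF M.subspace_M] by blast
  have "{l. M.proj l (m + m') \<noteq> 0} \<subseteq> ?S" using m by (auto simp: M.proj_add)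
  then have "extend_hom (m + m') = (\<Sum>l\<in>?S. extend_wt l (M.proj l (m + m')))"
    by (rule extend_hom_sum[OF mm S(1) _ S(2)])
  also have "\<dots> = (\<Sum>l\<in>?S. extend_wt l (M.proj l m) + extend_wt l (M.proj l m'))"
    by (intro sum.cong refl) (simp only: M.proj_add[OF m] extend_wt_add[OF S(2) M.proj_Wt[OF m(1)] M.proj_Wt[OF m(2)]])
  also have "\<dots> = extend_hom m + extend_hom m'"
    unfolding sum.distrib
    by (simp only: extend_hom_sum[OF m(1) S(1) _ S(2), symmetric] extend_hom_sum[OF m(2) S(1) _ S(2), symmetric] Un_upper1 Un_upper2)
  finally show "extend_hom (m + m') = extend_hom m + extend_hom m'" .
next
  have "(\<Sum>l\<in>{l. M.proj l m \<noteq> 0}. extend_wt l (M.proj l m)) \<in> N" if "m \<in> M" for m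
    using proj_degree[OF that] by (intro M.subspace_sum[OF N.subspace_M] N.Wt_M[OF extend_wt_Wt] M.proj_Wt[OF that]) auto
  then show "extend_hom \<in> M \<rightarrow>\<^sub>E N" by (auto simp: extend_hom_def)
next
  show "extend_hom v \<in> N.Wt l" if "fdeg l = a" "v \<in> M.Wt l" for l v
    using that extend_hom_weight extend_wt_Wt by simp
next
  show "extend_hom (M.Theta l m k v) = N.Theta l m k (extend_hom v)"
    if "fdeg l = a" "fdeg m = a" "k \<in> polys" "v \<in> M.Wt l" for l m k v
    using extend_wt_Theta[OF that] extend_hom_weight[OF that(1,4)] extend_hom_weight[OF that(2) M.Theta_Wt[OF _ that(3,4)]] that
    by simp
qed

lemma extend_hom_restrict: "restrict extend_hom M.V = g"
proof
  fix m
  show "restrict extend_hom M.V m = g m"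
  proof (cases "m \<in> M.V")
    case True
    have sub: "{l. M.proj l m \<noteq> 0} \<subseteq> lam ` verts Q" using True by (auto simp: M.FV_def)
    have pV: "M.proj l m \<in> M.Wt l" for l by (rule M.proj_Wt[OF M.V_M[OF True]])
    have "extend_hom m = (\<Sum>l\<in>lam ` verts Q. extend_wt l (M.proj l m))"
      by (rule extend_hom_sum[OF M.V_M[OF True] _ sub]) (auto simp: M.finite_verts M.lam_degree)
    also have "\<dots> = (\<Sum>u\<in>verts Q. extend_wt (lam u) (M.proj (lam u) m))"
      using M.inj_lam by (simp add: sum.reindex)
    also have "\<dots> = (\<Sum>u\<in>verts Q. g (M.proj (lam u) m))"
    proof (intro sum.cong refl)
      fix u assume u: "u \<in> verts Q"
      show "extend_wt (lam u) (M.proj (lam u) m) = g (M.proj (lam u) m)"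
        unfolding extend_wt_def M.type_vertex_lam[OF u] M.Theta_id[OF pV] by (rule N.Theta_id[OF rep_hom_Wt[OF u pV]])
    qed
    also have "\<dots> = g (\<Sum>u\<in>verts Q. M.proj (lam u) m)"
      by (rule M.additive_sum[OF M.subspace_V, symmetric]) (auto simp: rep_hom_add intro: M.Wt_V[OF _ pV])
    also have "\<dots> = g m" by (simp add: M.V_sum[OF True])
    finally show ?thesis using True by simp
  next
    case False
    then show ?thesis using g by (auto simp: left_module_hom_def PiE_def extensional_def)
  qed
qed

end

end

section \<open>Polynomials in commuting operators\<close>

locale commuting_operators = complex_vector_space scale
  for scale :: "complex \<Rightarrow> 'u \<Rightarrow> 'u::ab_group_add" +
  fixes V :: "'u set" and X :: "'i::finite \<Rightarrow> 'u \<Rightarrow> 'u"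
  assumes subspace_ops: "subspace V" and X_closed: "v \<in> V \<Longrightarrow> X i v \<in> V"
    and X_add: "v \<in> V \<Longrightarrow> w \<in> V \<Longrightarrow> X i (v + w) = X i v + X i w"
    and X_scale: "v \<in> V \<Longrightarrow> X i (scale c v) = scale c (X i v)"
    and X_commute: "v \<in> V \<Longrightarrow> X i (X j v) = X j (X i v)"
begin

text \<open>A relation, because a polynomial function can be built in many ways. That the operator
  does not depend on the construction is \<open>evaluates_unique\<close>.\<close>

inductive evaluates :: "(('i \<Rightarrow> complex) \<Rightarrow> complex) \<Rightarrow> ('u \<Rightarrow> 'u) \<Rightarrow> bool" where
  const: "evaluates (\<lambda>z. c) (scale c)"
| var: "evaluates (\<lambda>z. z i) (X i)"
| add: "evaluates f A \<Longrightarrow> evaluates g B \<Longrightarrow> evaluates (\<lambda>z. f z + g z) (\<lambda>v. A v + B v)"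
| mult: "evaluates f A \<Longrightarrow> evaluates g B \<Longrightarrow> evaluates (\<lambda>z. f z * g z) (\<lambda>v. A (B v))"

lemma ex_evaluates: "f \<in> polys \<Longrightarrow> \<exists>A. evaluates f A"
proof (induction rule: polys.induct)
  case (const c)
  show ?case using evaluates.const by blast
next
  case (var i)
  show ?case using evaluates.var by blast
next
  case (add f g)
  then show ?case using evaluates.add by blast
next
  case (mult f g)
  then show ?case using evaluates.mult by blast
qed

lemma evaluates_linear:
  assumes "evaluates f A"
  shows "(v \<in> V \<longrightarrow> A v \<in> V) \<and> (v \<in> V \<longrightarrow> w \<in> V \<longrightarrow> A (v + w) = A v + A w) \<and> (v \<in> V \<longrightarrow> A (scale c v) = scale c (A v))"
  using assms
proof (induction arbitrary: v w c)
  case (const c')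
  then show ?case using subspace_scale[OF subspace_ops] by (simp add: scale_right_distrib mult.commute)
next
  case (var i)
  then show ?case by (simp add: X_closed X_add X_scale)
next
  case (add f A g B)
  then show ?case using subspace_add[OF subspace_ops] by (simp add: scale_right_distrib)
next
  case (mult f A g B)
  then show ?case by simp
qed

text \<open>The operators commute only on \<open>V\<close>, so the list fixes an order of the
  factors.\<close>

definition op_monomial :: "'i list \<Rightarrow> ('i \<Rightarrow> nat) \<Rightarrow> 'u \<Rightarrow> 'u" where
  "op_monomial xs e v = foldr (\<lambda>i. X i ^^ e i) xs v"

lemma power_closed: "v \<in> V \<Longrightarrow> (X i ^^ n) v \<in> V"
  by (induction n) (auto simp: X_closed)

lemma power_linear: "v \<in> V \<Longrightarrow> w \<in> V \<Longrightarrow> (X i ^^ n) (v + w) = (X i ^^ n) v + (X i ^^ n) w"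
  "v \<in> V \<Longrightarrow> (X i ^^ n) (scale c v) = scale c ((X i ^^ n) v)"
  by (induction n) (auto simp: X_add X_scale power_closed)

lemma power_commute1: "v \<in> V \<Longrightarrow> X i ((X j ^^ n) v) = (X j ^^ n) (X i v)"
proof (induction n)
  case (Suc n)
  then show ?case using X_commute[of "(X j ^^ n) v" i j] power_closed[of v n j] by simp
qed simp

lemma power_commute: "v \<in> V \<Longrightarrow> (X i ^^ m) ((X j ^^ n) v) = (X j ^^ n) ((X i ^^ m) v)"
  by (induction m) (auto simp: power_closed power_commute1)

lemma op_monomial_Cons: "op_monomial (i # xs) e v = (X i ^^ e i) (op_monomial xs e v)"
  and op_monomial_Nil: "op_monomial [] e v = v"
  by (simp_all add: op_monomial_def)

lemma op_monomial_closed: "v \<in> V \<Longrightarrow> op_monomial xs e v \<in> V"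
  by (induction xs) (auto simp: op_monomial_Cons op_monomial_Nil power_closed)

lemma op_monomial_linear: "v \<in> V \<Longrightarrow> w \<in> V \<Longrightarrow> op_monomial xs e (v + w) = op_monomial xs e v + op_monomial xs e w"
  "v \<in> V \<Longrightarrow> op_monomial xs e (scale c v) = scale c (op_monomial xs e v)"
  by (induction xs) (auto simp: op_monomial_Cons op_monomial_Nil power_linear op_monomial_closed)

lemma op_monomial_power: "v \<in> V \<Longrightarrow> op_monomial xs e ((X i ^^ n) v) = (X i ^^ n) (op_monomial xs e v)"
  by (induction xs) (auto simp: op_monomial_Cons op_monomial_Nil op_monomial_closed power_commute)

lemma op_monomial_add:
  "v \<in> V \<Longrightarrow> op_monomial xs (\<lambda>i. e i + f i) v = op_monomial xs e (op_monomial xs f v)"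
  by (induction xs) (auto simp: op_monomial_Cons op_monomial_Nil op_monomial_closed op_monomial_power funpow_add)

lemma op_monomial_zero: "op_monomial xs (\<lambda>_. 0) v = v"
  by (induction xs) (auto simp: op_monomial_Cons op_monomial_Nil)

lemma op_monomial_unit: "distinct xs \<Longrightarrow> op_monomial xs (\<lambda>j. if j = i then 1 else 0) v = (if i \<in> set xs then X i v else v)"
  by (induction xs) (auto simp: op_monomial_Cons op_monomial_Nil)

lemma expansion_op_closed: "v \<in> V \<Longrightarrow> expansion ps (\<lambda>e. op_monomial xs e v) scale \<in> V"
  by (induction ps) (auto simp: subspace_0[OF subspace_ops] subspace_add[OF subspace_ops]
      subspace_scale[OF subspace_ops] op_monomial_closed)

lemma expansion_op_times:
  assumes v: "v \<in> V"
  shows "expansion (expansion_times ps qs) (\<lambda>e. op_monomial xs e v) scale =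
     expansion ps (\<lambda>e. op_monomial xs e (expansion qs (\<lambda>e. op_monomial xs e v) scale)) scale"
proof (induction ps)
  case (Cons p ps)
  obtain c e where p: "p = (c, e)" by force
  have z: "op_monomial xs e 0 = 0"
    using op_monomial_linear(2)[OF subspace_0[OF subspace_ops], of xs e 0] by simp
  have "expansion (map (\<lambda>(d, f). (c * d, \<lambda>i. e i + f i)) qs) (\<lambda>e. op_monomial xs e v) scale =
     scale c (op_monomial xs e (expansion qs (\<lambda>e. op_monomial xs e v) scale))"
    by (induction qs) (auto simp: z op_monomial_add[OF v] op_monomial_linear op_monomial_closed v
        expansion_op_closed subspace_scale[OF subspace_ops] scale_right_distrib)
  then show ?case by (simp add: p expansion_append Cons)
qed simp

text \<open>The point is that one and the same list of coefficients expands the function and the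
  operator.\<close>

lemma evaluates_expansion:
  assumes xs: "distinct xs" "set xs = (UNIV :: 'i set)" and "evaluates f A"
  shows "\<exists>ps. (\<forall>z. f z = expansion ps (\<lambda>e. monomial e z) (*)) \<and>
     (\<forall>v\<in>V. A v = expansion ps (\<lambda>e. op_monomial xs e v) scale)"
  using assms(3)
proof induction
  case (const c)
  show ?case by (intro exI[of _ "[(c, \<lambda>_. 0)]"]) (simp add: monomial_def op_monomial_zero)
next
  case (var i)
  have "(\<Prod>j\<in>UNIV. z j ^ (if j = i then 1 else 0)) = z i" for z :: "'i \<Rightarrow> complex"
  proof -
    have "(\<Prod>j\<in>UNIV. z j ^ (if j = i then 1 else 0)) = (\<Prod>j\<in>UNIV. if j = i then z j else 1)"
      by (intro prod.cong) auto
    then show ?thesis by simp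
  qed
  then show ?case
    using op_monomial_unit[OF xs(1), of i] xs(2)
    by (intro exI[of _ "[(1, \<lambda>j. if j = i then 1 else 0)]"]) (simp add: monomial_def)
next
  case (add f A g B)
  then obtain ps qs where "\<forall>z. f z = expansion ps (\<lambda>e. monomial e z) (*)" "\<forall>v\<in>V. A v = expansion ps (\<lambda>e. op_monomial xs e v) scale"
    "\<forall>z. g z = expansion qs (\<lambda>e. monomial e z) (*)" "\<forall>v\<in>V. B v = expansion qs (\<lambda>e. op_monomial xs e v) scale" by blast
  then show ?case by (intro exI[of _ "ps @ qs"]) (simp add: expansion_append)
next
  case (mult f A g B)
  then obtain ps qs where *: "\<forall>z. f z = expansion ps (\<lambda>e. monomial e z) (*)" "\<forall>v\<in>V. A v = expansion ps (\<lambda>e. op_monomial xs e v) scale"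
    "\<forall>z. g z = expansion qs (\<lambda>e. monomial e z) (*)" "\<forall>v\<in>V. B v = expansion qs (\<lambda>e. op_monomial xs e v) scale" by blast
  have "A (B v) = expansion (expansion_times ps qs) (\<lambda>e. op_monomial xs e v) scale" if "v \<in> V" for v
    using * that by (simp add: expansion_op_times expansion_op_closed)
  then show ?case using * by (intro exI[of _ "expansion_times ps qs"]) (simp add: expansion_times)
qed

lemma expansion_neg: "expansion (map (\<lambda>(c, e). (- c, e)) qs) \<phi> scale = - expansion qs \<phi> scale"
  "expansion (map (\<lambda>(c, e). (- c, e)) qs) \<psi> (*) = - expansion qs \<psi> ((*) :: complex \<Rightarrow> _)"
  by (induction qs) auto

text \<open>The difference of the two expansions is a list that vanishes as a polynomial function;
  by \<open>expansion_eq_0\<close> it also vanishes in the operators.\<close>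

lemma evaluates_unique:
  assumes "evaluates f A" "evaluates f B" "v \<in> V" shows "A v = B v"
proof -
  obtain xs where xs: "distinct xs" "set xs = (UNIV :: 'i set)"
    using finite_distinct_list[of "UNIV :: 'i set"] by auto
  obtain ps qs where ps: "\<forall>z. f z = expansion ps (\<lambda>e. monomial e z) (*)" "A v = expansion ps (\<lambda>e. op_monomial xs e v) scale"
    and qs: "\<forall>z. f z = expansion qs (\<lambda>e. monomial e z) (*)" "B v = expansion qs (\<lambda>e. op_monomial xs e v) scale"
    using evaluates_expansion[OF xs assms(1)] evaluates_expansion[OF xs assms(2)] assms(3) by blast
  have 0: "expansion (ps @ map (\<lambda>(c, e). (- c, e)) qs) (\<lambda>e. monomial e z) (*) = 0" for z
    using ps(1)[rule_format, of z, symmetric] qs(1)[rule_format, of z, symmetric] by (simp add: expansion_append expansion_neg)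
  have "expansion (ps @ map (\<lambda>(c, e). (- c, e)) qs) (\<lambda>e. op_monomial xs e v) scale = 0"
    by (rule expansion_eq_0[of 0, OF 0]) (simp_all add: scale_left_distrib)
  then show ?thesis by (simp add: expansion_append expansion_neg ps(2) qs(2))
qed

definition ev :: "(('i \<Rightarrow> complex) \<Rightarrow> complex) \<Rightarrow> 'u \<Rightarrow> 'u" where
  "ev f = (SOME A. evaluates f A)"

lemma evaluates_ev: "f \<in> polys \<Longrightarrow> evaluates f (ev f)"
  unfolding ev_def by (rule someI_ex[OF ex_evaluates])

lemma ev_const: "v \<in> V \<Longrightarrow> ev (\<lambda>z. c) v = scale c v"
  by (rule evaluates_unique[OF evaluates_ev[OF polys.const] evaluates.const])

lemma ev_var: "v \<in> V \<Longrightarrow> ev (\<lambda>z. z i) v = X i v"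
  by (rule evaluates_unique[OF evaluates_ev[OF polys.var] evaluates.var])

context
  fixes f :: "('i \<Rightarrow> complex) \<Rightarrow> complex" assumes f: "f \<in> polys"
begin

lemma ev_closed: "v \<in> V \<Longrightarrow> ev f v \<in> V"
  and ev_add: "v \<in> V \<Longrightarrow> w \<in> V \<Longrightarrow> ev f (v + w) = ev f v + ev f w"
  and ev_scale: "v \<in> V \<Longrightarrow> ev f (scale c v) = scale c (ev f v)"
  using evaluates_linear[OF evaluates_ev[OF f]] by blast+

lemma ev_0: "ev f 0 = 0"
  using ev_add[of 0 0] subspace_0[OF subspace_ops] by simp

lemma ev_plus: "g \<in> polys \<Longrightarrow> v \<in> V \<Longrightarrow> ev (\<lambda>z. f z + g z) v = ev f v + ev g v"
  by (rule evaluates_unique[OF evaluates_ev[OF polys.add[OF f]] evaluates.add[OF evaluates_ev[OF f] evaluates_ev]])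

lemma ev_mult: "g \<in> polys \<Longrightarrow> v \<in> V \<Longrightarrow> ev (\<lambda>z. f z * g z) v = ev f (ev g v)"
  by (rule evaluates_unique[OF evaluates_ev[OF polys.mult[OF f]] evaluates.mult[OF evaluates_ev[OF f] evaluates_ev]])

end

lemma ev_sum: "(\<And>j. j \<in> S \<Longrightarrow> f j \<in> polys) \<Longrightarrow> v \<in> V \<Longrightarrow> ev (\<lambda>z. \<Sum>j\<in>S. f j z) v = (\<Sum>j\<in>S. ev (f j) v)"
  by (induction S rule: infinite_finite_induct) (auto simp: ev_const ev_plus polys_sum)

end

section \<open>Representations of colored quivers\<close>

locale quiver_rep = weight_quiver Q R col \<nu> scale a lam
  for Q :: "('v, 'e) quiver" and R and col :: "'e \<Rightarrow> 'i::finite multiset" and \<nu> :: "'v \<Rightarrow> 'i set"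
    and scale :: "complex \<Rightarrow> 'u \<Rightarrow> 'u::ab_group_add" and a lam +
  fixes V :: "'u set" and actV :: "(('v, 'e) path \<Rightarrow> complex) set \<Rightarrow> 'u \<Rightarrow> 'u"
  assumes rep: "(V, actV) \<in> Obj (nilpotent_rep_cat scale Q R)"
begin

lemma rep_module: "left_module scale QA (V, actV)"
  and rep_finite: "finite_dimensional scale V"
  and rep_nilpotent: "\<exists>N. \<forall>p\<in>paths Q. N \<le> length (snd p) \<longrightarrow> (\<forall>m\<in>V. actV (cl (path_elt p)) m = 0)"
  using rep by (auto simp: nilpotent_rep_cat_def module_cat_def)

definition r :: "('v, 'e) path \<Rightarrow> 'u \<Rightarrow> 'u" where
  "r p v = actV (cl (path_elt p)) v"

lemma subspace_rep: "subspace V"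
  by (rule QA_subspace[OF rep_module])

lemma r_closed: "p \<in> paths Q \<Longrightarrow> v \<in> V \<Longrightarrow> r p v \<in> V"
  unfolding r_def by (rule QA_act_closed[OF rep_module path_elt_carrier])

lemma r_add: "p \<in> paths Q \<Longrightarrow> v \<in> V \<Longrightarrow> w \<in> V \<Longrightarrow> r p (v + w) = r p v + r p w"
  unfolding r_def by (rule QA_act_add[OF rep_module path_elt_carrier])

lemma r_scale: "p \<in> paths Q \<Longrightarrow> v \<in> V \<Longrightarrow> r p (scale c v) = scale c (r p v)"
  unfolding r_def by (rule QA_act_scale[OF rep_module path_elt_carrier])

lemma r_0: "p \<in> paths Q \<Longrightarrow> r p 0 = 0"
  using r_add[of p 0 0] subspace_0[OF subspace_rep] by simp

lemma r_mult: "(v, fs) \<in> paths Q \<Longrightarrow> (u, es) \<in> paths Q \<Longrightarrow> x \<in> V \<Longrightarrow>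
    r (v, fs) (r (u, es) x) = (if v = path_end Q (u, es) then r (u, es @ fs) x else 0)"
  unfolding r_def by (rule QA_act_path_mult[OF rep_module])

lemma r_unit: "x \<in> V \<Longrightarrow> (\<Sum>u\<in>verts Q. r (u, []) x) = x"
  unfolding r_def by (rule QA_act_unit[OF rep_module])

lemma r_color: "(u, es) \<in> paths Q \<Longrightarrow> (u, fs) \<in> paths Q \<Longrightarrow> path_end Q (u, es) = path_end Q (u, fs) \<Longrightarrow>
    cols es = cols fs \<Longrightarrow> r (u, es) = r (u, fs)"
  unfolding r_def using color_class by metis

definition Vs :: "'v \<Rightarrow> 'u set" where
  "Vs u = {v \<in> V. r (u, []) v = v}"

lemma Vs_V: "v \<in> Vs u \<Longrightarrow> v \<in> V"
  by (simp add: Vs_def)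

lemma r_Vs: "(u, es) \<in> paths Q \<Longrightarrow> x \<in> V \<Longrightarrow> r (u, es) x \<in> Vs (path_end Q (u, es))"
  using r_mult[of "path_end Q (u, es)" "[]" u es x] path_verts[of u es] r_closed[of "(u, es)" x] by (simp add: Vs_def)

lemma subspace_Vs: "u \<in> verts Q \<Longrightarrow> subspace (Vs u)"
  by (rule subspaceI) (auto simp: Vs_def r_0 r_add r_scale subspace_0[OF subspace_rep]
      subspace_add[OF subspace_rep] subspace_scale[OF subspace_rep])

lemma r_other: "(u, es) \<in> paths Q \<Longrightarrow> w \<in> verts Q \<Longrightarrow> x \<in> Vs w \<Longrightarrow> u \<noteq> w \<Longrightarrow> r (u, es) x = 0"
  using r_mult[of u es w "[]" x] by (simp add: Vs_def)

definition direct :: "'v \<Rightarrow> 'v \<Rightarrow> 'e list" where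
  "direct u v = (SOME es. (u, es) \<in> paths Q \<and> path_end Q (u, es) = v \<and> cols es = mset_set (sym_diff (\<nu> u) (\<nu> v)))"

lemma direct:
  assumes "u \<in> verts Q" "v \<in> verts Q"
  shows "(u, direct u v) \<in> paths Q" "path_end Q (u, direct u v) = v" "cols (direct u v) = mset_set (sym_diff (\<nu> u) (\<nu> v))"
  using someI_ex[OF direct_path[OF assms]] unfolding direct_def by blast+

definition loop :: "'v \<Rightarrow> 'i \<Rightarrow> 'e list" where
  "loop u i = (SOME es. (u, es) \<in> paths Q \<and> path_end Q (u, es) = u \<and> cols es = {#i, i#})"

lemma loop:
  assumes "u \<in> verts Q"
  shows "(u, loop u i) \<in> paths Q" "path_end Q (u, loop u i) = u" "cols (loop u i) = {#i, i#}"
  using someI_ex[OF loop_path[OF assms, of i]] unfolding loop_def by blast+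

definition sigma :: "'v \<Rightarrow> 'v \<Rightarrow> 'u \<Rightarrow> 'u" where
  "sigma u v = r (u, direct u v)"

text \<open>The operator that becomes the nilpotent part of
  \<open>t\<^sub>i\<partial>\<^sub>i\<close>: at each vertex a closed path of content
  \<open>{#i, i#}\<close>.\<close>

definition X :: "'i \<Rightarrow> 'u \<Rightarrow> 'u" where
  "X i x = (\<Sum>u\<in>verts Q. r (u, loop u i) x)"

lemma X_mult:
  assumes "x \<in> V" shows "X i (X j x) = (\<Sum>u\<in>verts Q. r (u, loop u j @ loop u i) x)"
proof -
  have "X i (X j x) = (\<Sum>w\<in>verts Q. \<Sum>u\<in>verts Q. r (w, loop w i) (r (u, loop u j) x))"
    unfolding X_def
    by (intro sum.cong refl additive_sum[OF subspace_rep]) (auto simp: r_add r_closed loop assms)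
  also have "\<dots> = (\<Sum>w\<in>verts Q. \<Sum>u\<in>verts Q. if u = w then r (u, loop u j @ loop u i) x else 0)"
    by (intro sum.cong refl) (auto simp: r_mult loop assms)
  also have "\<dots> = (\<Sum>u\<in>verts Q. r (u, loop u j @ loop u i) x)"
    using finite_verts by simp
  finally show ?thesis .
qed

sublocale commuting_operators scale V X
proof
  show "subspace V" by (rule subspace_rep)
  show "X i v \<in> V" if "v \<in> V" for v i
    unfolding X_def using that by (intro subspace_sum[OF subspace_rep] r_closed loop)
  show "X i (v + w) = X i v + X i w" if "v \<in> V" "w \<in> V" for v w i
    using that by (simp add: X_def r_add loop sum.distrib)
  show "X i (scale c v) = scale c (X i v)" if "v \<in> V" for v c i
    using that by (simp add: X_def r_scale loop scale_sum_right)
  show "X i (X j v) = X j (X i v)" if "v \<in> V" for v i j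
    unfolding X_mult[OF that]
  proof (intro sum.cong refl)
    fix u assume u: "u \<in> verts Q"
    \<comment> \<open>The two orders of the loops have the same content, hence the same
      class.\<close>
    show "r (u, loop u j @ loop u i) v = r (u, loop u i @ loop u j) v"
    proof (rule fun_cong[OF r_color])
      show "cols (loop u j @ loop u i) = cols (loop u i @ loop u j)"
        by (simp only: map_append sum_list_append add.commute)
    qed (simp_all add: paths_append path_end_append loop[OF u])
  qed
qed

lemma X_Vs:
  assumes "u \<in> verts Q" "x \<in> Vs u" shows "X i x = r (u, loop u i) x"
proof -
  have "X i x = (\<Sum>w\<in>verts Q. if w = u then r (u, loop u i) x else 0)"
    unfolding X_def using assms by (intro sum.cong refl) (auto simp: r_other loop)
  then show ?thesis using finite_verts assms by simp
qed

lemma X_in_Vs: "u \<in> verts Q \<Longrightarrow> x \<in> Vs u \<Longrightarrow> X i x \<in> Vs u"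
  using r_Vs[of u "loop u i" x] by (simp add: X_Vs loop Vs_V)

lemma ev_Vs: "k \<in> polys \<Longrightarrow> u \<in> verts Q \<Longrightarrow> x \<in> Vs u \<Longrightarrow> ev k x \<in> Vs u"
proof (induction arbitrary: x rule: polys.induct)
  case (const c)
  then show ?case using subspace_scale[OF subspace_Vs] by (simp add: ev_const Vs_V)
next
  case (var i)
  then show ?case using X_in_Vs by (simp add: ev_var Vs_V)
next
  case (add f g)
  then show ?case using subspace_add[OF subspace_Vs] by (simp add: ev_plus Vs_V)
next
  case (mult f g)
  then show ?case by (simp add: ev_mult Vs_V)
qed

lemma ev_one: "x \<in> V \<Longrightarrow> ev (\<lambda>z. 1) x = x"
  by (simp add: ev_const)

lemma sigma_Vs: "u \<in> verts Q \<Longrightarrow> v \<in> verts Q \<Longrightarrow> x \<in> V \<Longrightarrow> sigma u v x \<in> Vs v"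
  unfolding sigma_def using r_Vs[of u "direct u v" x] by (simp add: direct)

lemma sigma_add: "u \<in> verts Q \<Longrightarrow> v \<in> verts Q \<Longrightarrow> x \<in> V \<Longrightarrow> y \<in> V \<Longrightarrow> sigma u v (x + y) = sigma u v x + sigma u v y"
  by (simp add: sigma_def r_add direct)

lemma sigma_scale: "u \<in> verts Q \<Longrightarrow> v \<in> verts Q \<Longrightarrow> x \<in> V \<Longrightarrow> sigma u v (scale c x) = scale c (sigma u v x)"
  by (simp add: sigma_def r_scale direct)

lemma sigma_0: "u \<in> verts Q \<Longrightarrow> v \<in> verts Q \<Longrightarrow> sigma u v 0 = 0"
  by (simp add: sigma_def r_0 direct)

text \<open>The loop may be inserted at the start or at the end of the direct path: ends and content
  are the same.\<close>

lemma sigma_X: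
  assumes u: "u \<in> verts Q" and v: "v \<in> verts Q" and x: "x \<in> Vs u"
  shows "sigma u v (X i x) = X i (sigma u v x)"
proof -
  have "sigma u v (X i x) = r (u, loop u i @ direct u v) x"
    unfolding X_Vs[OF u x] sigma_def using r_mult[OF direct(1)[OF u v] loop(1)[OF u] Vs_V[OF x], of i] loop(2)[OF u] by simp
  also have "r (u, loop u i @ direct u v) = r (u, direct u v @ loop v i)"
    by (rule r_color) (auto simp: paths_append path_end_append direct[OF u v] loop[OF u] loop[OF v])
  also have "r (u, direct u v @ loop v i) x = X i (sigma u v x)"
    unfolding X_Vs[OF v sigma_Vs[OF u v Vs_V[OF x]]] unfolding sigma_def
    using r_mult[OF loop(1)[OF v] direct(1)[OF u v] Vs_V[OF x], of i] direct(2)[OF u v] by simp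
  finally show ?thesis .
qed

lemma sigma_ev:
  assumes u: "u \<in> verts Q" and v: "v \<in> verts Q"
  shows "k \<in> polys \<Longrightarrow> x \<in> Vs u \<Longrightarrow> sigma u v (ev k x) = ev k (sigma u v x)"
proof (induction arbitrary: x rule: polys.induct)
  case (const c)
  then show ?case using Vs_V[OF sigma_Vs[OF u v]] by (simp add: ev_const Vs_V sigma_scale u v)
next
  case (var i)
  then show ?case using Vs_V[OF sigma_Vs[OF u v]] by (simp add: ev_var Vs_V sigma_X u v)
next
  case (add f g)
  then show ?case using Vs_V[OF sigma_Vs[OF u v]] by (simp add: ev_plus ev_closed Vs_V sigma_add u v)
next
  case (mult f g)
  then show ?case using Vs_V[OF sigma_Vs[OF u v]] ev_Vs[OF mult.hyps(2) u] by (simp add: ev_mult Vs_V)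
qed

text \<open>Induction on the size of the content: each pair of equal colors is split off as a loop
  at \<open>u\<close>, until a direct path remains.\<close>

lemma ex_path_formula:
  assumes u: "u \<in> verts Q" and w: "w \<in> verts Q"
  shows "(\<And>i. odd (count c i) \<longleftrightarrow> i \<in> sym_diff (\<nu> u) (\<nu> w)) \<Longrightarrow>
    \<exists>fs. (u, fs) \<in> paths Q \<and> path_end Q (u, fs) = w \<and> cols fs = c \<and> (\<forall>x\<in>Vs u. r (u, fs) x = sigma u w (ev (half c) x))"
proof (induction "size c" arbitrary: c rule: less_induct)
  case less
  show ?case
  proof (cases "\<exists>i. count c i \<ge> 2")
    case False
    \<comment> \<open>Multiplicities at most 1 are determined by their parity.\<close>
    have "c = mset_set (sym_diff (\<nu> u) (\<nu> w))"
    proof (rule multiset_eqI)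
      fix i
      have "count c i = 0 \<or> count c i = 1" using False[simplified, rule_format, of i] by linarith
      then show "count c i = count (mset_set (sym_diff (\<nu> u) (\<nu> w))) i"
        using less.prems[of i] by (cases "i \<in> sym_diff (\<nu> u) (\<nu> w)") (auto simp: count_mset_set)
    qed
    moreover have "half (mset_set (sym_diff (\<nu> u) (\<nu> w))) = (\<lambda>x. 1)" by (rule HOL.ext) (rule half_direct)
    ultimately show ?thesis
      using direct[OF u w] by (intro exI[of _ "direct u w"]) (auto simp: sigma_def ev_one Vs_V)
  next
    case True
    then obtain i where i: "count c i \<ge> 2" by blast
    define d where "d = c - {#i, i#}"
    have "{#i, i#} \<subseteq># c" using i by (auto simp: subseteq_mset_def)
    then have "c - {#i, i#} + {#i, i#} = c" by (rule subset_mset.diff_add)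
    then have c: "c = d + {#i, i#}" unfolding d_def by (rule sym)
    have "size d < size c" by (simp add: c)
    moreover have "odd (count d j) \<longleftrightarrow> j \<in> sym_diff (\<nu> u) (\<nu> w)" for j
      unfolding less.prems[symmetric] by (simp add: c)
    ultimately obtain fs where fs: "(u, fs) \<in> paths Q" "path_end Q (u, fs) = w" "cols fs = d"
      "\<And>x. x \<in> Vs u \<Longrightarrow> r (u, fs) x = sigma u w (ev (half d) x)"
      using less.hyps[of d] by blast
    have "half c = (\<lambda>x. half d x * x i)"
      unfolding c by (rule HOL.ext) (simp only: half_add half_loop, auto intro!: prod.neutral)
    then have "r (u, loop u i @ fs) x = sigma u w (ev (half c) x)" if x: "x \<in> Vs u" for x
      using r_mult[OF fs(1) loop(1)[OF u] Vs_V[OF x], of i] loop(2)[OF u] fs(4)[OF X_in_Vs[OF u x]] x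
      by (simp add: X_Vs[OF u x] ev_mult half_polys polys.var Vs_V ev_var)
    then show ?thesis
      using fs loop[OF u] by (intro exI[of _ "loop u i @ fs"]) (auto simp: paths_append path_end_append c)
  qed
qed

text \<open>An arbitrary path is in the same color class as the one built in
  \<open>ex_path_formula\<close>, so it acts by the same operator.\<close>

lemma path_formula:
  assumes p: "(u, es) \<in> paths Q" and x: "x \<in> Vs u"
  shows "r (u, es) x = sigma u (path_end Q (u, es)) (ev (half (cols es)) x)"
proof -
  have V: "u \<in> verts Q" "path_end Q (u, es) \<in> verts Q" using path_verts[OF p] by auto
  have "odd (count (cols es) i) \<longleftrightarrow> i \<in> sym_diff (\<nu> u) (\<nu> (path_end Q (u, es)))" for i
    unfolding cols_parity[OF p] by auto
  from ex_path_formula[OF V this] obtain fs where fs: "(u, fs) \<in> paths Q" "path_end Q (u, fs) = path_end Q (u, es)"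
    "cols fs = cols es" "\<forall>x\<in>Vs u. r (u, fs) x = sigma u (path_end Q (u, es)) (ev (half (cols es)) x)" by blast
  then show ?thesis using r_color[OF p fs(1)] x by simp
qed

text \<open>The counterpart of \<open>Theta_comp\<close>: for two direct paths both factors
  \<open>half\<close> are 1, and only the carry of the concatenation remains.\<close>

lemma sigma_sigma:
  assumes u: "u \<in> verts Q" and v: "v \<in> verts Q" and w: "w \<in> verts Q" and x: "x \<in> Vs u"
  shows "sigma v w (sigma u v x) = sigma u w (ev (crossing (lam u) (lam v) (lam w)) x)"
proof -
  let ?es = "direct u v" and ?fs = "direct v w"
  have p: "(u, ?es) \<in> paths Q" "(path_end Q (u, ?es), ?fs) \<in> paths Q" using direct[OF u v] direct[OF v w] by auto
  have e: "path_end Q (u, ?es @ ?fs) = w" using direct[OF u v] direct[OF v w] by (simp add: path_end_append)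
  have "half (cols (?es @ ?fs)) = crossing (lam u) (lam v) (lam w)"
    using crossing_cols[OF p] unfolding e direct(2)[OF u v] direct(3)[OF u v] direct(3)[OF v w] half_direct
    by (intro HOL.ext) simp
  moreover have "r (u, ?es @ ?fs) x = sigma v w (sigma u v x)"
    unfolding sigma_def using r_mult[OF direct(1)[OF v w] p(1) Vs_V[OF x]] direct(2)[OF u v] by simp
  moreover have "(u, ?es @ ?fs) \<in> paths Q" using p by (simp add: paths_append)
  ultimately show ?thesis using path_formula[of u "?es @ ?fs" x] x e by simp
qed

lemma sigma_self:
  assumes "u \<in> verts Q" "x \<in> Vs u" shows "sigma u u x = x"
proof -
  have "half {#} = (\<lambda>x :: 'i \<Rightarrow> complex. 1)" by (rule HOL.ext) (rule half_empty)
  then have "r (u, []) x = sigma u u x"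
    using path_formula[of u "[]" x] assms ev_one[OF Vs_V[OF assms(2)]] by simp
  moreover have "r (u, []) x = x" using assms(2) by (simp add: Vs_def)
  ultimately show ?thesis by simp
qed

text \<open>Vectors are filtered by the length from which on all paths kill them. A loop has at
  least one arrow, so each \<open>X i\<close>, and with it their sum, lowers the filtration by one,
  while nilpotency of the representation bounds the filtration.\<close>

lemma X_nilpotent: "\<exists>N>0. \<forall>u\<in>verts Q. \<forall>x\<in>Vs u. ev (\<lambda>z. (\<Sum>i\<in>UNIV. z i) ^ N) x = 0 \<and> (\<forall>i. ev (\<lambda>z. z i ^ N) x = 0)"
proof -
  obtain N where N: "\<And>p m. p \<in> paths Q \<Longrightarrow> N \<le> length (snd p) \<Longrightarrow> m \<in> V \<Longrightarrow> r p m = 0"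
    using rep_nilpotent unfolding r_def by blast
  define U where "U n u = {x \<in> Vs u. \<forall>es. (u, es) \<in> paths Q \<longrightarrow> n \<le> length es \<longrightarrow> r (u, es) x = 0}" for n u
  have sub: "subspace (U n u)" if u: "u \<in> verts Q" for n u
    using subspace_Vs[OF u]
    by (intro subspaceI) (auto simp: U_def subspace_0 subspace_add subspace_scale r_0 r_add r_scale Vs_V)
  have X1: "X i x \<in> U n u" if u: "u \<in> verts Q" and x: "x \<in> U (Suc n) u" for i x n u
  proof -
    have xV: "x \<in> Vs u" using x by (simp add: U_def)
    have ne: "loop u i \<noteq> []" using loop(3)[OF u, of i] by auto
    have "r (u, es) (X i x) = 0" if es: "(u, es) \<in> paths Q" "n \<le> length es" for es
    proof -
      have "r (u, es) (X i x) = r (u, loop u i @ es) x"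
        using r_mult[OF es(1) loop(1)[OF u] Vs_V[OF xV], of i] loop(2)[OF u] by (simp add: X_Vs[OF u xV])
      moreover have "(u, loop u i @ es) \<in> paths Q" using loop[OF u] es by (simp add: paths_append)
      moreover have "Suc n \<le> length (loop u i @ es)" using es ne by (cases "loop u i") auto
      ultimately show ?thesis using x unfolding U_def by auto
    qed
    then show ?thesis using X_in_Vs[OF u xV] by (simp add: U_def)
  qed
  have U0: "x = 0" if "u \<in> verts Q" "x \<in> U 0 u" for u x
    using that by (auto simp: U_def Vs_def dest!: spec[of _ "[]"])
  have UN: "x \<in> U (Suc N) u" if "x \<in> Vs u" for x u
    using that N Vs_V by (auto simp: U_def)
  have gen: "ev (\<lambda>z. f z ^ n) x = 0"
    if f: "f \<in> polys" and fU: "\<And>n x. x \<in> U (Suc n) u \<Longrightarrow> ev f x \<in> U n u" and u: "u \<in> verts Q" and x: "x \<in> U n u" for f n x u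
    using x
  proof (induction n arbitrary: x)
    case 0
    then have "x = 0" by (rule U0[OF u])
    then show ?case using subspace_0[OF subspace_rep] ev_one by simp
  next
    case (Suc n)
    have xV: "x \<in> V" using Suc.prems by (simp add: U_def Vs_def)
    have "ev (\<lambda>z. f z ^ Suc n) x = ev (\<lambda>z. f z ^ n) (ev f x)"
      using ev_mult[OF polys_power[OF f, of n] f xV] by (simp add: mult.commute)
    then show ?case using Suc.IH[OF fU[OF Suc.prems]] by simp
  qed
  have "ev (\<lambda>z. \<Sum>i\<in>UNIV. z i) x \<in> U n u" if "u \<in> verts Q" "x \<in> U (Suc n) u" for n x u
  proof -
    have xV: "x \<in> V" using that by (simp add: U_def Vs_def)
    show ?thesis unfolding ev_sum[OF polys.var xV] ev_var[OF xV] by (intro subspace_sum[OF sub] X1 that)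
  qed
  moreover have "ev (\<lambda>z. z i) x \<in> U n u" if "u \<in> verts Q" "x \<in> U (Suc n) u" for i n x u
    using X1[OF that] that by (simp add: ev_var U_def Vs_def)
  \<comment> \<open>\<open>Suc N\<close> keeps the exponent positive, as the definition of weight
    spaces demands.\<close>
  ultimately have "ev (\<lambda>z. (\<Sum>i\<in>UNIV. z i) ^ Suc N) x = 0 \<and> (\<forall>i. ev (\<lambda>z. z i ^ Suc N) x = 0)" if "u \<in> verts Q" "x \<in> Vs u" for u x
    using gen[OF _ _ that(1) UN[OF that(2)]] that by (simp add: polys.var polys_sum del: power_Suc)
  then show ?thesis by (intro exI[of _ "Suc N"]) simp
qed

end

section \<open>The weight module of a representation\<close>

text \<open>The objects of the module categories are subspaces of one fixed space, so the module of finitely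
  supported functions has to be transported there along a linear injection.\<close>

definition embeds :: "(complex \<Rightarrow> 'u \<Rightarrow> 'u::ab_group_add) \<Rightarrow> 'u set \<Rightarrow> (('k \<Rightarrow> 'u) \<Rightarrow> 'u) \<Rightarrow> bool" where
  "embeds scale V J \<longleftrightarrow>
    (\<forall>g g'. finite {l. g l \<noteq> 0} \<longrightarrow> range g \<subseteq> V \<longrightarrow> finite {l. g' l \<noteq> 0} \<longrightarrow> range g' \<subseteq> V \<longrightarrow> J (\<lambda>l. g l + g' l) = J g + J g') \<and>
    (\<forall>c g. finite {l. g l \<noteq> 0} \<longrightarrow> range g \<subseteq> V \<longrightarrow> J (\<lambda>l. scale c (g l)) = scale c (J g)) \<and>
    (\<forall>g. finite {l. g l \<noteq> 0} \<longrightarrow> range g \<subseteq> V \<longrightarrow> J g = 0 \<longrightarrow> g = (\<lambda>l. 0))"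

text \<open>The functions have a basis of pairs of an index and an element of a finite basis
  \<open>B\<close>. There are countably many such pairs, and they are sent injectively into an
  infinite independent set.\<close>

lemma (in complex_vector_space) ex_embeds:
  assumes V: "finite_dimensional scale V" "subspace V" and inf: "\<not> finite_dimensional scale (UNIV :: 'u set)"
  shows "\<exists>J :: ('k::countable \<Rightarrow> 'u) \<Rightarrow> 'u. embeds scale V J"
proof -
  obtain B where B: "B \<subseteq> V" "finite B" "independent B" "span B = V"
    using finite_dimensional_basis[OF V] .
  obtain C where C: "C \<subseteq> (UNIV :: 'u set)" "independent C" "UNIV \<subseteq> span C"
    using maximal_independent_subset by blast
  have "infinite C" using inf C by (auto simp: finite_dimensional_def)
  then obtain f :: "nat \<Rightarrow> 'u" where f: "inj f" "range f \<subseteq> C" using infinite_countable_subset by blast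
  define h where "h p = f (to_nat_on ((UNIV :: 'k set) \<times> B) p)" for p
  have cnt: "countable ((UNIV :: 'k set) \<times> B)" using B by (intro countable_SIGMA) (auto intro: countable_finite)
  have h: "inj_on h (UNIV \<times> B)"
  proof (rule inj_onI)
    fix p q assume p: "p \<in> (UNIV :: 'k set) \<times> B" "q \<in> (UNIV :: 'k set) \<times> B" "h p = h q"
    then show "p = q" using injD[OF f(1), of "to_nat_on (UNIV \<times> B) p" "to_nat_on (UNIV \<times> B) q"]
      inj_onD[OF inj_on_to_nat_on[OF cnt] _ p(1,2)] by (simp add: h_def)
  qed
  have hC: "h ` (UNIV \<times> B) \<subseteq> C" using f by (auto simp: h_def)
  \<comment> \<open>The coordinate at \<open>b\<close> of the value at \<open>l\<close> becomes the
    coefficient of the vector \<open>h (l, b)\<close>.\<close>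
  define J where "J g = (\<Sum>p\<in>{l. g l \<noteq> 0} \<times> B. scale (representation B (g (fst p)) (snd p)) (h p))" for g :: "'k \<Rightarrow> 'u"
  have sup: "J g = (\<Sum>p\<in>S \<times> B. scale (representation B (g (fst p)) (snd p)) (h p))" if "finite S" "{l. g l \<noteq> 0} \<subseteq> S" for g S
    unfolding J_def using that B by (intro sum.mono_neutral_left) (auto simp: representation_zero)
  have "J (\<lambda>l. g l + g' l) = J g + J g'"
    if g: "finite {l. g l \<noteq> 0}" "range g \<subseteq> V" "finite {l. g' l \<noteq> 0}" "range g' \<subseteq> V" for g g'
  proof -
    let ?S = "{l. g l \<noteq> 0} \<union> {l. g' l \<noteq> 0}"
    have S: "finite ?S" using g by simp
    have "g l \<in> span B" "g' l \<in> span B" for l using g B by auto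
    moreover have "J (\<lambda>l. g l + g' l) = (\<Sum>p\<in>?S \<times> B. scale (representation B (g (fst p) + g' (fst p)) (snd p)) (h p))"
      by (rule sup[OF S]) auto
    moreover have "J g = (\<Sum>p\<in>?S \<times> B. scale (representation B (g (fst p)) (snd p)) (h p))"
      "J g' = (\<Sum>p\<in>?S \<times> B. scale (representation B (g' (fst p)) (snd p)) (h p))"
      by (rule sup[OF S]; auto)+
    ultimately show ?thesis
      by (simp add: representation_add[OF B(3)] scale_left_distrib sum.distrib)
  qed
  moreover have "J (\<lambda>l. scale c (g l)) = scale c (J g)" if g: "finite {l. g l \<noteq> 0}" "range g \<subseteq> V" for c g
  proof -
    have "g l \<in> span B" for l using g B by auto
    moreover have "J (\<lambda>l. scale c (g l)) = (\<Sum>p\<in>{l. g l \<noteq> 0} \<times> B. scale (representation B (scale c (g (fst p))) (snd p)) (h p))"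
      by (rule sup[OF g(1)]) auto
    ultimately show ?thesis
      by (simp add: representation_scale[OF B(3)] J_def scale_sum_right)
  qed
  moreover have "g = (\<lambda>l. 0)" if g: "finite {l. g l \<noteq> 0}" "range g \<subseteq> V" and 0: "J g = 0" for g
  proof
    fix l
    show "g l = 0"
    proof (rule ccontr)
      assume nz: "g l \<noteq> 0"
      let ?P = "{l. g l \<noteq> 0} \<times> B"
      have fin: "finite (h ` ?P)" using g B by simp
      have sub: "h ` ?P \<subseteq> C" using hC by auto
      have inj: "inj_on h ?P" using h by (rule inj_on_subset) auto
      let ?u = "\<lambda>c. representation B (g (fst (inv_into ?P h c))) (snd (inv_into ?P h c))"
      have "(\<Sum>c\<in>h ` ?P. scale (?u c) c) = J g"
        unfolding J_def by (subst sum.reindex[OF inj]) (simp add: inv_into_f_f[OF inj])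
      then have sum0: "(\<Sum>c\<in>h ` ?P. scale (?u c) c) = 0" using 0 by simp
      have rep0: "representation B (g l) b = 0" if b: "b \<in> B" for b
      proof -
        have P: "(l, b) \<in> ?P" using nz b by simp
        have "?u (h (l, b)) = 0" by (rule independentD[OF C(2) fin sub sum0 imageI[OF P]])
        then show ?thesis by (simp add: inv_into_f_f[OF inj P])
      qed
      have "g l \<in> span B" using g B by auto
      then have "(\<Sum>b\<in>B. scale (representation B (g l) b) b) = g l"
        by (rule sum_representation_eq[OF B(3) _ B(2) order_refl])
      then show False using nz rep0 by simp
    qed
  qed
  ultimately show ?thesis unfolding embeds_def by blast
qed

section \<open>Finitely supported functions with the action of kernels\<close>

context quiver_rep
begin

abbreviation "deg l \<equiv> (\<Sum>i\<in>UNIV. l i :: int)"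
abbreviation "tv \<equiv> type_vertex"

text \<open>Dictated by \<open>W_Theta\<close>: the plain shift from \<open>l\<close> to
  \<open>m\<close> with coefficient \<open>K\<close> must act as the normalized shift with this
  polynomial.\<close>

definition entry :: "(('i \<Rightarrow> int) \<Rightarrow> ('i \<Rightarrow> complex) \<Rightarrow> complex) \<Rightarrow> ('i \<Rightarrow> int) \<Rightarrow> ('i \<Rightarrow> int) \<Rightarrow> ('i \<Rightarrow> complex) \<Rightarrow> complex" where
  "entry K l m x = K (\<lambda>i. m i - l i) (plus_int x l) * descent l m x"

definition E :: "(('i \<Rightarrow> int) \<Rightarrow> ('i \<Rightarrow> complex) \<Rightarrow> complex) \<Rightarrow> ('i \<Rightarrow> int) \<Rightarrow> ('i \<Rightarrow> int) \<Rightarrow> 'u \<Rightarrow> 'u" where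
  "E K l m v = sigma (tv l) (tv m) (ev (entry K l m) v)"

definition balanced_kernel :: "(('i \<Rightarrow> int) \<Rightarrow> ('i \<Rightarrow> complex) \<Rightarrow> complex) \<Rightarrow> bool" where
  "balanced_kernel K \<longleftrightarrow> (\<forall>\<alpha>. K \<alpha> \<in> polys) \<and> finite {\<alpha>. K \<alpha> \<noteq> (\<lambda>z. 0)} \<and> (\<forall>\<alpha>. K \<alpha> \<noteq> (\<lambda>z. 0) \<longrightarrow> deg \<alpha> = 0)"

lemma kernel_balanced: "d \<in> carrier weyl_centralizer \<Longrightarrow> balanced_kernel (kernel d)"
  using kernel_weyl[of d] kernel_centralizer[of d] by (auto simp: balanced_kernel_def has_kernel_def weyl_centralizer_def)

definition M0 :: "(('i \<Rightarrow> int) \<Rightarrow> 'u) set" where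
  "M0 = {g. finite {l. g l \<noteq> 0} \<and> (\<forall>l. deg l = a \<longrightarrow> g l \<in> Vs (tv l)) \<and> (\<forall>l. deg l \<noteq> a \<longrightarrow> g l = 0)}"

text \<open>A matrix of operators, attached to kernels instead of operators because sums and
  composites of operators are computed on kernels.\<close>

definition act0 :: "(('i \<Rightarrow> int) \<Rightarrow> ('i \<Rightarrow> complex) \<Rightarrow> complex) \<Rightarrow> (('i \<Rightarrow> int) \<Rightarrow> 'u) \<Rightarrow> ('i \<Rightarrow> int) \<Rightarrow> 'u" where
  "act0 K g m = (if deg m = a then \<Sum>l\<in>{l. g l \<noteq> 0}. E K l m (g l) else 0)"

lemma M0_degree: "g \<in> M0 \<Longrightarrow> g l \<noteq> 0 \<Longrightarrow> deg l = a"
  and M0_finite: "g \<in> M0 \<Longrightarrow> finite {l. g l \<noteq> 0}"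
  and M0_Vs: "g \<in> M0 \<Longrightarrow> deg l = a \<Longrightarrow> g l \<in> Vs (tv l)"
  by (auto simp: M0_def)

lemma M0_V: "g \<in> M0 \<Longrightarrow> g l \<in> V"
  using subspace_0[OF subspace_rep] Vs_V by (cases "deg l = a") (auto simp: M0_def)

lemma M0_add: "g \<in> M0 \<Longrightarrow> g' \<in> M0 \<Longrightarrow> (\<lambda>l. g l + g' l) \<in> M0"
proof -
  assume g: "g \<in> M0" "g' \<in> M0"
  have "{l. g l + g' l \<noteq> 0} \<subseteq> {l. g l \<noteq> 0} \<union> {l. g' l \<noteq> 0}" by auto
  then have "finite {l. g l + g' l \<noteq> 0}" by (rule finite_subset) (use g in \<open>simp add: M0_def\<close>)
  then show ?thesis using g
    by (auto simp: M0_def intro!: subspace_add[OF subspace_Vs[OF type_vertex(1)]])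
qed

lemma M0_scale: "g \<in> M0 \<Longrightarrow> (\<lambda>l. scale c (g l)) \<in> M0"
  using finite_subset[of "{l. scale c (g l) \<noteq> 0}" "{l. g l \<noteq> 0}"]
  by (auto simp: M0_def intro!: subspace_scale[OF subspace_Vs[OF type_vertex(1)]])

lemma M0_0: "(\<lambda>l. 0) \<in> M0"
  by (auto simp: M0_def intro!: subspace_0[OF subspace_Vs[OF type_vertex(1)]])

context
  fixes K assumes K: "balanced_kernel K"
begin

lemma kernel_polys: "K \<alpha> \<in> polys"
  using K by (simp add: balanced_kernel_def)

lemma entry_polys: "entry K l m \<in> polys"
  unfolding entry_def[abs_def] by (intro polys.mult polys_shift kernel_polys descent_polys)

context
  fixes l m :: "'i \<Rightarrow> int" assumes l: "deg l = a" and m: "deg m = a"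
begin

lemma E_Vs: "v \<in> Vs (tv l) \<Longrightarrow> E K l m v \<in> Vs (tv m)"
  unfolding E_def
  by (intro sigma_Vs[OF type_vertex(1)[OF l] type_vertex(1)[OF m]] ev_closed[OF entry_polys] Vs_V)

lemma E_add: "v \<in> V \<Longrightarrow> w \<in> V \<Longrightarrow> E K l m (v + w) = E K l m v + E K l m w"
  unfolding E_def using type_vertex(1)[OF l] type_vertex(1)[OF m]
  by (simp add: ev_add entry_polys sigma_add ev_closed)

lemma E_0: "E K l m 0 = 0"
  using E_add[of 0 0] subspace_0[OF subspace_rep] by simp

lemma E_zero:
  assumes "v \<in> V" "K (\<lambda>i. m i - l i) = (\<lambda>z. 0)" shows "E K l m v = 0"
proof -
  have "entry K l m = (\<lambda>x. 0)" by (auto simp: entry_def assms)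
  then show ?thesis unfolding E_def using type_vertex(1)[OF l] type_vertex(1)[OF m] assms(1)
    by (simp add: ev_const sigma_0)
qed

end

lemma act0_superset:
  assumes "g \<in> M0" "finite S" "{l. g l \<noteq> 0} \<subseteq> S" "\<And>l. l \<in> S \<Longrightarrow> deg l = a" "deg m = a"
  shows "act0 K g m = (\<Sum>l\<in>S. E K l m (g l))"
proof -
  have "(\<Sum>l\<in>{l. g l \<noteq> 0}. E K l m (g l)) = (\<Sum>l\<in>S. E K l m (g l))"
    by (rule sum.mono_neutral_left[OF assms(2,3)]) (auto simp: E_0 assms)
  then show ?thesis using assms(5) by (simp add: act0_def)
qed

lemma act0_support: "g \<in> M0 \<Longrightarrow> {m. act0 K g m \<noteq> 0} \<subseteq> (\<lambda>(l, \<alpha>) i. l i + \<alpha> i) ` ({l. g l \<noteq> 0} \<times> {\<alpha>. K \<alpha> \<noteq> (\<lambda>z. 0)})"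
proof
  fix m assume g: "g \<in> M0" and "m \<in> {m. act0 K g m \<noteq> 0}"
  then have nz: "act0 K g m \<noteq> 0" by simp
  then have m: "deg m = a" by (auto simp: act0_def split: if_splits)
  with nz have "(\<Sum>l\<in>{l. g l \<noteq> 0}. E K l m (g l)) \<noteq> 0" by (simp add: act0_def)
  then obtain l where l: "l \<in> {l. g l \<noteq> 0}" "E K l m (g l) \<noteq> 0" by (rule sum.not_neutral_contains_not_neutral)
  then have "K (\<lambda>i. m i - l i) \<noteq> (\<lambda>z. 0)" using E_zero[OF _ m M0_V[OF g]] M0_degree[OF g] by auto
  then show "m \<in> (\<lambda>(l, \<alpha>) i. l i + \<alpha> i) ` ({l. g l \<noteq> 0} \<times> {\<alpha>. K \<alpha> \<noteq> (\<lambda>z. 0)})"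
    using l(1) by (intro image_eqI[of _ _ "(l, \<lambda>i. m i - l i)"]) auto
qed

lemma act0_M0:
  assumes g: "g \<in> M0" shows "act0 K g \<in> M0"
proof -
  have "finite {m. act0 K g m \<noteq> 0}"
    using act0_support[OF g] by (rule finite_subset) (use M0_finite[OF g] K in \<open>auto simp: balanced_kernel_def\<close>)
  moreover have "act0 K g m \<in> Vs (tv m)" if m: "deg m = a" for m
    using m M0_degree[OF g] M0_Vs[OF g]
    by (auto simp: act0_def intro!: subspace_sum[OF subspace_Vs[OF type_vertex(1)[OF m]]] E_Vs)
  ultimately show ?thesis by (simp add: M0_def act0_def)
qed

lemma act0_add:
  assumes g: "g \<in> M0" "g' \<in> M0" shows "act0 K (\<lambda>l. g l + g' l) = (\<lambda>m. act0 K g m + act0 K g' m)"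
proof
  fix m
  show "act0 K (\<lambda>l. g l + g' l) m = act0 K g m + act0 K g' m"
  proof (cases "deg m = a")
    case True
    let ?S = "{l. g l \<noteq> 0} \<union> {l. g' l \<noteq> 0}"
    have S: "finite ?S" "\<And>l. l \<in> ?S \<Longrightarrow> deg l = a" using g by (auto simp: M0_finite intro: M0_degree)
    have "act0 K (\<lambda>l. g l + g' l) m = (\<Sum>l\<in>?S. E K l m (g l + g' l))"
      by (rule act0_superset[OF M0_add[OF g] S(1) _ S(2) True]) auto
    also have "\<dots> = (\<Sum>l\<in>?S. E K l m (g l) + E K l m (g' l))"
      by (intro sum.cong refl E_add[OF S(2) True] M0_V g)
    also have "\<dots> = act0 K g m + act0 K g' m"
      unfolding sum.distrib by (simp only: act0_superset[OF g(1) S(1) _ S(2) True] act0_superset[OF g(2) S(1) _ S(2) True] Un_upper1 Un_upper2)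
    finally show ?thesis .
  qed (simp add: act0_def)
qed

end

lemma act0_plus:
  assumes K: "balanced_kernel K" "balanced_kernel K'" and g: "g \<in> M0"
  shows "act0 (\<lambda>\<alpha> z. K \<alpha> z + K' \<alpha> z) g = (\<lambda>m. act0 K g m + act0 K' g m)"
proof
  fix m
  have "E (\<lambda>\<alpha> z. K \<alpha> z + K' \<alpha> z) l m (g l) = E K l m (g l) + E K' l m (g l)" if "deg l = a" "deg m = a" for l
  proof -
    have "entry (\<lambda>\<alpha> z. K \<alpha> z + K' \<alpha> z) l m = (\<lambda>x. entry K l m x + entry K' l m x)" by (auto simp: entry_def distrib_right)
    then show ?thesis unfolding E_def using type_vertex(1)[OF that(1)] type_vertex(1)[OF that(2)] M0_V[OF g]
      by (simp add: ev_plus entry_polys[OF K(1)] entry_polys[OF K(2)] sigma_add ev_closed)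
  qed
  then show "act0 (\<lambda>\<alpha> z. K \<alpha> z + K' \<alpha> z) g m = act0 K g m + act0 K' g m"
    using M0_degree[OF g] by (simp add: act0_def sum.distrib[symmetric])
qed

text \<open>\<open>sigma\<close> commutes with polynomials in the \<open>X i\<close>, so both
  entries move to the first vertex and the direct paths leave one crossing. Since it depends on
  types only, it may be taken at the weights themselves.\<close>

lemma E_comp:
  assumes K: "balanced_kernel K" "balanced_kernel K'" and l: "deg l = a" and m: "deg m = a" and n: "deg n = a" and v: "v \<in> Vs (tv l)"
  shows "E K m n (E K' l m v) = sigma (tv l) (tv n) (ev (\<lambda>x. crossing l m n x * (entry K m n x * entry K' l m x)) v)"
proof -
  note t = type_vertex(1)[OF l] type_vertex(1)[OF m] type_vertex(1)[OF n]
  note e = entry_polys[OF K(1)] entry_polys[OF K(2)]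
  have w: "ev (entry K' l m) v \<in> Vs (tv l)" by (rule ev_Vs[OF e(2) t(1) v])
  have w2: "ev (entry K m n) (ev (entry K' l m) v) \<in> Vs (tv l)" by (rule ev_Vs[OF e(1) t(1) w])
  have lam: "(0 \<le> lam (tv l) i) = (0 \<le> l i)" if "deg l = a" for l i using type_vertex(3)[OF that] by auto
  have c: "crossing (lam (tv l)) (lam (tv m)) (lam (tv n)) = crossing l m n"
    unfolding crossing_def[abs_def] crossing_iff lam[OF l] lam[OF m] lam[OF n] ..
  have "E K m n (E K' l m v) = sigma (tv m) (tv n) (sigma (tv l) (tv m) (ev (entry K m n) (ev (entry K' l m) v)))"
    unfolding E_def sigma_ev[OF t(1,2) e(1) w, symmetric] ..
  also have "\<dots> = sigma (tv l) (tv n) (ev (crossing l m n) (ev (entry K m n) (ev (entry K' l m) v)))"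
    unfolding sigma_sigma[OF t w2] c ..
  also have "\<dots> = sigma (tv l) (tv n) (ev (\<lambda>x. crossing l m n x * (entry K m n x * entry K' l m x)) v)"
    by (simp only: ev_mult[OF crossing_polys polys.mult[OF e] Vs_V[OF v]] ev_mult[OF e Vs_V[OF v]])
  finally show ?thesis .
qed

text \<open>Summand by summand this is \<open>descent_turn\<close>: the crossing contributed by
  \<open>sigma_sigma\<close> balances the factor \<open>turn\<close> of
  \<open>kernel_comp\<close>.\<close>

lemma entry_comp:
  "entry (kernel_comp K K') l n x = (\<Sum>\<alpha>\<in>{\<alpha>. K' \<alpha> \<noteq> (\<lambda>z. 0)}.
     crossing l (\<lambda>i. l i + \<alpha> i) n x * (entry K (\<lambda>i. l i + \<alpha> i) n x * entry K' l (\<lambda>i. l i + \<alpha> i) x))"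
  unfolding entry_def[of "kernel_comp K K'"] kernel_comp_def sum_distrib_right
proof (intro sum.cong refl)
  fix \<alpha>
  have 1: "(\<lambda>i. n i - (l i + \<alpha> i)) = (\<lambda>i. n i - l i - \<alpha> i)" "(\<lambda>i. l i + \<alpha> i - l i) = \<alpha>"
    "plus_int x (\<lambda>i. l i + \<alpha> i) = plus_int (plus_int x l) \<alpha>" by (auto simp: algebra_simps)
  have t: "descent (\<lambda>i. l i + \<alpha> i) n x * descent l (\<lambda>i. l i + \<alpha> i) x * crossing l (\<lambda>i. l i + \<alpha> i) n x =
     turn (\<lambda>i. n i - l i - \<alpha> i) \<alpha> (plus_int x l) * descent l n x"
    using descent_turn[of "\<lambda>i. l i + \<alpha> i" n x l] unfolding 1 .
  have "T * k * k' * D = c * ((k * d1) * (k' * d2))" if "d1 * d2 * c = T * D" for T D k k' c d1 d2 :: complex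
  proof -
    have "T * k * k' * D = T * D * (k * k')" by (simp add: mult_ac)
    then show ?thesis unfolding that[symmetric] by (simp add: mult_ac)
  qed
  from this[OF t] show "turn (\<lambda>i. n i - l i - \<alpha> i) \<alpha> (plus_int x l) * K (\<lambda>i. n i - l i - \<alpha> i) (plus_int (plus_int x l) \<alpha>) * K' \<alpha> (plus_int x l) * descent l n x =
     crossing l (\<lambda>i. l i + \<alpha> i) n x * (entry K (\<lambda>i. l i + \<alpha> i) n x * entry K' l (\<lambda>i. l i + \<alpha> i) x)"
    unfolding entry_def 1 .
qed

text \<open>Matrix multiplication. The two sides differ in how they index the middle: by
  intermediate weights or by the shifts leading there.\<close>

lemma act0_comp:
  assumes K: "balanced_kernel K" "balanced_kernel K'" and g: "g \<in> M0"
  shows "act0 (kernel_comp K K') g = act0 K (act0 K' g)"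
proof
  fix n
  let ?A = "{\<alpha>. K' \<alpha> \<noteq> (\<lambda>z. 0)}" and ?S = "{l. g l \<noteq> 0}"
  have A: "finite ?A" "\<And>\<alpha>. \<alpha> \<in> ?A \<Longrightarrow> deg \<alpha> = 0" using K by (auto simp: balanced_kernel_def)
  have S: "finite ?S" "\<And>l. l \<in> ?S \<Longrightarrow> deg l = a" using g M0_finite M0_degree by auto
  let ?T = "(\<lambda>(l, \<alpha>) i. l i + \<alpha> i) ` (?S \<times> ?A)"
  show "act0 (kernel_comp K K') g n = act0 K (act0 K' g) n"
  proof (cases "deg n = a")
    case n: True
    have T: "finite ?T" "\<And>m. m \<in> ?T \<Longrightarrow> deg m = a" using S A by (auto simp: sum.distrib)
    have EV: "E K' l m (g l) \<in> Vs (tv m)" if "l \<in> ?S" "deg m = a" for l m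
      by (rule E_Vs[OF K(2) S(2)[OF that(1)] that(2) M0_Vs[OF g S(2)[OF that(1)]]])
    have "act0 K (act0 K' g) n = (\<Sum>m\<in>?T. E K m n (act0 K' g m))"
      by (rule act0_superset[OF K(1) act0_M0[OF K(2) g] T(1) act0_support[OF K(2) g] T(2) n])
    also have "\<dots> = (\<Sum>m\<in>?T. \<Sum>l\<in>?S. E K m n (E K' l m (g l)))"
    proof (intro sum.cong refl)
      fix m assume m: "m \<in> ?T"
      have "E K m n (act0 K' g m) = E K m n (\<Sum>l\<in>?S. E K' l m (g l))" using T(2)[OF m] by (simp add: act0_def)
      also have "\<dots> = (\<Sum>l\<in>?S. E K m n (E K' l m (g l)))"
        by (rule additive_sum[OF subspace_rep]) (auto intro: E_add[OF K(1) T(2)[OF m] n] Vs_V[OF EV[OF _ T(2)[OF m]]])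
      finally show "E K m n (act0 K' g m) = (\<Sum>l\<in>?S. E K m n (E K' l m (g l)))" .
    qed
    also have "\<dots> = (\<Sum>l\<in>?S. \<Sum>m\<in>?T. E K m n (E K' l m (g l)))" by (rule sum.swap)
    also have "\<dots> = (\<Sum>l\<in>?S. E (kernel_comp K K') l n (g l))"
    proof (intro sum.cong refl)
      fix l assume l: "l \<in> ?S"
      let ?f = "\<lambda>\<alpha> i. l i + \<alpha> i"
      have inj: "inj_on ?f ?A" by (auto simp: inj_on_def fun_eq_iff)
      have fd: "deg (?f \<alpha>) = a" if "\<alpha> \<in> ?A" for \<alpha> using A(2)[OF that] S(2)[OF l] by (simp add: sum.distrib)
      \<comment> \<open>\<open>?T\<close> collects the weights reached from any point of the support
        of \<open>g\<close>; from this particular \<open>l\<close> only \<open>l + \<alpha>\<close>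
        with a shift of \<open>K'\<close> contributes.\<close>
      have "(\<Sum>m\<in>?T. E K m n (E K' l m (g l))) = (\<Sum>m\<in>?f ` ?A. E K m n (E K' l m (g l)))"
      proof (rule sum.mono_neutral_right[OF T(1)])
        show "?f ` ?A \<subseteq> ?T" using l by auto
        show "\<forall>m\<in>?T - ?f ` ?A. E K m n (E K' l m (g l)) = 0"
        proof
          fix m assume m: "m \<in> ?T - ?f ` ?A"
          have "K' (\<lambda>i. m i - l i) = (\<lambda>z. 0)"
          proof (rule ccontr)
            assume "K' (\<lambda>i. m i - l i) \<noteq> (\<lambda>z. 0)"
            then have "m \<in> ?f ` ?A" by (intro image_eqI[of _ _ "\<lambda>i. m i - l i"]) auto
            then show False using m by blast
          qed
          then have "E K' l m (g l) = 0" using E_zero[OF K(2) S(2)[OF l] T(2) M0_V[OF g]] m by blast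
          then show "E K m n (E K' l m (g l)) = 0" using E_0[OF K(1) T(2) n] m by simp
        qed
      qed
      also have "\<dots> = (\<Sum>\<alpha>\<in>?A. E K (?f \<alpha>) n (E K' l (?f \<alpha>) (g l)))"
        by (simp add: sum.reindex[OF inj])
      also have "\<dots> = (\<Sum>\<alpha>\<in>?A. sigma (tv l) (tv n) (ev (\<lambda>x. crossing l (?f \<alpha>) n x * (entry K (?f \<alpha>) n x * entry K' l (?f \<alpha>) x)) (g l)))"
        by (intro sum.cong refl E_comp[OF K S(2)[OF l] fd n M0_Vs[OF g S(2)[OF l]]])
      also have "\<dots> = sigma (tv l) (tv n) (\<Sum>\<alpha>\<in>?A. ev (\<lambda>x. crossing l (?f \<alpha>) n x * (entry K (?f \<alpha>) n x * entry K' l (?f \<alpha>) x)) (g l))"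
        by (rule additive_sum[OF subspace_rep, symmetric])
          (auto intro!: sigma_add type_vertex(1) S(2)[OF l] n ev_closed M0_V[OF g] polys.mult crossing_polys entry_polys K)
      also have "(\<Sum>\<alpha>\<in>?A. ev (\<lambda>x. crossing l (?f \<alpha>) n x * (entry K (?f \<alpha>) n x * entry K' l (?f \<alpha>) x)) (g l)) =
          ev (entry (kernel_comp K K') l n) (g l)"
        unfolding entry_comp[abs_def]
        by (rule ev_sum[symmetric]) (intro polys.mult crossing_polys entry_polys K M0_V g)+
      finally show "(\<Sum>m\<in>?T. E K m n (E K' l m (g l))) = E (kernel_comp K K') l n (g l)" by (simp add: E_def)
    qed
    finally show ?thesis using n by (simp add: act0_def)
  qed (simp add: act0_def)
qed

text \<open>Covers the scalars, the \<open>t\<^sub>i\<partial>\<^sub>i\<close> and the Euler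
  operator, which determine the weight structure.\<close>

lemma act0_diagonal:
  assumes k: "k \<in> polys" and g: "g \<in> M0"
  shows "act0 (\<lambda>\<alpha>. if \<alpha> = (\<lambda>_. 0) then k else (\<lambda>z. 0)) g = (\<lambda>m. ev (\<lambda>x. k (plus_int x m)) (g m))"
proof
  fix m
  let ?K = "\<lambda>\<alpha>. if \<alpha> = (\<lambda>_. 0) then k else (\<lambda>z. 0)"
  have "{\<alpha>. ?K \<alpha> \<noteq> (\<lambda>z. 0)} \<subseteq> {\<lambda>_. 0}" by auto
  then have K: "balanced_kernel ?K" using k finite_subset
    by (auto simp: balanced_kernel_def intro: polys.const split: if_splits)
  have kp: "(\<lambda>x. k (plus_int x m)) \<in> polys" by (rule polys_shift[OF k])
  show "act0 ?K g m = ev (\<lambda>x. k (plus_int x m)) (g m)"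
  proof (cases "deg m = a")
    case m: True
    have "E ?K l m (g l) = 0" if "l \<noteq> m" "deg l = a" for l
    proof -
      have "(\<lambda>i. m i - l i) \<noteq> (\<lambda>_. 0)"
      proof
        assume "(\<lambda>i. m i - l i) = (\<lambda>_. 0)"
        then have "l = m" by (auto simp: fun_eq_iff)
        then show False using that(1) by blast
      qed
      then show ?thesis by (intro E_zero[OF K that(2) m M0_V[OF g]]) simp
    qed
    moreover have "E ?K m m (g m) = ev (\<lambda>x. k (plus_int x m)) (g m)"
      unfolding E_def entry_def[abs_def]
      by (simp add: sigma_self[OF type_vertex(1)[OF m] ev_Vs[OF kp type_vertex(1)[OF m] M0_Vs[OF g m]]])
    moreover have "act0 ?K g m = (\<Sum>l\<in>insert m {l. g l \<noteq> 0}. E ?K l m (g l))"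
      using M0_degree[OF g] M0_finite[OF g] m by (intro act0_superset[OF K g]) auto
    moreover have "(\<Sum>l\<in>insert m {l. g l \<noteq> 0}. E ?K l m (g l)) = (\<Sum>l\<in>{m}. E ?K l m (g l))"
      using calculation(1) M0_degree[OF g] M0_finite[OF g] m by (intro sum.mono_neutral_right) auto
    ultimately show ?thesis by simp
  next
    case False
    then have "g m = 0" using g by (simp add: M0_def)
    then show ?thesis using False by (simp add: act0_def ev_0[OF kp])
  qed
qed

end

section \<open>Transport of the functions into the universe\<close>

locale embedded_rep = quiver_rep Q R col \<nu> scale a lam V actV
  for Q :: "('v, 'e) quiver" and R and col :: "'e \<Rightarrow> 'i::finite multiset" and \<nu> :: "'v \<Rightarrow> 'i set"
    and scale :: "complex \<Rightarrow> 'u \<Rightarrow> 'u::ab_group_add" and a lam V and actV :: "(('v, 'e) path \<Rightarrow> complex) set \<Rightarrow> 'u \<Rightarrow> 'u" +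
  fixes Jm :: "(('i \<Rightarrow> int) \<Rightarrow> 'u) \<Rightarrow> 'u"
  assumes Jm: "embeds scale V Jm"
begin

lemma M0_range: "g \<in> M0 \<Longrightarrow> range g \<subseteq> V"
  using M0_V by auto

lemma J_add: "g \<in> M0 \<Longrightarrow> g' \<in> M0 \<Longrightarrow> Jm (\<lambda>l. g l + g' l) = Jm g + Jm g'"
  by (rule Jm[unfolded embeds_def, THEN conjunct1, rule_format, OF M0_finite M0_range M0_finite M0_range])

lemma J_scale: "g \<in> M0 \<Longrightarrow> Jm (\<lambda>l. scale c (g l)) = scale c (Jm g)"
  by (rule Jm[unfolded embeds_def, THEN conjunct2, THEN conjunct1, rule_format, OF M0_finite M0_range])

lemma J_eq_0: "g \<in> M0 \<Longrightarrow> Jm g = 0 \<Longrightarrow> g = (\<lambda>l. 0)"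
  by (rule Jm[unfolded embeds_def, THEN conjunct2, THEN conjunct2, rule_format, OF M0_finite M0_range])

lemma J_0: "Jm (\<lambda>l. 0) = 0"
  using J_add[OF M0_0 M0_0] by simp

lemma J_diff: "g \<in> M0 \<Longrightarrow> g' \<in> M0 \<Longrightarrow> Jm (\<lambda>l. g l - g' l) = Jm g - Jm g' \<and> (\<lambda>l. g l - g' l) \<in> M0"
  using J_add[of g "\<lambda>l. scale (-1) (g' l)"] J_scale[of g' "-1"] M0_scale[of g' "-1"] M0_add[of g "\<lambda>l. scale (-1) (g' l)"]
  by simp

lemma inj_J: "inj_on Jm M0"
proof (rule inj_onI)
  fix g g' assume g: "g \<in> M0" "g' \<in> M0" "Jm g = Jm g'"
  then have "(\<lambda>l. g l - g' l) = (\<lambda>l. 0)" using J_diff[OF g(1,2)] by (intro J_eq_0) auto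
  then show "g = g'" by (auto simp: fun_eq_iff)
qed

lemma J_sum: "(\<And>j. j \<in> S \<Longrightarrow> g j \<in> M0) \<Longrightarrow> (\<Sum>j\<in>S. Jm (g j)) = Jm (\<lambda>l. \<Sum>j\<in>S. g j l) \<and> (\<lambda>l. \<Sum>j\<in>S. g j l) \<in> M0"
proof (induction S rule: infinite_finite_induct)
  case (insert j S)
  then show ?case using J_add[of "g j" "\<lambda>l. \<Sum>j\<in>S. g j l"] M0_add[of "g j" "\<lambda>l. \<Sum>j\<in>S. g j l"] by simp
qed (auto simp: J_0 M0_0)

definition wmod :: "'u set" where
  "wmod = Jm ` M0"

definition actM :: "'i operator \<Rightarrow> 'u \<Rightarrow> 'u" where
  "actM d m = Jm (act0 (kernel d) (inv_into M0 Jm m))"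

lemma wmodI: "g \<in> M0 \<Longrightarrow> Jm g \<in> wmod"
  by (simp add: wmod_def)

lemma wmodE: assumes "m \<in> wmod" obtains g where "g \<in> M0" "m = Jm g"
  using assms by (auto simp: wmod_def)

lemma actM_J: "g \<in> M0 \<Longrightarrow> actM d (Jm g) = Jm (act0 (kernel d) g)"
  by (simp add: actM_def inv_into_f_f[OF inj_J])

lemma actM_wop0: "k \<in> polys \<Longrightarrow> g \<in> M0 \<Longrightarrow> actM (wop (\<lambda>_. 0) k) (Jm g) = Jm (\<lambda>m. ev (\<lambda>x. k (plus_int x m)) (g m))"
  unfolding actM_J kernel_eq[OF has_kernel_wop] by (simp only: act0_diagonal)

lemma ev_M0: "(\<And>m. k m \<in> polys) \<Longrightarrow> g \<in> M0 \<Longrightarrow> (\<lambda>m. ev (k m) (g m)) \<in> M0"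
proof -
  assume k: "\<And>m. k m \<in> polys" and g: "g \<in> M0"
  have "{m. ev (k m) (g m) \<noteq> 0} \<subseteq> {m. g m \<noteq> 0}" using ev_0[OF k] by auto
  then have "finite {m. ev (k m) (g m) \<noteq> 0}" using M0_finite[OF g] by (rule finite_subset)
  moreover have "ev (k m) (g m) \<in> Vs (tv m)" if "deg m = a" for m
    using ev_Vs[OF k type_vertex(1)[OF that] M0_Vs[OF g that]] .
  moreover have "ev (k m) (g m) = 0" if "deg m \<noteq> a" for m
    using g that ev_0[OF k] by (simp add: M0_def)
  ultimately show ?thesis by (simp add: M0_def)
qed

lemma wmod_module: "left_module scale weyl_centralizer (wmod, actM)"
  unfolding left_module_def prod.case
proof (intro conjI ballI allI)
  show "subspace wmod"
  proof (rule subspaceI)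
    show "0 \<in> wmod" using wmodI[OF M0_0] J_0 by simp
    show "x + y \<in> wmod" if xy: "x \<in> wmod" "y \<in> wmod" for x y
    proof -
      obtain g g' where g: "g \<in> M0" "x = Jm g" "g' \<in> M0" "y = Jm g'" using xy by (auto elim!: wmodE)
      show ?thesis unfolding g(2,4) J_add[OF g(1,3), symmetric] by (rule wmodI[OF M0_add[OF g(1,3)]])
    qed
    show "scale c x \<in> wmod" if x: "x \<in> wmod" for c x
    proof -
      obtain g where g: "g \<in> M0" "x = Jm g" using x by (rule wmodE)
      show ?thesis unfolding g(2) J_scale[OF g(1), symmetric] by (rule wmodI[OF M0_scale[OF g(1)]])
    qed
  qed
next
  fix d m assume "d \<in> carrier (weyl_centralizer :: 'i operator calgebra)" "m \<in> wmod"
  then show "actM d m \<in> wmod"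
    by (auto elim!: wmodE simp: actM_J intro!: wmodI act0_M0 kernel_balanced)
next
  fix d m m' assume d: "d \<in> carrier (weyl_centralizer :: 'i operator calgebra)" and "m \<in> wmod" "m' \<in> wmod"
  then obtain g g' where g: "g \<in> M0" "m = Jm g" "g' \<in> M0" "m' = Jm g'" by (auto elim!: wmodE)
  note K = kernel_balanced[OF d]
  show "actM d (m + m') = actM d m + actM d m'"
    unfolding g J_add[OF g(1,3), symmetric] actM_J[OF g(1)] actM_J[OF g(3)] actM_J[OF M0_add[OF g(1,3)]] act0_add[OF K g(1,3)]
    by (rule J_add[OF act0_M0[OF K g(1)] act0_M0[OF K g(3)]])
next
  fix d d' m assume d: "d \<in> carrier (weyl_centralizer :: 'i operator calgebra)" "d' \<in> carrier (weyl_centralizer :: 'i operator calgebra)" and "m \<in> wmod"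
  then obtain g where g: "g \<in> M0" "m = Jm g" by (auto elim!: wmodE)
  note K = kernel_balanced[OF d(1)] kernel_balanced[OF d(2)]
  have k: "has_kernel d (kernel d)" "has_kernel d' (kernel d')" using d by (auto simp: weyl_centralizer_def intro: kernel_weyl)
  have "kernel (d \<oplus>\<^bsub>weyl_centralizer\<^esub> d') = (\<lambda>\<alpha> z. kernel d \<alpha> z + kernel d' \<alpha> z)"
    using kernel_eq[OF has_kernel_add[OF k]] by (simp add: weyl_centralizer_def)
  then show "actM (d \<oplus>\<^bsub>weyl_centralizer\<^esub> d') m = actM d m + actM d' m"
    unfolding g(2) actM_J[OF g(1)]
    by (simp only: act0_plus[OF K g(1)] J_add[OF act0_M0[OF K(1) g(1)] act0_M0[OF K(2) g(1)]])
next
  fix d d' m assume d: "d \<in> carrier (weyl_centralizer :: 'i operator calgebra)" "d' \<in> carrier (weyl_centralizer :: 'i operator calgebra)" and "m \<in> wmod"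
  then obtain g where g: "g \<in> M0" "m = Jm g" by (auto elim!: wmodE)
  note K = kernel_balanced[OF d(1)] kernel_balanced[OF d(2)]
  have k: "has_kernel d (kernel d)" "has_kernel d' (kernel d')" using d by (auto simp: weyl_centralizer_def intro: kernel_weyl)
  have "kernel (d \<otimes>\<^bsub>weyl_centralizer\<^esub> d') = kernel_comp (kernel d) (kernel d')"
    using kernel_eq[OF has_kernel_comp[OF k]] by (simp add: weyl_centralizer_def)
  then show "actM (d \<otimes>\<^bsub>weyl_centralizer\<^esub> d') m = actM d (actM d' m)"
    unfolding g(2) actM_J[OF g(1)] actM_J[OF act0_M0[OF K(2) g(1)]] by (simp only: act0_comp[OF K g(1)])
next
  have const: "actM (const_op c) m = scale c m" if "m \<in> wmod" for c m
  proof -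
    obtain g where g: "g \<in> M0" "m = Jm g" using \<open>m \<in> wmod\<close> by (auto simp: wmod_def)
    show ?thesis unfolding const_op_wop g(2) actM_wop0[OF polys.const g(1)]
      using J_scale[OF g(1)] M0_V[OF g(1)] by (simp add: ev_const)
  qed
  fix m assume m: "m \<in> wmod"
  have "const_op 1 = (id :: 'i operator)" by (auto simp: const_op_def fun_eq_iff)
  then show "actM \<one>\<^bsub>weyl_centralizer\<^esub> m = m" using const[OF m, of 1] by (simp add: weyl_centralizer_def)
  show "actM (cscal weyl_centralizer c) m = scale c m" for c using const[OF m] by (simp add: weyl_centralizer_def)
qed

lemma actM_power:
  assumes k: "k \<in> polys" and g: "g \<in> M0"
  shows "((\<lambda>x. actM (wop (\<lambda>_. 0) k) x - scale c x) ^^ N) (Jm g) = Jm (\<lambda>m. ev (\<lambda>x. (k (plus_int x m) - c) ^ N) (g m))"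
proof (induction N)
  case 0
  then show ?case using ev_one[OF M0_V[OF g]] by simp
next
  case (Suc N)
  have p: "(\<lambda>x. k (plus_int x m)) \<in> polys" "(\<lambda>x. k (plus_int x m) - c) \<in> polys" "(\<lambda>x. (k (plus_int x m) - c) ^ N) \<in> polys" for m
    by (intro polys_intros polys_shift k)+
  let ?g = "\<lambda>m. ev (\<lambda>x. (k (plus_int x m) - c) ^ N) (g m)"
  have gM: "?g \<in> M0" by (rule ev_M0[OF p(3) g])
  have gM2: "(\<lambda>m. ev (\<lambda>x. k (plus_int x m)) (?g m)) \<in> M0" by (rule ev_M0[OF p(1) gM])
  have "((\<lambda>x. actM (wop (\<lambda>_. 0) k) x - scale c x) ^^ Suc N) (Jm g) =
     Jm (\<lambda>m. ev (\<lambda>x. k (plus_int x m)) (?g m)) - Jm (\<lambda>m. scale c (?g m))"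
    using Suc by (simp add: actM_wop0[OF k gM] J_scale[OF gM])
  also have "\<dots> = Jm (\<lambda>m. ev (\<lambda>x. k (plus_int x m)) (?g m) - scale c (?g m))"
    using J_diff[OF gM2 M0_scale[OF gM]] by simp
  also have "(\<lambda>m. ev (\<lambda>x. k (plus_int x m)) (?g m) - scale c (?g m)) = (\<lambda>m. ev (\<lambda>x. (k (plus_int x m) - c) ^ Suc N) (g m))"
  proof
    fix m
    have V: "?g m \<in> V" by (rule M0_V[OF gM])
    have "ev (\<lambda>x. (k (plus_int x m) - c) + c) (?g m) = ev (\<lambda>x. k (plus_int x m) - c) (?g m) + scale c (?g m)"
      using ev_plus[OF p(2)[of m] polys.const V, of c] ev_const[OF V, of c] by simp
    then have "ev (\<lambda>x. k (plus_int x m)) (?g m) - scale c (?g m) = ev (\<lambda>x. k (plus_int x m) - c) (?g m)" by simp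
    then show "ev (\<lambda>x. k (plus_int x m)) (?g m) - scale c (?g m) = ev (\<lambda>x. (k (plus_int x m) - c) ^ Suc N) (g m)"
      using ev_mult[OF p(2) p(3) M0_V[OF g]] by simp
  qed
  finally show ?case .
qed

text \<open>A nilpotent operator plus a nonzero scalar is injective. This separates distinct
  weights.\<close>

lemma ev_shift_inj:
  assumes c: "c \<noteq> 0" and u: "u \<in> verts Q" and w: "w \<in> Vs u" and 0: "ev (\<lambda>x. (x i + c) ^ N) w = 0"
  shows "w = 0"
proof -
  have p: "(\<lambda>x :: 'i \<Rightarrow> complex. x i + c) \<in> polys" "(\<lambda>x :: 'i \<Rightarrow> complex. (x i + c) ^ n) \<in> polys"
    "(\<lambda>x :: 'i \<Rightarrow> complex. x i ^ n) \<in> polys" for n by (intro polys_intros)+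
  have one: "w = 0" if w: "w \<in> Vs u" and 0: "ev (\<lambda>x. x i + c) w = 0" for w
  proof -
    have V: "w \<in> V" by (rule Vs_V[OF w])
    have "ev (\<lambda>x. x i) w + scale c w = 0" using 0 ev_plus[OF polys.var polys.const V, of i c] ev_const[OF V, of c] by simp
    then have x: "ev (\<lambda>x. x i) w = scale (- c) w" by (simp add: add_eq_0_iff2)
    have "ev (\<lambda>x. x i ^ n) w = scale ((- c) ^ n) w" for n
    proof (induction n)
      case 0
      then show ?case using ev_one[OF V] by simp
    next
      case (Suc n)
      have "ev (\<lambda>x. x i ^ n * x i) w = ev (\<lambda>x. x i ^ n) (ev (\<lambda>x. x i) w)" by (rule ev_mult[OF p(3) polys.var V])
      also have "\<dots> = scale (- c) (ev (\<lambda>x. x i ^ n) w)" unfolding x by (rule ev_scale[OF p(3) V])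
      finally show ?case using Suc by (simp add: mult.commute)
    qed
    moreover obtain n where "ev (\<lambda>x. x i ^ n) w = 0" using X_nilpotent u w by blast
    ultimately show ?thesis using c by simp
  qed
  show ?thesis using w 0
  proof (induction N arbitrary: w)
    case 0
    then show ?case using ev_one[OF Vs_V] by simp
  next
    case (Suc N)
    have "ev (\<lambda>x. (x i + c) ^ N * (x i + c)) w = ev (\<lambda>x. (x i + c) ^ N) (ev (\<lambda>x. x i + c) w)"
      by (rule ev_mult[OF p(2) p(1) Vs_V[OF Suc.prems(1)]])
    then have "ev (\<lambda>x. (x i + c) ^ N) (ev (\<lambda>x. x i + c) w) = 0" using Suc.prems(2) by (simp add: mult.commute)
    then show ?case using Suc.IH[OF ev_Vs[OF p(1) u Suc.prems(1)]] one[OF Suc.prems(1)] by blast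
  qed
qed

abbreviation emb :: "('i \<Rightarrow> int) \<Rightarrow> 'i \<Rightarrow> complex" where
  "emb l \<equiv> (\<lambda>i. of_int (l i))"

text \<open>At the weight \<open>m\<close> the operator
  \<open>t\<^sub>i\<partial>\<^sub>i - l i\<close> acts as \<open>x i + (m i - l i)\<close>, which
  is nilpotent if \<open>m i = l i\<close> and injective otherwise.\<close>

lemma weight_space_J:
  assumes g: "g \<in> M0"
  shows "Jm g \<in> weight_space scale (wmod, actM) l \<longleftrightarrow> (\<forall>m. g m \<noteq> 0 \<longrightarrow> emb m = l)"
proof -
  have pw: "((\<lambda>x. actM (theta_op i) x - scale (l i) x) ^^ N) (Jm g) = Jm (\<lambda>m. ev (\<lambda>x. (x i + (of_int (m i) - l i)) ^ N) (g m))" for i N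
    unfolding theta_op_wop actM_power[OF polys.var g] by (simp add: add_diff_eq)
  have gp: "(\<lambda>m. ev (\<lambda>x. (x i + (of_int (m i) - l i)) ^ N) (g m)) \<in> M0" for i N
    by (rule ev_M0[OF _ g]) (intro polys_intros)
  have m: "Jm g \<in> wmod" using g by (auto simp: wmod_def)
  show ?thesis
  proof
    assume "Jm g \<in> weight_space scale (wmod, actM) l"
    then obtain N where N: "\<And>i. Jm (\<lambda>m. ev (\<lambda>x. (x i + (of_int (m i) - l i)) ^ N) (g m)) = 0"
      by (auto simp: weight_space_def pw)
    have z: "ev (\<lambda>x. (x i + (of_int (m i) - l i)) ^ N) (g m) = 0" for i m
      using J_eq_0[OF gp N, of i] by (rule fun_cong)
    show "\<forall>m. g m \<noteq> 0 \<longrightarrow> emb m = l"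
    proof (intro allI impI HOL.ext)
      fix m i assume nz: "g m \<noteq> 0"
      have d: "deg m = a" by (rule M0_degree[OF g nz])
      show "emb m i = l i"
        using ev_shift_inj[OF _ type_vertex(1)[OF d] M0_Vs[OF g d] z, of i] nz by auto
    qed
  next
    assume s: "\<forall>m. g m \<noteq> 0 \<longrightarrow> emb m = l"
    obtain N where N: "N > 0" "\<And>u x i. u \<in> verts Q \<Longrightarrow> x \<in> Vs u \<Longrightarrow> ev (\<lambda>z. z i ^ N) x = 0" using X_nilpotent by blast
    have "(\<lambda>m. ev (\<lambda>x. (x i + (of_int (m i) - l i)) ^ N) (g m)) = (\<lambda>m. 0)" for i
    proof
      fix m
      have p: "(\<lambda>x :: 'i \<Rightarrow> complex. (x i + (of_int (m i) - l i)) ^ N) \<in> polys" by (intro polys_intros)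
      show "ev (\<lambda>x. (x i + (of_int (m i) - l i)) ^ N) (g m) = 0"
      proof (cases "g m = 0")
        case True
        then show ?thesis using ev_0[OF p] by simp
      next
        case False
        have d: "deg m = a" by (rule M0_degree[OF g False])
        have "of_int (m i) - l i = 0" using s False by auto
        then show ?thesis using N(2)[OF type_vertex(1)[OF d] M0_Vs[OF g d]] by simp
      qed
    qed
    then show "Jm g \<in> weight_space scale (wmod, actM) l"
      using N(1) m J_0 by (auto simp: weight_space_def pw)
  qed
qed

lemma weight_space_E: "m \<in> weight_space scale (wmod, actM) l \<Longrightarrow> \<exists>g\<in>M0. m = Jm g \<and> (\<forall>k. g k \<noteq> 0 \<longrightarrow> emb k = l)"
proof -
  assume m: "m \<in> weight_space scale (wmod, actM) l"
  then have "m \<in> wmod" by (simp add: weight_space_def)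
  then obtain g where g: "g \<in> M0" "m = Jm g" by (rule wmodE)
  then show ?thesis using m weight_space_J[OF g(1), of l] by blast
qed

lemma wmod_decomposition: "weight_decomposition scale (wmod, actM)"
  unfolding weight_decomposition_def fst_conv
proof
  fix m assume "m \<in> wmod"
  then obtain g where g: "g \<in> M0" "m = Jm g" by (auto simp: wmod_def)
  \<comment> \<open>The component of weight \<open>l\<close> is the restriction of \<open>g\<close>
    to the single integral weight that equals \<open>l\<close>, if there is one.\<close>
  define G where "G l k = (if emb k = l then g k else 0)" for l k
  have GM: "G l \<in> M0" for l
  proof -
    have "finite {k. G l k \<noteq> 0}"
      by (rule finite_subset[OF _ M0_finite[OF g(1)]]) (auto simp: G_def)
    then show ?thesis
      using g(1) by (auto simp: M0_def G_def intro!: subspace_0[OF subspace_Vs[OF type_vertex(1)]])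
  qed
  let ?f = "\<lambda>l. Jm (G l)"
  have emb_inj: "emb k = emb k' \<Longrightarrow> k = k'" for k k' by (auto simp: fun_eq_iff)
  have sub: "{l. ?f l \<noteq> 0} \<subseteq> emb ` {k. g k \<noteq> 0}"
  proof
    fix l assume "l \<in> {l. ?f l \<noteq> 0}"
    then have "G l \<noteq> (\<lambda>k. 0)" using J_0 by auto
    then obtain k where "G l k \<noteq> 0" by auto
    then show "l \<in> emb ` {k. g k \<noteq> 0}" by (auto simp: G_def split: if_splits)
  qed
  have fin: "finite (emb ` {k. g k \<noteq> 0})" using M0_finite[OF g(1)] by simp
  have "(\<Sum>l\<in>{l. ?f l \<noteq> 0}. ?f l) = (\<Sum>l\<in>emb ` {k. g k \<noteq> 0}. ?f l)"
    by (rule sum.mono_neutral_left[OF fin sub]) auto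
  also have "\<dots> = Jm (\<lambda>k. \<Sum>l\<in>emb ` {k. g k \<noteq> 0}. G l k)" using J_sum[of "emb ` {k. g k \<noteq> 0}" G] GM by blast
  also have "(\<lambda>k. \<Sum>l\<in>emb ` {k. g k \<noteq> 0}. G l k) = g"
  proof
    fix k
    have "(\<Sum>l\<in>emb ` {k. g k \<noteq> 0}. G l k) = (\<Sum>l\<in>emb ` {k. g k \<noteq> 0}. if l = emb k then g k else 0)"
      by (intro sum.cong) (auto simp: G_def)
    then show "(\<Sum>l\<in>emb ` {k. g k \<noteq> 0}. G l k) = g k" using fin emb_inj by auto
  qed
  finally have "(\<Sum>l\<in>{l. ?f l \<noteq> 0}. ?f l) = m" using g(2) by simp
  then have dec: "(\<forall>l. ?f l \<in> weight_space scale (wmod, actM) l) \<and> finite {l. ?f l \<noteq> 0} \<and> m = (\<Sum>l\<in>{l. ?f l \<noteq> 0}. ?f l)"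
    using finite_subset[OF sub fin] weight_space_J[OF GM] by (auto simp: G_def split: if_splits)
  have uniq: "f = ?f" if f: "(\<forall>l. f l \<in> weight_space scale (wmod, actM) l) \<and> finite {l. f l \<noteq> 0} \<and> m = (\<Sum>l\<in>{l. f l \<noteq> 0}. f l)" for f
  proof -
  from f have "\<forall>l. \<exists>h\<in>M0. f l = Jm h \<and> (\<forall>k. h k \<noteq> 0 \<longrightarrow> emb k = l)" using weight_space_E by blast
  then obtain H where H: "\<And>l. H l \<in> M0" "\<And>l. f l = Jm (H l)" "\<And>l k. H l k \<noteq> 0 \<Longrightarrow> emb k = l" by metis
  have "Jm g = (\<Sum>l\<in>{l. f l \<noteq> 0}. Jm (H l))" using f g(2) H(2) by simp
  also have "\<dots> = Jm (\<lambda>k. \<Sum>l\<in>{l. f l \<noteq> 0}. H l k)" using J_sum[of "{l. f l \<noteq> 0}" H] H(1) by blast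
  \<comment> \<open>\<open>Jm\<close> is injective, so the functions behind any decomposition add up
    to \<open>g\<close>. Each is supported at a single weight, which identifies it with the
    restriction \<open>G l\<close>.\<close>
  finally have gsum: "g = (\<lambda>k. \<Sum>l\<in>{l. f l \<noteq> 0}. H l k)"
    by (rule inj_onD[OF inj_J _ g(1)]) (use J_sum[of "{l. f l \<noteq> 0}" H] H(1) in blast)
  have "H l = G l" for l
  proof
    fix k
    show "H l k = G l k"
    proof (cases "emb k = l")
      case True
      have "g k = (\<Sum>l\<in>{l. f l \<noteq> 0}. H l k)" using gsum by (rule fun_cong)
      also have "\<dots> = (\<Sum>l'\<in>{l. f l \<noteq> 0}. if l' = l then H l k else 0)"
        using H(3) True by (intro sum.cong) auto
      also have "\<dots> = H l k"
      proof (cases "f l = 0")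
        case z: True
        then have "H l = (\<lambda>k. 0)" using J_eq_0[OF H(1)] H(2) by simp
        then show ?thesis using z f by simp
      qed (use f in simp)
      finally show ?thesis using True by (simp add: G_def)
    next
      case False
      then show ?thesis using H(3) by (auto simp: G_def)
    qed
  qed
  then show "f = ?f" using H(2) by auto
  qed
  show "\<exists>!f. (\<forall>l. f l \<in> weight_space scale (wmod, actM) l) \<and> finite {l. f l \<noteq> 0} \<and> m = (\<Sum>l\<in>{l. f l \<noteq> 0}. f l)"
  proof (rule ex1I)
    show "(\<forall>l. ?f l \<in> weight_space scale (wmod, actM) l) \<and> finite {l. ?f l \<noteq> 0} \<and> m = (\<Sum>l\<in>{l. ?f l \<noteq> 0}. ?f l)"
      by (rule dec)
  qed (rule uniq)
qed

definition single0 :: "('i \<Rightarrow> int) \<Rightarrow> 'u \<Rightarrow> ('i \<Rightarrow> int) \<Rightarrow> 'u" where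
  "single0 l v = (\<lambda>k. if k = l then v else 0)"

lemma single0_M0: "deg l = a \<Longrightarrow> v \<in> Vs (tv l) \<Longrightarrow> single0 l v \<in> M0"
  using finite_subset[of "{k. single0 l v k \<noteq> 0}" "{l}"]
  by (auto simp: M0_def single0_def intro!: subspace_0[OF subspace_Vs[OF type_vertex(1)]])

lemma single0_add: "single0 l (v + w) = (\<lambda>k. single0 l v k + single0 l w k)"
  and single0_scale: "single0 l (scale c v) = (\<lambda>k. scale c (single0 l v k))"
  by (auto simp: single0_def)

lemma wmod_weight_finite: "finite_dimensional scale (weight_space scale (wmod, actM) l)"
proof (cases "\<exists>k. emb k = l \<and> deg k = a")
  case False
  have "weight_space scale (wmod, actM) l \<subseteq> span {}"
  proof
    fix m assume "m \<in> weight_space scale (wmod, actM) l"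
    then obtain g where g: "g \<in> M0" "m = Jm g" "\<And>k. g k \<noteq> 0 \<Longrightarrow> emb k = l" using weight_space_E by blast
    then have "g = (\<lambda>k. 0)" using False M0_degree[OF g(1)] by blast
    then show "m \<in> span {}" using g(2) J_0 by simp
  qed
  then show ?thesis unfolding finite_dimensional_def by blast
next
  case True
  then obtain k where k: "emb k = l" "deg k = a" by blast
  have sV: "subspace (Vs (tv k))" by (rule subspace_Vs[OF type_vertex(1)[OF k(2)]])
  have "finite_dimensional scale (Vs (tv k))" using rep_finite Vs_V unfolding finite_dimensional_def by blast
  then obtain B where B: "B \<subseteq> Vs (tv k)" "finite B" "span B = Vs (tv k)"
    using finite_dimensional_basis[OF _ sV] by metis
  have "v \<in> Vs (tv k) \<and> Jm (single0 k v) \<in> span ((\<lambda>v. Jm (single0 k v)) ` B)" if "v \<in> span B" for v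
    using that
  proof (induction rule: span_induct_alt)
    case base
    then show ?case using subspace_0[OF sV] J_0 by (simp add: single0_def span_zero)
  next
    case (step c b v)
    have b: "b \<in> Vs (tv k)" "scale c b \<in> Vs (tv k)" using step B subspace_scale[OF sV] by auto
    have "Jm (single0 k (scale c b + v)) = scale c (Jm (single0 k b)) + Jm (single0 k v)"
      using J_add[OF single0_M0[OF k(2) b(2)] single0_M0[OF k(2)], of v] J_scale[OF single0_M0[OF k(2) b(1)], of c] step
      by (simp only: single0_add single0_scale)
    moreover have "scale c (Jm (single0 k b)) \<in> span ((\<lambda>v. Jm (single0 k v)) ` B)"
      using step by (intro span_scale span_base) auto
    ultimately show ?case using step b subspace_add[OF sV] span_add by auto
  qed
  moreover have "\<exists>v\<in>Vs (tv k). m = Jm (single0 k v)" if "m \<in> weight_space scale (wmod, actM) l" for m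
  proof -
    obtain g where g: "g \<in> M0" "m = Jm g" "\<And>k. g k \<noteq> 0 \<Longrightarrow> emb k = l" using weight_space_E \<open>m \<in> _\<close> by blast
    have "g = single0 k (g k)"
    proof
      fix k'
      show "g k' = single0 k (g k) k'"
      proof (cases "k' = k")
        case False
        have "emb k' \<noteq> l"
        proof
          assume "emb k' = l"
          then have "emb k' = emb k" using k(1) by simp
          then have "k' = k" by (auto simp: fun_eq_iff)
          then show False using False by blast
        qed
        then show ?thesis using g(3) False by (auto simp: single0_def)
      qed (simp add: single0_def)
    qed
    then show ?thesis using g M0_Vs[OF g(1) k(2)] by metis
  qed
  ultimately have "weight_space scale (wmod, actM) l \<subseteq> span ((\<lambda>v. Jm (single0 k v)) ` B)" using B(3) by blast
  then show ?thesis unfolding finite_dimensional_def using B(2) by blast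
qed

lemma wmod_integral:
  assumes "weight_space scale (wmod, actM) l \<noteq> {0}" shows "l i \<in> \<int>"
proof -
  have "0 \<in> weight_space scale (wmod, actM) l" using weight_space_J[OF M0_0, of l] J_0 by simp
  then obtain m where m: "m \<in> weight_space scale (wmod, actM) l" "m \<noteq> 0" using assms by blast
  from weight_space_E[OF m(1)] obtain g where g: "m = Jm g" "\<forall>k. g k \<noteq> 0 \<longrightarrow> emb k = l" by blast
  have "g \<noteq> (\<lambda>k. 0)" using m(2) g(1) J_0 by auto
  then obtain k where "g k \<noteq> 0" by auto
  then have "emb k = l" using g(2) by blast
  then have "l i = of_int (k i)" by auto
  then show ?thesis by simp
qed

text \<open>At a weight of degree \<open>a\<close> the scalar parts cancel and \<open>E - a\<close>
  acts as the sum of the \<open>X i\<close>, which is nilpotent by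
  \<open>X_nilpotent\<close>.\<close>

lemma wmod_euler:
  assumes "m \<in> wmod" shows "\<exists>N. ((\<lambda>x. actM euler_op x - scale (of_int a) x) ^^ N) m = 0"
proof -
    obtain g where g: "g \<in> M0" "m = Jm g" using assms by (auto simp: wmod_def)
    obtain N where N: "\<And>u x. u \<in> verts Q \<Longrightarrow> x \<in> Vs u \<Longrightarrow> ev (\<lambda>z. (\<Sum>i\<in>UNIV. z i) ^ N) x = 0"
      using X_nilpotent by metis
    have p: "(\<lambda>z :: 'i \<Rightarrow> complex. \<Sum>i\<in>UNIV. z i) \<in> polys" by (intro polys_intros)
    have "ev (\<lambda>x. ((\<Sum>i\<in>UNIV. plus_int x k i) - of_int a) ^ N) (g k) = 0" for k
    proof (cases "g k = 0")
      case True
      have "(\<lambda>x :: 'i \<Rightarrow> complex. ((\<Sum>i\<in>UNIV. plus_int x k i) - of_int a) ^ N) \<in> polys" by (intro polys_intros)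
      then show ?thesis using True ev_0 by simp
    next
      case False
      have d: "deg k = a" by (rule M0_degree[OF g(1) False])
      have "(\<Sum>i\<in>UNIV. of_int (k i)) = (of_int a :: complex)" unfolding d[symmetric] by (rule of_int_sum[symmetric])
      then have "(\<Sum>i\<in>UNIV. plus_int x k i) - of_int a = (\<Sum>i\<in>UNIV. x i)" for x :: "'i \<Rightarrow> complex"
        unfolding sum.distrib by simp
      then show ?thesis using N[OF type_vertex(1)[OF d] M0_Vs[OF g(1) d]] by simp
    qed
    then have "((\<lambda>x. actM euler_op x - scale (of_int a) x) ^^ N) m = 0"
      unfolding euler_op_wop g(2) actM_power[OF p g(1)] using J_0 by simp
    then show ?thesis by blast
qed

lemma wmod_object: "(wmod, actM) \<in> Obj (bounded_weight_cat TYPE('i) scale a)"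
  unfolding bounded_weight_cat_def module_cat_def cat.simps mem_Collect_eq fst_conv snd_conv
  by (intro conjI allI ballI impI wmod_module wmod_decomposition wmod_weight_finite wmod_euler wmod_integral)

end

section \<open>The representation recovered from its weight module\<close>

context embedded_rep
begin

sublocale N: weight_module_quiver Q R col \<nu> scale a lam wmod actM
  by unfold_locales (rule wmod_object)

lemma W_single0:
  assumes l: "deg l = a" and m: "deg m = a" and k: "k \<in> polys" and v: "v \<in> Vs (tv l)"
  shows "N.W (\<lambda>i. m i - l i) k (Jm (single0 l v)) =
    Jm (single0 m (sigma (tv l) (tv m) (ev (\<lambda>x. k (plus_int x l) * descent l m x) v)))"
proof -
  let ?\<alpha> = "\<lambda>i. m i - l i"
  let ?K = "\<lambda>\<alpha>. if \<alpha> = ?\<alpha> then k else (\<lambda>z. 0)"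
  have bal: "N.balanced ?\<alpha>" using l m by (simp add: sum_subtractf)
  have K: "balanced_kernel ?K"
    using kernel_balanced[OF wop_centralizer[OF k bal]] unfolding kernel_eq[OF has_kernel_wop[OF k]] .
  have g: "single0 l v \<in> M0" by (rule single0_M0[OF l v])
  have vV: "v \<in> V" by (rule Vs_V[OF v])
  have "act0 ?K (single0 l v) = single0 m (E ?K l m v)"
  proof
    fix n
    show "act0 ?K (single0 l v) n = single0 m (E ?K l m v) n"
    proof (cases "deg n = a")
      case n: True
      have "act0 ?K (single0 l v) n = (\<Sum>l'\<in>{l}. E ?K l' n (single0 l v l'))"
        by (rule act0_superset[OF K g]) (auto simp: single0_def l n)
      then have "act0 ?K (single0 l v) n = E ?K l n v" by (simp add: single0_def)
      moreover have "E ?K l n v = 0" if "n \<noteq> m"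
      proof (rule E_zero[OF K l n vV])
        have "(\<lambda>i. n i - l i) \<noteq> ?\<alpha>"
        proof
          assume "(\<lambda>i. n i - l i) = ?\<alpha>"
          then have "n = m" by (auto simp: fun_eq_iff)
          then show False using that by blast
        qed
        then show "?K (\<lambda>i. n i - l i) = (\<lambda>z. 0)" by simp
      qed
      ultimately show ?thesis by (auto simp: single0_def)
    next
      case False
      then show ?thesis using m by (auto simp: act0_def single0_def)
    qed
  qed
  then have "N.W ?\<alpha> k (Jm (single0 l v)) = Jm (single0 m (E ?K l m v))"
    unfolding N.W_def actM_J[OF g] kernel_eq[OF has_kernel_wop[OF k]] by simp
  then show ?thesis by (simp add: E_def entry_def[abs_def])
qed

lemma Wt_wmod:
  assumes l: "deg l = a" shows "N.Wt l = (\<lambda>v. Jm (single0 l v)) ` Vs (tv l)"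
proof (intro equalityI subsetI)
  fix m assume "m \<in> N.Wt l"
  then obtain g where g: "g \<in> M0" "m = Jm g" "\<And>k. g k \<noteq> 0 \<Longrightarrow> emb k = emb l" using weight_space_E by blast
  have "g = single0 l (g l)"
  proof
    fix k
    show "g k = single0 l (g l) k"
    proof (cases "k = l")
      case False
      have "g k = 0"
      proof (rule ccontr)
        assume "g k \<noteq> 0"
        then have "emb k = emb l" by (rule g(3))
        then have "k = l" by (auto simp: fun_eq_iff)
        then show False using False by blast
      qed
      then show ?thesis using False by (simp add: single0_def)
    qed (simp add: single0_def)
  qed
  then show "m \<in> (\<lambda>v. Jm (single0 l v)) ` Vs (tv l)" using g(2) M0_Vs[OF g(1) l] by (metis image_eqI)
next
  fix m assume "m \<in> (\<lambda>v. Jm (single0 l v)) ` Vs (tv l)"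
  then obtain v where v: "v \<in> Vs (tv l)" "m = Jm (single0 l v)" by blast
  show "m \<in> N.Wt l" unfolding v(2) weight_space_J[OF single0_M0[OF l v(1)]] by (auto simp: single0_def split: if_splits)
qed

lemma J_single0_inj: "deg l = a \<Longrightarrow> v \<in> Vs (tv l) \<Longrightarrow> w \<in> Vs (tv l) \<Longrightarrow> Jm (single0 l v) = Jm (single0 l w) \<Longrightarrow> v = w"
  using fun_cong[OF inj_onD[OF inj_J _ single0_M0 single0_M0, of l v l w], of l] by (simp add: single0_def)

text \<open>In the constructed module the normalized shift is \<open>sigma\<close>. Writing
  \<open>v\<close> as \<open>ev (descent l m) w\<close> undoes the division in \<open>Theta\<close>,
  and the matrix entry of the remaining plain shift supplies the same factor
  \<open>descent l m\<close>.\<close>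

lemma Theta_single0:
  assumes l: "deg l = a" and m: "deg m = a" and k: "k \<in> polys" and v: "v \<in> Vs (tv l)"
  shows "N.Theta l m k (Jm (single0 l v)) = Jm (single0 m (sigma (tv l) (tv m) (ev k v)))"
proof -
  note t = type_vertex(1)[OF l] type_vertex(1)[OF m]
  have c: "(\<lambda>x. centered l f (plus_int x l)) = f" for f by (simp add: centered_def)
  have lm: "deg l = deg m" using l m by simp
  have "Jm (single0 l v) \<in> N.Wt l" using v by (simp add: Wt_wmod[OF l])
  then obtain v0 where v0: "v0 \<in> N.Wt l" "Jm (single0 l v) = N.W (\<lambda>_. 0) (centered l (descent l m)) v0"
    using N.ex_descent_preimage by blast
  then obtain w where w: "w \<in> Vs (tv l)" "v0 = Jm (single0 l w)" unfolding Wt_wmod[OF l] by blast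
  have "Jm (single0 l v) = Jm (single0 l (sigma (tv l) (tv l) (ev (\<lambda>x. centered l (descent l m) (plus_int x l) * descent l l x) w)))"
    using W_single0[OF l l centered_polys[OF descent_polys] w(1), of l l m] unfolding v0(2) w(2) by simp
  also have "(\<lambda>x. centered l (descent l m) (plus_int x l) * descent l l x) = descent l m" by (simp add: centered_def)
  also have "sigma (tv l) (tv l) (ev (descent l m) w) = ev (descent l m) w"
    by (rule sigma_self[OF t(1) ev_Vs[OF descent_polys t(1) w(1)]])
  finally have v_eq: "v = ev (descent l m) w"
    by (rule J_single0_inj[OF l v ev_Vs[OF descent_polys t(1) w(1)]])
  have "N.Theta l m k (Jm (single0 l v)) = N.W (\<lambda>i. m i - l i) (centered l k) v0"
    unfolding v0(2) by (rule N.Theta_on1[OF lm k v0(1)])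
  also have "\<dots> = Jm (single0 m (sigma (tv l) (tv m) (ev (\<lambda>x. centered l k (plus_int x l) * descent l m x) w)))"
    unfolding w(2) by (rule W_single0[OF l m centered_polys[OF k] w(1)])
  also have "(\<lambda>x. centered l k (plus_int x l) * descent l m x) = (\<lambda>x. k x * descent l m x)" by (simp add: centered_def)
  also have "ev (\<lambda>x. k x * descent l m x) w = ev k v"
    unfolding v_eq by (rule ev_mult[OF k descent_polys Vs_V[OF w(1)]])
  finally show ?thesis .
qed

text \<open>The component of \<open>v\<close> at the vertex \<open>u\<close> is placed at the chosen
  weight \<open>lam u\<close>; exactly these weight spaces are kept by the functor.\<close>

definition \<phi> :: "'u \<Rightarrow> 'u" where
  "\<phi> = restrict (\<lambda>v. \<Sum>u\<in>verts Q. Jm (single0 (lam u) (r (u, []) v))) V"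

lemma r_Nil_Vs: "u \<in> verts Q \<Longrightarrow> v \<in> V \<Longrightarrow> r (u, []) v \<in> Vs u"
  using r_Vs[of u "[]" v] by simp

lemma single0_lam: "u \<in> verts Q \<Longrightarrow> v \<in> Vs u \<Longrightarrow> single0 (lam u) v \<in> M0"
  by (rule single0_M0[OF lam_degree]) (simp_all add: type_vertex_lam)

lemma J_single0_Wt: "u \<in> verts Q \<Longrightarrow> v \<in> Vs u \<Longrightarrow> Jm (single0 (lam u) v) \<in> N.Wt (lam u)"
  unfolding Wt_wmod[OF lam_degree] by (simp add: type_vertex_lam)

lemma J_single0_0: "Jm (single0 l 0) = 0"
  using J_0 by (simp add: single0_def)

lemma proj_sum_single0:
  assumes "\<And>u. u \<in> verts Q \<Longrightarrow> x u \<in> Vs u" "w \<in> verts Q"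
  shows "N.proj (lam w) (\<Sum>u\<in>verts Q. Jm (single0 (lam u) (x u))) = Jm (single0 (lam w) (x w))"
proof -
  have "(\<Sum>u\<in>verts Q. Jm (single0 (lam u) (x u))) = (\<Sum>l\<in>lam ` verts Q. Jm (single0 l (x (tv l))))"
    unfolding sum.reindex[OF inj_lam] by (intro sum.cong refl) (simp add: type_vertex_lam)
  moreover have "Jm (single0 l (x (tv l))) \<in> N.Wt l" if "l \<in> lam ` verts Q" for l
    using that assms(1) by (auto simp: type_vertex_lam intro: J_single0_Wt)
  ultimately show ?thesis
    using N.proj_of_sum[of "lam ` verts Q" "\<lambda>l. Jm (single0 l (x (tv l)))" "lam w"] finite_verts assms(2)
    by (simp add: type_vertex_lam)
qed

lemma \<phi>_iso: "is_iso (nilpotent_rep_cat scale Q R) (V, actV) (N.V, Fact wmod actM) \<phi>"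
proof -
  have cat: "nilpotent_rep_cat scale Q R = module_cat scale QA (\<lambda>X. finite_dimensional scale (fst X) \<and>
     (\<exists>N. \<forall>p\<in>paths Q. length (snd p) \<ge> N \<longrightarrow> (\<forall>m\<in>fst X. snd X (cl (path_elt p)) m = 0)))"
    by (simp add: nilpotent_rep_cat_def)
  have \<phi>V: "\<phi> v = (\<Sum>u\<in>verts Q. Jm (single0 (lam u) (r (u, []) v)))" if "v \<in> V" for v
    using that by (simp add: \<phi>_def)
  have proj\<phi>: "N.proj (lam w) (\<phi> v) = Jm (single0 (lam w) (r (w, []) v))" if "v \<in> V" "w \<in> verts Q" for v w
    unfolding \<phi>V[OF that(1)] by (rule proj_sum_single0) (auto intro: r_Nil_Vs that)
  have \<phi>N: "\<phi> v \<in> N.V" if "v \<in> V" for v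
    unfolding \<phi>V[OF that]
  proof (rule subspace_sum[OF N.subspace_V])
    fix u assume u: "u \<in> verts Q"
    show "Jm (single0 (lam u) (r (u, []) v)) \<in> N.V" by (rule N.Wt_V[OF u J_single0_Wt[OF u r_Nil_Vs[OF u that]]])
  qed
  have add: "\<phi> (v + w) = \<phi> v + \<phi> w" if v: "v \<in> V" and w: "w \<in> V" for v w
  proof -
    have "Jm (single0 (lam u) (r (u, []) (v + w))) = Jm (single0 (lam u) (r (u, []) v)) + Jm (single0 (lam u) (r (u, []) w))"
      if u: "u \<in> verts Q" for u
    proof -
      have p: "(u, []) \<in> paths Q" using u by simp
      show ?thesis unfolding r_add[OF p v w] single0_add
        by (rule J_add[OF single0_lam[OF u r_Nil_Vs[OF u v]] single0_lam[OF u r_Nil_Vs[OF u w]]])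
    qed
    then show ?thesis
      unfolding \<phi>V[OF v] \<phi>V[OF w] \<phi>V[OF subspace_add[OF subspace_rep v w]] by (simp add: sum.distrib)
  qed
  have scale: "\<phi> (scale c v) = scale c (\<phi> v)" if v: "v \<in> V" for c v
  proof -
    have "Jm (single0 (lam u) (r (u, []) (scale c v))) = scale c (Jm (single0 (lam u) (r (u, []) v)))" if u: "u \<in> verts Q" for u
    proof -
      have p: "(u, []) \<in> paths Q" using u by simp
      show ?thesis unfolding r_scale[OF p v] single0_scale by (rule J_scale[OF single0_lam[OF u r_Nil_Vs[OF u v]]])
    qed
    then show ?thesis
      unfolding \<phi>V[OF v] \<phi>V[OF subspace_scale[OF subspace_rep v]] by (simp add: scale_sum_right)
  qed
  have path: "\<phi> (r p v) = N.\<rho> p (\<phi> v)" if p: "p \<in> paths Q" and v: "v \<in> V" for p v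
  proof -
    obtain u es where pu: "p = (u, es)" by force
    let ?w = "path_end Q (u, es)"
    have P: "(u, es) \<in> paths Q" using p pu by simp
    have V: "u \<in> verts Q" "?w \<in> verts Q" using path_verts[OF P] by auto
    have ru: "r (u, []) v \<in> Vs u" by (rule r_Nil_Vs[OF V(1) v])
    \<comment> \<open>\<open>path_formula\<close> rewrites the path in terms of \<open>sigma\<close>
      and \<open>half\<close>, the form in which \<open>Theta_single0\<close> gives the other
      side.\<close>
    have rp: "r (u, es) v = sigma u ?w (ev (half (cols es)) (r (u, []) v))"
      using path_formula[OF P ru] r_mult[OF P _ v, of u "[]"] V by simp
    have rV: "r (u, es) v \<in> Vs ?w" by (rule r_Vs[OF P v])
    have "N.\<rho> p (\<phi> v) = N.Theta (lam u) (lam ?w) (half (cols es)) (Jm (single0 (lam u) (r (u, []) v)))"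
      unfolding path_op_def pu fst_conv snd_conv proj\<phi>[OF v V(1)] ..
    also have "\<dots> = Jm (single0 (lam ?w) (sigma u ?w (ev (half (cols es)) (r (u, []) v))))"
      using Theta_single0[OF lam_degree[OF V(1)] lam_degree[OF V(2)] half_polys, of "r (u, []) v" "cols es"] ru
      by (simp add: type_vertex_lam V)
    also have "\<dots> = Jm (single0 (lam ?w) (r (u, es) v))" by (simp add: rp)
    also have "\<dots> = (\<Sum>w\<in>verts Q. if w = ?w then Jm (single0 (lam ?w) (r (u, es) v)) else 0)"
      using finite_verts V by simp
    also have "\<dots> = (\<Sum>w\<in>verts Q. Jm (single0 (lam w) (r (w, []) (r (u, es) v))))"
    proof (intro sum.cong refl)
      fix w assume w: "w \<in> verts Q"
      have "(w, []) \<in> paths Q" using w by simp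
      from r_mult[OF this P v] show "(if w = ?w then Jm (single0 (lam ?w) (r (u, es) v)) else 0) = Jm (single0 (lam w) (r (w, []) (r (u, es) v)))"
        by (simp add: J_single0_0)
    qed
    also have "\<dots> = \<phi> (r p v)" unfolding pu using \<phi>V[OF Vs_V[OF rV]] by simp
    finally show ?thesis by simp
  qed
  have hom: "\<phi> \<in> left_module_hom QA (V, actV) (N.V, Fact wmod actM)"
  proof (rule QA_module_homI[OF rep_module N.F_module])
    show "\<phi> \<in> V \<rightarrow>\<^sub>E N.V" using \<phi>N by (auto simp: \<phi>_def)
    show "\<phi> (actV (cl (path_elt p)) m) = Fact wmod actM (cl (path_elt p)) (\<phi> m)" if "p \<in> paths Q" "m \<in> V" for p m
      using path[OF that] N.Fact_path[OF that(1) \<phi>N[OF that(2)]] by (simp add: r_def)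
  qed (auto simp: add scale)
  have "inj_on \<phi> V"
  proof (rule inj_onI)
    fix v w assume v: "v \<in> V" and w: "w \<in> V" and eq: "\<phi> v = \<phi> w"
    have "r (u, []) v = r (u, []) w" if u: "u \<in> verts Q" for u
      using J_single0_inj[OF lam_degree[OF u], of "r (u, []) v" "r (u, []) w"] proj\<phi>[OF v u] proj\<phi>[OF w u] eq
        r_Nil_Vs[OF u v] r_Nil_Vs[OF u w] by (simp add: type_vertex_lam[OF u])
    then have "(\<Sum>u\<in>verts Q. r (u, []) v) = (\<Sum>u\<in>verts Q. r (u, []) w)" by (intro sum.cong refl)
    then show "v = w" by (simp only: r_unit[OF v] r_unit[OF w])
  qed
  moreover have "\<phi> ` V = N.V"
  proof (intro equalityI subsetI)
    fix m assume m: "m \<in> N.V"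
    have "\<exists>v. u \<in> verts Q \<longrightarrow> v \<in> Vs u \<and> N.proj (lam u) m = Jm (single0 (lam u) v)" for u
    proof (cases "u \<in> verts Q")
      case True
      have "N.proj (lam u) m \<in> N.Wt (lam u)" by (rule N.proj_Wt[OF N.V_M[OF m]])
      then show ?thesis unfolding Wt_wmod[OF lam_degree[OF True]] type_vertex_lam[OF True] by blast
    qed simp
    then obtain x where x: "\<And>u. u \<in> verts Q \<Longrightarrow> x u \<in> Vs u" "\<And>u. u \<in> verts Q \<Longrightarrow> N.proj (lam u) m = Jm (single0 (lam u) (x u))" by metis
    define v where "v = (\<Sum>u\<in>verts Q. x u)"
    have xV: "x u \<in> V" if "u \<in> verts Q" for u using x(1)[OF that] Vs_V by blast
    have v: "v \<in> V" unfolding v_def by (intro subspace_sum[OF subspace_rep] xV)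
    have rv: "r (u, []) v = x u" if u: "u \<in> verts Q" for u
    proof -
      have p: "(u, []) \<in> paths Q" using u by simp
      have "r (u, []) v = (\<Sum>w\<in>verts Q. r (u, []) (x w))"
        unfolding v_def by (rule additive_sum[OF subspace_rep]) (auto simp: r_add[OF p] xV)
      also have "\<dots> = (\<Sum>w\<in>verts Q. if w = u then x u else 0)"
      proof (intro sum.cong refl)
        fix w assume w: "w \<in> verts Q"
        show "r (u, []) (x w) = (if w = u then x u else 0)"
          using r_other[OF p w x(1)[OF w]] x(1)[OF u] by (auto simp: Vs_def)
      qed
      finally show ?thesis using finite_verts u by simp
    qed
    have "\<phi> v = (\<Sum>u\<in>verts Q. N.proj (lam u) m)"
      unfolding \<phi>V[OF v] by (intro sum.cong refl) (simp add: rv x(2))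
    then have "\<phi> v = m" using N.V_sum[OF m] by simp
    then show "m \<in> \<phi> ` V" using v by blast
  qed (use \<phi>N in auto)
  ultimately have "bij_betw \<phi> V N.V" by (simp add: bij_betw_def)
  then show ?thesis
    unfolding cat
    using rep N.F_object hom rep_module subspace_add[OF subspace_rep]
    by (intro module_cat_isoI) (auto simp: cat left_module_def)
qed

end

lemma is_iso_sym: "is_iso C X Y f \<Longrightarrow> X \<in> Obj C \<Longrightarrow> Y \<in> Obj C \<Longrightarrow> \<exists>g. is_iso C Y X g"
  unfolding is_iso_def by blast

text \<open>The infinite dimension of the universe enters in essential surjectivity, where it makes
  room for the weight module of a representation.\<close>

theorem (in weight_quiver) weight_equivalence:
  assumes inf: "\<not> finite_dimensional scale (UNIV :: 'u set)"
  shows "equivalent_categories (bounded_weight_cat TYPE('i) scale a) (nilpotent_rep_cat scale Q R)"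
proof -
  let ?C = "bounded_weight_cat TYPE('i) scale a" and ?D = "nilpotent_rep_cat scale Q R"
  let ?Fm = "\<lambda>X (Y :: ('i operator, 'u) module_obj) f. restrict f (FV (fst X) (snd X))"
  have vs: "vector_space scale" by unfold_locales
  have wm: "weight_module_quiver Q R col \<nu> scale a lam M act" if "(M, act) \<in> Obj ?C" for M act
    by (intro weight_module_quiver.intro weight_quiver_axioms weight_module.intro complex_vector_space_axioms weight_module_axioms.intro that)
  have wp: "weight_module_pair Q R col \<nu> scale a lam M act N act'" if "(M, act) \<in> Obj ?C" "(N, act') \<in> Obj ?C" for M act N act'
    by (intro weight_module_pair.intro wm that)
  have C: "is_category ?C" and D: "is_category ?D"
    unfolding bounded_weight_cat_def nilpotent_rep_cat_def by (rule module_cat_is_category[OF vs])+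
  have HomC: "Hom ?C = left_module_hom weyl_centralizer" and HomD: "Hom ?D = left_module_hom QA"
    and CompC: "Comp ?C = (\<lambda>X Y Z g f. compose (fst X) g f)" and CompD: "Comp ?D = (\<lambda>X Y Z g f. compose (fst X) g f)"
    and IdC: "Id ?C = (\<lambda>X. restrict (\<lambda>m. m) (fst X))" and IdD: "Id ?D = (\<lambda>X. restrict (\<lambda>m. m) (fst X))"
    by (simp_all add: bounded_weight_cat_def nilpotent_rep_cat_def module_cat_def)
  have sub: "FV M act \<subseteq> M" for M act by (auto simp: FV_def)
  have Fobj: "F X \<in> Obj ?D" if "X \<in> Obj ?C" for X
    using weight_module_quiver.F_object[OF wm, of "fst X" "snd X"] that by (simp add: F_def)
  have Fhom: "?Fm X Y f \<in> Hom ?D (F X) (F Y)" if "X \<in> Obj ?C" "Y \<in> Obj ?C" "f \<in> Hom ?C X Y" for X Y f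
    using weight_module_pair.hom_restrict[OF wp, of "fst X" "snd X" "fst Y" "snd Y" f] that by (simp add: F_def HomC HomD)
  show ?thesis
  proof (rule fully_faithful_equivalence[OF C D, where F = F and Fm = ?Fm])
    show "is_functor ?C ?D F ?Fm"
      unfolding is_functor_def
    proof (intro conjI ballI)
      show "?Fm X X (Id ?C X) = Id ?D (F X)" for X
        using sub[of "fst X" "snd X"] by (auto simp: IdC IdD F_def restrict_def fun_eq_iff)
      fix X Y Z f g assume X: "X \<in> Obj ?C" "Y \<in> Obj ?C" "Z \<in> Obj ?C" "f \<in> Hom ?C X Y" "g \<in> Hom ?C Y Z"
      have "f v \<in> FV (fst Y) (snd Y)" if "v \<in> FV (fst X) (snd X)" for v
        using weight_module_pair.hom_V[OF wp, of "fst X" "snd X" "fst Y" "snd Y" f v] X that by (simp add: HomC)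
      then show "?Fm X Z (Comp ?C X Y Z g f) = Comp ?D (F X) (F Y) (F Z) (?Fm Y Z g) (?Fm X Y f)"
        using sub[of "fst X" "snd X"] by (auto simp: CompC CompD F_def compose_def restrict_def fun_eq_iff)
    qed (auto intro: Fobj Fhom)
  next
    fix X Y assume X: "X \<in> Obj ?C" "Y \<in> Obj ?C"
    show "inj_on (?Fm X Y) (Hom ?C X Y)"
      using weight_module_pair.faithful[OF wp, of "fst X" "snd X" "fst Y" "snd Y"] X by (auto simp: HomC intro!: inj_onI)
  next
    fix X Y g assume X: "X \<in> Obj ?C" "Y \<in> Obj ?C" and g: "g \<in> Hom ?D (F X) (F Y)"
    have wpXY: "weight_module_pair Q R col \<nu> scale a lam (fst X) (snd X) (fst Y) (snd Y)" using wp[of "fst X" "snd X" "fst Y" "snd Y"] X by simp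
    have g': "g \<in> left_module_hom QA (FV (fst X) (snd X), Fact (fst X) (snd X)) (FV (fst Y) (snd Y), Fact (fst Y) (snd Y))"
      using g by (simp add: HomD F_def)
    show "\<exists>f\<in>Hom ?C X Y. ?Fm X Y f = g"
      using weight_module_pair.extend_hom_hom[OF wpXY g'] weight_module_pair.extend_hom_restrict[OF wpXY g'] by (auto simp: HomC)
  next
    fix Y assume Y: "Y \<in> Obj ?D"
    obtain V actV where Yeq: "Y = (V, actV)" by force
    have qr: "quiver_rep Q R col \<nu> scale a lam V actV"
      by (intro quiver_rep.intro weight_quiver_axioms quiver_rep_axioms.intro) (use Y Yeq in simp)
    obtain J :: "(('i \<Rightarrow> int) \<Rightarrow> 'u) \<Rightarrow> 'u" where J: "embeds scale V J"
      using ex_embeds[OF quiver_rep.rep_finite[OF qr] quiver_rep.subspace_rep[OF qr] inf] by blast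
    have er: "embedded_rep Q R col \<nu> scale a lam V actV J"
      by (intro embedded_rep.intro qr embedded_rep_axioms.intro J)
    interpret E: embedded_rep Q R col \<nu> scale a lam V actV J by (rule er)
    have X: "(E.wmod, E.actM) \<in> Obj ?C" by (rule E.wmod_object)
    have "\<exists>h. is_iso ?D (F (E.wmod, E.actM)) Y h"
      using is_iso_sym[OF E.\<phi>_iso] Y Fobj[OF X] by (simp add: F_def Yeq)
    then show "\<exists>X\<in>Obj ?C. \<exists>h. is_iso ?D (F X) Y h" using X by blast
  qed
qed

section \<open>The quivers of the theorem\<close>

text \<open>Start with 0 on \<open>S\<close> and -1 elsewhere, of total \<open>s\<close>. The
  missing \<open>a - s\<close> goes to one coordinate: inside \<open>S\<close> if it is nonnegative,
  outside \<open>S\<close> if it is negative. The hypotheses provide such a coordinate.\<close>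

lemma ex_weight_of_type:
  fixes S :: "'i::finite set" and a :: int
  assumes "S \<noteq> {}" "a < 0 \<Longrightarrow> S \<noteq> UNIV"
  shows "\<exists>l. (\<Sum>i\<in>UNIV. l i) = a \<and> {i. 0 \<le> l i} = S"
proof -
  define s :: int where "s = - int (card (- S))"
  define l :: "'i \<Rightarrow> int \<Rightarrow> 'i \<Rightarrow> int" where "l j d i = (if i \<in> S then 0 else - 1) + (if i = j then d else 0)" for j d i
  have sum_l: "(\<Sum>i\<in>UNIV. l j d i) = s + d" for j d
  proof -
    have "(\<Sum>i\<in>UNIV. if i \<in> S then 0 else - 1 :: int) = s"
      by (simp add: s_def sum.If_cases Compl_eq)
    then show ?thesis by (simp add: l_def sum.distrib)
  qed
  show ?thesis
  proof (cases "s \<le> a")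
    case True
    obtain j where "j \<in> S" using assms(1) by blast
    then have "{i. 0 \<le> l j (a - s) i} = S" using True by (auto simp: l_def split: if_splits)
    then show ?thesis using sum_l[of j "a - s"] by auto
  next
    case False
    then have "S \<noteq> UNIV" using assms(2) by (auto simp: s_def)
    then obtain j where "j \<notin> S" by blast
    then have "{i. 0 \<le> l j (a - s) i} = S" using False by (auto simp: l_def split: if_splits)
    then show ?thesis using sum_l[of j "a - s"] by auto
  qed
qed

lemma weight_type_constraints:
  fixes l :: "'i::finite \<Rightarrow> int"
  assumes "- int CARD('i) < (\<Sum>i\<in>UNIV. l i)"
  shows "{i. 0 \<le> l i} \<noteq> {}" "(\<Sum>i\<in>UNIV. l i) < 0 \<Longrightarrow> {i. 0 \<le> l i} \<noteq> UNIV"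
proof -
  show "{i. 0 \<le> l i} \<noteq> {}"
  proof
    assume "{i. 0 \<le> l i} = {}"
    then have neg: "\<not> 0 \<le> l i" for i by blast
    have "l i \<le> - 1" for i using neg[of i] by linarith
    then have "(\<Sum>i\<in>UNIV. l i) \<le> (\<Sum>i\<in>(UNIV :: 'i set). - 1)" by (intro sum_mono)
    then show False using assms by simp
  qed
  show "{i. 0 \<le> l i} \<noteq> UNIV" if "(\<Sum>i\<in>UNIV. l i) < 0"
  proof
    assume "{i. 0 \<le> l i} = UNIV"
    then have "0 \<le> (\<Sum>i\<in>UNIV. l i)" by (intro sum_nonneg) blast
    then show False using that by simp
  qed
qed

lemma colored_quiver_equivalence:
  fixes col :: "'e \<Rightarrow> 'i::finite multiset" and \<nu> :: "'v \<Rightarrow> 'i set"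
    and scale :: "complex \<Rightarrow> 'u \<Rightarrow> 'u::ab_group_add"
  assumes Q: "colored_quiver Q R col \<nu>"
    and scale: "vector_space scale" "\<not> finite_dimensional scale (UNIV :: 'u set)"
    and types: "\<nu> ` verts Q = {S. S \<noteq> {} \<and> (a < 0 \<longrightarrow> S \<noteq> UNIV)}"
    and a: "- int CARD('i) < a"
  shows "equivalent_categories (bounded_weight_cat TYPE('i) scale a) (nilpotent_rep_cat scale Q R)"
proof -
  interpret colored_quiver Q R col \<nu> by (rule Q)
  interpret vector_space scale by (rule scale(1))
  have "\<exists>l. (\<Sum>i\<in>UNIV. l i) = a \<and> {i. 0 \<le> l i} = \<nu> u" if "u \<in> verts Q" for u
  proof -
    have "\<nu> u \<in> {S. S \<noteq> {} \<and> (a < 0 \<longrightarrow> S \<noteq> UNIV)}" using that types by blast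
    then show ?thesis by (intro ex_weight_of_type) auto
  qed
  then obtain lam where lam: "\<And>u. u \<in> verts Q \<Longrightarrow> (\<Sum>i\<in>UNIV. lam u i) = a \<and> {i. 0 \<le> lam u i} = \<nu> u"
    by metis
  interpret weight_quiver Q R col \<nu> scale a lam
  proof
    fix l :: "'i \<Rightarrow> int" assume "(\<Sum>i\<in>UNIV. l i) = a"
    then have "{i. 0 \<le> l i} \<in> \<nu> ` verts Q" unfolding types using weight_type_constraints[of l] a by blast
    then show "\<exists>u\<in>verts Q. \<nu> u = {i. 0 \<le> l i}" by auto
  qed (use lam in auto)
  show ?thesis by (rule weight_equivalence[OF scale(2)])
qed

section \<open>Punctured cubes and their geodesics\<close>

lemma punctured_cube_simps:
  "verts (punctured_cube X) = - X" "tail (punctured_cube X) = cube_tail" "head (punctured_cube X) = cube_head"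
  "Step S i \<in> arcs (punctured_cube X) \<longleftrightarrow> S \<notin> X \<and> sym_diff S {i} \<notin> X"
  "Loop S i \<in> arcs (punctured_cube X) \<longleftrightarrow> S \<notin> X \<and> sym_diff S {i} \<in> X"
  by (auto simp: punctured_cube_def)

interpretation cube: quiver "punctured_cube X" for X :: "'i::finite set set"
proof
  fix e assume "e \<in> arcs (punctured_cube X)"
  then show "tail (punctured_cube X) e \<in> verts (punctured_cube X)" "head (punctured_cube X) e \<in> verts (punctured_cube X)"
    by (auto simp: punctured_cube_def)
qed simp

text \<open>A geodesic of the cube that avoids \<open>X\<close>: every direction in which the ends
  differ is taken exactly once. A loop would contribute a color twice.\<close>

definition reaches :: "'i set set \<Rightarrow> 'i set \<Rightarrow> 'i set \<Rightarrow> bool" where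
  "reaches X S T \<longleftrightarrow> (\<exists>es. (S, es) \<in> paths (punctured_cube X) \<and> path_end (punctured_cube X) (S, es) = T \<and>
     mset (concat (map cube_colors es)) = mset_set (sym_diff S T))"

lemma reaches_refl: "(S :: 'i::finite set) \<notin> X \<Longrightarrow> reaches X S S"
  unfolding reaches_def by (rule exI[of _ "[]"]) (simp add: punctured_cube_simps)

lemma reaches_step: "(S :: 'i::finite set) \<notin> X \<Longrightarrow> sym_diff S {i} \<notin> X \<Longrightarrow> reaches X S (sym_diff S {i})"
proof -
  assume "S \<notin> X" "sym_diff S {i} \<notin> X"
  moreover have "sym_diff S (sym_diff S {i}) = {i}" by auto
  ultimately show ?thesis
    unfolding reaches_def by (intro exI[of _ "[Step S i]"]) (simp add: cube.Cons_in_paths punctured_cube_simps)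
qed

text \<open>Disjointness of the changed directions keeps the concatenation geodesic.\<close>

lemma reaches_trans:
  fixes S :: "'i::finite set"
  assumes "reaches X S T" "reaches X T U" and disj: "sym_diff S T \<inter> sym_diff T U = {}"
  shows "reaches X S U"
proof -
  obtain es fs where
    es: "(S, es) \<in> paths (punctured_cube X)" "path_end (punctured_cube X) (S, es) = T"
      "mset (concat (map cube_colors es)) = mset_set (sym_diff S T)" and
    fs: "(T, fs) \<in> paths (punctured_cube X)" "path_end (punctured_cube X) (T, fs) = U"
      "mset (concat (map cube_colors fs)) = mset_set (sym_diff T U)"
    using assms(1,2) unfolding reaches_def by blast
  have "sym_diff S U = sym_diff S T \<union> sym_diff T U" using disj by blast
  then have "mset_set (sym_diff S U) = mset_set (sym_diff S T) + mset_set (sym_diff T U)"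
    using mset_set_Union[OF _ _ disj] by simp
  then show ?thesis
    unfolding reaches_def
    by (intro exI[of _ "es @ fs"]) (simp add: es fs cube.paths_append cube.path_end_append)
qed

text \<open>Adding or removing the elements of \<open>D\<close> one at a time stays between
  \<open>A\<close> and \<open>A \<union> D\<close>, where no vertex is missing.\<close>

lemma reaches_interval:
  fixes A :: "'i::finite set"
  assumes "A \<inter> D = {}" "\<And>C. A \<subseteq> C \<Longrightarrow> C \<subseteq> A \<union> D \<Longrightarrow> C \<notin> X"
  shows "reaches X A (A \<union> D) \<and> reaches X (A \<union> D) A"
proof -
  have "finite D" by simp
  then show ?thesis using assms
  proof (induction D rule: finite_induct)
    case empty
    then show ?case by (simp add: reaches_refl)
  next
    case (insert i D)
    have IH: "reaches X A (A \<union> D)" "reaches X (A \<union> D) A" using insert.IH insert.prems by blast+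
    have out: "A \<union> D \<notin> X" "A \<union> insert i D \<notin> X" using insert.prems(2) by blast+
    have eq: "sym_diff (A \<union> D) {i} = A \<union> insert i D" "sym_diff (A \<union> insert i D) {i} = A \<union> D"
      using insert.hyps insert.prems(1) by blast+
    have step: "reaches X (A \<union> D) (A \<union> insert i D)" "reaches X (A \<union> insert i D) (A \<union> D)"
      using reaches_step[of "A \<union> D" X i] reaches_step[of "A \<union> insert i D" X i] out unfolding eq by blast+
    show ?case
      using reaches_trans[OF IH(1) step(1)] reaches_trans[OF step(2) IH(2)] insert.hyps insert.prems(1) by blast
  qed
qed

lemma reaches_subset:
  fixes A :: "'i::finite set"
  assumes "A \<subseteq> B" "\<And>C. A \<subseteq> C \<Longrightarrow> C \<subseteq> B \<Longrightarrow> C \<notin> X"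
  shows "reaches X A B" "reaches X B A"
proof -
  have "A \<union> (B - A) = B" using assms(1) by blast
  then show "reaches X A B" "reaches X B A" using reaches_interval[of A "B - A" X] assms(2) by auto
qed

text \<open>Up to the union, then down: all vertices on the way are nonempty subsets of
  \<open>S \<union> T\<close>. The next lemma is the dual way through the intersection.\<close>

lemma reaches_union:
  fixes S :: "'i::finite set"
  assumes "\<And>C. C \<noteq> {} \<Longrightarrow> C \<subseteq> S \<union> T \<Longrightarrow> C \<notin> X" "S \<noteq> {}" "T \<noteq> {}"
  shows "reaches X S T"
proof (rule reaches_trans[of X S "S \<union> T" T])
  show "reaches X S (S \<union> T)" by (rule reaches_subset(1), blast, rule assms(1)) (use assms(2) in auto)
  show "reaches X (S \<union> T) T" by (rule reaches_subset(2), blast, rule assms(1)) (use assms(3) in auto)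
qed blast

lemma reaches_inter:
  fixes S :: "'i::finite set"
  assumes "\<And>C. S \<inter> T \<subseteq> C \<Longrightarrow> C \<noteq> UNIV \<Longrightarrow> C \<notin> X" "S \<noteq> UNIV" "T \<noteq> UNIV"
  shows "reaches X S T"
proof (rule reaches_trans[of X S "S \<inter> T" T])
  show "reaches X S (S \<inter> T)" by (rule reaches_subset(2), blast, rule assms(1)) (use assms(2) in auto)
  show "reaches X (S \<inter> T) T" by (rule reaches_subset(1), blast, rule assms(1)) (use assms(3) in auto)
qed blast

lemma reaches_A1: "S \<noteq> {} \<Longrightarrow> T \<noteq> {} \<Longrightarrow> reaches {{}} (S :: 'i::finite set) T"
  by (rule reaches_union) auto

text \<open>The ways through union and intersection both fail only for complementary
  \<open>S\<close> and \<open>T\<close>. With at least three directions one of the two has two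
  elements, so an element of \<open>S\<close> can be removed first, or one of \<open>T\<close>
  added, after which one of the two ways is open.\<close>

lemma reaches_A2:
  fixes S T :: "'i::finite set"
  assumes card: "3 \<le> CARD('i)" and S: "S \<noteq> {}" "S \<noteq> UNIV" and T: "T \<noteq> {}" "T \<noteq> UNIV"
  shows "reaches {{}, UNIV} S T"
proof -
  consider "S \<union> T \<noteq> UNIV" | "S \<inter> T \<noteq> {}" | "S \<union> T = UNIV" "S \<inter> T = {}" by blast
  then show ?thesis
  proof cases
    case 1
    then show ?thesis using S T by (intro reaches_union) auto
  next
    case 2
    then show ?thesis using S T by (intro reaches_inter) auto
  next
    case 3
    have "card S + card T = CARD('i)" using card_Un_disjoint[of S T] 3 by simp
    then consider "2 \<le> card S" | "2 \<le> card T" using card by linarith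
    then show ?thesis
    proof cases
      case 1
      obtain i where i: "i \<in> S" using S by blast
      then have "card (S - {i}) \<noteq> 0" using 1 by simp
      then have ne: "S - {i} \<noteq> {}" by (metis card.empty)
      show ?thesis
      proof (rule reaches_trans[of _ S "S - {i}" T])
        show "reaches {{}, UNIV} S (S - {i})" using ne S by (intro reaches_subset(2)) auto
        show "reaches {{}, UNIV} (S - {i}) T" using ne T i 3 by (intro reaches_union) auto
      qed (use i 3 in blast)
    next
      case 2
      obtain j where j: "j \<in> T" using T by blast
      then have "card (T - {j}) \<noteq> 0" using 2 by simp
      then have "T - {j} \<noteq> {}" by (metis card.empty)
      then have ne: "insert j S \<noteq> UNIV" using 3 by blast
      show ?thesis
      proof (rule reaches_trans[of _ S "insert j S" T])
        show "reaches {{}, UNIV} S (insert j S)" using ne S by (intro reaches_subset(1)) auto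
        show "reaches {{}, UNIV} (insert j S) T" using ne T j 3 by (intro reaches_inter) auto
      qed (use j 3 in blast)
    qed
  qed
qed

lemma sum_list_cube_colors: "sum_list (map (\<lambda>e. mset (cube_colors e)) es) = mset (concat (map cube_colors es))"
  by (induction es) auto

lemma punctured_cube_colored:
  fixes X :: "'i::finite set set"
  assumes reaches: "\<And>S T. S \<notin> X \<Longrightarrow> T \<notin> X \<Longrightarrow> reaches X S T"
  shows "colored_quiver (punctured_cube X) (color_relations (punctured_cube X)) (\<lambda>e. mset (cube_colors e)) (\<lambda>S. S)"
proof -
  interpret quiver_relations "punctured_cube X" "color_relations (punctured_cube X)"
    by unfold_locales (simp add: color_relations_def)
  show ?thesis
  proof (unfold_locales, goal_cases)
    case 1
    then show ?case by simp
  next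
    case (2 e i)
    then show ?case by (cases e) (auto simp: punctured_cube_simps)
  next
    case (3 e)
    then show ?case by (cases e) auto
  next
    case (4 S T)
    then show ?case using reaches[of S T] by (simp add: reaches_def punctured_cube_simps sum_list_cube_colors)
  next
    case (5 S i)
    have eq: "sym_diff (sym_diff S {i}) {i} = S" by blast
    show ?case
    \<comment> \<open>A present neighbor gives the content \<open>{#i, i#}\<close> by going there
      and back; for a removed one the attached loop replaces this detour.\<close>
    proof (cases "sym_diff S {i} \<in> X")
      case True
      then show ?thesis using 5
        by (intro exI[of _ "[Loop S i]"]) (simp add: cube.Cons_in_paths punctured_cube_simps)
    next
      case False
      then show ?thesis using 5
        by (intro exI[of _ "[Step S i, Step (sym_diff S {i}) i]"])
           (simp only: cube.Cons_in_paths cube.path_end_Cons cube.path_end_Nil cube.Nil_in_paths punctured_cube_simps cube_head.simps cube_tail.simps eq, simp)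
    qed
  next
    case (6 p q)
    then show ?case by (simp add: color_relations_def sum_list_cube_colors)
  next
    case (7 S es fs)
    then show ?case by (intro relation_class) (simp add: color_relations_def sum_list_cube_colors)
  qed
qed

section \<open>The quiver with two vertices\<close>

fun sq_loop0 :: "sq_vertex \<Rightarrow> sq_arrow" where "sq_loop0 SqV = Alpha" | "sq_loop0 SqW = Epsilon"
fun sq_loop1 :: "sq_vertex \<Rightarrow> sq_arrow" where "sq_loop1 SqV = Beta" | "sq_loop1 SqW = Phi"
fun sq_cross :: "sq_vertex \<Rightarrow> sq_arrow" where "sq_cross SqV = Gamma" | "sq_cross SqW = Delta"
fun sq_other :: "sq_vertex \<Rightarrow> sq_vertex" where "sq_other SqV = SqW" | "sq_other SqW = SqV"

fun sq_col :: "'i \<Rightarrow> 'i \<Rightarrow> sq_arrow \<Rightarrow> 'i multiset" where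
  "sq_col i j Alpha = {#i, i#}" | "sq_col i j Epsilon = {#i, i#}"
| "sq_col i j Beta = {#j, j#}" | "sq_col i j Phi = {#j, j#}"
| "sq_col i j Gamma = {#i, j#}" | "sq_col i j Delta = {#i, j#}"

fun sq_type :: "'i \<Rightarrow> 'i \<Rightarrow> sq_vertex \<Rightarrow> 'i set" where
  "sq_type i j SqV = {i}" | "sq_type i j SqW = {j}"

abbreviation "sq_relations \<equiv> sq_product_relations \<union> sq_commutation_relations"

lemma sq_quiver_simps [simp]:
  "verts sq_quiver = UNIV" "arcs sq_quiver = UNIV" "tail sq_quiver = sq_tail" "head sq_quiver = sq_head"
  by (simp_all add: sq_quiver_def)

lemma finite_sq_vertex: "finite (UNIV :: sq_vertex set)"
proof -
  have "(UNIV :: sq_vertex set) = {SqV, SqW}" using sq_vertex.exhaust by blast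
  then show ?thesis by (metis finite.emptyI finite_insert)
qed

lemma quiver_relations_sq: "quiver_relations sq_quiver sq_relations"
proof -
  interpret quiver sq_quiver by unfold_locales (simp_all add: finite_sq_vertex)
  show ?thesis
    by unfold_locales (auto simp: sq_product_relations_def sq_commutation_relations_def Cons_in_paths)
qed

locale sq_quiver_relations = quiver_relations sq_quiver sq_relations

context sq_quiver_relations
begin

text \<open>With arrows named relative to their vertex, the relations and normal forms are treated
  at both vertices at once.\<close>

lemma sq_arrow_simps [simp]:
  "sq_tail (sq_loop0 u) = u" "sq_tail (sq_loop1 u) = u" "sq_tail (sq_cross u) = u"
  "sq_head (sq_loop0 u) = u" "sq_head (sq_loop1 u) = u" "sq_head (sq_cross u) = sq_other u"
  "sq_col i j (sq_loop0 u) = {#i, i#}" "sq_col i j (sq_loop1 u) = {#j, j#}" "sq_col i j (sq_cross u) = {#i, j#}"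
  "sq_other (sq_other u) = u" "sq_other u \<noteq> u" "u \<noteq> sq_other u"
  by (cases u; simp)+

lemma sq_arrow_cases: "e = sq_loop0 (sq_tail e) \<or> e = sq_loop1 (sq_tail e) \<or> e = sq_cross (sq_tail e)"
  by (cases e) simp_all

text \<open>Equality in the quotient together with equality of ends and content, so that passing to
  a normal form preserves what \<open>color_class\<close> compares. The two booleans are the
  colors.\<close>

definition sq_sim :: "sq_vertex \<Rightarrow> sq_arrow list \<Rightarrow> sq_arrow list \<Rightarrow> bool" where
  "sq_sim u es fs \<longleftrightarrow> (u, es) \<in> paths sq_quiver \<and> (u, fs) \<in> paths sq_quiver \<and>
     path_end sq_quiver (u, es) = path_end sq_quiver (u, fs) \<and>
     sum_list (map (sq_col False True) es) = sum_list (map (sq_col False True) fs) \<and>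
     cl (path_elt (u, es)) = cl (path_elt (u, fs))"

lemma sq_sim_refl: "(u, es) \<in> paths sq_quiver \<Longrightarrow> sq_sim u es es"
  by (simp add: sq_sim_def)

lemma sq_sim_sym: "sq_sim u es fs \<Longrightarrow> sq_sim u fs es"
  by (simp add: sq_sim_def)

lemma sq_sim_trans [trans]: "sq_sim u es fs \<Longrightarrow> sq_sim u fs gs \<Longrightarrow> sq_sim u es gs"
  by (simp add: sq_sim_def)

lemma sq_cl_append:
  assumes "(u, es) \<in> paths sq_quiver" "(path_end sq_quiver (u, es), fs) \<in> paths sq_quiver"
  shows "cl (path_elt (u, es @ fs)) = cl (path_elt (path_end sq_quiver (u, es), fs)) \<otimes>\<^bsub>QA\<^esub> cl (path_elt (u, es))"
  using assms by (simp add: QA_mult path_elt_mult)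

lemma sq_sim_append:
  assumes "sq_sim u es es'" "sq_sim (path_end sq_quiver (u, es)) fs fs'"
  shows "sq_sim u (es @ fs) (es' @ fs')"
  using assms sq_cl_append[of u es fs] sq_cl_append[of u es' fs'] unfolding sq_sim_def
  by (simp add: paths_append path_end_append)

lemma sq_sim_relation: "((u, es), (u, fs)) \<in> sq_relations \<Longrightarrow> sq_sim u es fs"
  using relations_paths[of "(u, es)" "(u, fs)"] relation_class[of "(u, es)" "(u, fs)"]
  unfolding sq_sim_def by (auto simp: sq_product_relations_def sq_commutation_relations_def)

lemma sq_relations:
  "sq_sim u [sq_loop1 u, sq_loop0 u] [sq_loop0 u, sq_loop1 u]"
  "sq_sim u [sq_loop0 u, sq_loop1 u] [sq_cross u, sq_cross (sq_other u)]"
  "sq_sim u [sq_loop0 u, sq_cross u] [sq_cross u, sq_loop0 (sq_other u)]"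
  "sq_sim u [sq_loop1 u, sq_cross u] [sq_cross u, sq_loop1 (sq_other u)]"
proof -
  note rels = sq_product_relations_def sq_commutation_relations_def
  show "sq_sim u [sq_loop1 u, sq_loop0 u] [sq_loop0 u, sq_loop1 u]"
    "sq_sim u [sq_loop0 u, sq_loop1 u] [sq_cross u, sq_cross (sq_other u)]"
    by (cases u; rule sq_sim_relation; simp add: rels)+
  show "sq_sim u [sq_loop0 u, sq_cross u] [sq_cross u, sq_loop0 (sq_other u)]"
  proof (cases u)
    case SqV
    then show ?thesis by (intro sq_sim_relation) (simp add: rels)
  next
    case SqW
    then show ?thesis by (intro sq_sim_sym[OF sq_sim_relation]) (simp add: rels)
  qed
  show "sq_sim u [sq_loop1 u, sq_cross u] [sq_cross u, sq_loop1 (sq_other u)]"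
  proof (cases u)
    case SqV
    then show ?thesis by (intro sq_sim_relation) (simp add: rels)
  next
    case SqW
    then show ?thesis by (intro sq_sim_sym[OF sq_sim_relation]) (simp add: rels)
  qed
qed

lemma replicate_path: "sq_tail x = u \<Longrightarrow> sq_head x = u \<Longrightarrow> (u, replicate n x) \<in> paths sq_quiver \<and> path_end sq_quiver (u, replicate n x) = u"
  by (induction n) (auto simp: Cons_in_paths)

text \<open>One relation moves \<open>x\<close> past one letter and turns \<open>z\<close> into
  \<open>y\<close>. This covers sliding a crossing past loops as well as reordering loops at one
  vertex, where \<open>y = z\<close>.\<close>

lemma sq_sim_swap:
  assumes "sq_sim u [x, z] [y, x]" "sq_head y = u" "sq_head z = sq_head x"
  shows "sq_sim u (x # replicate n z) (replicate n y @ [x])"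
proof (induction n)
  case 0
  show ?case using assms(1) by (simp add: sq_sim_def Cons_in_paths)
next
  case (Suc n)
  have t: "sq_tail x = u" "sq_tail y = u" "sq_tail z = sq_head x" using assms(1) by (auto simp: sq_sim_def Cons_in_paths)
  have "sq_sim u ([x, z] @ replicate n z) ([y, x] @ replicate n z)"
    using assms t replicate_path[of z "sq_head x" n] by (intro sq_sim_append sq_sim_refl) auto
  also have "sq_sim u ([y] @ (x # replicate n z)) ([y] @ (replicate n y @ [x]))"
    using assms(2) t Suc by (intro sq_sim_append sq_sim_refl) (auto simp: Cons_in_paths)
  then have "sq_sim u ([y, x] @ replicate n z) (replicate (Suc n) y @ [x])" by simp
  finally show ?case by simp
qed

text \<open>The content in the two colors is \<open>2 * m + of_bool c\<close> and
  \<open>2 * n + of_bool c\<close>, and the end tells \<open>c\<close>; so ends and content separate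
  these forms.\<close>

definition sq_normal :: "sq_vertex \<Rightarrow> nat \<Rightarrow> nat \<Rightarrow> bool \<Rightarrow> sq_arrow list" where
  "sq_normal u m n c = replicate m (sq_loop0 u) @ replicate n (sq_loop1 u) @ (if c then [sq_cross u] else [])"

lemma sq_normal_path: "(u, sq_normal u m n c) \<in> paths sq_quiver"
  "path_end sq_quiver (u, sq_normal u m n c) = (if c then sq_other u else u)"
  using replicate_path[of "sq_loop0 u" u m] replicate_path[of "sq_loop1 u" u n]
  by (auto simp: sq_normal_def paths_append path_end_append Cons_in_paths)

lemma sq_sim_loop0: "sq_sim u (sq_loop0 u # sq_normal u m n c) (sq_normal u (Suc m) n c)"
  using sq_normal_path(1)[of u m n c] by (simp add: sq_normal_def sq_sim_refl Cons_in_paths)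

lemma sq_sim_loop1: "sq_sim u (sq_loop1 u # sq_normal u m n c) (sq_normal u m (Suc n) c)"
proof -
  let ?r = "replicate n (sq_loop1 u) @ (if c then [sq_cross u] else [])"
  have "(u, ?r) \<in> paths sq_quiver" using sq_normal_path(1)[of u 0 n c] by (simp add: sq_normal_def)
  then have "sq_sim u ((sq_loop1 u # replicate m (sq_loop0 u)) @ ?r) ((replicate m (sq_loop0 u) @ [sq_loop1 u]) @ ?r)"
    using replicate_path[of "sq_loop0 u" u m] by (intro sq_sim_append sq_sim_swap sq_relations sq_sim_refl) simp_all
  then show ?thesis by (simp add: sq_normal_def)
qed

text \<open>The crossing slides to the right past the loops, which become loops at \<open>u\<close>.
  If it meets a second crossing, the pair is replaced by one loop of each kind.\<close>

lemma sq_sim_cross: "\<exists>m' n' c'. sq_sim u (sq_cross u # sq_normal (sq_other u) m n c) (sq_normal u m' n' c')"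
proof -
  let ?w = "sq_other u"
  let ?l0 = "\<lambda>v. replicate m (sq_loop0 v)" and ?l1 = "\<lambda>v. replicate n (sq_loop1 v)" and ?c = "if c then [sq_cross ?w] else []"
  have r: "(v, ?l0 v) \<in> paths sq_quiver" "path_end sq_quiver (v, ?l0 v) = v"
    "(v, ?l1 v) \<in> paths sq_quiver" "path_end sq_quiver (v, ?l1 v) = v" for v
    using replicate_path[of "sq_loop0 v" v m] replicate_path[of "sq_loop1 v" v n] by auto
  have c: "(?w, ?c) \<in> paths sq_quiver" by (simp add: Cons_in_paths)
  have 1: "sq_sim u ((sq_cross u # ?l0 ?w) @ (?l1 ?w @ ?c)) ((?l0 u @ [sq_cross u]) @ (?l1 ?w @ ?c))"
    by (intro sq_sim_append sq_sim_swap sq_sim_sym[OF sq_relations(3)] sq_sim_refl)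
       (simp_all add: r c paths_append)
  have 2: "sq_sim u ((sq_cross u # ?l1 ?w) @ ?c) ((?l1 u @ [sq_cross u]) @ ?c)"
    by (intro sq_sim_append sq_sim_swap sq_sim_sym[OF sq_relations(4)] sq_sim_refl)
       (simp_all add: r c)
  have 3: "sq_sim u (?l0 u @ ((sq_cross u # ?l1 ?w) @ ?c)) (?l0 u @ ((?l1 u @ [sq_cross u]) @ ?c))"
    by (rule sq_sim_append[OF sq_sim_refl[OF r(1)]]) (unfold r(2), rule 2)
  have s: "sq_sim u (sq_cross u # sq_normal ?w m n c) (?l0 u @ ?l1 u @ (sq_cross u # ?c))"
    using sq_sim_trans[OF 1] 3 by (simp add: sq_normal_def)
  show ?thesis
  proof (cases c)
    case False
    then show ?thesis using s by - (rule exI[of _ m], rule exI[of _ n], rule exI[of _ True], simp add: sq_normal_def)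
  next
    case True
    note s
    \<comment> \<open>Of the two orders for the replacement of the round trip,
      \<open>sq_loop1\<close> first is chosen: it joins the block already present, and
      \<open>sq_loop0\<close> is moved to its own block afterwards.\<close>
    also have "sq_sim u (?l0 u @ ?l1 u @ (sq_cross u # ?c)) (?l0 u @ ?l1 u @ [sq_loop1 u, sq_loop0 u])"
      using True sq_sim_sym[OF sq_sim_trans[OF sq_relations(1,2)], of u]
      by (intro sq_sim_append sq_sim_refl) (simp_all add: r)
    also have "sq_sim u (?l0 u @ ?l1 u @ [sq_loop1 u, sq_loop0 u]) (?l0 u @ (replicate (Suc n) (sq_loop1 u) @ [sq_loop0 u]))"
      using replicate_path[of "sq_loop1 u" u n] r(1,2)[of u]
      by (simp add: replicate_append_same[symmetric] sq_sim_refl paths_append Cons_in_paths)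
    also have "sq_sim u (?l0 u @ (replicate (Suc n) (sq_loop1 u) @ [sq_loop0 u])) (?l0 u @ (sq_loop0 u # replicate (Suc n) (sq_loop1 u)))"
    proof -
      have "sq_sim u (replicate (Suc n) (sq_loop1 u) @ [sq_loop0 u]) (sq_loop0 u # replicate (Suc n) (sq_loop1 u))"
        by (intro sq_sim_sym[OF sq_sim_swap] sq_sim_sym[OF sq_relations(1)]) simp_all
      then show ?thesis by (intro sq_sim_append sq_sim_refl) (simp_all add: r)
    qed
    also have "?l0 u @ (sq_loop0 u # replicate (Suc n) (sq_loop1 u)) = sq_normal u (Suc m) (Suc n) False"
      by (simp add: sq_normal_def replicate_app_Cons_same)
    finally show ?thesis by blast
  qed
qed

lemma sq_normal_form: "(u, es) \<in> paths sq_quiver \<Longrightarrow> \<exists>m n c. sq_sim u es (sq_normal u m n c)"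
proof (induction es arbitrary: u)
  case Nil
  have "sq_sim u [] (sq_normal u 0 0 False)" by (simp add: sq_normal_def sq_sim_refl)
  then show ?case by blast
next
  case (Cons e es)
  have e: "sq_tail e = u" "(sq_head e, es) \<in> paths sq_quiver" using Cons.prems by (auto simp: Cons_in_paths)
  obtain m n c where "sq_sim (sq_head e) es (sq_normal (sq_head e) m n c)" using Cons.IH[OF e(2)] by blast
  then have s: "sq_sim u (e # es) (e # sq_normal (sq_head e) m n c)"
    using sq_sim_append[of u "[e]" "[e]" es] e(1) by (simp add: sq_sim_refl Cons_in_paths)
  consider "e = sq_loop0 u" | "e = sq_loop1 u" | "e = sq_cross u" using sq_arrow_cases[of e] e(1) by auto
  then show ?case
  proof cases
    case 1
    then show ?thesis using sq_sim_trans[OF s, of "sq_normal u (Suc m) n c"] sq_sim_loop0 by auto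
  next
    case 2
    then show ?thesis using sq_sim_trans[OF s, of "sq_normal u m (Suc n) c"] sq_sim_loop1 by auto
  next
    case 3
    then show ?thesis using sq_sim_trans[OF s] sq_sim_cross[of u m n c] by auto
  qed
qed

lemma sq_normal_colors:
  "sum_list (map (sq_col i j) (sq_normal u m n c)) =
     replicate_mset (2 * m + of_bool c) i + replicate_mset (2 * n + of_bool c) j"
proof -
  have "sum_list (map (sq_col i j) (replicate k (sq_loop0 u))) = replicate_mset (2 * k) i"
    "sum_list (map (sq_col i j) (replicate k (sq_loop1 u))) = replicate_mset (2 * k) j" for k
    by (induction k) auto
  then show ?thesis by (simp add: sq_normal_def)
qed

end

lemma image_sq_colors: "image_mset f (sum_list (map (sq_col i j) es)) = sum_list (map (sq_col (f i) (f j)) es)"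
proof (induction es)
  case (Cons e es)
  then show ?case by (cases e) simp_all
qed simp

lemma sq_colored:
  fixes i j :: "'i::finite"
  assumes ij: "i \<noteq> j" and UNIV: "UNIV = {i, j}"
  shows "colored_quiver sq_quiver sq_relations (sq_col i j) (sq_type i j)"
proof -
  interpret quiver_relations sq_quiver sq_relations by (rule quiver_relations_sq)
  interpret sq_quiver_relations ..
  show ?thesis
  proof (unfold_locales, goal_cases)
    case 1
    then show ?case using ij by (auto simp: inj_on_def elim: sq_type.elims)
  next
    case (2 e k)
    then show ?case using ij UNIV by (cases e) auto
  next
    case (3 e)
    then show ?case by (cases e) auto
  next
    case (4 u v)
    show ?case
    proof (cases "u = v")
      case True
      then show ?thesis by (intro exI[of _ "[]"]) simp
    next
      case False
      then have v: "v = sq_other u" by (cases u; cases v) auto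
      have "sym_diff (sq_type i j u) (sq_type i j v) = {i, j}" using ij unfolding v by (cases u) auto
      then show ?thesis using ij v by (intro exI[of _ "[sq_cross u]"]) (simp add: Cons_in_paths)
    qed
  next
    case (5 u k)
    have "k = i \<or> k = j" using UNIV by blast
    then show ?case
      by (intro exI[of _ "if k = i then [sq_loop0 u] else [sq_loop1 u]"]) (auto simp: Cons_in_paths)
  next
    case (6 p q)
    then show ?case by (auto simp: sq_product_relations_def sq_commutation_relations_def add_mset_commute)
  next
    case (7 u es fs)
    obtain m n c where es: "sq_sim u es (sq_normal u m n c)" using sq_normal_form[OF 7(1)] by blast
    obtain m' n' c' where fs: "sq_sim u fs (sq_normal u m' n' c')" using sq_normal_form[OF 7(2)] by blast
    let ?col = "sq_col False True"
    \<comment> \<open>Sending \<open>j\<close> to \<open>True\<close> and \<open>i\<close> to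
      \<open>False\<close> translates the content into the colors of \<open>sq_sim\<close>.\<close>
    have "sum_list (map ?col es) = sum_list (map ?col fs)"
      using arg_cong[OF 7(4), of "image_mset (\<lambda>k. k = j)"] ij by (simp only: image_sq_colors) simp
    then have "sum_list (map ?col (sq_normal u m n c)) = sum_list (map ?col (sq_normal u m' n' c'))"
      using es fs by (simp add: sq_sim_def)
    then have cnt: "count (sum_list (map ?col (sq_normal u m n c))) k = count (sum_list (map ?col (sq_normal u m' n' c'))) k" for k
      by simp
    have c: "c = c'" using es fs 7(3) by (auto simp: sq_sim_def sq_normal_path split: if_splits)
    have "m = m'" "n = n'" using cnt[of False] cnt[of True] c by (simp_all add: sq_normal_colors)
    then show ?case using es fs c by (simp add: sq_sim_def)
  qed
qed

theorem proposition6p7: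
  fixes scale :: "complex \<Rightarrow> 'u \<Rightarrow> 'u::ab_group_add" and n :: nat and a :: int
  assumes universe: "vector_space scale" "\<not> finite_dimensional scale (UNIV :: 'u set)"
    and index: "CARD('i::finite) = n + 1"
    and n: "n \<ge> 1"
  shows "(a \<ge> 0 \<longrightarrow>
            equivalent_categories (bounded_weight_cat TYPE('i) scale a)
              (A1_nilpotent_rep_cat TYPE('i) scale)) \<and>
         (- int n - 1 < a \<and> a < 0 \<longrightarrow>
            (n \<ge> 2 \<longrightarrow>
               equivalent_categories (bounded_weight_cat TYPE('i) scale a)
                 (A2_nilpotent_rep_cat TYPE('i) scale)) \<and>
            (n = 1 \<longrightarrow>
               equivalent_categories (bounded_weight_cat TYPE('i) scale a)
                 (A2_sq_nilpotent_rep_cat scale)))"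
proof (intro conjI impI; (elim conjE)?)
  assume a: "0 \<le> a"
  have "colored_quiver (punctured_cube {{} :: 'i set}) (color_relations (punctured_cube {{}}))
      (\<lambda>e. mset (cube_colors e)) (\<lambda>S. S)"
    by (rule punctured_cube_colored) (simp add: reaches_A1)
  then show "equivalent_categories (bounded_weight_cat TYPE('i) scale a) (A1_nilpotent_rep_cat TYPE('i) scale)"
    unfolding A1_nilpotent_rep_cat_def Let_def
    by (rule colored_quiver_equivalence[OF _ universe]) (use a index in \<open>auto simp: punctured_cube_simps\<close>)
next
  assume a: "- int n - 1 < a" "a < 0" and "2 \<le> n"
  \<comment> \<open>Here \<open>n + 1 \<ge> 3\<close>, the number of directions that
    \<open>reaches_A2\<close> asks for.\<close>
  then have "colored_quiver (punctured_cube {{}, UNIV :: 'i set}) (color_relations (punctured_cube {{}, UNIV}))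
      (\<lambda>e. mset (cube_colors e)) (\<lambda>S. S)"
    using index by (intro punctured_cube_colored reaches_A2) auto
  then show "equivalent_categories (bounded_weight_cat TYPE('i) scale a) (A2_nilpotent_rep_cat TYPE('i) scale)"
    unfolding A2_nilpotent_rep_cat_def Let_def
    by (rule colored_quiver_equivalence[OF _ universe]) (use a index in \<open>auto simp: punctured_cube_simps\<close>)
next
  assume a: "- int n - 1 < a" "a < 0" and "n = 1"
  then have "card (UNIV :: 'i set) = 2" using index by simp
  then obtain i j :: 'i where ij: "UNIV = {i, j}" "i \<noteq> j" by (auto simp: card_2_iff)
  \<comment> \<open>With two variables the proper nonempty types are the two singletons, one for
    each vertex.\<close>
  have "{S. S \<noteq> {} \<and> S \<noteq> UNIV} = {{i}, {j}}"
  proof (intro equalityI subsetI)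
    fix S :: "'i set" assume S: "S \<in> {S. S \<noteq> {} \<and> S \<noteq> UNIV}"
    have "S \<subseteq> {i, j}" using ij(1) by blast
    moreover have "\<not> {i, j} \<subseteq> S" using S ij(1) by blast
    ultimately show "S \<in> {{i}, {j}}" using S by blast
  qed (use ij in auto)
  moreover have "range (sq_type i j) = {{i}, {j}}"
  proof -
    have UNIV: "(UNIV :: sq_vertex set) = {SqV, SqW}" using sq_vertex.exhaust by blast
    show ?thesis unfolding UNIV by simp
  qed
  ultimately have types: "sq_type i j ` verts sq_quiver = {S. S \<noteq> {} \<and> (a < 0 \<longrightarrow> S \<noteq> UNIV)}"
    using a(2) by simp
  show "equivalent_categories (bounded_weight_cat TYPE('i) scale a) (A2_sq_nilpotent_rep_cat scale)"
    unfolding A2_sq_nilpotent_rep_cat_def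
    by (rule colored_quiver_equivalence[OF sq_colored[OF ij(2,1)] universe types]) (use a(1) index in simp)
qed

end
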